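(* Let the operator $A=(\operatorname{sgn} x)\left(-\frac{d^2}{dx^2}+q(x)\right)$ be similar to a selfadjoint operator. Then there exist constants $K_1^+,K_1^-$ such that for all $g^+\in L^2(\mathbb R,d\Sigma_+)$ and all $g^-\in L^2(\mathbb R,d\Sigma_-)$ the following inequalities hold, each of them both with $\operatorname{Im}M_+$ and with $\operatorname{Im}M_-$ in the numerator: $$\int_{\mathbb R}\frac{\operatorname{Im}M_\pm(t)}{|M_+(t)-M_-(t)|^2}\left|g^+(t)\Sigma'_{ac+}(t)+\big(H(g^+d\Sigma_+)\big)(t)\right|^2dt\le K_1^+\int_{\mathbb R}|g^+(t)|^2d\Sigma_+(t),$$ $$\int_{\mathbb R}\frac{\operatorname{Im}M_\pm(t)}{|M_+(t)-M_-(t)|^2}\left|g^-(t)\Sigma'_{ac-}(t)+\big(H(g^-d\Sigma_-)\big)(t)\right|^2dt\le K_1^-\int_{\mathbb R}|g^-(t)|^2d\Sigma_-(t).$$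
   Context: Setting. $q:\mathbb R\to\mathbb R$ is continuous, and the minimal operators $L^\pm_{\min}$ generated by $-\frac{d^2}{dx^2}+q(x)$ in $L^2(\mathbb R_\pm)$ have deficiency indices $(1,1)$ (limit point case at $\pm\infty$). $L=-\frac{d^2}{dx^2}+q(x)$ denotes the corresponding selfadjoint operator in $L^2(\mathbb R)$, $J$ is multiplication by $\operatorname{sgn}x$, and $A=JL$ with $\operatorname{dom}A=\operatorname{dom}L$. Weyl functions. Let $s(x,\lambda),c(x,\lambda)$ solve $-y''+qy=\lambda y$ with $s(0,\lambda)=c'(0,\lambda)=0$, $s'(0,\lambda)=c(0,\lambda)=1$. For $\lambda\in\mathbb C\setminus\mathbb R$, $m_\pm(\lambda)$ is the number such that $s(\cdot,\lambda)\mp m_\pm(\lambda)c(\cdot,\lambda)\in L^2(\mathbb R_\pm)$. Put $M_\pm(\lambda):=\pm m_\pm(\pm\lambda)$. The functions $M_\pm$ are Nevanlinna–Herglotz functions and $M_\pm(\lambda)=\int_{\mathbb R}\frac{d\Sigma_\pm(t)}{t-\lambda}$ with nondecreasing $\Sigma_\pm$ satisfying $\int_{\mathbb R}\frac{d\Sigma_\pm(t)}{1+|t|}<\infty$. For a.e. $t\in\mathbb R$, $M_\pm(t):=M_\pm(t+i0)$ exists, and $M_+(t)\ne M_-(t)$ for a.e. $t$. $\Sigma_{ac\pm}$ is the absolutely continuous part of $\Sigma_\pm$ and $\Sigma_{ac\pm}'$ its density. For a (complex) Borel measure $\mu$ with $\int(1+|t|)^{-1}d|\mu|(t)<\infty$,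 the Hilbert transform is $(H\mu)(x)=\frac1\pi\lim_{\delta\to0}\int_{|x-t|>\delta}\frac{d\mu(t)}{x-t}$ (which exists for a.e. $x$). Closed operators $T_1,T_2$ in a Hilbert space are similar if there is a bounded operator $V$ with bounded inverse such that $V\operatorname{dom}(T_1)=\operatorname{dom}(T_2)$ and $T_2=VT_1V^{-1}$. *)

theory Defs
  imports "HOL-Analysis.Analysis"
begin

section \<open>Operators in \<open>L\<^sup>2\<close>\<close>

text \<open>
  Elements of \<open>L\<^sup>2(M)\<close> are represented by square integrable functions; equality in \<open>L\<^sup>2(M)\<close>
  is equality almost everywhere.  A (possibly unbounded) operator is represented by its graph,
  a set of pairs of such functions that is closed under a.e. equality in both components.
\<close>

definition L2 :: "real measure \<Rightarrow> (real \<Rightarrow> complex) set" where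
  "L2 M = {f \<in> borel_measurable M. integrable M (\<lambda>x. (cmod (f x))\<^sup>2)}"

definition L2_norm :: "real measure \<Rightarrow> (real \<Rightarrow> complex) \<Rightarrow> real" where
  "L2_norm M f = sqrt (LINT x|M. (cmod (f x))\<^sup>2)"

definition L2_inner :: "real measure \<Rightarrow> (real \<Rightarrow> complex) \<Rightarrow> (real \<Rightarrow> complex) \<Rightarrow> complex" where
  "L2_inner M f g = (LINT x|M. f x * cnj (g x))"

type_synonym graph = "((real \<Rightarrow> complex) \<times> (real \<Rightarrow> complex)) set"

definition L2_closure :: "real measure \<Rightarrow> graph \<Rightarrow> graph" where
  "L2_closure M T = {(f, g). f \<in> L2 M \<and> g \<in> L2 M \<and>
     (\<forall>\<epsilon>>0. \<exists>(u, v)\<in>T. L2_norm M (\<lambda>x. f x - u x) < \<epsilon> \<and> L2_norm M (\<lambda>x. g x - v x) < \<epsilon>)}"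

definition L2_adjoint :: "real measure \<Rightarrow> graph \<Rightarrow> graph" where
  "L2_adjoint M T = {(u, v). u \<in> L2 M \<and> v \<in> L2 M \<and>
     (\<forall>(f, g)\<in>T. L2_inner M g u = L2_inner M f v)}"

text \<open>
  An adjoint graph is automatically linear, closed and closed under a.e. equality.  If \<open>T\<close> equals
  its adjoint, then single-valuedness of \<open>T\<close> is equivalent to its domain being dense.
\<close>

definition L2_selfadjoint :: "real measure \<Rightarrow> graph \<Rightarrow> bool" where
  "L2_selfadjoint M T \<longleftrightarrow> L2_adjoint M T = T \<and>
     (\<forall>(f, g)\<in>T. (AE x in M. f x = 0) \<longrightarrow> (AE x in M. g x = 0))"

definition L2_has_dim :: "real measure \<Rightarrow> (real \<Rightarrow> complex) set \<Rightarrow> nat \<Rightarrow> bool" where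
  "L2_has_dim M N n \<longleftrightarrow> (\<exists>b :: nat \<Rightarrow> real \<Rightarrow> complex.
     (\<forall>i<n. b i \<in> N) \<and>
     (\<forall>a. (AE x in M. (\<Sum>i<n. a i * b i x) = 0) \<longrightarrow> (\<forall>i<n. a i = 0)) \<and>
     (\<forall>f\<in>N. \<exists>a. AE x in M. f x = (\<Sum>i<n. a i * b i x)))"

text \<open>The indices are \<open>n = dim ker (T\<^sup>* - \<i>)\<close> and \<open>k = dim ker (T\<^sup>* + \<i>)\<close>.\<close>

definition L2_deficiency_indices :: "real measure \<Rightarrow> graph \<Rightarrow> nat \<Rightarrow> nat \<Rightarrow> bool" where
  "L2_deficiency_indices M T n k \<longleftrightarrow>
     L2_has_dim M {f. (f, \<lambda>x. \<i> * f x) \<in> L2_adjoint M T} n \<and>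
     L2_has_dim M {f. (f, \<lambda>x. - \<i> * f x) \<in> L2_adjoint M T} k"

definition L2_bounded_operator ::
    "real measure \<Rightarrow> ((real \<Rightarrow> complex) \<Rightarrow> (real \<Rightarrow> complex)) \<Rightarrow> bool" where
  "L2_bounded_operator M V \<longleftrightarrow>
     (\<forall>f\<in>L2 M. V f \<in> L2 M) \<and>
     (\<forall>f\<in>L2 M. \<forall>g\<in>L2 M. AE x in M. V (\<lambda>t. f t + g t) x = V f x + V g x) \<and>
     (\<forall>f\<in>L2 M. \<forall>a. AE x in M. V (\<lambda>t. a * f t) x = a * V f x) \<and>
     (\<exists>C. \<forall>f\<in>L2 M. L2_norm M (V f) \<le> C * L2_norm M f)"

text \<open>
  The last conjunct says that the graph of \<open>T\<^sub>2\<close> is the image of the graph of \<open>T\<^sub>1\<close> under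
  \<open>V \<times> V\<close>, i.e. \<open>V dom T\<^sub>1 = dom T\<^sub>2\<close> and \<open>T\<^sub>2 = V T\<^sub>1 V\<^sup>-\<^sup>1\<close>.
\<close>

definition L2_similar :: "real measure \<Rightarrow> graph \<Rightarrow> graph \<Rightarrow> bool" where
  "L2_similar M T\<^sub>1 T\<^sub>2 \<longleftrightarrow> (\<exists>V W.
     L2_bounded_operator M V \<and> L2_bounded_operator M W \<and>
     (\<forall>f\<in>L2 M. (AE x in M. W (V f) x = f x) \<and> (AE x in M. V (W f) x = f x)) \<and>
     T\<^sub>2 = {(u, v). u \<in> L2 M \<and> v \<in> L2 M \<and>
            (\<exists>(f, g)\<in>T\<^sub>1. (AE x in M. u x = V f x) \<and> (AE x in M. v x = V g x))})"


section \<open>Sturm--Liouville operators\<close>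

abbreviation lborel_on :: "real set \<Rightarrow> real measure" where
  "lborel_on S \<equiv> restrict_space lborel S"

lemma lborel_on_UNIV: "lborel_on UNIV = lborel"
  by (rule measure_eqI) (auto simp: sets_restrict_space emeasure_restrict_space)

text \<open>
  Maximal operator generated by \<open>-d\<^sup>2/dx\<^sup>2 + q\<close> in \<open>L\<^sup>2(S)\<close>, \<open>S\<close> an open interval: \<open>f\<close> has a
  representative \<open>y\<close> with \<open>y\<close>, \<open>y'\<close> locally absolutely continuous in \<open>S\<close> and \<open>-y'' + q y = g\<close> a.e.
  Local absolute continuity of \<open>y'\<close> together with the a.e. equation \<open>y'' = q y - g\<close> is written as
  \<open>y'\<close> being an indefinite Lebesgue integral of \<open>q y - g\<close>.
\<close>

definition sl_maximal :: "(real \<Rightarrow> real) \<Rightarrow> real set \<Rightarrow> graph" where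
  "sl_maximal q S = {(f, g). f \<in> L2 (lborel_on S) \<and> g \<in> L2 (lborel_on S) \<and>
     (\<exists>y y'. (AE x in lborel_on S. f x = y x) \<and>
        (\<forall>x\<in>S. (y has_vector_derivative y' x) (at x)) \<and>
        (\<forall>a b. a \<le> b \<longrightarrow> {a..b} \<subseteq> S \<longrightarrow>
           y' b - y' a = (LINT x:{a..b}|lborel. complex_of_real (q x) * y x - g x)))}"

definition sl_preminimal :: "(real \<Rightarrow> real) \<Rightarrow> real set \<Rightarrow> graph" where
  "sl_preminimal q S = {(f, g) \<in> sl_maximal q S.
     \<exists>K. compact K \<and> K \<subseteq> S \<and> (AE x in lborel_on S. x \<notin> K \<longrightarrow> f x = 0)}"

definition sl_minimal :: "(real \<Rightarrow> real) \<Rightarrow> real set \<Rightarrow> graph" where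
  "sl_minimal q S = L2_closure (lborel_on S) (sl_preminimal q S)"

text \<open>
  In the limit point case at both ends the selfadjoint operator in \<open>L\<^sup>2(\<real>)\<close> generated by the
  differential expression is the maximal one (no boundary conditions).
\<close>

definition sl_operator :: "(real \<Rightarrow> real) \<Rightarrow> graph" where
  "sl_operator q = sl_maximal q UNIV"

text \<open>\<open>A = J L\<close> with \<open>dom A = dom L\<close>, as a graph closed under a.e. equality.\<close>

definition indefinite_sl_operator :: "(real \<Rightarrow> real) \<Rightarrow> graph" where
  "indefinite_sl_operator q = {(f, h). h \<in> L2 lborel \<and>
     (\<exists>g. (f, g) \<in> sl_operator q \<and> (AE x in lborel. h x = complex_of_real (sgn x) * g x))}"

text \<open>\<open>y\<close> solves \<open>-y'' + q y = z y\<close> on \<open>\<real>\<close> with \<open>y 0 = a\<close>, \<open>y' 0 = b\<close>.\<close>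

definition sl_solution ::
    "(real \<Rightarrow> real) \<Rightarrow> complex \<Rightarrow> complex \<Rightarrow> complex \<Rightarrow> (real \<Rightarrow> complex) \<Rightarrow> bool" where
  "sl_solution q z a b y \<longleftrightarrow> (\<exists>y' y''.
     (\<forall>x. (y has_vector_derivative y' x) (at x) \<and> (y' has_vector_derivative y'' x) (at x) \<and>
          - y'' x + complex_of_real (q x) * y x = z * y x) \<and>
     y 0 = a \<and> y' 0 = b)"


section \<open>Stieltjes measures, boundary values, Hilbert transform\<close>

text \<open>
  The measure \<open>d\<Sigma>\<close> of a nondecreasing function.  The library's \<^const>\<open>interval_measure\<close> expects a
  right-continuous function, so \<open>\<Sigma>\<close> is first replaced by \<open>t \<mapsto> \<Sigma>(t+0)\<close>.
\<close>

definition stieltjes_measure :: "(real \<Rightarrow> real) \<Rightarrow> real measure" where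
  "stieltjes_measure \<Sigma> = interval_measure (\<lambda>t. Lim (at_right t) \<Sigma>)"

text \<open>
  \<open>w\<close> is the density of the absolutely continuous part of \<open>\<mu>\<close>, that is, \<open>\<mu> = w dt + \<sigma>\<close>
  with \<open>\<sigma>\<close> singular.  A singular part \<open>\<sigma>\<close> concentrated on a null set \<open>N\<close> is \<open>\<mu>\<close> restricted to \<open>N\<close>.
  Such a density is determined a.e.
\<close>

definition is_ac_density :: "real measure \<Rightarrow> (real \<Rightarrow> real) \<Rightarrow> bool" where
  "is_ac_density \<mu> w \<longleftrightarrow> w \<in> borel_measurable borel \<and> (\<forall>t. 0 \<le> w t) \<and>
     (\<exists>N\<in>null_sets lborel. \<forall>B\<in>sets borel.
        emeasure \<mu> B = emeasure (density lborel (\<lambda>t. ennreal (w t))) B + emeasure \<mu> (B \<inter> N))"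

definition ac_density :: "real measure \<Rightarrow> real \<Rightarrow> real" where
  "ac_density \<mu> = (SOME w. is_ac_density \<mu> w)"

text \<open>\<open>M(t + \<i>0)\<close>\<close>

definition boundary_value :: "(complex \<Rightarrow> complex) \<Rightarrow> real \<Rightarrow> complex" where
  "boundary_value M t = Lim (at_right 0) (\<lambda>\<epsilon>. M (Complex t \<epsilon>))"

text \<open>Hilbert transform of the complex measure \<open>g d\<mu>\<close>.\<close>

definition hilbert_transform :: "real measure \<Rightarrow> (real \<Rightarrow> complex) \<Rightarrow> real \<Rightarrow> complex" where
  "hilbert_transform \<mu> g x = complex_of_real (1 / pi) *
     Lim (at_right 0) (\<lambda>\<delta>. LINT t:{t. \<bar>x - t\<bar> > \<delta>}|\<mu>. g t / complex_of_real (x - t))"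

end

theory Submission
  imports Defs "HOL-Complex_Analysis.Complex_Analysis" "HOL-Real_Asymp.Real_Asymp"
    "HOL-Computational_Algebra.Fundamental_Theorem_Algebra"
begin

text \<open>
  Similarity to a selfadjoint operator bounds \<open>\<epsilon> \<integral> \<parallel>(A - \<xi> - \<i>\<epsilon>)\<^sup>-\<^sup>1 f\<parallel>\<^sup>2 d\<xi>\<close> by \<open>K \<parallel>f\<parallel>\<^sup>2\<close>.  The
  half-line Neumann problems satisfy the same bound, so it also holds for the difference of the resolvents,
  which is \<open>(F\<^sub>+ - F\<^sub>-) / (M\<^sub>+ - M\<^sub>-)\<close> times the Weyl solutions, where \<open>F\<^sub>\<plusminus>\<close> is the Cauchy
  transform of \<open>g\<^sub>\<plusminus> d\<Sigma>\<^sub>\<plusminus>\<close> and \<open>g\<^sub>\<plusminus>\<close> is the spectral representation of \<open>f\<close> on the half-lines.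
  The squared norm of a Weyl solution is \<open>Im M\<^sub>\<plusminus> / \<epsilon>\<close>.  This gives the inequality with
  \<open>F\<^sub>+ - F\<^sub>-\<close> on every line \<open>Im z = \<epsilon>\<close>, first for finite combinations of Weyl solutions, that is
  partial fractions \<open>g\<^sub>\<plusminus>\<close>, and by density for all \<open>g\<^sub>\<plusminus>\<close>.  With one of \<open>g\<^sub>\<plusminus>\<close> equal to zero,
  Fatou's lemma for \<open>\<epsilon> \<rightarrow> 0\<close> and the formula \<open>F(t + \<i>0) = \<pi> (\<i> g \<Sigma>'\<^sub>a\<^sub>c - H(g d\<Sigma>))(t)\<close> finish the proof.
\<close>

section \<open>Analytic functions in a half-plane\<close>

text \<open>No spectral theorem enters. For symmetric \<open>T\<close> and (T - z) u = f, the
  function \<phi>(z) = (u(z), f) has Im \<phi> = Im z |u(z)|^2 and |\<phi>| \<le> |f|^2 / Im z, and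
  a contour integral bounds the integral of Im \<phi> over a horizontal line. Only symmetry is used,
  so the bound holds for the selfadjoint operator similar to \<open>A\<close> and for multiplication
  by t in L^2(\<mu>) alike. The latter stands in for the half-line Neumann operators: the Weyl
  solutions have the same Gram matrix as the kernels 1/(t - z), so norms of finite combinations can
  be computed in L^2(\<mu>), without a spectral transform. The Gram identity needs Wronskians that
  vanish at infinity, and this rests on \<open>c\<close> not being square integrable; otherwise
  \<open>c\<close> would help to glue an eigenfunction of \<open>A\<close> with nonreal eigenvalue,
  against similarity. On the real line the obstacle is the singular part of the measures. Boundary
  values and principal values exist almost everywhere because a weak type estimate for Cauchy
  transforms of finite measures makes the set of functions with these limits closed in L^1.\<close>

lemma half_disc_integral_bound:
  fixes f :: "complex \<Rightarrow> complex"
  assumes holo: "f holomorphic_on {z. Im z > b}" and a: "Im a > b" and R: "R > 0" and B: "B \<ge> 0"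
    and bound: "\<And>z. cmod (z - a) = R \<Longrightarrow> Im z \<ge> Im a \<Longrightarrow> cmod (f z) \<le> B"
  shows "cmod (integral {-R..R} (\<lambda>v. f (a + of_real v))) \<le> B * R * pi"
proof -
  let ?l = "linepath (a - of_real R) (a + of_real R)"
  let ?c = "part_circlepath a R 0 pi"
  have start: "pathstart ?c = a + of_real R" "pathfinish ?c = a - of_real R"
    by (auto simp: exp_Euler)
  have imc: "Im z \<ge> Im a \<and> cmod (z - a) = R" if "z \<in> path_image ?c" for z
  proof -
    have "path_image ?c = (\<lambda>x. a + R * cis x) ` {0..pi}"
      by (simp add: path_image_part_circlepath' closed_segment_eq_real_ivl)
    then obtain t where t: "t \<in> {0..pi}" "z = a + R * cis t"
      using \<open>z \<in> path_image ?c\<close> by auto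
    have "sin t \<ge> 0" using t(1) by (auto intro: sin_ge_zero)
    then show ?thesis using t(2) R
      by (simp add: norm_mult)
  qed
  have iml: "Im z = Im a" if zl: "z \<in> path_image ?l" for z
  proof -
    obtain u where "z = (1 - u) *\<^sub>R (a - of_real R) + u *\<^sub>R (a + of_real R)"
      using zl unfolding path_image_linepath closed_segment_def by blast
    from arg_cong[OF this, of Im] show ?thesis by (simp add: algebra_simps)
  qed
  have sub: "path_image (?l +++ ?c) \<subseteq> {z. Im z > b}"
    using start imc iml a by (subst path_image_join) (fastforce simp: )+
  have vp: "valid_path (?l +++ ?c)" using start by (intro valid_path_join) auto
  have conv: "convex {z. Im z > b}" by (rule convex_halfspace_Im_gt)
  have "(f has_contour_integral 0) (?l +++ ?c)"
    by (rule Cauchy_theorem_convex_simple[OF holo conv vp sub]) (use start in auto)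
  have contl: "continuous_on (path_image ?l) f"  "continuous_on (path_image ?c) f"
    using sub by (auto intro!: continuous_on_subset[OF holomorphic_on_imp_continuous_on[OF holo]]
          simp: path_image_join start)
  have il: "f contour_integrable_on ?l" 
    using contl(1) by (intro contour_integrable_continuous_linepath) auto
  have ic: "f contour_integrable_on ?c"
    using contl(2) by (rule contour_integrable_continuous_part_circlepath)
  have "contour_integral (?l +++ ?c) f = contour_integral ?l f + contour_integral ?c f"
    using il ic start by (intro contour_integral_join) auto
  then have sum0: "contour_integral ?l f + contour_integral ?c f = 0"
    using \<open>(f has_contour_integral 0) _\<close> contour_integral_unique by metis
  have "norm (contour_integral ?c f) \<le> B * R * (pi - 0)"
  proof -
    have "(f has_contour_integral contour_integral ?c f) ?c"
      using ic by (rule has_contour_integral_integral)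
    then show ?thesis
      using imc bound R B pi_gt_zero
      by (intro has_contour_integral_bound_part_circlepath_strong[where k="{}"]) auto
  qed
  then have bc: "norm (contour_integral ?l f) \<le> B * R * pi"
    using sum0 by (metis add_eq_0_iff diff_zero norm_minus_cancel)
  \<comment> \<open>A line path is parametrised over [0, 1]; the substitution v = 2 R x - R accounts
    for its derivative 2 R.\<close>
  have "contour_integral ?l f = integral {-R..R} (\<lambda>v. f (a + of_real v))"
  proof -
    have cont: "continuous_on {-R..R} (\<lambda>v. f (a + of_real v))"
      using a by (intro continuous_on_compose2[OF holomorphic_on_imp_continuous_on[OF holo]])
        (auto intro!: continuous_intros)
    then have "((\<lambda>v. f (a + of_real v)) has_integral integral {-R..R} (\<lambda>v. f (a + of_real v))) {-R..R}"
      by (intro integrable_integral integrable_continuous_real)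
    then have "((\<lambda>x. f (a + of_real ((2*R) *\<^sub>R x + (-R)))) has_integral
       (1 / (2*R)) *\<^sub>R integral {-R..R} (\<lambda>v. f (a + of_real v))) ((\<lambda>x. (1/(2*R)) *\<^sub>R x + - ((1/(2*R)) *\<^sub>R (-R))) ` cbox (-R) R)"
      using R has_integral_affinity[of "(\<lambda>v. f (a + of_real v))" _ "-R" R "2*R" "-R"] by simp
    moreover have "(\<lambda>x. (1/(2*R)) *\<^sub>R x + - ((1/(2*R)) *\<^sub>R (-R))) ` cbox (-R) R = {0..1}"
      using R by (subst image_affinity_cbox) (auto simp: field_simps)
    ultimately have "((\<lambda>x. f (a + of_real (2*R * x - R))) has_integral
       (1 / (2*R)) *\<^sub>R integral {-R..R} (\<lambda>v. f (a + of_real v))) {0..1}" by simp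
    then have "((\<lambda>x. f (a + of_real (2*R * x - R)) * (2*R)) has_integral
       (1 / (2*R)) *\<^sub>R integral {-R..R} (\<lambda>v. f (a + of_real v)) * (2*R)) {0..1}"
      by (rule has_integral_mult_left)
    then have "(f has_contour_integral (1 / (2*R)) *\<^sub>R integral {-R..R} (\<lambda>v. f (a + of_real v)) * (2*R)) ?l"
      unfolding has_contour_integral_linepath
      by (rule has_integral_eq[rotated]) (simp add: linepath_def algebra_simps scaleR_conv_of_real)
    then show ?thesis using R by (simp add: contour_integral_unique scaleR_conv_of_real)
  qed
  with bc show ?thesis by simp
qed


text \<open>Fatou's lemma, with the limit replaced almost everywhere by the lower limit of the
  measurable approximants.\<close>

lemma nn_integral_le_of_tendsto:
  fixes f :: "nat \<Rightarrow> 'a \<Rightarrow> real"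
  assumes meas: "\<And>n. f n \<in> borel_measurable M"
    and lim: "AE x in M. (\<lambda>n. f n x) \<longlonglongrightarrow> g x"
    and le: "\<And>n. (\<integral>\<^sup>+x. ennreal (f n x) \<partial>M) \<le> B"
  shows "(\<integral>\<^sup>+x. ennreal (g x) \<partial>M) \<le> B"
proof -
  have "(\<integral>\<^sup>+x. ennreal (g x) \<partial>M) = (\<integral>\<^sup>+x. liminf (\<lambda>n. ennreal (f n x)) \<partial>M)"
  proof (rule nn_integral_cong_AE)
    show "AE x in M. ennreal (g x) = liminf (\<lambda>n. ennreal (f n x))"
      using lim
    proof eventually_elim
      case (elim x)
      then have "(\<lambda>n. ennreal (f n x)) \<longlonglongrightarrow> ennreal (g x)" by (rule tendsto_ennrealI)
      then show ?case by (simp add: lim_imp_Liminf)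
    qed
  qed
  also have "\<dots> \<le> liminf (\<lambda>n. (\<integral>\<^sup>+x. ennreal (f n x) \<partial>M))"
    using meas by (intro nn_integral_liminf) auto
  also have "\<dots> \<le> liminf (\<lambda>n. B)"
    using le by (intro Liminf_mono) auto
  also have "\<dots> = B" by (simp add: Liminf_const)
  finally show ?thesis .
qed

text \<open>The multiplier 1 - u^2 with u = (z - a) / R is nonnegative on the diameter, and on the
  semicircle it has modulus 2 Im u because 1 = u * cnj u there. It compensates the possible growth C
  / Im z near the end points: the integrand stays below 2 C / R on an arc of length pi R. Letting R
  grow with Fatou's lemma yields 2 pi C, twice the value pi C that a Herglotz representation would
  give.\<close>

lemma halfplane_integral_bound:
  fixes \<phi> :: "complex \<Rightarrow> complex"
  assumes holo: "\<phi> holomorphic_on {z. Im z > 0}"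
    and pos: "\<And>z. Im z > 0 \<Longrightarrow> Im (\<phi> z) \<ge> 0"
    and bound: "\<And>z. Im z > 0 \<Longrightarrow> cmod (\<phi> z) \<le> C / Im z"
    and e: "e > 0"
  shows "(\<integral>\<^sup>+x. ennreal (Im (\<phi> (Complex x e))) \<partial>lborel) \<le> ennreal (2 * pi * C)"
proof -
  have C: "C \<ge> 0" using order_trans[OF norm_ge_zero bound[of \<i>]] by simp
  define a where "a = Complex 0 e"
  have av: "a + of_real v = Complex v e" for v by (simp add: a_def complex_eq_iff)
  define h where "h n v = Im (\<phi> (Complex v e)) * (1 - (v / real (Suc n))\<^sup>2) * indicator {-real (Suc n)..real (Suc n)} v" for n v
  have cont\<phi>: "continuous_on UNIV (\<lambda>v. \<phi> (Complex v e))"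
    by (rule continuous_on_compose2[OF holomorphic_on_imp_continuous_on[OF holo]])
       (use e in \<open>auto simp: Complex_eq intro!: continuous_intros\<close>)
  have meas: "h n \<in> borel_measurable lborel" for n
  proof -
    have "(\<lambda>v. Im (\<phi> (Complex v e))) \<in> borel_measurable borel"
      by (intro borel_measurable_continuous_onI continuous_intros cont\<phi>)
    then show ?thesis unfolding h_def by measurable
  qed
  have le: "(\<integral>\<^sup>+x. ennreal (h n x) \<partial>lborel) \<le> ennreal (2 * pi * C)" for n
  proof -
    define R where "R = real (Suc n)"
    have R: "R > 0" by (simp add: R_def)
    define f where "f z = \<phi> z * (1 - ((z - a) / of_real R)\<^sup>2)" for z
    have hf: "f holomorphic_on {z. Im z > 0}"
      unfolding f_def using R by (intro holomorphic_intros holo) auto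
    have bd: "cmod (integral {-R..R} (\<lambda>v. f (a + of_real v))) \<le> (2 * C / R) * R * pi"
    proof (rule half_disc_integral_bound[OF hf])
      fix z assume z: "cmod (z - a) = R" "Im z \<ge> Im a"
      define u where "u = (z - a) / of_real R"
      have u1: "cmod u = 1" using z R by (simp add: u_def norm_divide)
      have "1 - u\<^sup>2 = u * (cnj u - u)"
        using u1 by (simp add: algebra_simps power2_eq_square complex_norm_square[symmetric])
      then have "cmod (1 - u\<^sup>2) = cmod (cnj u - u)" using u1 by (simp add: norm_mult)
      also have "\<dots> = 2 * \<bar>Im u\<bar>"
      proof -
        have "cnj u - u = of_real (-2 * Im u) * \<i>" by (simp add: complex_eq_iff)
        then show ?thesis by (simp add: norm_mult)
      qed
      also have "Im u = (Im z - e) / R" by (simp add: u_def a_def)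
      finally have 1: "cmod (1 - u\<^sup>2) = 2 * (Im z - e) / R" using z R by (simp add: a_def)
      have zp: "Im z > 0" using z e by (simp add: a_def)
      have "cmod (f z) \<le> C / Im z * (2 * (Im z - e) / R)"
        unfolding f_def u_def[symmetric] norm_mult 1 using z R e
        by (intro mult_right_mono bound zp) (auto simp: a_def)
      also have "\<dots> \<le> 2 * C / R"
      proof -
        have "C / Im z * (2 * (Im z - e) / R) = 2 * C / R * ((Im z - e) / Im z)" using zp R by (simp add: divide_simps)
        also have "\<dots> \<le> 2 * C / R * 1" using zp R e C by (intro mult_left_mono) (auto simp: field_simps)
        finally show ?thesis by simp
      qed
      finally show "cmod (f z) \<le> 2 * C / R" .
    qed (use e R C in \<open>auto simp: a_def\<close>)
    have contf: "continuous_on {-R..R} (\<lambda>v. f (a + of_real v))"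
      unfolding f_def av using R
      by (intro continuous_intros continuous_on_subset[OF cont\<phi>]) (auto simp: Complex_eq intro!: continuous_intros)
    have int: "((\<lambda>v. f (a + of_real v)) has_integral integral {-R..R} (\<lambda>v. f (a + of_real v))) {-R..R}"
      by (intro integrable_integral integrable_continuous_real contf)
    have Imf: "Im (f (a + of_real v)) = Im (\<phi> (Complex v e)) * (1 - (v / R)\<^sup>2)" for v
    proof -
      have "1 - ((a + of_real v - a) / of_real R)\<^sup>2 = of_real (1 - (v/R)\<^sup>2)" by simp
      then show ?thesis unfolding f_def by (simp only: av) simp
    qed
    have nn: "Im (\<phi> (Complex v e)) * (1 - (v / R)\<^sup>2) \<ge> 0" if "v \<in> {-R..R}" for v
    proof -
      have "\<bar>v/R\<bar> \<le> 1" using that R by (simp add: abs_divide abs_le_iff)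
      then have "(v/R)\<^sup>2 \<le> 1" by (simp only: abs_square_le_1)
      then show ?thesis using pos[of "Complex v e"] e by simp
    qed
    from has_integral_linear[OF int bounded_linear_Im]
    have hi: "((\<lambda>v. Im (\<phi> (Complex v e)) * (1 - (v / R)\<^sup>2)) has_integral
        Im (integral {-R..R} (\<lambda>v. f (a + of_real v)))) {-R..R}"
      by (simp add: o_def Imf)
    have "(\<integral>\<^sup>+x. ennreal (h n x) \<partial>lborel)
      = (\<integral>\<^sup>+x. ennreal (Im (\<phi> (Complex x e)) * (1 - (x / R)\<^sup>2)) * indicator {-R..R} x \<partial>lborel)"
      unfolding h_def R_def[symmetric] by (intro nn_integral_cong) (auto split: split_indicator)
    also have "\<dots> = ennreal (Im (integral {-R..R} (\<lambda>v. f (a + of_real v))))"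
      by (rule nn_integral_has_integral_lebesgue'[OF nn hi])
    also have "\<dots> \<le> ennreal (2 * pi * C)"
      using bd R abs_Im_le_cmod[of "integral {-R..R} (\<lambda>v. f (a + of_real v))"]
      by (intro ennreal_leI) (simp add: field_simps)
    finally show ?thesis .
  qed
  have lim: "(\<lambda>n. h n x) \<longlonglongrightarrow> Im (\<phi> (Complex x e))" for x
  proof -
    have "(\<lambda>n. Im (\<phi> (Complex x e)) * (1 - (x / real (Suc n))\<^sup>2)) \<longlonglongrightarrow> Im (\<phi> (Complex x e)) * (1 - 0\<^sup>2)"
      by (intro tendsto_intros LIMSEQ_Suc lim_const_over_n)
    moreover have "\<forall>\<^sub>F n in sequentially. h n x = Im (\<phi> (Complex x e)) * (1 - (x / real (Suc n))\<^sup>2)"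
    proof -
      obtain N where N: "\<bar>x\<bar> \<le> real N" using real_arch_simple by blast
      show ?thesis using eventually_ge_at_top[of N]
      proof eventually_elim
        case (elim n)
        then have "x \<in> {-real (Suc n)..real (Suc n)}" using N by auto
        then show ?case by (simp add: h_def)
      qed
    qed
    ultimately show ?thesis by (simp cong: filterlim_cong) (subst filterlim_cong, auto)
  qed
  show ?thesis
    by (rule nn_integral_le_of_tendsto[where f = h, OF meas _ le]) (use lim in auto)
qed

text \<open>Subtracting g(p) before dividing by (z - p)(z - p'), with p' the reflection of p = a + i
  s in the horizontal line through a, leaves a function without poles on or above that line. On the
  line the denominator is v^2 + s^2, whose reciprocal has integral pi / s, and boundedness of g
  makes the contribution of the arc O(1 / R). So g(p) is the Poisson mean of g, of which only the
  inequality for moduli is kept.\<close>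

lemma poisson_kernel_bound:
  fixes g :: "complex \<Rightarrow> complex"
  assumes holo: "g holomorphic_on {z. Im z > b}" and B: "\<And>z. Im z > b \<Longrightarrow> cmod (g z) \<le> B"
    and a: "Im a > b" and s: "s > 0"
  shows "ennreal (cmod (g (a + \<i> * of_real s)))
    \<le> (\<integral>\<^sup>+v. ennreal (s / pi / (v\<^sup>2 + s\<^sup>2) * cmod (g (a + of_real v))) \<partial>lborel)"
proof -
  define p where "p = a + \<i> * of_real s"
  define p' where "p' = a - \<i> * of_real s"
  have B0: "B \<ge> 0" using B[OF a] norm_ge_zero order_trans by blast
  have Imp: "Im p > b" using a s by (simp add: p_def)
  \<comment> \<open>The difference quotient at \<open>p\<close> with its removable singularity
    filled in.\<close>
  define q where "q z = (if z = p then deriv g p else (g z - g p) / (z - p))" for z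
  have opn: "open {z. Im z > b}" by (rule open_halfspace_Im_gt)
  have hq: "q holomorphic_on {z. Im z > b}"
    unfolding q_def by (rule pole_lemma[OF holo]) (use Imp in \<open>simp add: interior_open[OF opn]\<close>)
  define k where "k z = q z / (z - p')" for z
  \<comment> \<open>The pole \<open>p'\<close> has imaginary part Im a - s and must stay outside the
    half-plane in which \<open>k\<close> is holomorphic.\<close>
  define b' where "b' = max b (Im a - s)"
  have hk: "k holomorphic_on {z. Im z > b'}"
    unfolding k_def
    by (intro holomorphic_intros holomorphic_on_subset[OF hq]) (auto simp: b'_def p'_def)
  define w where "w v = 1 / (v\<^sup>2 + s\<^sup>2)" for v :: real
  have wpos: "w v > 0" for v using s by (simp add: w_def add_nonneg_pos)
  have kv: "k (a + of_real v) = of_real (w v) * (g (a + of_real v) - g p)" for v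
  proof -
    have 1: "a + of_real v - p = of_real v - \<i> * of_real s" "a + of_real v - p' = of_real v + \<i> * of_real s"
      by (auto simp: p_def p'_def)
    have ne: "a + of_real v \<noteq> p" using s by (auto simp: p_def complex_eq_iff)
    have "(of_real v - \<i> * of_real s) * (of_real v + \<i> * of_real s) = (of_real (v\<^sup>2 + s\<^sup>2) :: complex)"
      by (simp add: complex_eq_iff power2_eq_square)
    then show ?thesis unfolding k_def q_def using ne
      by (simp add: 1 w_def)
  qed
  have contg: "continuous_on UNIV (\<lambda>v. g (a + of_real v))"
    by (rule continuous_on_compose2[OF holomorphic_on_imp_continuous_on[OF holo]])
       (use a in \<open>auto intro!: continuous_intros\<close>)
  have contw: "continuous_on S w" for S
    unfolding w_def using s by (intro continuous_intros) (auto simp: add_nonneg_eq_0_iff)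
  define I where "I = (\<integral>\<^sup>+v. ennreal (w v * cmod (g (a + of_real v))) \<partial>lborel)"
  \<comment> \<open>The first term is |g(p)| times the integral of \<open>w\<close> over [-R, R];
    the second is the length pi R of the arc times the bound 2 B / (R - s)^2 for \<open>k\<close> on
    it.\<close>
  have est: "ennreal (cmod (g p) * (2 / s * arctan (R / s)) - 2 * B * R * pi / (R - s)\<^sup>2) \<le> I" if R: "R > s" for R
  proof -
    have Rp: "R > 0" using R s by simp
    have "cmod (integral {-R..R} (\<lambda>v. k (a + of_real v))) \<le> (2 * B / (R - s)\<^sup>2) * R * pi"
    proof (rule half_disc_integral_bound[OF hk])
      fix z assume z: "cmod (z - a) = R" "Im z \<ge> Im a"
      have zb: "Im z > b" using z a by simp
      have d: "cmod (z - p) \<ge> R - s" "cmod (z - p') \<ge> R - s"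
        using z norm_triangle_ineq2[of "z - a" "\<i> * of_real s"] norm_triangle_ineq2[of "z - a" "- \<i> * of_real s"] s
        by (auto simp: p_def p'_def norm_mult algebra_simps)
      then have "z \<noteq> p" using R by auto
      then have "cmod (k z) = cmod (g z - g p) / (cmod (z - p) * cmod (z - p'))"
        by (simp add: k_def q_def norm_divide norm_mult)
      also have "\<dots> \<le> (B + B) / ((R - s) * (R - s))"
        using R d B[OF zb] B[OF Imp] B0
        by (intro frac_le mult_mono order_trans[OF norm_triangle_ineq4] add_mono) auto
      finally show "cmod (k z) \<le> 2 * B / (R - s)\<^sup>2" by (simp add: power2_eq_square)
    qed (use a s Rp B0 in \<open>auto simp: b'_def\<close>)
    moreover have "integral {-R..R} (\<lambda>v. k (a + of_real v)) =
       integral {-R..R} (\<lambda>v. of_real (w v) * g (a + of_real v)) - of_real (2 / s * arctan (R/s)) * g p"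
    proof -
      have "(w has_integral (1/s * arctan (R/s) - 1/s * arctan (-R/s))) {-R..R}"
      proof (rule fundamental_theorem_of_calculus)
        fix x assume "x \<in> {-R..R}"
        have "((\<lambda>x. 1/s * arctan (x/s)) has_real_derivative (1/s * (inverse (1 + (x/s)\<^sup>2) * (1/s)))) (at x within {-R..R})"
          using s by (auto intro!: derivative_eq_intros)
        moreover have "1/s * (inverse (1 + (x/s)\<^sup>2) * (1/s)) = w x"
        proof -
          have "1 + (x/s)\<^sup>2 = (x\<^sup>2 + s\<^sup>2) / s\<^sup>2" using s by (simp add: field_simps)
          then show ?thesis using s by (simp add: w_def power2_eq_square)
        qed
        ultimately show "((\<lambda>x. 1/s * arctan (x/s)) has_vector_derivative w x) (at x within {-R..R})"
          by (simp add: has_real_derivative_iff_has_vector_derivative)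
      qed (use Rp in auto)
      then have "(w has_integral (2/s * arctan (R/s))) {-R..R}" by (simp add: arctan_minus)
      then have "((\<lambda>v. of_real (w v) * g p) has_integral (of_real (2/s * arctan (R/s)) * g p)) {-R..R}"
        by (intro has_integral_mult_left has_integral_of_real)
      moreover have "((\<lambda>v. of_real (w v) * g (a + of_real v)) has_integral
          integral {-R..R} (\<lambda>v. of_real (w v) * g (a + of_real v))) {-R..R}"
        by (intro integrable_integral integrable_continuous_real continuous_intros contw continuous_on_subset[OF contg]) auto
      ultimately have "((\<lambda>v. of_real (w v) * g (a + of_real v) - of_real (w v) * g p) has_integral
          integral {-R..R} (\<lambda>v. of_real (w v) * g (a + of_real v)) - (of_real (2/s * arctan (R/s)) * g p)) {-R..R}"
        by (intro has_integral_diff)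
      then show ?thesis by (simp add: kv algebra_simps integral_unique)
    qed
    ultimately have 1: "cmod (of_real (2 / s * arctan (R/s)) * g p) \<le>
        cmod (integral {-R..R} (\<lambda>v. of_real (w v) * g (a + of_real v))) + (2 * B / (R - s)\<^sup>2) * R * pi"
      using norm_triangle_sub[of "of_real (2 / s * arctan (R/s)) * g p" "integral {-R..R} (\<lambda>v. of_real (w v) * g (a + of_real v))"]
      by (simp add: norm_minus_commute)
    have hi: "((\<lambda>v. w v * cmod (g (a + of_real v))) has_integral
        integral {-R..R} (\<lambda>v. w v * cmod (g (a + of_real v)))) {-R..R}"
      by (intro integrable_integral integrable_continuous_real continuous_intros contw continuous_on_subset[OF contg]) auto
    have 2: "cmod (integral {-R..R} (\<lambda>v. of_real (w v) * g (a + of_real v)))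
       \<le> integral {-R..R} (\<lambda>v. w v * cmod (g (a + of_real v)))"
      using hi wpos
      by (intro integral_norm_bound_integral has_integral_integrable[OF hi] integrable_continuous_real
            continuous_intros contw continuous_on_subset[OF contg])
         (auto simp: norm_mult less_imp_le)
    have "ennreal (integral {-R..R} (\<lambda>v. w v * cmod (g (a + of_real v))))
       = (\<integral>\<^sup>+v. ennreal (w v * cmod (g (a + of_real v))) * indicator {-R..R} v \<partial>lborel)"
      by (rule nn_integral_has_integral_lebesgue'[OF _ hi, symmetric]) (use wpos in \<open>auto simp: less_imp_le\<close>)
    also have "\<dots> \<le> I" unfolding I_def by (intro nn_integral_mono) (auto split: split_indicator)
    finally have 3: "ennreal (integral {-R..R} (\<lambda>v. w v * cmod (g (a + of_real v)))) \<le> I" .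
    have "arctan (R/s) \<ge> 0" using Rp s by (simp add: zero_le_arctan_iff)
    then have "cmod (of_real (2 / s * arctan (R/s)) * g p) = cmod (g p) * (2 / s * arctan (R / s))"
      using s by (simp add: norm_mult norm_divide)
    then have "cmod (g p) * (2 / s * arctan (R / s)) - 2 * B * R * pi / (R - s)\<^sup>2 \<le>
       integral {-R..R} (\<lambda>v. w v * cmod (g (a + of_real v)))"
      using 1 2 by simp
    then show ?thesis using 3 ennreal_leI order_trans by blast
  qed
  have "((\<lambda>R. cmod (g p) * (2 / s * arctan (R / s)) - 2 * B * R * pi / (R - s)\<^sup>2)
       \<longlongrightarrow> cmod (g p) * (2 / s * (pi / 2)) - 0) at_top"
  proof (intro tendsto_intros filterlim_compose[OF tendsto_arctan_at_top])
    show "filterlim (\<lambda>x. x / s) at_top at_top" using s by real_asymp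
    show "((\<lambda>x. 2 * B * x * pi / (x - s)\<^sup>2) \<longlongrightarrow> 0) at_top" by real_asymp
  qed
  then have "((\<lambda>R. ennreal (cmod (g p) * (2 / s * arctan (R / s)) - 2 * B * R * pi / (R - s)\<^sup>2))
       \<longlongrightarrow> ennreal (cmod (g p) * (pi / s))) at_top"
    by (intro tendsto_ennrealI) simp
  then have fin: "ennreal (cmod (g p) * (pi / s)) \<le> I"
    by (rule tendsto_upperbound[OF _ eventually_mono[OF eventually_gt_at_top[of s] est]]) auto
  have "(\<integral>\<^sup>+v. ennreal (s / pi / (v\<^sup>2 + s\<^sup>2) * cmod (g (a + of_real v))) \<partial>lborel)
      = (\<integral>\<^sup>+v. ennreal (s / pi) * ennreal (w v * cmod (g (a + of_real v))) \<partial>lborel)"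
    using s by (intro nn_integral_cong) (simp add: w_def ennreal_mult'[symmetric])
  also have "\<dots> = ennreal (s / pi) * I"
    unfolding I_def
    by (intro nn_integral_cmult borel_measurable_continuous_onI measurable_compose[OF _ measurable_ennreal])
       (simp, intro borel_measurable_continuous_onI continuous_intros contw contg)
  also have "\<dots> \<ge> ennreal (s / pi) * ennreal (cmod (g p) * (pi / s))"
    using fin by (rule mult_left_mono) simp
  also have "ennreal (s / pi) * ennreal (cmod (g p) * (pi / s)) = ennreal (cmod (g p))"
    using s by (simp add: ennreal_mult'[symmetric])
  finally show ?thesis by (simp add: p_def)
qed

section \<open>Resolvent bounds\<close>

lemma L2_measurable [measurable_dest]: "f \<in> L2 M \<Longrightarrow> f \<in> borel_measurable M"
  and L2_integrable_sq: "f \<in> L2 M \<Longrightarrow> integrable M (\<lambda>x. (cmod (f x))\<^sup>2)"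
  by (auto simp: L2_def)

lemma L2_norm_sq: "(L2_norm M f)\<^sup>2 = (LINT x|M. (cmod (f x))\<^sup>2)"
  by (simp add: L2_norm_def)

lemma L2_norm_nonneg [simp]: "L2_norm M f \<ge> 0"
  by (simp add: L2_norm_def)

lemma L2_norm_cong_AE:
  assumes "f \<in> borel_measurable M" "g \<in> borel_measurable M" "AE x in M. f x = g x"
  shows "L2_norm M f = L2_norm M g"
  unfolding L2_norm_def using assms
  by (intro arg_cong[of _ _ sqrt] integral_cong_AE) auto

lemma integrable_L2_mult:
  assumes "f \<in> L2 M" "g \<in> L2 M"
  shows "integrable M (\<lambda>x. f x * g x)"
proof (rule Bochner_Integration.integrable_bound)
  show "integrable M (\<lambda>x. (cmod (f x))\<^sup>2 + (cmod (g x))\<^sup>2)"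
    using assms by (intro Bochner_Integration.integrable_add L2_integrable_sq)
  show "(\<lambda>x. f x * g x) \<in> borel_measurable M"
    using assms[THEN L2_measurable] by simp
  show "AE x in M. norm (f x * g x) \<le> norm ((cmod (f x))\<^sup>2 + (cmod (g x))\<^sup>2)"
  proof (intro AE_I2)
    fix x
    have "cmod (f x) * cmod (g x) \<le> (cmod (f x))\<^sup>2 + (cmod (g x))\<^sup>2"
      using sum_squares_bound[of "cmod (f x)" "cmod (g x)"] mult_nonneg_nonneg[OF norm_ge_zero[of "f x"] norm_ge_zero[of "g x"]]
      by linarith
    then show "norm (f x * g x) \<le> norm ((cmod (f x))\<^sup>2 + (cmod (g x))\<^sup>2)"
      by (simp add: norm_mult)
  qed
qed

lemma L2_cnj: "f \<in> L2 M \<Longrightarrow> (\<lambda>x. cnj (f x)) \<in> L2 M"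
  by (auto simp: L2_def intro: measurable_compose[OF _ borel_measurable_continuous_onI[OF continuous_on_cnj[OF continuous_on_id]]])

lemma integrable_L2_mult_cnj:
  "f \<in> L2 M \<Longrightarrow> g \<in> L2 M \<Longrightarrow> integrable M (\<lambda>x. f x * cnj (g x))"
  by (intro integrable_L2_mult L2_cnj)

lemma cmod_add_sq_le: "(cmod (a + b))\<^sup>2 \<le> 2 * (cmod a)\<^sup>2 + 2 * (cmod b)\<^sup>2"
proof -
  have "(cmod (a + b))\<^sup>2 \<le> (cmod a + cmod b)\<^sup>2"
    by (intro power_mono norm_triangle_ineq) auto
  then show ?thesis using sum_squares_bound[of "cmod a" "cmod b"] by (simp add: power2_sum)
qed

lemma L2_add:
  assumes "f \<in> L2 M" "g \<in> L2 M"
  shows "(\<lambda>x. f x + g x) \<in> L2 M"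
proof -
  have "integrable M (\<lambda>x. (cmod (f x + g x))\<^sup>2)"
  proof (rule Bochner_Integration.integrable_bound)
    show "integrable M (\<lambda>x. 2 * (cmod (f x))\<^sup>2 + 2 * (cmod (g x))\<^sup>2)"
      using assms by (auto intro!: Bochner_Integration.integrable_add L2_integrable_sq)
  qed (use assms[THEN L2_measurable] cmod_add_sq_le in auto)
  then show ?thesis using assms[THEN L2_measurable] by (simp add: L2_def)
qed

lemma L2_cmult:
  assumes "f \<in> L2 M" shows "(\<lambda>x. a * f x) \<in> L2 M"
  using assms by (auto simp: L2_def norm_mult power_mult_distrib)

lemma L2_zero: "(\<lambda>x. 0) \<in> L2 M"
  by (simp add: L2_def)

lemma L2_diff: "f \<in> L2 M \<Longrightarrow> g \<in> L2 M \<Longrightarrow> (\<lambda>x. f x - g x) \<in> L2 M"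
  using L2_add[OF _ L2_cmult[of g M "-1"]] by simp

lemma L2_sum:
  "(\<And>i. i \<in> Z \<Longrightarrow> f i \<in> L2 M) \<Longrightarrow> (\<lambda>x. \<Sum>i\<in>Z. f i x) \<in> L2 M"
  by (induction Z rule: infinite_finite_induct) (auto intro: L2_zero L2_add)

lemma L2_bound:
  assumes "g \<in> L2 M" "f \<in> borel_measurable M" "\<And>x. x \<in> space M \<Longrightarrow> cmod (f x) \<le> cmod (g x)"
  shows "f \<in> L2 M"
proof -
  have "integrable M (\<lambda>x. (cmod (f x))\<^sup>2)"
    by (rule Bochner_Integration.integrable_bound[OF L2_integrable_sq[OF assms(1)]])
       (use assms in \<open>auto intro!: power_mono\<close>)
  then show ?thesis using assms by (simp add: L2_def)
qed

lemma L2_norm_add_sq: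
  assumes "f \<in> L2 M" "g \<in> L2 M"
  shows "(L2_norm M (\<lambda>x. f x + g x))\<^sup>2 \<le> 2 * (L2_norm M f)\<^sup>2 + 2 * (L2_norm M g)\<^sup>2"
proof -
  have "(LINT x|M. (cmod (f x + g x))\<^sup>2) \<le> (LINT x|M. 2 * (cmod (f x))\<^sup>2 + 2 * (cmod (g x))\<^sup>2)"
    using assms by (intro integral_mono cmod_add_sq_le L2_integrable_sq L2_add) 
      (auto intro!: Bochner_Integration.integrable_add L2_integrable_sq)
  also have "\<dots> = 2 * (LINT x|M. (cmod (f x))\<^sup>2) + 2 * (LINT x|M. (cmod (g x))\<^sup>2)"
    using assms[THEN L2_integrable_sq] by simp
  finally show ?thesis by (simp add: L2_norm_sq)
qed

lemma L2_norm_cmult: "L2_norm M (\<lambda>x. a * f x) = cmod a * L2_norm M f"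
  by (simp add: L2_norm_def norm_mult power_mult_distrib real_sqrt_mult)

lemma L2_inner_self: "L2_inner M f f = of_real ((L2_norm M f)\<^sup>2)"
proof -
  have "L2_inner M f f = (LINT x|M. of_real ((cmod (f x))\<^sup>2))"
    unfolding L2_inner_def by (intro Bochner_Integration.integral_cong) (simp_all add: complex_norm_square[symmetric])
  then show ?thesis by (simp add: L2_norm_sq del: of_real_power)
qed

lemma L2_inner_cnj: "cnj (L2_inner M f g) = L2_inner M g f"
  unfolding L2_inner_def Bochner_Integration.integral_cnj[symmetric] by (simp add: mult.commute)

lemma L2_inner_add_left:
  "f \<in> L2 M \<Longrightarrow> g \<in> L2 M \<Longrightarrow> h \<in> L2 M \<Longrightarrow>
   L2_inner M (\<lambda>x. f x + g x) h = L2_inner M f h + L2_inner M g h"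
  unfolding L2_inner_def by (simp add: distrib_right integrable_L2_mult_cnj)

lemma L2_inner_diff_left:
  "f \<in> L2 M \<Longrightarrow> g \<in> L2 M \<Longrightarrow> h \<in> L2 M \<Longrightarrow>
   L2_inner M (\<lambda>x. f x - g x) h = L2_inner M f h - L2_inner M g h"
  unfolding L2_inner_def by (simp add: left_diff_distrib integrable_L2_mult_cnj)

lemma L2_inner_cmult_left: "L2_inner M (\<lambda>x. a * f x) h = a * L2_inner M f h"
  unfolding L2_inner_def by (simp add: mult.assoc)

lemma L2_inner_add_right:
  "f \<in> L2 M \<Longrightarrow> g \<in> L2 M \<Longrightarrow> h \<in> L2 M \<Longrightarrow>
   L2_inner M h (\<lambda>x. f x + g x) = L2_inner M h f + L2_inner M h g"
  using L2_inner_add_left[of f M g h] by (metis L2_inner_cnj complex_cnj_add)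

lemma L2_inner_diff_right:
  "f \<in> L2 M \<Longrightarrow> g \<in> L2 M \<Longrightarrow> h \<in> L2 M \<Longrightarrow>
   L2_inner M h (\<lambda>x. f x - g x) = L2_inner M h f - L2_inner M h g"
  using L2_inner_diff_left[of f M g h] by (metis L2_inner_cnj complex_cnj_diff)

lemma L2_inner_cmult_right: "L2_inner M h (\<lambda>x. a * f x) = cnj a * L2_inner M h f"
  using L2_inner_cmult_left[of M a f h] by (metis L2_inner_cnj complex_cnj_mult)

lemma L2_inner_sum_left:
  "(\<And>i. i \<in> Z \<Longrightarrow> f i \<in> L2 M) \<Longrightarrow> h \<in> L2 M \<Longrightarrow>
   L2_inner M (\<lambda>x. \<Sum>i\<in>Z. a i * f i x) h = (\<Sum>i\<in>Z. a i * L2_inner M (f i) h)"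
proof (induction Z rule: infinite_finite_induct)
  case (insert i Z)
  then show ?case
    using L2_inner_add_left[OF L2_cmult[of "f i" M "a i"] L2_sum[of Z "\<lambda>i x. a i * f i x" M], of h]
    by (simp add: L2_inner_cmult_left L2_cmult)
qed (simp_all add: L2_inner_def)

lemma L2_inner_sum_right:
  "(\<And>i. i \<in> Z \<Longrightarrow> f i \<in> L2 M) \<Longrightarrow> h \<in> L2 M \<Longrightarrow>
   L2_inner M h (\<lambda>x. \<Sum>i\<in>Z. a i * f i x) = (\<Sum>i\<in>Z. cnj (a i) * L2_inner M h (f i))"
  by (subst L2_inner_cnj[symmetric]) (simp add: L2_inner_sum_left L2_inner_cnj)

lemma L2_Cauchy_Schwarz_abs:
  assumes "f \<in> L2 M" "g \<in> L2 M"
  shows "(LINT x|M. cmod (f x * g x)) \<le> L2_norm M f * L2_norm M g"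
proof -
  define A B C where "A = (LINT x|M. (cmod (f x))\<^sup>2)" and "B = (LINT x|M. (cmod (g x))\<^sup>2)"
    and "C = (LINT x|M. cmod (f x * g x))"
  have [measurable]: "f \<in> borel_measurable M" "g \<in> borel_measurable M" using assms by auto
  have nn: "A \<ge> 0" "B \<ge> 0" "C \<ge> 0" by (auto simp: A_def B_def C_def)
  have int: "integrable M (\<lambda>x. cmod (f x * g x))"
    using integrable_L2_mult[OF assms] by simp
  have "C\<^sup>2 \<le> A * B"
  proof (cases "A = 0")
    case True
    then have "AE x in M. (cmod (f x))\<^sup>2 = 0"
      using integral_nonneg_eq_0_iff_AE[OF L2_integrable_sq[OF assms(1)]] by (simp add: A_def)
    then have "AE x in M. cmod (f x * g x) = 0" by eventually_elim simp
    then have "C = (LINT x|M. 0)" unfolding C_def by (intro integral_cong_AE) auto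
    then show ?thesis using nn by simp
  next
    case False
    \<comment> \<open>The minimiser of the quadratic polynomial t^2 A - 2 t C + B; that its minimum
      is nonnegative is the claim.\<close>
    define t where "t = C / A"
    have "0 \<le> (LINT x|M. (t * cmod (f x) - cmod (g x))\<^sup>2)" by simp
    also have "\<dots> = (LINT x|M. t\<^sup>2 * (cmod (f x))\<^sup>2 + (cmod (g x))\<^sup>2 - 2 * t * cmod (f x * g x))"
      by (intro Bochner_Integration.integral_cong) (auto simp: power2_eq_square algebra_simps norm_mult)
    also have "\<dots> = t\<^sup>2 * A + B - 2 * t * C"
      unfolding A_def B_def C_def using int assms[THEN L2_integrable_sq]
      by (subst Bochner_Integration.integral_diff) auto
    finally have "0 \<le> t\<^sup>2 * A + B - 2 * t * C" .
    then have "0 \<le> A * (t\<^sup>2 * A + B - 2 * t * C)" using nn by simp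
    also have "\<dots> = A * B - C\<^sup>2" using False by (simp add: t_def power2_eq_square field_simps)
    finally show ?thesis by simp
  qed
  then have "sqrt (C\<^sup>2) \<le> sqrt (A * B)" by (rule real_sqrt_le_mono)
  then show ?thesis using nn by (simp add: L2_norm_def real_sqrt_mult A_def B_def C_def)
qed

lemma L2_Cauchy_Schwarz:
  assumes "f \<in> L2 M" "g \<in> L2 M"
  shows "cmod (L2_inner M f g) \<le> L2_norm M f * L2_norm M g"
proof -
  have "cmod (L2_inner M f g) \<le> (LINT x|M. cmod (f x * cnj (g x)))"
    unfolding L2_inner_def by (rule integral_norm_bound)
  also have "\<dots> \<le> L2_norm M f * L2_norm M (\<lambda>x. cnj (g x))"
    by (rule L2_Cauchy_Schwarz_abs[OF assms(1) L2_cnj[OF assms(2)]])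
  finally show ?thesis by (simp add: L2_norm_def)
qed

section \<open>Resolvents of symmetric operators on horizontal lines\<close>

lemma holomorphic_extend_finite:
  fixes f :: "complex \<Rightarrow> complex"
  assumes "finite E" "open S" "f holomorphic_on S - E"
    and "\<And>e. e \<in> S \<Longrightarrow> \<exists>B. \<forall>\<^sub>F z in at e. cmod (f z) \<le> B"
  shows "\<exists>g. g holomorphic_on S \<and> (\<forall>z\<in>S - E. g z = f z)"
  using assms
proof (induction E arbitrary: S rule: finite_induct)
  case empty
  then show ?case by auto
next
  case (insert e E)
  \<comment> \<open>One point is removed from the domain, the induction hypothesis treats the others
    on the open set \<open>S - {e}\<close>, and Riemann's theorem on removable singularities puts
    the point back.\<close>
  have "open (S - {e})" using insert.prems(1) by auto
  moreover have "f holomorphic_on S - {e} - E"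
    using insert.prems(2) by (rule holomorphic_on_subset) auto
  ultimately have "\<exists>g. g holomorphic_on S - {e} \<and> (\<forall>z\<in>S - {e} - E. g z = f z)"
    by (rule insert.IH) (use insert.prems(3) in blast)
  then obtain g where g: "g holomorphic_on S - {e}" "\<forall>z\<in>S - {e} - E. g z = f z" by blast
  show ?case
  proof (cases "e \<in> S")
    case False
    then have "S - {e} = S" by blast
    then have "g holomorphic_on S \<and> (\<forall>z\<in>S - insert e E. g z = f z)" using g by auto
    then show ?thesis by blast
  next
    case True
    obtain B where B: "\<forall>\<^sub>F z in at e. cmod (f z) \<le> B" using insert.prems(3) True by blast
    have "\<forall>\<^sub>F z in at e. z \<in> S - E"
    proof -
      have "open (S - E)" using insert.prems(1) insert.hyps(1) by (auto intro: open_Diff finite_imp_closed)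
      then have "\<forall>\<^sub>F z in nhds e. z \<in> S - E" using True insert.hyps(2) by (intro eventually_nhds_in_open) auto
      then show ?thesis by (auto simp: eventually_at_filter elim: eventually_mono)
    qed
    moreover have "\<forall>\<^sub>F z in at e. z \<noteq> e" by (simp add: eventually_at_filter)
    ultimately have "\<forall>\<^sub>F z in at e. cmod (g z) \<le> B"
      using B by eventually_elim (use g in auto)
    then obtain h where "h holomorphic_on S" "\<forall>z\<in>S - {e}. h z = g z"
      using holomorphic_on_extend_bounded[OF g(1)] True insert.prems(1) by (auto simp: interior_open)
    then show ?thesis using g by (intro exI[of _ h]) auto
  qed
qed

text \<open>Here \<open>u z\<close> plays the role of the resolvent at z applied to
  \<open>f\<close>, known only as some solution of (T - z) u = f off a finite set \<open>E\<close>.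
  Symmetry alone makes \<phi>(z) = (u z, f) a Nevanlinna function with Im \<phi> = Im z |u z|^2, so
  that \<open>halfplane_integral_bound\<close> applies to its extension over \<open>E\<close>. At
  the exceptional points \<open>u\<close> is arbitrary, hence the everywhere defined majorant
  \<open>G\<close>.\<close>

lemma symmetric_resolvent_bound:
  fixes u :: "complex \<Rightarrow> real \<Rightarrow> complex"
  assumes sym: "\<And>f g f' g'. (f, g) \<in> T \<Longrightarrow> (f', g') \<in> T \<Longrightarrow> L2_inner M g f' = L2_inner M f g'"
    and TL2: "\<And>f g. (f, g) \<in> T \<Longrightarrow> f \<in> L2 M"
    and f: "f \<in> L2 M" and E: "finite E"
    and res: "\<And>z. z \<notin> \<real> \<Longrightarrow> z \<notin> E \<Longrightarrow> (u z, \<lambda>x. f x + z * u z x) \<in> T"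
    and e: "e > 0"
  shows "\<exists>G\<in>borel_measurable lborel. (\<forall>x. 0 \<le> G x) \<and>
    (AE x in lborel. e * (L2_norm M (u (Complex x e)))\<^sup>2 \<le> G x) \<and>
    (\<integral>\<^sup>+x. ennreal (G x) \<partial>lborel) \<le> ennreal (2 * pi * (L2_norm M f)\<^sup>2)"
proof -
  \<comment> \<open>The exceptional set is made invariant under conjugation because differences of
    \<phi> involve \<open>u (cnj w)\<close>.\<close>
  define E' where "E' = E \<union> cnj ` E"
  define D where "D = {z. z \<notin> \<real> \<and> z \<notin> E'}"
  define N where "N z = L2_norm M (u z)" for z
  define F where "F = L2_norm M f"
  define \<phi> where "\<phi> z = L2_inner M (u z) f" for z
  have finE': "finite E'" using E by (simp add: E'_def)
  have Dc: "cnj z \<in> D" if "z \<in> D" for z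
    using that by (auto simp: D_def E'_def complex_is_Real_iff) (metis complex_cnj_cnj imageI)
  have uL2: "u z \<in> L2 M" if "z \<in> D" for z
    using TL2[OF res] that by (auto simp: D_def E'_def)
  \<comment> \<open>Symmetry of \<open>T\<close> for the pairs at z and w. With w = z it gives the
    formula for Im \<phi>, with w replaced by its conjugate the first resolvent identity.\<close>
  have star: "(z - cnj w) * L2_inner M (u z) (u w) = \<phi> z - cnj (\<phi> w)" if "z \<in> D" "w \<in> D" for z w
  proof -
    have "L2_inner M (\<lambda>x. f x + z * u z x) (u w) = L2_inner M (u z) (\<lambda>x. f x + w * u w x)"
      using that by (intro sym[OF res res]) (auto simp: D_def E'_def)
    then have "L2_inner M f (u w) + z * L2_inner M (u z) (u w) = \<phi> z + cnj w * L2_inner M (u z) (u w)"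
      using that f by (simp add: L2_inner_add_left L2_inner_add_right L2_inner_cmult_left L2_inner_cmult_right
          uL2 L2_cmult \<phi>_def)
    then show ?thesis by (simp add: \<phi>_def L2_inner_cnj algebra_simps)
  qed
  have Im\<phi>: "Im z * (N z)\<^sup>2 = Im (\<phi> z)" if "z \<in> D" for z
    using arg_cong[OF star[OF that that], of Im] by (simp add: L2_inner_self N_def)
  have \<phi>le: "cmod (\<phi> z) \<le> N z * F" if "z \<in> D" for z
    unfolding \<phi>_def N_def F_def using that f by (intro L2_Cauchy_Schwarz uL2)
  \<comment> \<open>One factor N z cancels in |Im z| N^2 \<le> N F; the case N = 0 is
    separate.\<close>
  have Nle: "N z \<le> F / \<bar>Im z\<bar>" if "z \<in> D" for z
  proof -
    have Im0: "\<bar>Im z\<bar> > 0" using that by (auto simp: D_def complex_is_Real_iff)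
    have "\<bar>Im z\<bar> * (N z)\<^sup>2 = \<bar>Im (\<phi> z)\<bar>" by (simp add: Im\<phi>[OF that, symmetric] abs_mult)
    also have "\<dots> \<le> N z * F" using \<phi>le[OF that] abs_Im_le_cmod order_trans by blast
    finally have "\<bar>Im z\<bar> * N z * N z \<le> F * N z" by (simp add: power2_eq_square mult.commute mult.left_commute)
    then have "\<bar>Im z\<bar> * N z \<le> F \<or> N z = 0"
      using L2_norm_nonneg[of M "u z"] mult_right_le_imp_le[of "\<bar>Im z\<bar> * N z" "N z" F]
      unfolding N_def[symmetric] by linarith
    then show ?thesis using Im0 by (auto simp: field_simps F_def)
  qed
  have \<phi>cnj: "\<phi> (cnj w) = cnj (\<phi> w)" if "w \<in> D" for w
    using star[OF Dc[OF that] that] by simp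
  have diff: "\<phi> z - \<phi> w = (z - w) * L2_inner M (u z) (u (cnj w))" if "z \<in> D" "w \<in> D" for z w
    using star[OF that(1) Dc[OF that(2)]] \<phi>cnj[OF that(2)] by simp
  define U where "U = {z. Im z > 0}"
  have UD: "U - E' \<subseteq> D" by (auto simp: U_def D_def complex_is_Real_iff)
  have opU: "open U" unfolding U_def by (rule open_halfspace_Im_gt)
  have opUE: "open (U - E')" using opU finE' by (auto intro: open_Diff finite_imp_closed)
  have holo: "\<phi> holomorphic_on U - E'"
    unfolding holomorphic_on_def
  proof
    fix z assume z: "z \<in> U - E'"
    then have zD: "z \<in> D" and Imz: "Im z > 0" using UD by (auto simp: U_def)
    have ev1: "\<forall>\<^sub>F w in at z. w \<in> U - E'"
      using eventually_nhds_in_open[OF opUE z] by (auto simp: eventually_at_filter elim: eventually_mono)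
    have ImT: "(Im \<longlongrightarrow> Im z) (at z)" by (intro tendsto_intros)
    then have ev2: "\<forall>\<^sub>F w in at z. Im w > Im z / 2"
      using Imz by (intro order_tendstoD(1)) auto
    have \<phi>lim: "(\<phi> \<longlongrightarrow> \<phi> z) (at z)"
    proof (rule Lim_transform2)
      show "((\<lambda>w. \<phi> z) \<longlongrightarrow> \<phi> z) (at z)" by simp
      show "((\<lambda>w. \<phi> z - \<phi> w) \<longlongrightarrow> 0) (at z)"
      proof (rule Lim_null_comparison)
        show "\<forall>\<^sub>F w in at z. norm (\<phi> z - \<phi> w) \<le> cmod (z - w) * (F / Im z * (F / (Im z / 2)))"
          using ev1 ev2
        proof eventually_elim
          case (elim w)
          then have wD: "w \<in> D" using UD by auto
          have "N (cnj w) \<le> F / \<bar>Im (cnj w)\<bar>" by (rule Nle[OF Dc[OF wD]])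
          also have "\<dots> \<le> F / (Im z / 2)"
            using elim Imz by (intro divide_left_mono) (auto simp: F_def)
          finally have "N (cnj w) \<le> F / (Im z / 2)" .
          then show ?case
            unfolding diff[OF zD wD] norm_mult
            using Nle[OF zD] Imz L2_Cauchy_Schwarz[OF uL2[OF zD] uL2[OF Dc[OF wD]]]
            by (intro mult_left_mono order_trans[OF L2_Cauchy_Schwarz[OF uL2[OF zD] uL2[OF Dc[OF wD]]]] mult_mono)
               (auto simp: N_def F_def)
        qed
        have "((\<lambda>w. cmod (z - w) * (F / Im z * (F / (Im z / 2)))) \<longlongrightarrow> cmod (z - z) * (F / Im z * (F / (Im z / 2)))) (at z)"
          by (intro tendsto_intros)
        then show "((\<lambda>w. cmod (z - w) * (F / Im z * (F / (Im z / 2)))) \<longlongrightarrow> 0) (at z)" by simp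
      qed
    qed
    \<comment> \<open>By \<open>star\<close> the squared distance of \<open>u w\<close> and
      \<open>u z\<close> is expressible through \<phi> alone. Continuity of \<phi> thus yields
      continuity of \<open>u\<close> in norm, which the difference quotient of \<phi>
      requires.\<close>
    define d where "d w = (L2_norm M (\<lambda>x. u w x - u z x))\<^sup>2" for w
    have d_eq: "d w = Im (\<phi> w) / Im w + (N z)\<^sup>2 - 2 * Re ((\<phi> w - cnj (\<phi> z)) / (w - cnj z))"
      if w: "w \<in> U - E'" for w
    proof -
      have wD: "w \<in> D" and Imw: "Im w > 0" using UD w by (auto simp: U_def)
      have "of_real (d w) = L2_inner M (\<lambda>x. u w x - u z x) (\<lambda>x. u w x - u z x)"
        by (simp add: L2_inner_self d_def)
      also have "\<dots> = L2_inner M (u w) (u w) - L2_inner M (u w) (u z) - L2_inner M (u z) (u w) + L2_inner M (u z) (u z)"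
        by (simp add: L2_inner_diff_left L2_inner_diff_right uL2[OF wD] uL2[OF zD] L2_diff)
      also have "L2_inner M (u z) (u w) = cnj (L2_inner M (u w) (u z))" by (simp add: L2_inner_cnj)
      finally have "of_real (d w) = of_real ((N w)\<^sup>2) - L2_inner M (u w) (u z) - cnj (L2_inner M (u w) (u z)) + of_real ((N z)\<^sup>2)"
        by (simp add: L2_inner_self N_def)
      from arg_cong[OF this, of Re] have 1: "d w = (N w)\<^sup>2 + (N z)\<^sup>2 - 2 * Re (L2_inner M (u w) (u z))"
        by simp
      have "w - cnj z \<noteq> 0" using Imw Imz by (auto simp: complex_eq_iff)
      then have "L2_inner M (u w) (u z) = (\<phi> w - cnj (\<phi> z)) / (w - cnj z)"
        using star[OF wD zD] by (simp add: field_simps)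
      moreover have "(N w)\<^sup>2 = Im (\<phi> w) / Im w" using Im\<phi>[OF wD] Imw by (simp add: field_simps)
      ultimately show ?thesis using 1 by simp
    qed
    have "((\<lambda>w. Im (\<phi> w) / Im w + (N z)\<^sup>2 - 2 * Re ((\<phi> w - cnj (\<phi> z)) / (w - cnj z))) \<longlongrightarrow>
        Im (\<phi> z) / Im z + (N z)\<^sup>2 - 2 * Re ((\<phi> z - cnj (\<phi> z)) / (z - cnj z))) (at z)"
      using Imz by (intro tendsto_intros \<phi>lim) (auto simp: complex_eq_iff)
    moreover have "(\<phi> z - cnj (\<phi> z)) / (z - cnj z) = of_real ((N z)\<^sup>2)"
    proof -
      have "z - cnj z \<noteq> 0" using Imz by (auto simp: complex_eq_iff)
      then show ?thesis using star[OF zD zD] by (simp add: field_simps L2_inner_self N_def)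
    qed
    moreover have "Im (\<phi> z) / Im z = (N z)\<^sup>2" using Im\<phi>[OF zD] Imz by (simp add: field_simps)
    ultimately have "((\<lambda>w. Im (\<phi> w) / Im w + (N z)\<^sup>2 - 2 * Re ((\<phi> w - cnj (\<phi> z)) / (w - cnj z))) \<longlongrightarrow> 0) (at z)"
      by simp
    moreover have "\<forall>\<^sub>F w in at z. Im (\<phi> w) / Im w + (N z)\<^sup>2 - 2 * Re ((\<phi> w - cnj (\<phi> z)) / (w - cnj z)) = d w"
      using ev1 by eventually_elim (simp add: d_eq)
    ultimately have "(d \<longlongrightarrow> 0) (at z)" by (simp cong: filterlim_cong add: tendsto_cong)
    from tendsto_real_sqrt[OF this] have dl: "((\<lambda>w. sqrt (d w)) \<longlongrightarrow> 0) (at z)" by simp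
    \<comment> \<open>The difference quotient is exactly the inner product of \<open>u w\<close> and
      \<open>u (cnj z)\<close>, so it converges by continuity of \<open>u\<close>.\<close>
    have "((\<lambda>w. (\<phi> w - \<phi> z) / (w - z)) \<longlongrightarrow> L2_inner M (u z) (u (cnj z))) (at z)"
    proof (rule Lim_transform2)
      show "((\<lambda>w. L2_inner M (u z) (u (cnj z))) \<longlongrightarrow> L2_inner M (u z) (u (cnj z))) (at z)" by simp
      show "((\<lambda>w. L2_inner M (u z) (u (cnj z)) - (\<phi> w - \<phi> z) / (w - z)) \<longlongrightarrow> 0) (at z)"
      proof (rule Lim_null_comparison)
        have "\<forall>\<^sub>F w in at z. w \<noteq> z" by (simp add: eventually_at_filter)
        then show "\<forall>\<^sub>F w in at z. norm (L2_inner M (u z) (u (cnj z)) - (\<phi> w - \<phi> z) / (w - z)) \<le> sqrt (d w) * N (cnj z)"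
          using ev1
        proof eventually_elim
          case (elim w)
          then have wD: "w \<in> D" using UD by auto
          have "(\<phi> w - \<phi> z) / (w - z) = L2_inner M (u w) (u (cnj z))"
            using diff[OF wD zD] elim by simp
          then have "(\<phi> w - \<phi> z) / (w - z) - L2_inner M (u z) (u (cnj z)) = L2_inner M (\<lambda>x. u w x - u z x) (u (cnj z))"
            by (simp add: L2_inner_diff_left uL2 wD zD Dc)
          moreover have "cmod (L2_inner M (\<lambda>x. u w x - u z x) (u (cnj z))) \<le> L2_norm M (\<lambda>x. u w x - u z x) * N (cnj z)"
            unfolding N_def by (intro L2_Cauchy_Schwarz L2_diff uL2 wD zD Dc)
          moreover have "sqrt (d w) = L2_norm M (\<lambda>x. u w x - u z x)" by (simp add: d_def)
          ultimately show ?case by (metis norm_minus_commute)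
        qed
        have "((\<lambda>w. sqrt (d w) * N (cnj z)) \<longlongrightarrow> 0 * N (cnj z)) (at z)" by (intro tendsto_intros dl)
        then show "((\<lambda>w. sqrt (d w) * N (cnj z)) \<longlongrightarrow> 0) (at z)" by simp
      qed
    qed
    then have "(\<phi> has_field_derivative L2_inner M (u z) (u (cnj z))) (at z)"
      by (simp add: has_field_derivative_iff)
    then show "\<phi> field_differentiable at z within U - E'"
      using field_differentiable_at_within field_differentiable_def by blast
  qed
  have bnd: "cmod (\<phi> z) \<le> F\<^sup>2 / Im z" if "z \<in> U - E'" for z
  proof -
    have "cmod (\<phi> z) \<le> N z * F" using \<phi>le UD that by blast
    also have "\<dots> \<le> F / \<bar>Im z\<bar> * F" using Nle UD that by (intro mult_right_mono) (auto simp: F_def)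
    finally show ?thesis using that by (simp add: U_def power2_eq_square)
  qed
  have ev: "\<forall>\<^sub>F w in at z. w \<in> U - E'" if "z \<in> U" for z
  proof -
    have "open (U - (E' - {z}))" using opU finE' by (auto intro: open_Diff finite_imp_closed)
    then have "\<forall>\<^sub>F w in nhds z. w \<in> U - (E' - {z})" using that by (intro eventually_nhds_in_open) auto
    then show ?thesis by (auto simp: eventually_at_filter elim: eventually_mono)
  qed
  \<comment> \<open>The bound F^2 / Im w keeps \<phi> bounded near each point of \<open>U\<close>,
    so the exceptional points are removable. Both inequalities pass to the extension by
    continuity.\<close>
  have "\<exists>g. g holomorphic_on U \<and> (\<forall>z\<in>U - E'. g z = \<phi> z)"
  proof (rule holomorphic_extend_finite[OF finE' opU holo])
    fix z assume z: "z \<in> U"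
    have "((\<lambda>w. F\<^sup>2 / Im w) \<longlongrightarrow> F\<^sup>2 / Im z) (at z)" using z by (intro tendsto_intros) (auto simp: U_def)
    then have "\<forall>\<^sub>F w in at z. F\<^sup>2 / Im w < F\<^sup>2 / Im z + 1" by (rule order_tendstoD) simp
    then have "\<forall>\<^sub>F w in at z. cmod (\<phi> w) \<le> F\<^sup>2 / Im z + 1"
      using ev[OF z] by eventually_elim (use bnd in fastforce)
    then show "\<exists>B. \<forall>\<^sub>F w in at z. cmod (\<phi> w) \<le> B" by blast
  qed
  then obtain g where g: "g holomorphic_on U" "\<And>z. z \<in> U - E' \<Longrightarrow> g z = \<phi> z" by blast
  have glim: "(g \<longlongrightarrow> g z) (at z)" if "z \<in> U" for z
    using holomorphic_on_imp_continuous_on[OF g(1)] that opU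
    by (simp add: continuous_on_eq_continuous_at isCont_def)
  have g1: "Im (g z) \<ge> 0" if "z \<in> U" for z
  proof (rule tendsto_lowerbound)
    show "((\<lambda>w. Im (g w)) \<longlongrightarrow> Im (g z)) (at z)" by (intro tendsto_intros glim that)
    show "\<forall>\<^sub>F w in at z. 0 \<le> Im (g w)" using ev[OF that]
    proof eventually_elim
      case (elim w)
      then have "w \<in> D" "Im w > 0" using UD by (auto simp: U_def)
      then show ?case unfolding g(2)[OF elim] Im\<phi>[OF \<open>w \<in> D\<close>, symmetric] by simp
    qed
  qed simp
  have g2: "cmod (g z) \<le> F\<^sup>2 / Im z" if "z \<in> U" for z
  proof (rule tendsto_le)
    show "((\<lambda>w. cmod (g w)) \<longlongrightarrow> cmod (g z)) (at z)" by (intro tendsto_intros glim that)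
    show "((\<lambda>w. F\<^sup>2 / Im w) \<longlongrightarrow> F\<^sup>2 / Im z) (at z)" using that by (intro tendsto_intros) (auto simp: U_def)
    show "\<forall>\<^sub>F w in at z. cmod (g w) \<le> F\<^sup>2 / Im w" using ev[OF that]
      by eventually_elim (use bnd g(2) in auto)
  qed simp
  show ?thesis
  proof (intro bexI[where x = "\<lambda>x. Im (g (Complex x e))"] conjI allI)
    show "0 \<le> Im (g (Complex x e))" for x using e by (intro g1) (simp add: U_def)
    \<comment> \<open>The line Im z = e meets \<open>E'\<close> in finitely many points only, a null
      set.\<close>
    have "finite ((\<lambda>z. Re z) ` E')" using finE' by simp
    then have "AE x in lborel. x \<notin> (\<lambda>z. Re z) ` E'"
      by (intro AE_not_in finite_imp_null_set_lborel)
    then show "AE x in lborel. e * (L2_norm M (u (Complex x e)))\<^sup>2 \<le> Im (g (Complex x e))"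
    proof eventually_elim
      case (elim x)
      then have "Complex x e \<notin> E'" by force
      then have z: "Complex x e \<in> U - E'" using e by (simp add: U_def)
      then show ?case using g(2)[OF z] Im\<phi>[of "Complex x e"] UD by (auto simp: N_def)
    qed
    show "(\<integral>\<^sup>+x. ennreal (Im (g (Complex x e))) \<partial>lborel) \<le> ennreal (2 * pi * (L2_norm M f)\<^sup>2)"
      unfolding F_def[symmetric]
      by (rule halfplane_integral_bound) (use g(1) g1 g2 e in \<open>auto simp: U_def\<close>)
    have "continuous_on UNIV (\<lambda>x. Im (g (Complex x e)))"
      by (intro continuous_intros continuous_on_compose2[OF holomorphic_on_imp_continuous_on[OF g(1)]])
         (use e in \<open>auto simp: Complex_eq U_def intro!: continuous_intros\<close>)
    then show "(\<lambda>x. Im (g (Complex x e))) \<in> borel_measurable lborel"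
      by (simp add: borel_measurable_continuous_onI)
  qed
qed

text \<open>If (A - z) h = f, then (T - z) V h = V f, so the bound for \<open>T\<close> transfers at
  the cost of the squared norms of \<open>V\<close> and \<open>W\<close>. An eigenvector of
  \<open>A\<close> with nonreal eigenvalue is mapped by \<open>V\<close> to one of the symmetric
  operator \<open>T\<close> and is therefore zero.\<close>

lemma similar_selfadjoint_bounds:
  assumes sa: "L2_selfadjoint M T" and sim: "L2_similar M A T"
    and AL2: "\<And>f g. (f, g) \<in> A \<Longrightarrow> f \<in> L2 M \<and> g \<in> L2 M"
  obtains K where "K \<ge> 0"
    "\<And>E f h e. finite E \<Longrightarrow> f \<in> L2 M \<Longrightarrow>
       (\<And>z. z \<notin> \<real> \<Longrightarrow> z \<notin> E \<Longrightarrow> (h z, \<lambda>x. f x + z * h z x) \<in> A) \<Longrightarrow> e > 0 \<Longrightarrow>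
       \<exists>G\<in>borel_measurable lborel. (\<forall>x. 0 \<le> G x) \<and>
         (AE x in lborel. e * (L2_norm M (h (Complex x e)))\<^sup>2 \<le> G x) \<and>
         (\<integral>\<^sup>+x. ennreal (G x) \<partial>lborel) \<le> ennreal (K * (L2_norm M f)\<^sup>2)"
    "\<And>z h. z \<notin> \<real> \<Longrightarrow> (h, \<lambda>x. z * h x) \<in> A \<Longrightarrow> L2_norm M h = 0"
proof -
  obtain V W where V: "L2_bounded_operator M V" and W: "L2_bounded_operator M W"
    and WV: "\<And>f. f \<in> L2 M \<Longrightarrow> AE x in M. W (V f) x = f x"
    and T: "T = {(u, v). u \<in> L2 M \<and> v \<in> L2 M \<and>
            (\<exists>(f, g)\<in>A. (AE x in M. u x = V f x) \<and> (AE x in M. v x = V g x))}"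
    using sim unfolding L2_similar_def by blast
  obtain C1 where C1: "\<And>f. f \<in> L2 M \<Longrightarrow> L2_norm M (V f) \<le> C1 * L2_norm M f"
    using V unfolding L2_bounded_operator_def by blast
  obtain C2' where C2': "\<And>f. f \<in> L2 M \<Longrightarrow> L2_norm M (W f) \<le> C2' * L2_norm M f"
    using W unfolding L2_bounded_operator_def by blast
  define C2 where "C2 = \<bar>C2'\<bar> + 1"
  have C2: "L2_norm M (W f) \<le> C2 * L2_norm M f" if "f \<in> L2 M" for f
  proof -
    have "C2' \<le> C2" by (simp add: C2_def)
    from mult_right_mono[OF this, of "L2_norm M f"] show ?thesis using C2'[OF that] by simp
  qed
  have VL2: "V f \<in> L2 M" if "f \<in> L2 M" for f using V that unfolding L2_bounded_operator_def by blast
  have WL2: "W f \<in> L2 M" if "f \<in> L2 M" for f using W that unfolding L2_bounded_operator_def by blast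
  have Vadd: "AE x in M. V (\<lambda>t. f t + g t) x = V f x + V g x" if "f \<in> L2 M" "g \<in> L2 M" for f g
    using V that by (simp add: L2_bounded_operator_def)
  have Vscale: "AE x in M. V (\<lambda>t. a * f t) x = a * V f x" if "f \<in> L2 M" for f a
    using V that by (simp add: L2_bounded_operator_def)
  have le: "L2_norm M f \<le> C2 * L2_norm M (V f)" if "f \<in> L2 M" for f
  proof -
    have "L2_norm M f = L2_norm M (W (V f))"
      using WV[OF that] that VL2[OF that] WL2[OF VL2[OF that]]
      by (intro L2_norm_cong_AE) auto
    then show ?thesis using C2[OF VL2[OF that]] by simp
  qed
  have sym: "L2_inner M g f' = L2_inner M f g'" if "(f, g) \<in> T" "(f', g') \<in> T" for f g f' g'
  proof -
    have "(f', g') \<in> L2_adjoint M T" using sa that(2) by (simp add: L2_selfadjoint_def)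
    then show ?thesis using that(1) unfolding L2_adjoint_def by blast
  qed
  have TL2: "f \<in> L2 M" if "(f, g) \<in> T" for f g using that T by auto
  \<comment> \<open>\<open>V\<close> is linear only up to null sets. This suffices because
    \<open>T\<close> contains, with each pair, all square integrable pairs that agree with it almost
    everywhere.\<close>
  have trans: "(V h, \<lambda>x. V f x + z * V h x) \<in> T"
    if hA: "(h, \<lambda>x. f x + z * h x) \<in> A" and f: "f \<in> L2 M" for h f z
  proof -
    have hL: "h \<in> L2 M" using AL2[OF hA] by simp
    have 1: "AE x in M. V (\<lambda>t. f t + z * h t) x = V f x + V (\<lambda>t. z * h t) x"
      by (rule Vadd[OF f L2_cmult[OF hL]])
    have 2: "AE x in M. V (\<lambda>t. z * h t) x = z * V h x"
      by (rule Vscale[OF hL])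
    have "AE x in M. V f x + z * V h x = V (\<lambda>t. f t + z * h t) x"
      using 1 2 by eventually_elim simp
    then show ?thesis unfolding T using hA
      by (auto intro!: VL2 L2_add L2_cmult f hL bexI[OF _ hA])
  qed
  have C20: "C2 > 0" by (simp add: C2_def)
  show ?thesis
  proof
    show "C2\<^sup>2 * (2 * pi * C1\<^sup>2) \<ge> 0" by simp
  next
    fix E f h and e :: real
    assume E: "finite E" and f: "f \<in> L2 M" and e: "e > 0"
      and h: "\<And>z. z \<notin> \<real> \<Longrightarrow> z \<notin> E \<Longrightarrow> (h z, \<lambda>x. f x + z * h z x) \<in> A"
    have "\<exists>G\<in>borel_measurable lborel. (\<forall>x. 0 \<le> G x) \<and>
        (AE x in lborel. e * (L2_norm M (V (h (Complex x e))))\<^sup>2 \<le> G x) \<and>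
        (\<integral>\<^sup>+x. ennreal (G x) \<partial>lborel) \<le> ennreal (2 * pi * (L2_norm M (V f))\<^sup>2)"
    proof (rule symmetric_resolvent_bound[where T = T and u = "\<lambda>z. V (h z)"])
      show "(V (h z), \<lambda>x. V f x + z * V (h z) x) \<in> T" if "z \<notin> \<real>" "z \<notin> E" for z
        by (rule trans[OF h[OF that] f])
      show "L2_inner M g f' = L2_inner M f g'" if "(f, g) \<in> T" "(f', g') \<in> T" for f g f' g'
        by (rule sym[OF that])
      show "f \<in> L2 M" if "(f, g) \<in> T" for f g by (rule TL2[OF that])
    qed (use VL2[OF f] E e in auto)
    then obtain G where G[measurable]: "G \<in> borel_measurable lborel" and G0: "\<And>x. 0 \<le> G x"
      and GA: "AE x in lborel. e * (L2_norm M (V (h (Complex x e))))\<^sup>2 \<le> G x"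
      and GI: "(\<integral>\<^sup>+x. ennreal (G x) \<partial>lborel) \<le> ennreal (2 * pi * (L2_norm M (V f))\<^sup>2)" by blast
    show "\<exists>G\<in>borel_measurable lborel. (\<forall>x. 0 \<le> G x) \<and>
         (AE x in lborel. e * (L2_norm M (h (Complex x e)))\<^sup>2 \<le> G x) \<and>
         (\<integral>\<^sup>+x. ennreal (G x) \<partial>lborel) \<le> ennreal (C2\<^sup>2 * (2 * pi * C1\<^sup>2) * (L2_norm M f)\<^sup>2)"
    proof (intro bexI[where x = "\<lambda>x. C2\<^sup>2 * G x"] conjI allI)
      show "0 \<le> C2\<^sup>2 * G x" for x using G0 by simp
      have "finite ((\<lambda>z. Re z) ` E)" using E by simp
      then have "AE x in lborel. x \<notin> (\<lambda>z. Re z) ` E"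
        by (intro AE_not_in finite_imp_null_set_lborel)
      then show "AE x in lborel. e * (L2_norm M (h (Complex x e)))\<^sup>2 \<le> C2\<^sup>2 * G x"
        using GA
      proof eventually_elim
        case (elim x)
        then have "Complex x e \<notin> E" by force
        then have "h (Complex x e) \<in> L2 M" using h[of "Complex x e"] e AL2 by (auto simp: complex_is_Real_iff)
        then have "(L2_norm M (h (Complex x e)))\<^sup>2 \<le> (C2 * L2_norm M (V (h (Complex x e))))\<^sup>2"
          by (intro power_mono le) auto
        from mult_left_mono[OF this less_imp_le[OF e]]
        have "e * (L2_norm M (h (Complex x e)))\<^sup>2 \<le> C2\<^sup>2 * (e * (L2_norm M (V (h (Complex x e))))\<^sup>2)"
          by (simp add: power_mult_distrib mult_ac)
        also have "\<dots> \<le> C2\<^sup>2 * G x" by (intro mult_left_mono elim) simp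
        finally show ?case .
      qed
      have "(\<integral>\<^sup>+x. ennreal (C2\<^sup>2 * G x) \<partial>lborel) = ennreal (C2\<^sup>2) * (\<integral>\<^sup>+x. ennreal (G x) \<partial>lborel)"
        by (simp add: ennreal_mult' nn_integral_cmult)
      also have "\<dots> \<le> ennreal (C2\<^sup>2) * ennreal (2 * pi * (L2_norm M (V f))\<^sup>2)"
        by (intro mult_left_mono GI) simp
      also have "\<dots> \<le> ennreal (C2\<^sup>2 * (2 * pi * C1\<^sup>2) * (L2_norm M f)\<^sup>2)"
      proof -
        have "(L2_norm M (V f))\<^sup>2 \<le> (C1 * L2_norm M f)\<^sup>2" by (intro power_mono C1 f) auto
        then have "C2\<^sup>2 * (2 * pi * (L2_norm M (V f))\<^sup>2) \<le> C2\<^sup>2 * (2 * pi * (C1 * L2_norm M f)\<^sup>2)"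
          by (intro mult_left_mono) auto
        then show ?thesis by (simp add: ennreal_mult'[symmetric] power_mult_distrib algebra_simps ennreal_leI)
      qed
      finally show "(\<integral>\<^sup>+x. ennreal (C2\<^sup>2 * G x) \<partial>lborel) \<le> ennreal (C2\<^sup>2 * (2 * pi * C1\<^sup>2) * (L2_norm M f)\<^sup>2)" .
    qed measurable
  next
    fix z h assume z: "z \<notin> \<real>" and hA: "(h, \<lambda>x. z * h x) \<in> A"
    have hL: "h \<in> L2 M" using AL2[OF hA] by simp
    have "AE x in M. V (\<lambda>t. z * h t) x = z * V h x"
      by (rule Vscale[OF hL])
    then have "AE x in M. z * V h x = V (\<lambda>t. z * h t) x" by eventually_elim simp
    then have inT: "(V h, \<lambda>x. z * V h x) \<in> T" unfolding T using hA
      by (auto intro!: VL2 L2_cmult hL bexI[OF _ hA])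
    have "(z - cnj z) * of_real ((L2_norm M (V h))\<^sup>2) = 0"
      using sym[OF inT inT] by (simp add: L2_inner_cmult_left L2_inner_cmult_right L2_inner_self algebra_simps)
    moreover have "z - cnj z \<noteq> 0" using z by (auto simp: complex_is_Real_iff complex_eq_iff)
    ultimately have "L2_norm M (V h) = 0" by simp
    then show "L2_norm M h = 0" using le[OF hL] L2_norm_nonneg[of M h] by simp
  qed
qed

text \<open>Multiplication by t is symmetric, and its resolvent, division by t - z, is available at
  every nonreal z, so the exceptional set is empty. This operator is the spectral model of a
  half-line Neumann problem.\<close>

lemma multiplication_resolvent_bound:
  fixes \<mu> :: "real measure"
  assumes sets: "sets \<mu> = sets borel" and g: "g \<in> L2 \<mu>" and e: "e > 0"
  shows "\<exists>G\<in>borel_measurable lborel. (\<forall>x. 0 \<le> G x) \<and>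
    (AE x in lborel. e * (L2_norm \<mu> (\<lambda>t. g t / (complex_of_real t - Complex x e)))\<^sup>2 \<le> G x) \<and>
    (\<integral>\<^sup>+x. ennreal (G x) \<partial>lborel) \<le> ennreal (2 * pi * (L2_norm \<mu> g)\<^sup>2)"
proof (rule symmetric_resolvent_bound[where E = "{}" and u = "\<lambda>z t. g t / (complex_of_real t - z)"
      and T = "{(u, v). u \<in> L2 \<mu> \<and> v \<in> L2 \<mu> \<and> v = (\<lambda>t. complex_of_real t * u t)}"])
  fix f h f' h'
  assume "(f, h) \<in> {(u, v). u \<in> L2 \<mu> \<and> v \<in> L2 \<mu> \<and> v = (\<lambda>t. complex_of_real t * u t)}"
    "(f', h') \<in> {(u, v). u \<in> L2 \<mu> \<and> v \<in> L2 \<mu> \<and> v = (\<lambda>t. complex_of_real t * u t)}"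
  then show "L2_inner \<mu> h f' = L2_inner \<mu> f h'" by (simp add: L2_inner_def mult_ac)
next
  fix z :: complex assume z: "z \<notin> \<real>"
  then have Im: "\<bar>Im z\<bar> > 0" by (simp add: complex_is_Real_iff)
  have u: "(\<lambda>t. g t / (complex_of_real t - z)) \<in> L2 \<mu>"
  proof (rule L2_bound[OF L2_cmult[OF g, of "of_real (1 / \<bar>Im z\<bar>)"]])
    have [measurable]: "g \<in> borel_measurable borel"
      using L2_measurable[OF g] measurable_cong_sets[OF sets refl] by blast
    show "(\<lambda>t. g t / (complex_of_real t - z)) \<in> borel_measurable \<mu>"
      by (subst measurable_cong_sets[OF sets refl]) measurable
    fix t
    have "\<bar>Im z\<bar> \<le> cmod (complex_of_real t - z)" using abs_Im_le_cmod[of "complex_of_real t - z"] by simp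
    then have "cmod (g t) * (1 / cmod (complex_of_real t - z)) \<le> cmod (g t) * (1 / \<bar>Im z\<bar>)"
      using Im by (intro mult_left_mono divide_left_mono mult_pos_pos) (linarith | simp)+
    then show "cmod (g t / (complex_of_real t - z)) \<le> cmod (of_real (1 / \<bar>Im z\<bar>) * g t)"
      unfolding norm_mult norm_of_real norm_divide by simp
  qed
  have "(\<lambda>t. g t + z * (g t / (complex_of_real t - z))) = (\<lambda>t. complex_of_real t * (g t / (complex_of_real t - z)))"
  proof
    fix t
    have "complex_of_real t - z \<noteq> 0" using z by auto
    then show "g t + z * (g t / (complex_of_real t - z)) = complex_of_real t * (g t / (complex_of_real t - z))"
      by (simp add: divide_simps) (simp add: algebra_simps)
  qed
  then show "(\<lambda>t. g t / (complex_of_real t - z), \<lambda>t. g t + z * (g t / (complex_of_real t - z)))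
    \<in> {(u, v). u \<in> L2 \<mu> \<and> v \<in> L2 \<mu> \<and> v = (\<lambda>t. complex_of_real t * u t)}"
    using u L2_add[OF g L2_cmult[OF u, of z]] by simp
qed (use g e in auto)

section \<open>Weyl solutions on a half-line\<close>

definition sl_sys :: "(real \<Rightarrow> real) \<Rightarrow> complex \<Rightarrow> (real \<Rightarrow> complex) \<Rightarrow> (real \<Rightarrow> complex) \<Rightarrow> bool" where
  "sl_sys q z y y' \<longleftrightarrow> (\<forall>x. (y has_vector_derivative y' x) (at x) \<and>
     (y' has_vector_derivative (complex_of_real (q x) - z) * y x) (at x))"

lemma sl_solution_sys:
  "sl_solution q z a b y \<Longrightarrow> \<exists>y'. sl_sys q z y y' \<and> y 0 = a \<and> y' 0 = b"
proof -
  assume "sl_solution q z a b y"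
  then obtain y' y'' where y: "\<And>x. (y has_vector_derivative y' x) (at x)"
      "\<And>x. (y' has_vector_derivative y'' x) (at x)" "\<And>x. - y'' x + complex_of_real (q x) * y x = z * y x"
    and i: "y 0 = a" "y' 0 = b" unfolding sl_solution_def by blast
  have "y'' x = (complex_of_real (q x) - z) * y x" for x using y(3)[of x] by (simp add: algebra_simps)
  then have "sl_sys q z y y'" using y(1,2) unfolding sl_sys_def by metis
  then show ?thesis using i by blast
qed

lemma sl_sys_derivs:
  assumes "sl_sys q z y y'"
  shows "(y has_vector_derivative y' x) (at x within S)"
    "(y' has_vector_derivative (complex_of_real (q x) - z) * y x) (at x within S)"
  using assms unfolding sl_sys_def by (blast intro: has_vector_derivative_at_within)+

lemma sl_sys_continuous:
  assumes "sl_sys q z y y'" shows "continuous_on S y" "continuous_on S y'"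
  using sl_sys_derivs[OF assms]
  by (blast intro: continuous_at_imp_continuous_on has_vector_derivative_continuous)+

lemma sl_sys_cnj:
  assumes "sl_sys q z y y'" shows "sl_sys q (cnj z) (\<lambda>x. cnj (y x)) (\<lambda>x. cnj (y' x))"
  unfolding sl_sys_def
proof (intro allI conjI)
  fix x
  show "((\<lambda>x. cnj (y x)) has_vector_derivative cnj (y' x)) (at x)"
    by (intro has_vector_derivative_cnj sl_sys_derivs[OF assms])
  have "((\<lambda>x. cnj (y' x)) has_vector_derivative cnj ((of_real (q x) - z) * y x)) (at x)"
    by (intro has_vector_derivative_cnj sl_sys_derivs[OF assms])
  then show "((\<lambda>x. cnj (y' x)) has_vector_derivative (of_real (q x) - cnj z) * cnj (y x)) (at x)" by simp
qed

text \<open>Carries the left half-line to the right one: the sign of the derivative changes, the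
  spectral parameter does not.\<close>

lemma sl_sys_reflect:
  assumes "sl_sys q z y y'" shows "sl_sys (\<lambda>x. q (- x)) z (\<lambda>x. y (- x)) (\<lambda>x. - y' (- x))"
  unfolding sl_sys_def
proof (intro allI conjI)
  fix x
  have m: "((\<lambda>x::real. - x) has_vector_derivative -1) (at x)"
    by (auto intro!: derivative_eq_intros)
  have "(y \<circ> (\<lambda>x. - x) has_vector_derivative (-1) *\<^sub>R y' (- x)) (at x)"
    by (rule vector_diff_chain_at[OF m]) (rule sl_sys_derivs[OF assms])
  then show "((\<lambda>x. y (- x)) has_vector_derivative - y' (- x)) (at x)" by (simp add: o_def)
  have "(y' \<circ> (\<lambda>x. - x) has_vector_derivative (-1) *\<^sub>R ((of_real (q (-x)) - z) * y (- x))) (at x)"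
    by (rule vector_diff_chain_at[OF m]) (rule sl_sys_derivs[OF assms])
  from has_vector_derivative_minus[OF this]
  show "((\<lambda>x. - y' (- x)) has_vector_derivative (of_real (q (- x)) - z) * y (- x)) (at x)"
    by (simp add: o_def)
qed

lemma sl_sys_diff_cmult:
  assumes "sl_sys q z y y'" "sl_sys q z u u'"
  shows "sl_sys q z (\<lambda>x. y x - a * u x) (\<lambda>x. y' x - a * u' x)"
  unfolding sl_sys_def
proof (intro allI conjI)
  fix x
  show "((\<lambda>x. y x - a * u x) has_vector_derivative y' x - a * u' x) (at x)"
    by (intro has_vector_derivative_diff has_vector_derivative_mult_right sl_sys_derivs[OF assms(1)] sl_sys_derivs[OF assms(2)])
  have "((\<lambda>x. y' x - a * u' x) has_vector_derivative (of_real (q x) - z) * y x - a * ((of_real (q x) - z) * u x)) (at x)"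
    by (intro has_vector_derivative_diff has_vector_derivative_mult_right sl_sys_derivs[OF assms(1)] sl_sys_derivs[OF assms(2)])
  then show "((\<lambda>x. y' x - a * u' x) has_vector_derivative (of_real (q x) - z) * (y x - a * u x)) (at x)"
    by (simp add: algebra_simps)
qed

lemma borel_measurable_lborel_on:
  "continuous_on UNIV f \<Longrightarrow> f \<in> borel_measurable (lborel_on S)" for f :: "real \<Rightarrow> 'a::topological_space"
  by (intro measurable_restrict_space1) (simp add: borel_measurable_continuous_onI)

lemma integral_lborel_on_FTC:
  fixes f :: "real \<Rightarrow> complex"
  assumes "b \<ge> 0" and "\<And>x. (F has_vector_derivative f x) (at x)" and "continuous_on UNIV f"
  shows "(LINT x|lborel_on {0<..}. indicator {..b} x *\<^sub>R f x) = F b - F 0"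
proof -
  have fm: "f \<in> borel_measurable borel" using assms(3) by (rule borel_measurable_continuous_onI)
  have "(LINT x|lborel_on {0<..}. indicator {..b} x *\<^sub>R f x)
      = (LINT x|lborel. indicator {0<..} x *\<^sub>R (indicator {..b} x *\<^sub>R f x))"
    by (rule integral_restrict_space) simp
  also have "\<dots> = (LINT x|lborel. indicator {0..b} x *\<^sub>R f x)"
  proof (rule integral_cong_AE)
    have "AE x in lborel. x \<notin> {0::real}" by (intro AE_not_in finite_imp_null_set_lborel) simp
    then show "AE x in lborel. indicator {0<..} x *\<^sub>R (indicator {..b} x *\<^sub>R f x) = indicator {0..b} x *\<^sub>R f x"
      by eventually_elim (auto split: split_indicator)
  qed (use fm in measurable)
  also have "\<dots> = F b - F 0"
    by (rule integral_FTC_atLeastAtMost)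
       (use assms in \<open>auto intro: continuous_on_subset has_vector_derivative_at_within\<close>)
  finally show ?thesis .
qed

text \<open>Lagrange's identity: y1 y2' - y1' y2 has derivative (z1 - z2) y1 y2. The form is
  bilinear; conjugates enter through \<open>sl_sys_cnj\<close>.\<close>

lemma wronskian_integral:
  assumes 1: "sl_sys q z1 y1 y1'" and 2: "sl_sys q z2 y2 y2'" and b: "b \<ge> 0"
  shows "(y1 b * y2' b - y1' b * y2 b) - (y1 0 * y2' 0 - y1' 0 * y2 0) =
    (z1 - z2) * (LINT x|lborel_on {0<..}. indicator {..b} x *\<^sub>R (y1 x * y2 x))"
proof -
  have "(LINT x|lborel_on {0<..}. indicator {..b} x *\<^sub>R ((z1 - z2) * (y1 x * y2 x))) =
     (y1 b * y2' b - y1' b * y2 b) - (y1 0 * y2' 0 - y1' 0 * y2 0)"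
  proof (rule integral_lborel_on_FTC[OF b])
    fix x
    have "((\<lambda>b. y1 b * y2' b - y1' b * y2 b) has_vector_derivative
       (y1 x * ((of_real (q x) - z2) * y2 x) + y1' x * y2' x) - (y1' x * y2' x + (of_real (q x) - z1) * y1 x * y2 x)) (at x)"
      by (intro has_vector_derivative_diff has_vector_derivative_mult sl_sys_derivs[OF 1] sl_sys_derivs[OF 2])
    then show "((\<lambda>b. y1 b * y2' b - y1' b * y2 b) has_vector_derivative (z1 - z2) * (y1 x * y2 x)) (at x)"
      by (simp add: algebra_simps)
  next
    show "continuous_on UNIV (\<lambda>x. (z1 - z2) * (y1 x * y2 x))"
      by (intro continuous_intros sl_sys_continuous[OF 1] sl_sys_continuous[OF 2])
  qed
  moreover have "(\<lambda>x. indicator {..b} x *\<^sub>R ((z1 - z2) * (y1 x * y2 x))) = (\<lambda>x. (z1 - z2) * (indicator {..b} x *\<^sub>R (y1 x * y2 x)))"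
    by simp
  ultimately show ?thesis by (simp only: integral_mult_right_zero)
qed

lemma borel_measurable_indicator_lborel_on [measurable]:
  "A \<in> sets borel \<Longrightarrow> (indicator A :: real \<Rightarrow> real) \<in> borel_measurable (lborel_on S)"
  by (intro measurable_restrict_space1) simp

lemma tendsto_integral_lborel_on_at_top:
  fixes f :: "real \<Rightarrow> complex"
  assumes f: "integrable (lborel_on S) f"
  shows "((\<lambda>b. LINT x|lborel_on S. indicator {..b} x *\<^sub>R f x) \<longlongrightarrow> (LINT x|lborel_on S. f x)) at_top"
proof (rule integral_dominated_convergence_at_top[where w = "\<lambda>x. cmod (f x)"])
  have [measurable]: "f \<in> borel_measurable (lborel_on S)" using f by simp
  show "(\<lambda>x. indicator {..b} x *\<^sub>R f x) \<in> borel_measurable (lborel_on S)" for b by measurable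
  show "AE x in lborel_on S. ((\<lambda>b. indicator {..b} x *\<^sub>R f x) \<longlongrightarrow> f x) at_top"
  proof (intro AE_I2 tendsto_eventually)
    fix x
    show "\<forall>\<^sub>F b in at_top. indicator {..b} x *\<^sub>R f x = f x"
      using eventually_ge_at_top[of x] by eventually_elim simp
  qed
  show "\<forall>\<^sub>F b in at_top. AE x in lborel_on S. norm (indicator {..b} x *\<^sub>R f x) \<le> cmod (f x)"
    by (intro always_eventually allI AE_I2) (simp split: split_indicator)
qed (use f in auto)

text \<open>By Lagrange's identity the Wronskian W(y, p) has a limit k at infinity. Suppose that k
  is not 0. Since W(c, p) is a constant d, one has W(y, p) c = d y + W(y, c) p, which can be solved
  for \<open>c\<close> far out. On [0, b] the factor W(y, c) is at most a constant plus a multiple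
  of the norm of \<open>c\<close> on (0, b]. It multiplies \<open>p\<close>, whose tail has small
  norm, so the square of that norm of \<open>c\<close> is at most a constant plus half of itself,
  and \<open>c\<close> would be square integrable.\<close>

lemma limit_point_wronskian:
  assumes y: "sl_sys q lam y y'" and p: "sl_sys q om p p'" and c: "sl_sys q om c c'"
    and d: "c 0 * p' 0 - c' 0 * p 0 \<noteq> 0"
    and yL: "y \<in> L2 (lborel_on {0<..})" and pL: "p \<in> L2 (lborel_on {0<..})"
    and cL: "c \<notin> L2 (lborel_on {0<..})"
  shows "((\<lambda>b. y b * p' b - y' b * p b) \<longlongrightarrow> 0) at_top"
proof -
  define P where "P = lborel_on {0<..}"
  define d where "d = c 0 * p' 0 - c' 0 * p 0"
  define Wy where "Wy b = y b * p' b - y' b * p b" for b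
  define Wc where "Wc b = y b * c' b - y' b * c b" for b
  define k where "k = Wy 0 + (lam - om) * (LINT x|P. y x * p x)"
  note yL = yL[folded P_def] and pL = pL[folded P_def]
  have sP: "space P = {0<..}" by (simp add: P_def space_restrict_space)
  have [measurable]: "c \<in> borel_measurable P"
    unfolding P_def by (intro borel_measurable_lborel_on sl_sys_continuous[OF c])
  have ind[measurable]: "(indicator A :: real \<Rightarrow> real) \<in> borel_measurable P" if "A \<in> sets borel" for A
    unfolding P_def using that by (intro measurable_restrict_space1) simp
  have [measurable]: "y \<in> borel_measurable P" "p \<in> borel_measurable P" using yL pL by auto
  have const: "c x * p' x - c' x * p x = d" if "x \<ge> 0" for x
    using wronskian_integral[OF c p that] by (simp add: d_def)
  \<comment> \<open>The algebraic identity between the three Wronskians of \<open>y\<close>,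
    \<open>p\<close> and \<open>c\<close>, with W(c, p) = d.\<close>
  have ident: "Wy x * c x = y x * d + Wc x * p x" if "x \<ge> 0" for x
    unfolding const[OF that, symmetric] Wy_def Wc_def by (simp add: algebra_simps)
  have Wylim: "(Wy \<longlongrightarrow> k) at_top"
  proof -
    have "((\<lambda>b. Wy 0 + (lam - om) * (LINT x|P. indicator {..b} x *\<^sub>R (y x * p x))) \<longlongrightarrow> k) at_top"
      unfolding k_def
      by (intro tendsto_intros tendsto_integral_lborel_on_at_top[where S = "{0<..}", folded P_def] integrable_L2_mult[OF yL pL])
    moreover have "\<forall>\<^sub>F b in at_top. Wy 0 + (lam - om) * (LINT x|P. indicator {..b} x *\<^sub>R (y x * p x)) = Wy b"
      using eventually_ge_at_top[of 0]
    proof eventually_elim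
      case (elim b)
      then show ?case using wronskian_integral[OF y p elim] by (simp add: Wy_def P_def algebra_simps)
    qed
    ultimately show ?thesis by (rule Lim_transform_eventually)
  qed
  have "k = 0"
  proof (rule ccontr)
    assume k: "k \<noteq> 0"
    have "((\<lambda>b. cmod (Wy b)) \<longlongrightarrow> cmod k) at_top" by (intro tendsto_intros Wylim)
    then have "\<forall>\<^sub>F b in at_top. cmod (Wy b) > cmod k / 2" using k by (intro order_tendstoD(1)) auto
    then obtain b0 where b0: "\<And>b. b \<ge> b0 \<Longrightarrow> cmod (Wy b) > cmod k / 2"
      by (auto simp: eventually_at_top_linorder)
    \<comment> \<open>\<open>c\<close> cut off at b; it is square integrable because
      \<open>c\<close> is bounded on [0, b].\<close>
    define cb where "cb b x = indicator {..b} x *\<^sub>R c x" for b :: real and x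
    have cbL: "cb b \<in> L2 P" for b
    proof -
      have "bounded (c ` {0..b})"
        by (intro compact_imp_bounded compact_continuous_image sl_sys_continuous[OF c]) auto
      then obtain C where C: "\<And>x. x \<in> {0..b} \<Longrightarrow> cmod (c x) \<le> C"
        unfolding bounded_iff by blast
      have "integrable lborel (indicator {0<..b} :: real \<Rightarrow> real)"
        by (intro integrable_real_indicator emeasure_bounded_finite) auto
      then have "integrable lborel (\<lambda>x. indicator {0<..b} x *\<^sub>R C\<^sup>2)" by simp
      then have "integrable P (\<lambda>x. indicator {..b} x *\<^sub>R C\<^sup>2)"
      proof -
        assume *: "integrable lborel (\<lambda>x. indicator {0<..b} x *\<^sub>R C\<^sup>2)"
        have eq: "(\<lambda>x. indicator {0<..} x *\<^sub>R (indicator {..b} x *\<^sub>R C\<^sup>2)) = (\<lambda>x. indicator {0<..b} x *\<^sub>R C\<^sup>2)"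
          by (auto split: split_indicator simp: fun_eq_iff)
        show ?thesis unfolding P_def using *
          by (subst integrable_restrict_space) (simp, simp only: eq)
      qed
      then have "integrable P (\<lambda>x. (cmod (cb b x))\<^sup>2)"
      proof (rule Bochner_Integration.integrable_bound)
        show "AE x in P. norm ((cmod (cb b x))\<^sup>2) \<le> norm (indicator {..b} x *\<^sub>R C\<^sup>2)"
          by (intro AE_I2) (auto simp: cb_def sP intro!: power_mono C split: split_indicator)
      qed (unfold cb_def, measurable)
      moreover have "cb b \<in> borel_measurable P" unfolding cb_def by measurable
      ultimately show ?thesis by (simp add: L2_def)
    qed
    define N where "N b = L2_norm P (cb b)" for b
    define A0 where "A0 = cmod (Wc 0)"
    define A1 where "A1 = cmod (lam - om) * L2_norm P y"
    \<comment> \<open>Lagrange's identity for \<open>y\<close> and \<open>c\<close>, and the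
      Cauchy-Schwarz inequality on (0, b].\<close>
    have Wcle: "cmod (Wc b) \<le> A0 + A1 * N b" if "b \<ge> 0" for b
    proof -
      have "Wc b = Wc 0 + (lam - om) * (LINT x|P. y x * cb b x)"
        using wronskian_integral[OF y c that]
        by (simp add: Wc_def P_def cb_def algebra_simps)
      moreover have "cmod (LINT x|P. y x * cb b x) \<le> L2_norm P y * N b"
        unfolding N_def by (rule order_trans[OF integral_norm_bound L2_Cauchy_Schwarz_abs[OF yL cbL]])
      ultimately have "cmod (Wc b) \<le> cmod (Wc 0) + cmod (lam - om) * cmod (LINT x|P. y x * cb b x)"
        using norm_triangle_ineq[of "Wc 0" "(lam - om) * (LINT x|P. y x * cb b x)"] by (simp add: norm_mult)
      also have "\<dots> \<le> A0 + cmod (lam - om) * (L2_norm P y * N b)"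
        unfolding A0_def by (intro add_left_mono mult_left_mono) (fact, simp)
      finally show ?thesis by (simp add: A1_def mult.assoc)
    qed
    have Nmono: "N a \<le> N b" if "a \<le> b" for a b
      unfolding N_def L2_norm_def using that
      by (intro real_sqrt_le_mono integral_mono L2_integrable_sq cbL) (auto simp: cb_def split: split_indicator)
    have N0: "N b \<ge> 0" for b by (simp add: N_def)
    have A: "A0 \<ge> 0" "A1 \<ge> 0" by (auto simp: A0_def A1_def)
    \<comment> \<open>8 = 4 * 2: the 4 comes from |W(y, p)| > |k| / 2, the 2 from |a + b|^2 \<le> 2
      |a|^2 + 2 |b|^2.\<close>
    define B where "B = 8 / (cmod k)\<^sup>2"
    have B: "B > 0" using k by (simp add: B_def)
    define Y where "Y = (L2_norm P y)\<^sup>2"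
    define Z where "Z = (L2_norm P p)\<^sup>2"
    \<comment> \<open>The squared norm of the tail of \<open>p\<close>. From a suitable
      \<open>m\<close> on it is small enough for the term with N(b)^2 to be absorbed.\<close>
    define \<tau> where "\<tau> n = (LINT x|P. indicator {real n<..} x *\<^sub>R (cmod (p x))\<^sup>2)" for n
    have ptw: "(cmod (c x))\<^sup>2 \<le> B * (cmod d)\<^sup>2 * (cmod (y x))\<^sup>2 + B * (2 * A0\<^sup>2 + 2 * A1\<^sup>2 * (N b)\<^sup>2) * (cmod (p x))\<^sup>2"
      if x: "x \<ge> b0" "x \<ge> 0" "x \<le> b" for x b
    proof -
      have "cmod (Wc x) \<le> A0 + A1 * N b"
        using Wcle[OF x(2)] mult_left_mono[OF Nmono[OF x(3)] A(2)] by linarith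
      then have "(cmod (Wc x))\<^sup>2 \<le> (A0 + A1 * N b)\<^sup>2" by (intro power_mono) auto
      also have "\<dots> \<le> 2 * A0\<^sup>2 + 2 * A1\<^sup>2 * (N b)\<^sup>2"
        using sum_squares_bound[of A0 "A1 * N b"] by (simp add: power2_sum power_mult_distrib)
      finally have w2: "(cmod (Wc x))\<^sup>2 \<le> 2 * A0\<^sup>2 + 2 * A1\<^sup>2 * (N b)\<^sup>2" .
      have "(cmod k / 2)\<^sup>2 * (cmod (c x))\<^sup>2 \<le> (cmod (Wy x))\<^sup>2 * (cmod (c x))\<^sup>2"
        using b0[OF x(1)] by (intro mult_right_mono power_mono) auto
      also have "\<dots> = (cmod (y x * d + Wc x * p x))\<^sup>2"
        by (simp only: ident[OF x(2), symmetric] norm_mult power_mult_distrib)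
      also have "\<dots> \<le> 2 * (cmod (y x * d))\<^sup>2 + 2 * (cmod (Wc x * p x))\<^sup>2" by (rule cmod_add_sq_le)
      also have "\<dots> = 2 * (cmod d)\<^sup>2 * (cmod (y x))\<^sup>2 + 2 * (cmod (Wc x))\<^sup>2 * (cmod (p x))\<^sup>2"
        by (simp add: norm_mult power_mult_distrib)
      also have "\<dots> \<le> 2 * (cmod d)\<^sup>2 * (cmod (y x))\<^sup>2 + 2 * (2 * A0\<^sup>2 + 2 * A1\<^sup>2 * (N b)\<^sup>2) * (cmod (p x))\<^sup>2"
        by (intro add_left_mono mult_right_mono mult_left_mono w2) auto
      finally have "(cmod k / 2)\<^sup>2 * (cmod (c x))\<^sup>2 \<le>
         2 * (cmod d)\<^sup>2 * (cmod (y x))\<^sup>2 + 2 * (2 * A0\<^sup>2 + 2 * A1\<^sup>2 * (N b)\<^sup>2) * (cmod (p x))\<^sup>2" .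
      then have "(4 / (cmod k)\<^sup>2) * ((cmod k / 2)\<^sup>2 * (cmod (c x))\<^sup>2) \<le>
         (4 / (cmod k)\<^sup>2) * (2 * (cmod d)\<^sup>2 * (cmod (y x))\<^sup>2 + 2 * (2 * A0\<^sup>2 + 2 * A1\<^sup>2 * (N b)\<^sup>2) * (cmod (p x))\<^sup>2)"
        by (intro mult_left_mono) auto
      moreover have "(4 / (cmod k)\<^sup>2) * ((cmod k / 2)\<^sup>2 * (cmod (c x))\<^sup>2) = (cmod (c x))\<^sup>2"
        using k by (simp add: power_divide)
      moreover have "(4 / (cmod k)\<^sup>2) * (2 * (cmod d)\<^sup>2 * (cmod (y x))\<^sup>2 + 2 * (2 * A0\<^sup>2 + 2 * A1\<^sup>2 * (N b)\<^sup>2) * (cmod (p x))\<^sup>2)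
         = B * (cmod d)\<^sup>2 * (cmod (y x))\<^sup>2 + B * (2 * A0\<^sup>2 + 2 * A1\<^sup>2 * (N b)\<^sup>2) * (cmod (p x))\<^sup>2"
      proof -
        have "B = 4 / (cmod k)\<^sup>2 * 2" by (simp add: B_def)
        then show ?thesis by (simp only:) (simp only: distrib_left mult_ac)
      qed
      ultimately show ?thesis by linarith
    qed
    have "\<tau> \<longlonglongrightarrow> (LINT x|P. 0)"
      unfolding \<tau>_def
    proof (rule integral_dominated_convergence[where w = "\<lambda>x. (cmod (p x))\<^sup>2"])
      show "AE x in P. (\<lambda>n. indicator {real n<..} x *\<^sub>R (cmod (p x))\<^sup>2) \<longlonglongrightarrow> 0"
      proof (intro AE_I2 tendsto_eventually)
        fix x
        obtain m where m: "x \<le> real m" using real_arch_simple by blast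
        show "\<forall>\<^sub>F n in sequentially. indicator {real n<..} x *\<^sub>R (cmod (p x))\<^sup>2 = 0"
          using eventually_ge_at_top[of m] by eventually_elim (use m in \<open>auto split: split_indicator\<close>)
      qed
    qed (use L2_integrable_sq[OF pL] in \<open>auto split: split_indicator\<close>)
    then have "(\<lambda>n. B * 2 * A1\<^sup>2 * \<tau> n) \<longlonglongrightarrow> B * 2 * A1\<^sup>2 * 0" by (intro tendsto_intros) simp
    then have "\<forall>\<^sub>F n in sequentially. B * 2 * A1\<^sup>2 * \<tau> n < 1/2" by (rule order_tendstoD) simp
    moreover have "\<forall>\<^sub>F n in sequentially. real n \<ge> b0"
      using eventually_ge_at_top[of "nat \<lceil>b0\<rceil>"] by eventually_elim linarith
    ultimately obtain m where m: "B * 2 * A1\<^sup>2 * \<tau> m < 1/2" "real m \<ge> b0"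
      using eventually_happens[OF eventually_conj] by fastforce
    \<comment> \<open>Moving half of N(b)^2 to the left side doubles the remaining terms.\<close>
    define Q where "Q = 2 * ((N (real m))\<^sup>2 + B * (cmod d)\<^sup>2 * Y + B * 2 * A0\<^sup>2 * Z)"
    have Nb: "(N b)\<^sup>2 \<le> Q" if b: "b \<ge> real m" for b
    proof -
      let ?G = "\<lambda>x. (cmod (cb (real m) x))\<^sup>2 + B * (cmod d)\<^sup>2 * (cmod (y x))\<^sup>2 + B * 2 * A0\<^sup>2 * (cmod (p x))\<^sup>2
           + B * 2 * A1\<^sup>2 * (N b)\<^sup>2 * (indicator {real m<..} x *\<^sub>R (cmod (p x))\<^sup>2)"
      have i1: "integrable P (\<lambda>x. (cmod (y x))\<^sup>2)" "integrable P (\<lambda>x. (cmod (p x))\<^sup>2)"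
        "integrable P (\<lambda>x. (cmod (cb b x))\<^sup>2)" for b
        using yL pL cbL by (auto intro: L2_integrable_sq)
      have i2: "integrable P (\<lambda>x. indicator {real m<..} x *\<^sub>R (cmod (p x))\<^sup>2)"
        by (rule Bochner_Integration.integrable_bound[OF i1(2)]) (auto split: split_indicator)
      have "(N b)\<^sup>2 = (LINT x|P. (cmod (cb b x))\<^sup>2)" by (simp add: N_def L2_norm_sq)
      also have "\<dots> \<le> (LINT x|P. ?G x)"
      proof (rule integral_mono)
        show "integrable P ?G" using i1 i2 by (auto intro!: Bochner_Integration.integrable_add)
        fix x assume "x \<in> space P"
        then have x: "x > 0" by (simp add: sP)
        have g0: "0 \<le> B * (cmod d)\<^sup>2 * (cmod (y x))\<^sup>2" "0 \<le> B * 2 * A0\<^sup>2 * (cmod (p x))\<^sup>2"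
          "0 \<le> B * 2 * A1\<^sup>2 * (N b)\<^sup>2 * (indicator {real m<..} x *\<^sub>R (cmod (p x))\<^sup>2)" using B by auto
        show "(cmod (cb b x))\<^sup>2 \<le> ?G x"
        proof (cases "x \<le> real m \<or> x > b")
          case True
          then have "(cmod (cb b x))\<^sup>2 \<le> (cmod (cb (real m) x))\<^sup>2" using b by (auto simp: cb_def)
          then show ?thesis using g0 by linarith
        next
          case False
          then have "(cmod (c x))\<^sup>2 \<le> B * (cmod d)\<^sup>2 * (cmod (y x))\<^sup>2 + B * (2 * A0\<^sup>2 + 2 * A1\<^sup>2 * (N b)\<^sup>2) * (cmod (p x))\<^sup>2"
            using x m(2) by (intro ptw) auto
          then show ?thesis using False by (simp add: cb_def algebra_simps)
        qed
      qed (rule i1)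
      also have "\<dots> = (N (real m))\<^sup>2 + B * (cmod d)\<^sup>2 * Y + B * 2 * A0\<^sup>2 * Z + B * 2 * A1\<^sup>2 * (N b)\<^sup>2 * \<tau> m"
        using i1 i2 by (simp add: N_def L2_norm_sq Y_def Z_def \<tau>_def)
      also have "\<dots> \<le> Q / 2 + (N b)\<^sup>2 * (1/2)"
      proof -
        have "B * 2 * A1\<^sup>2 * (N b)\<^sup>2 * \<tau> m = (B * 2 * A1\<^sup>2 * \<tau> m) * (N b)\<^sup>2" by (simp only: mult_ac)
        also have "\<dots> \<le> 1/2 * (N b)\<^sup>2" using m(1) by (intro mult_right_mono) auto
        finally have *: "B * 2 * A1\<^sup>2 * (N b)\<^sup>2 * \<tau> m \<le> (N b)\<^sup>2 * (1/2)" by simp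
        have q: "Q / 2 = (N (real m))\<^sup>2 + B * (cmod d)\<^sup>2 * Y + B * 2 * A0\<^sup>2 * Z" by (simp add: Q_def)
        show ?thesis unfolding q by (intro add_left_mono *)
      qed
      finally show ?thesis by simp
    qed
    have "(\<integral>\<^sup>+x. ennreal ((cmod (c x))\<^sup>2) \<partial>P) \<le> ennreal Q"
    proof (rule nn_integral_le_of_tendsto[where f = "\<lambda>n x. (cmod (cb (real n + real m) x))\<^sup>2"])
      show "AE x in P. (\<lambda>n. (cmod (cb (real n + real m) x))\<^sup>2) \<longlonglongrightarrow> (cmod (c x))\<^sup>2"
      proof (intro AE_I2 tendsto_eventually)
        fix x
        obtain j where j: "x \<le> real j" using real_arch_simple by blast
        show "\<forall>\<^sub>F n in sequentially. (cmod (cb (real n + real m) x))\<^sup>2 = (cmod (c x))\<^sup>2"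
          using eventually_ge_at_top[of j] by eventually_elim (use j in \<open>auto simp: cb_def split: split_indicator\<close>)
      qed
      fix n
      have "(\<integral>\<^sup>+x. ennreal ((cmod (cb (real n + real m) x))\<^sup>2) \<partial>P) = ennreal ((N (real n + real m))\<^sup>2)"
        unfolding N_def L2_norm_sq by (intro nn_integral_eq_integral L2_integrable_sq cbL) auto
      then show "(\<integral>\<^sup>+x. ennreal ((cmod (cb (real n + real m) x))\<^sup>2) \<partial>P) \<le> ennreal Q"
        using Nb by (simp add: ennreal_leI)
    qed (intro borel_measurable_integrable L2_integrable_sq cbL)
    then have "integrable P (\<lambda>x. (cmod (c x))\<^sup>2)"
      by (intro integrableI_bounded) (simp_all add: le_less_trans[OF _ ennreal_less_top])
    then show False using cL unfolding L2_def P_def[symmetric] by simp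
  qed
  then show ?thesis using Wylim by (simp add: Wy_def[abs_def])
qed


section \<open>Cauchy kernels and their isometry with the Weyl solutions\<close>

lemma integrable_mult_bounded:
  fixes f k :: "real \<Rightarrow> complex"
  assumes sets: "sets M = sets borel" and f: "integrable M f"
    and k: "k \<in> borel_measurable borel" and le: "\<And>t. cmod (k t) \<le> B"
  shows "integrable M (\<lambda>t. f t * k t)"
proof (rule Bochner_Integration.integrable_bound[OF integrable_mult_left[OF f, of "of_real B"]])
  have "k \<in> borel_measurable M" using k by (simp add: measurable_cong_sets[OF sets refl])
  then show "(\<lambda>t. f t * k t) \<in> borel_measurable M" using borel_measurable_integrable[OF f] by measurable
  have "B \<ge> 0" using le[of 0] norm_ge_zero order_trans by blast
  then show "AE t in M. norm (f t * k t) \<le> norm (f t * of_real B)"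
    by (intro AE_I2) (auto simp: norm_mult intro!: mult_left_mono le)
qed

lemma cauchy_kernel_bound:
  assumes z: "z \<notin> \<real>"
  shows "\<exists>C. \<forall>t. cmod (1 / (complex_of_real t - z)) \<le> C * (1 / (1 + \<bar>t\<bar>))"
proof -
  \<comment> \<open>1 + |t| \<le> |t - z| + (1 + |z|), and the second summand is at most (1 + |z|) /
    |Im z| times |t - z|.\<close>
  define C where "C = 1 + (1 + cmod z) / \<bar>Im z\<bar>"
  have Im: "\<bar>Im z\<bar> > 0" using z by (simp add: complex_is_Real_iff)
  have "cmod (1 / (complex_of_real t - z)) \<le> C * (1 / (1 + \<bar>t\<bar>))" for t
  proof -
    have 1: "\<bar>Im z\<bar> \<le> cmod (complex_of_real t - z)" using abs_Im_le_cmod[of "complex_of_real t - z"] by simp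
    have "\<bar>t\<bar> \<le> cmod (complex_of_real t - z) + cmod z"
      using norm_triangle_ineq[of "complex_of_real t - z" z] by simp
    moreover have "1 + cmod z \<le> (1 + cmod z) / \<bar>Im z\<bar> * cmod (complex_of_real t - z)"
      using mult_left_mono[OF 1, of "(1 + cmod z) / \<bar>Im z\<bar>"] Im by simp
    ultimately have "1 + \<bar>t\<bar> \<le> C * cmod (complex_of_real t - z)" by (simp add: C_def algebra_simps)
    moreover have "cmod (complex_of_real t - z) > 0" using 1 Im by linarith
    moreover have "1 + \<bar>t\<bar> > 0" by linarith
    ultimately show ?thesis by (simp add: norm_divide divide_simps mult.commute)
  qed
  then show ?thesis by blast
qed

lemma integrable_diff_inverse:
  fixes \<mu> :: "real measure"
  assumes sets: "sets \<mu> = sets borel" and int: "integrable \<mu> (\<lambda>t. 1 / (1 + \<bar>t\<bar>))" and z: "z \<notin> \<real>"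
  shows "integrable \<mu> (\<lambda>t. 1 / (complex_of_real t - z))" and "(\<lambda>t. 1 / (complex_of_real t - z)) \<in> L2 \<mu>"
proof -
  obtain C where le: "\<And>t. cmod (1 / (complex_of_real t - z)) \<le> C * (1 / (1 + \<bar>t\<bar>))"
    using cauchy_kernel_bound[OF z] by blast
  have m: "(\<lambda>t. 1 / (complex_of_real t - z)) \<in> borel_measurable \<mu>"
    by (subst measurable_cong_sets[OF sets refl]) measurable
  show "integrable \<mu> (\<lambda>t. 1 / (complex_of_real t - z))"
    by (rule Bochner_Integration.integrable_bound[OF integrable_mult_right[OF int, of C] m])
       (intro AE_I2 order_trans[OF le], simp only: real_norm_def abs_ge_self)
  have "integrable \<mu> (\<lambda>t. (cmod (1 / (complex_of_real t - z)))\<^sup>2)"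
  proof (rule Bochner_Integration.integrable_bound[OF integrable_mult_right[OF int, of "C\<^sup>2"]])
    show "(\<lambda>t. (cmod (1 / (complex_of_real t - z)))\<^sup>2) \<in> borel_measurable \<mu>" using m by measurable
    show "AE t in \<mu>. norm ((cmod (1 / (complex_of_real t - z)))\<^sup>2) \<le> norm (C\<^sup>2 * (1 / (1 + \<bar>t\<bar>)))"
    proof (intro AE_I2)
      fix t
      have "(cmod (1 / (complex_of_real t - z)))\<^sup>2 \<le> (C * (1 / (1 + \<bar>t\<bar>)))\<^sup>2"
        by (intro power_mono le) auto
      also have "\<dots> = C\<^sup>2 * (1 / (1 + \<bar>t\<bar>))\<^sup>2" by (rule power_mult_distrib)
      also have "\<dots> \<le> C\<^sup>2 * (1 / (1 + \<bar>t\<bar>))"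
        by (intro mult_left_mono) (auto simp: power2_eq_square divide_simps)
      finally show "norm ((cmod (1 / (complex_of_real t - z)))\<^sup>2) \<le> norm (C\<^sup>2 * (1 / (1 + \<bar>t\<bar>)))"
        by (simp del: norm_divide)
    qed
  qed
  then show "(\<lambda>t. 1 / (complex_of_real t - z)) \<in> L2 \<mu>" using m by (simp add: L2_def)
qed

text \<open>The norm of a linear combination depends only on the Gram matrix, so a family may be
  exchanged for another one in a different space.\<close>

lemma L2_norm_combination_eq:
  assumes "\<And>i. i \<in> Z \<Longrightarrow> f i \<in> L2 M" "\<And>i. i \<in> Z \<Longrightarrow> g i \<in> L2 N"
    and "\<And>i j. i \<in> Z \<Longrightarrow> j \<in> Z \<Longrightarrow> L2_inner M (f i) (f j) = L2_inner N (g i) (g j)"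
  shows "L2_norm M (\<lambda>x. \<Sum>i\<in>Z. a i * f i x) = L2_norm N (\<lambda>x. \<Sum>i\<in>Z. a i * g i x)"
proof -
  have fs: "(\<lambda>x. \<Sum>i\<in>Z. a i * f i x) \<in> L2 M" and gs: "(\<lambda>x. \<Sum>i\<in>Z. a i * g i x) \<in> L2 N"
    using assms by (auto intro!: L2_sum L2_cmult)
  have "complex_of_real ((L2_norm M (\<lambda>x. \<Sum>i\<in>Z. a i * f i x))\<^sup>2) = (\<Sum>i\<in>Z. a i * (\<Sum>j\<in>Z. cnj (a j) * L2_inner M (f i) (f j)))"
    using assms fs by (simp add: L2_inner_self[symmetric] L2_inner_sum_left L2_inner_sum_right del: of_real_power)
  also have "\<dots> = (\<Sum>i\<in>Z. a i * (\<Sum>j\<in>Z. cnj (a j) * L2_inner N (g i) (g j)))"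
    using assms(3) by (intro sum.cong) auto
  also have "\<dots> = complex_of_real ((L2_norm N (\<lambda>x. \<Sum>i\<in>Z. a i * g i x))\<^sup>2)"
    using assms gs by (simp add: L2_inner_self[symmetric] L2_inner_sum_left L2_inner_sum_right del: of_real_power)
  finally show ?thesis by (simp only: of_real_eq_iff) (simp add: power2_eq_iff_nonneg)
qed

text \<open>Green's formula gives (z - cnj w) (p z, p w) = M z - cnj (M w), since the Wronskian
  vanishes at infinity and the initial values are -M and k. The kernels satisfy the same identity by
  the integral representation of \<open>M\<close>. In the applications k is 1 or -1 and accounts for
  the sign of the equation on the two half-lines. For z = cnj w the identity is void, and z is
  approached by other points.\<close>

lemma half_line_isometry:
  fixes \<mu> :: "real measure" and M :: "complex \<Rightarrow> complex"
  assumes sets: "sets \<mu> = sets borel" and int: "integrable \<mu> (\<lambda>t. 1 / (1 + \<bar>t\<bar>))"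
    and k: "k \<noteq> 0"
    and p: "\<And>z. z \<notin> \<real> \<Longrightarrow> sl_sys q (of_real k * z) (p z) (p' z)"
    and c: "\<And>z. z \<notin> \<real> \<Longrightarrow> sl_sys q (of_real k * z) (c z) (c' z)"
    and p0: "\<And>z. z \<notin> \<real> \<Longrightarrow> p z 0 = - M z" "\<And>z. z \<notin> \<real> \<Longrightarrow> p' z 0 = of_real k"
    and c0: "\<And>z. z \<notin> \<real> \<Longrightarrow> c z 0 = 1" "\<And>z. z \<notin> \<real> \<Longrightarrow> c' z 0 = 0"
    and pL: "\<And>z. z \<notin> \<real> \<Longrightarrow> p z \<in> L2 (lborel_on {0<..})"
    and cL: "\<And>z. z \<notin> \<real> \<Longrightarrow> c z \<notin> L2 (lborel_on {0<..})"
    and M: "\<And>z. z \<notin> \<real> \<Longrightarrow> M z = (LINT t|\<mu>. 1 / (complex_of_real t - z))"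
    and z: "z \<notin> \<real>" and w: "w \<notin> \<real>"
  shows "L2_inner (lborel_on {0<..}) (p z) (p w) =
    L2_inner \<mu> (\<lambda>t. 1 / (complex_of_real t - z)) (\<lambda>t. 1 / (complex_of_real t - w))"
proof -
  define P where "P = lborel_on {0<..}"
  define g where "g z t = 1 / (complex_of_real t - z)" for z t
  note gL = integrable_diff_inverse(2)[OF sets int, folded g_def]
  note gI = integrable_diff_inverse(1)[OF sets int, folded g_def]
  have ne: "complex_of_real t - z \<noteq> 0" if "z \<notin> \<real>" for t z using that by auto
  have cnjR: "cnj z \<notin> \<real>" if "z \<notin> \<real>" for z using that by (simp add: complex_is_Real_iff)
  have main: "L2_inner P (p z) (p w) = L2_inner \<mu> (g z) (g w)"
    if z: "z \<notin> \<real>" and w: "w \<notin> \<real>" and zw: "z \<noteq> cnj w" for z w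
  proof -
    note pw = sl_sys_cnj[OF p[OF w]] and cw = sl_sys_cnj[OF c[OF w]]
    let ?W = "\<lambda>b. p z b * cnj (p' w b) - p' z b * cnj (p w b)"
    \<comment> \<open>The conjugate of \<open>p w\<close> solves the equation with the conjugate
      parameter, and the conjugate of \<open>c w\<close> is no more square integrable than
      \<open>c w\<close>.\<close>
    have "(?W \<longlongrightarrow> 0) at_top"
    proof (rule limit_point_wronskian[OF p[OF z] pw cw])
      show "(\<lambda>x. cnj (c w x)) \<notin> L2 (lborel_on {0<..})"
        using L2_cnj[of "\<lambda>x. cnj (c w x)"] cL[OF w] by auto
      show "cnj (c w 0) * cnj (p' w 0) - cnj (c' w 0) * cnj (p w 0) \<noteq> 0"
        using c0[OF w] p0[OF w] k by simp
    qed (intro pL L2_cnj z w)+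
    moreover have "(?W \<longlongrightarrow> ?W 0 + (of_real k * z - cnj (of_real k * w)) * (LINT x|P. p z x * cnj (p w x))) at_top"
    proof (rule Lim_transform_eventually)
      show "((\<lambda>b. ?W 0 + (of_real k * z - cnj (of_real k * w)) * (LINT x|P. indicator {..b} x *\<^sub>R (p z x * cnj (p w x)))) \<longlongrightarrow>
        ?W 0 + (of_real k * z - cnj (of_real k * w)) * (LINT x|P. p z x * cnj (p w x))) at_top"
        unfolding P_def
        by (intro tendsto_intros tendsto_integral_lborel_on_at_top integrable_L2_mult pL L2_cnj z w)
      show "\<forall>\<^sub>F b in at_top. ?W 0 + (of_real k * z - cnj (of_real k * w)) * (LINT x|P. indicator {..b} x *\<^sub>R (p z x * cnj (p w x))) = ?W b"
        using eventually_ge_at_top[of 0]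
      proof eventually_elim
        case (elim b)
        then show ?case using wronskian_integral[OF p[OF z] pw elim] by (simp add: P_def algebra_simps)
      qed
    qed
    ultimately have "?W 0 + (of_real k * z - cnj (of_real k * w)) * L2_inner P (p z) (p w) = 0"
      unfolding L2_inner_def by (rule tendsto_unique[OF trivial_limit_at_top_linorder, symmetric])
    then have "of_real k * ((z - cnj w) * L2_inner P (p z) (p w)) = of_real k * (M z - cnj (M w))"
      using p0[OF z] p0[OF w] by (simp add: algebra_simps)
    then have 1: "(z - cnj w) * L2_inner P (p z) (p w) = M z - cnj (M w)" using k by simp
    have "M z - cnj (M w) = (LINT t|\<mu>. g z t - cnj (g w t))"
      using gI[OF z] gI[OF w] by (simp add: M[OF z, folded g_def] M[OF w, folded g_def])
    also have "\<dots> = (LINT t|\<mu>. (z - cnj w) * (g z t * cnj (g w t)))"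
    proof (intro Bochner_Integration.integral_cong refl)
      fix t
      show "g z t - cnj (g w t) = (z - cnj w) * (g z t * cnj (g w t))"
        using ne[OF z, of t] ne[OF cnjR[OF w], of t] by (simp add: g_def divide_simps)
    qed
    also have "\<dots> = (z - cnj w) * L2_inner \<mu> (g z) (g w)" by (simp add: L2_inner_def)
    finally show ?thesis using 1 zw by simp
  qed
  show ?thesis
  proof (cases "z = cnj w")
    case False
    then show ?thesis using main[OF z w] by (simp add: P_def g_def[abs_def])
  next
    case True
    have Imz: "Im z \<noteq> 0" using z by (simp add: complex_is_Real_iff)
    \<comment> \<open>The shift is parallel to the real axis: all these points have the same nonzero
      imaginary part, so no two of them are conjugate and \<open>main\<close> already applies among
      them.\<close>
    define v where "v n = z + of_real (1 / real (Suc n))" for n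
    have v: "v n \<notin> \<real>" "Im (v n) = Im z" "v n \<noteq> z" for n
    proof -
      show i: "Im (v n) = Im z" by (simp add: v_def)
      then show "v n \<notin> \<real>" using Imz by (simp add: complex_is_Real_iff)
      have "Re (v n) \<noteq> Re z" by (simp add: v_def)
      then show "v n \<noteq> z" by auto
    qed
    have diff_eq: "L2_norm P (\<lambda>x. p (v n) x - p z x) = L2_norm \<mu> (\<lambda>x. g (v n) x - g z x)" for n
    proof -
      define a where "a i = (if i = z then -1 else 1 :: complex)" for i
      have "L2_norm P (\<lambda>x. \<Sum>i\<in>{v n, z}. a i * p i x) = L2_norm \<mu> (\<lambda>x. \<Sum>i\<in>{v n, z}. a i * g i x)"
      proof (rule L2_norm_combination_eq)
        fix i j assume "i \<in> {v n, z}" "j \<in> {v n, z}"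
        then have "Im i = Im z" "Im j = Im z" using v(2)[of n] by auto
        then have "i \<notin> \<real>" "j \<notin> \<real>" "i \<noteq> cnj j" using Imz by (auto simp: complex_eq_iff complex_is_Real_iff)
        then show "L2_inner P (p i) (p j) = L2_inner \<mu> (g i) (g j)" by (rule main)
      qed (use v z pL gL in \<open>auto simp: P_def\<close>)
      then show ?thesis using v[of n] by (simp add: a_def)
    qed
    have gdiff: "L2_norm \<mu> (\<lambda>x. g (v n) x - g z x) \<le> (1 / real (Suc n)) * (1 / \<bar>Im z\<bar> * L2_norm \<mu> (g z))" for n
    proof -
      have ptw: "cmod (g (v n) t - g z t) \<le> cmod (of_real (1 / real (Suc n) * (1 / \<bar>Im z\<bar>)) * g z t)" for t
      proof -
        have eq: "g (v n) t - g z t = of_real (1 / real (Suc n)) * g (v n) t * g z t"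
          using ne[OF z, of t] ne[OF v(1)[of n], of t] by (simp add: g_def divide_simps) (simp add: v_def)
        have "cmod (g (v n) t) \<le> 1 / \<bar>Im z\<bar>"
          using abs_Im_le_cmod[of "complex_of_real t - v n"] Imz v(2)[of n]
          by (auto simp: g_def norm_divide intro!: divide_left_mono mult_pos_pos)
        then have le: "cmod (of_real (1 / real (Suc n)) * g (v n) t * g z t) \<le> 1 / real (Suc n) * (1 / \<bar>Im z\<bar>) * cmod (g z t)"
          unfolding norm_mult norm_of_real by (intro mult_right_mono mult_mono) auto
        have r: "cmod (of_real (1 / real (Suc n) * (1 / \<bar>Im z\<bar>)) * g z t) = 1 / real (Suc n) * (1 / \<bar>Im z\<bar>) * cmod (g z t)"
          unfolding norm_mult norm_of_real by simp
        show ?thesis unfolding eq r by (rule le)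
      qed
      have "L2_norm \<mu> (\<lambda>x. g (v n) x - g z x) \<le> L2_norm \<mu> (\<lambda>x. of_real (1 / real (Suc n) * (1 / \<bar>Im z\<bar>)) * g z x)"
        unfolding L2_norm_def
        by (intro real_sqrt_le_mono integral_mono L2_integrable_sq L2_diff L2_cmult gL z v power_mono ptw) auto
      also have "\<dots> = (1 / real (Suc n)) * (1 / \<bar>Im z\<bar> * L2_norm \<mu> (g z))"
        unfolding L2_norm_cmult norm_of_real by simp
      finally show ?thesis .
    qed
    have lim0: "(\<lambda>n. L2_norm \<mu> (\<lambda>x. g (v n) x - g z x)) \<longlonglongrightarrow> 0"
    proof (rule Lim_null_comparison)
      have "(\<lambda>n. (1 / real (Suc n)) * (1 / \<bar>Im z\<bar> * L2_norm \<mu> (g z))) \<longlonglongrightarrow> 0 * (1 / \<bar>Im z\<bar> * L2_norm \<mu> (g z))"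
        by (intro tendsto_intros LIMSEQ_Suc lim_1_over_n)
      then show "(\<lambda>n. (1 / real (Suc n)) * (1 / \<bar>Im z\<bar> * L2_norm \<mu> (g z))) \<longlonglongrightarrow> 0" by simp
    qed (use gdiff in auto)
    \<comment> \<open>Norm convergence of the first argument. By \<open>diff_eq\<close> the same
      estimate serves for the Weyl solutions and for the kernels.\<close>
    have conv: "(\<lambda>n. L2_inner N (f (v n)) (f w)) \<longlonglongrightarrow> L2_inner N (f z) (f w)"
      if fL: "\<And>z. z \<notin> \<real> \<Longrightarrow> f z \<in> L2 N" and f: "\<And>n. L2_norm N (\<lambda>x. f (v n) x - f z x) = L2_norm \<mu> (\<lambda>x. g (v n) x - g z x)"
      for N and f :: "complex \<Rightarrow> real \<Rightarrow> complex"
    proof (rule LIM_zero_cancel, rule Lim_null_comparison)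
      show "\<forall>\<^sub>F n in sequentially. norm (L2_inner N (f (v n)) (f w) - L2_inner N (f z) (f w)) \<le>
         L2_norm \<mu> (\<lambda>x. g (v n) x - g z x) * L2_norm N (f w)"
      proof (intro always_eventually allI)
        fix n
        show "norm (L2_inner N (f (v n)) (f w) - L2_inner N (f z) (f w)) \<le>
         L2_norm \<mu> (\<lambda>x. g (v n) x - g z x) * L2_norm N (f w)"
          using L2_Cauchy_Schwarz[OF L2_diff[OF fL[OF v(1)[of n]] fL[OF z]] fL[OF w]]
          by (simp add: L2_inner_diff_left fL z w v f)
      qed
      show "(\<lambda>n. L2_norm \<mu> (\<lambda>x. g (v n) x - g z x) * L2_norm N (f w)) \<longlonglongrightarrow> 0"
        using tendsto_mult_right[OF lim0, of "L2_norm N (f w)"] by simp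
    qed
    have "(\<lambda>n. L2_inner P (p (v n)) (p w)) \<longlonglongrightarrow> L2_inner P (p z) (p w)"
      by (rule conv) (use pL diff_eq in \<open>auto simp: P_def\<close>)
    moreover have "(\<lambda>n. L2_inner P (p (v n)) (p w)) = (\<lambda>n. L2_inner \<mu> (g (v n)) (g w))"
      using main[OF v(1) w] v(3) True by auto
    moreover have "(\<lambda>n. L2_inner \<mu> (g (v n)) (g w)) \<longlonglongrightarrow> L2_inner \<mu> (g z) (g w)"
      by (rule conv) (use gL in auto)
    ultimately have "L2_inner P (p z) (p w) = L2_inner \<mu> (g z) (g w)"
      using LIMSEQ_unique by metis
    then show ?thesis by (simp add: P_def g_def[abs_def])
  qed
qed

section \<open>The indefinite operator\<close>

definition sl_inh :: "(real \<Rightarrow> real) \<Rightarrow> (real \<Rightarrow> complex) \<Rightarrow> (real \<Rightarrow> complex) \<Rightarrow> (real \<Rightarrow> complex) \<Rightarrow> bool" where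
  "sl_inh q y y' g \<longleftrightarrow> continuous_on UNIV g \<and> (\<forall>x. (y has_vector_derivative y' x) (at x) \<and>
     (y' has_vector_derivative complex_of_real (q x) * y x - g x) (at x))"

lemma sl_inh_of_sys: "sl_sys q z y y' \<Longrightarrow> sl_inh q y y' (\<lambda>x. z * y x)"
  using sl_sys_continuous(1)[of q z y y' UNIV] unfolding sl_inh_def sl_sys_def
  by (simp add: algebra_simps continuous_on_mult_left)

lemma sl_inh_zero: "sl_inh q (\<lambda>x. 0) (\<lambda>x. 0) (\<lambda>x. 0)"
  by (simp add: sl_inh_def)

lemma sl_inh_add:
  assumes "sl_inh q y y' g" "sl_inh q u u' h"
  shows "sl_inh q (\<lambda>x. y x + u x) (\<lambda>x. y' x + u' x) (\<lambda>x. g x + h x)"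
  unfolding sl_inh_def
proof (intro conjI allI)
  show "continuous_on UNIV (\<lambda>x. g x + h x)" using assms by (auto simp: sl_inh_def intro!: continuous_intros)
  fix x
  show "((\<lambda>x. y x + u x) has_vector_derivative y' x + u' x) (at x)"
    using assms by (auto simp: sl_inh_def intro!: has_vector_derivative_add)
  have "((\<lambda>x. y' x + u' x) has_vector_derivative (of_real (q x) * y x - g x) + (of_real (q x) * u x - h x)) (at x)"
    using assms by (intro has_vector_derivative_add) (auto simp: sl_inh_def)
  then show "((\<lambda>x. y' x + u' x) has_vector_derivative of_real (q x) * (y x + u x) - (g x + h x)) (at x)"
    by (simp add: algebra_simps)
qed

lemma sl_inh_cmult:
  assumes "sl_inh q y y' g"
  shows "sl_inh q (\<lambda>x. a * y x) (\<lambda>x. a * y' x) (\<lambda>x. a * g x)"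
  unfolding sl_inh_def
proof (intro conjI allI)
  show "continuous_on UNIV (\<lambda>x. a * g x)" using assms by (auto simp: sl_inh_def intro!: continuous_intros)
  fix x
  show "((\<lambda>x. a * y x) has_vector_derivative a * y' x) (at x)"
    using assms by (auto simp: sl_inh_def intro!: has_vector_derivative_mult_right)
  have "((\<lambda>x. a * y' x) has_vector_derivative a * (of_real (q x) * y x - g x)) (at x)"
    using assms by (intro has_vector_derivative_mult_right) (auto simp: sl_inh_def)
  then show "((\<lambda>x. a * y' x) has_vector_derivative of_real (q x) * (a * y x) - a * g x) (at x)"
    by (simp add: algebra_simps)
qed

lemma sl_inh_sum:
  "(\<And>i. i \<in> Z \<Longrightarrow> sl_inh q (y i) (y' i) (g i)) \<Longrightarrow>
   sl_inh q (\<lambda>x. \<Sum>i\<in>Z. y i x) (\<lambda>x. \<Sum>i\<in>Z. y' i x) (\<lambda>x. \<Sum>i\<in>Z. g i x)"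
  by (induction Z rule: infinite_finite_induct) (auto intro: sl_inh_zero sl_inh_add)

lemma L2_glue:
  fixes f1 f2 :: "real \<Rightarrow> complex"
  assumes 1: "f1 \<in> L2 (lborel_on {0<..})" and 2: "f2 \<in> L2 (lborel_on {..<0})"
    and m1[measurable]: "f1 \<in> borel_measurable borel" and m2[measurable]: "f2 \<in> borel_measurable borel"
  shows "(\<lambda>x. if x > 0 then f1 x else f2 x) \<in> L2 lborel"
    and "(L2_norm lborel (\<lambda>x. if x > 0 then f1 x else f2 x))\<^sup>2 =
      (L2_norm (lborel_on {0<..}) f1)\<^sup>2 + (L2_norm (lborel_on {..<0}) f2)\<^sup>2"
proof -
  let ?h = "\<lambda>x. if x > 0 then f1 x else f2 x"
  have i1: "integrable lborel (\<lambda>x. indicator {0<..} x *\<^sub>R (cmod (f1 x))\<^sup>2)"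
    using L2_integrable_sq[OF 1] by (subst (asm) integrable_restrict_space) auto
  have i2: "integrable lborel (\<lambda>x. indicator {..<0} x *\<^sub>R (cmod (f2 x))\<^sup>2)"
    using L2_integrable_sq[OF 2] by (subst (asm) integrable_restrict_space) auto
  have AE: "AE x in lborel. (cmod (?h x))\<^sup>2 = indicator {0<..} x *\<^sub>R (cmod (f1 x))\<^sup>2 + indicator {..<0} x *\<^sub>R (cmod (f2 x))\<^sup>2"
  proof -
    have "AE x in lborel. x \<notin> {0::real}" by (intro AE_not_in finite_imp_null_set_lborel) simp
    then show ?thesis by eventually_elim (auto split: split_indicator)
  qed
  have mh: "(\<lambda>x. (cmod (?h x))\<^sup>2) \<in> borel_measurable lborel" by measurable
  have "integrable lborel (\<lambda>x. (cmod (?h x))\<^sup>2)"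
    by (rule integrable_cong_AE_imp[OF Bochner_Integration.integrable_add[OF i1 i2] mh])
       (use AE in \<open>eventually_elim, simp\<close>)
  then show "?h \<in> L2 lborel" by (simp add: L2_def)
  have "(LINT x|lborel. (cmod (?h x))\<^sup>2) = (LINT x|lborel. indicator {0<..} x *\<^sub>R (cmod (f1 x))\<^sup>2 + indicator {..<0} x *\<^sub>R (cmod (f2 x))\<^sup>2)"
    by (rule integral_cong_AE[OF mh _ AE]) measurable
  also have "\<dots> = (LINT x|lborel. indicator {0<..} x *\<^sub>R (cmod (f1 x))\<^sup>2) + (LINT x|lborel. indicator {..<0} x *\<^sub>R (cmod (f2 x))\<^sup>2)"
    by (rule Bochner_Integration.integral_add[OF i1 i2])
  also have "\<dots> = (LINT x|lborel_on {0<..}. (cmod (f1 x))\<^sup>2) + (LINT x|lborel_on {..<0}. (cmod (f2 x))\<^sup>2)"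
    by (simp add: integral_restrict_space)
  finally show "(L2_norm lborel ?h)\<^sup>2 = (L2_norm (lborel_on {0<..}) f1)\<^sup>2 + (L2_norm (lborel_on {..<0}) f2)\<^sup>2"
    by (simp add: L2_norm_sq)
qed

text \<open>Equal values and derivatives at 0 make the glued function continuously differentiable.
  Its derivative is still an indefinite integral, because the right side of the equation jumps at
  most at 0.\<close>

lemma glued_in_sl_operator:
  assumes q: "continuous_on UNIV q" and y: "sl_inh q y y' g" and u: "sl_inh q u u' h"
    and eq: "y 0 = u 0" "y' 0 = u' 0"
    and L: "y \<in> L2 (lborel_on {0<..})" "g \<in> L2 (lborel_on {0<..})"
      "u \<in> L2 (lborel_on {..<0})" "h \<in> L2 (lborel_on {..<0})"
  shows "(\<lambda>x. if x > 0 then y x else u x, \<lambda>x. if x > 0 then g x else h x) \<in> sl_operator q"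
proof -
  have cont: "continuous_on UNIV y" "continuous_on UNIV y'" "continuous_on UNIV u" "continuous_on UNIV u'"
    "continuous_on UNIV g" "continuous_on UNIV h"
    using y u unfolding sl_inh_def
    by (auto intro: continuous_at_imp_continuous_on has_vector_derivative_continuous)
  note meas[measurable] = cont[THEN borel_measurable_continuous_onI]
  define Y Y' H where "Y x = (if x > 0 then y x else u x)" and "Y' x = (if x > 0 then y' x else u' x)"
    and "H x = (if x > 0 then g x else h x)" for x
  have glue: "((\<lambda>x. if x > 0 then a x else b x) has_vector_derivative c) (at x)"
    if "x > 0 \<Longrightarrow> (a has_vector_derivative c) (at x)" "x < 0 \<Longrightarrow> (b has_vector_derivative c) (at x)" "x \<noteq> 0"
    for a b :: "real \<Rightarrow> complex" and c x
  proof (cases "x > 0")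
    case True
    show ?thesis
      by (rule has_vector_derivative_transform_within_open[OF that(1)[OF True], of "{0<..}"]) (use True in auto)
  next
    case False
    show ?thesis
      by (rule has_vector_derivative_transform_within_open[OF that(2), of "{..<0}"]) (use False that(3) in auto)
  qed
  have dY: "(Y has_vector_derivative Y' x) (at x)" for x
  proof (cases "x = 0")
    case False
    then show ?thesis unfolding Y_def[abs_def] using y u
      by (intro glue) (auto simp: sl_inh_def Y'_def)
  next
    case True
    have d: "(y has_derivative (\<lambda>t. t *\<^sub>R y' 0)) (at 0)" "(u has_derivative (\<lambda>t. t *\<^sub>R y' 0)) (at 0)"
    proof -
      have "(y has_vector_derivative y' 0) (at 0)" using y by (simp add: sl_inh_def)
      moreover have "(u has_vector_derivative u' 0) (at 0)" using u by (simp add: sl_inh_def)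
      ultimately show "(y has_derivative (\<lambda>t. t *\<^sub>R y' 0)) (at 0)" "(u has_derivative (\<lambda>t. t *\<^sub>R y' 0)) (at 0)"
        by (simp_all add: has_vector_derivative_def eq)
    qed
    have "((\<lambda>x. if x \<in> {0<..} then y x else u x) has_derivative (if (0::real) \<in> {0<..} then (\<lambda>t. t *\<^sub>R y' 0) else (\<lambda>t. t *\<^sub>R y' 0))) (at 0 within ({0<..} \<union> {..0}))"
      by (rule has_derivative_If_within_closures)
         (use d eq in \<open>auto intro: has_derivative_at_withinI has_derivative_subset\<close>)
    moreover have "{0<..} \<union> {..0} = (UNIV :: real set)" by auto
    ultimately show ?thesis using True eq by (simp add: has_vector_derivative_def Y_def[abs_def] Y'_def)
  qed
  have contY': "continuous_on UNIV Y'"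
  proof -
    have "continuous_on ({0..} \<union> {..0}) (\<lambda>x. if x > 0 then y' x else u' x)"
    proof (rule continuous_on_If)
      show "continuous_on {0..} y'" "continuous_on {..0} u'" using cont by (auto intro: continuous_on_subset)
    qed (use eq in auto)
    moreover have "{0..} \<union> {..0} = (UNIV :: real set)" by auto
    ultimately show ?thesis by (simp add: Y'_def[abs_def])
  qed
  have dY': "(Y' has_vector_derivative of_real (q x) * Y x - H x) (at x)" if "x \<noteq> 0" for x
    unfolding Y'_def[abs_def] using that y u
    by (intro glue) (auto simp: sl_inh_def Y_def H_def)
  have int: "Y' b - Y' a = (LINT x:{a..b}|lborel. of_real (q x) * Y x - H x)" if ab: "a \<le> b" for a b
  proof -
    \<comment> \<open>The fundamental theorem tolerates the exceptional point 0, given continuity of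
      \<open>Y'\<close>.\<close>
    have "((\<lambda>x. of_real (q x) * Y x - H x) has_integral (Y' b - Y' a)) {a..b}"
      by (rule fundamental_theorem_of_calculus_strong[where S = "{0}"])
         (use ab dY' contY' in \<open>auto intro: has_vector_derivative_at_within continuous_on_subset\<close>)
    moreover have "set_integrable lborel {a..b} (\<lambda>x. of_real (q x) * Y x - H x)"
    proof -
      let ?F = "\<lambda>x. complex_of_real (q x) * y x - g x" and ?G = "\<lambda>x. complex_of_real (q x) * u x - h x"
      have cF: "continuous_on UNIV ?F" "continuous_on UNIV ?G" by (intro continuous_intros q cont)+
      then have "set_integrable lborel {a..b} ?F" "set_integrable lborel {a..b} ?G"
        by (auto intro!: borel_integrable_atLeastAtMost' intro: continuous_on_subset)
      then have "integrable lborel (\<lambda>x. norm (indicator {a..b} x *\<^sub>R ?F x) + norm (indicator {a..b} x *\<^sub>R ?G x))"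
        unfolding set_integrable_def by (intro Bochner_Integration.integrable_add integrable_norm)
      moreover note cF[THEN borel_measurable_continuous_onI, measurable]
      have eqF: "of_real (q x) * Y x - H x = (if x > 0 then ?F x else ?G x)" for x
        by (auto simp: Y_def H_def)
      have "(\<lambda>x. indicator {a..b} x *\<^sub>R (of_real (q x) * Y x - H x)) \<in> borel_measurable lborel"
        unfolding eqF using cF[THEN borel_measurable_continuous_onI] by measurable
      ultimately show ?thesis unfolding set_integrable_def
        by (rule Bochner_Integration.integrable_bound) (auto simp: Y_def H_def split: split_indicator)
    qed
    ultimately show ?thesis
      using set_borel_integral_eq_integral(2) integral_unique by metis
  qed
  have "Y \<in> L2 lborel" "H \<in> L2 lborel"
    unfolding Y_def[abs_def] H_def[abs_def] by (intro L2_glue L meas)+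
  then have "(Y, H) \<in> sl_operator q"
    unfolding sl_operator_def sl_maximal_def lborel_on_UNIV
    using dY int by (simp, intro exI[of _ Y] conjI AE_I2 exI[of _ Y'] allI impI refl) auto
  then show ?thesis by (simp add: Y_def[abs_def] H_def[abs_def])
qed

text \<open>On the left half-line J reverses the sign, so that (A - z) h = f reads -u'' + q u = -(f2
  + z u) there.\<close>

lemma glued_in_indefinite_sl_operator:
  assumes q: "continuous_on UNIV q"
    and y: "sl_inh q y y' (\<lambda>x. f1 x + z * y x)" and u: "sl_inh q u u' (\<lambda>x. - (f2 x + z * u x))"
    and eq: "y 0 = u 0" "y' 0 = u' 0"
    and L: "y \<in> L2 (lborel_on {0<..})" "f1 \<in> L2 (lborel_on {0<..})"
      "u \<in> L2 (lborel_on {..<0})" "f2 \<in> L2 (lborel_on {..<0})"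
  shows "(\<lambda>x. if x > 0 then y x else u x,
      \<lambda>x. (if x > 0 then f1 x else f2 x) + z * (if x > 0 then y x else u x)) \<in> indefinite_sl_operator q"
proof -
  let ?g = "\<lambda>x. if x > 0 then f1 x + z * y x else - (f2 x + z * u x)"
  have L': "(\<lambda>x. f1 x + z * y x) \<in> L2 (lborel_on {0<..})" "(\<lambda>x. f2 x + z * u x) \<in> L2 (lborel_on {..<0})"
    by (intro L2_add L2_cmult L)+
  then have L'': "(\<lambda>x. - (f2 x + z * u x)) \<in> L2 (lborel_on {..<0})"
    using L2_cmult[OF L'(2), of "-1"] by simp
  have op: "(\<lambda>x. if x > 0 then y x else u x, ?g) \<in> sl_operator q"
    by (rule glued_in_sl_operator[OF q y u eq L(1) L'(1) L(3) L''])
  have "continuous_on UNIV (\<lambda>x. f1 x + z * y x)" "continuous_on UNIV (\<lambda>x. - (f2 x + z * u x))"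
    using y u unfolding sl_inh_def by blast+
  then have m: "(\<lambda>x. f1 x + z * y x) \<in> borel_measurable borel" "(\<lambda>x. - (f2 x + z * u x)) \<in> borel_measurable borel"
    by (auto intro: borel_measurable_continuous_onI)
  have m': "(\<lambda>x. f2 x + z * u x) \<in> borel_measurable borel"
    using borel_measurable_uminus[OF m(2)] by (simp add: add.commute)
  have "(\<lambda>x. if x > 0 then f1 x + z * y x else f2 x + z * u x) \<in> L2 lborel"
    by (rule L2_glue(1)[OF L' m(1) m'])
  moreover have "(\<lambda>x. if x > 0 then f1 x + z * y x else f2 x + z * u x) =
     (\<lambda>x. (if x > 0 then f1 x else f2 x) + z * (if x > 0 then y x else u x))" by auto
  ultimately have 1: "(\<lambda>x. (if x > 0 then f1 x else f2 x) + z * (if x > 0 then y x else u x)) \<in> L2 lborel" by simp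
  have "AE x in lborel. x \<notin> {0::real}" by (intro AE_not_in finite_imp_null_set_lborel) simp
  then have 2: "AE x in lborel. (if x > 0 then f1 x else f2 x) + z * (if x > 0 then y x else u x) = of_real (sgn x) * ?g x"
    by eventually_elim (auto simp: sgn_if)
  show ?thesis unfolding indefinite_sl_operator_def using op 1 2 by blast
qed

lemma L2_reflect:
  fixes f :: "real \<Rightarrow> complex"
  assumes f: "continuous_on UNIV f"
  shows "(\<lambda>x. f (- x)) \<in> L2 (lborel_on {0<..}) \<longleftrightarrow> f \<in> L2 (lborel_on {..<0})"
proof -
  have "integrable (lborel_on {0<..}) (\<lambda>x. (cmod (f (- x)))\<^sup>2) \<longleftrightarrow>
      integrable lborel (\<lambda>x. indicator {0<..} x *\<^sub>R (cmod (f (- x)))\<^sup>2)"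
    by (rule integrable_restrict_space) simp
  also have "\<dots> \<longleftrightarrow> integrable lborel (\<lambda>x. indicator {0<..} (- x) *\<^sub>R (cmod (f (- (- x))))\<^sup>2)"
    using lborel_integrable_real_affine_iff[of "-1" "\<lambda>x. indicator {0<..} x *\<^sub>R (cmod (f (- x)))\<^sup>2" 0] by simp
  also have "(\<lambda>x::real. indicator {0<..} (- x) *\<^sub>R (cmod (f (- (- x))))\<^sup>2) = (\<lambda>x. indicator {..<0} x *\<^sub>R (cmod (f x))\<^sup>2)"
    by (auto simp: fun_eq_iff split: split_indicator)
  also have "integrable lborel \<dots> \<longleftrightarrow> integrable (lborel_on {..<0}) (\<lambda>x. (cmod (f x))\<^sup>2)"
    by (rule integrable_restrict_space[symmetric]) simp
  finally have "integrable (lborel_on {0<..}) (\<lambda>x. (cmod (f (- x)))\<^sup>2) \<longleftrightarrow> integrable (lborel_on {..<0}) (\<lambda>x. (cmod (f x))\<^sup>2)" .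
  moreover have "continuous_on UNIV (\<lambda>x. f (- x))"
    by (rule continuous_on_compose2[OF f]) (auto intro!: continuous_intros)
  ultimately show ?thesis using f by (simp add: L2_def borel_measurable_lborel_on)
qed

lemma L2_inner_reflect:
  "L2_inner (lborel_on {0<..}) (\<lambda>x. f (- x)) (\<lambda>x. g (- x)) = L2_inner (lborel_on {..<0}) f g"
proof -
  have "L2_inner (lborel_on {0<..}) (\<lambda>x. f (- x)) (\<lambda>x. g (- x)) =
      (LINT x|lborel. indicator {0<..} x *\<^sub>R (f (- x) * cnj (g (- x))))"
    unfolding L2_inner_def by (rule integral_restrict_space) simp
  also have "\<dots> = (LINT x|lborel. indicator {0<..} (- x) *\<^sub>R (f (- (- x)) * cnj (g (- (- x)))))"
    using lborel_integral_real_affine[of "-1" "\<lambda>x. indicator {0<..} x *\<^sub>R (f (- x) * cnj (g (- x)))" 0] by simp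
  also have "(\<lambda>x::real. indicator {0<..} (- x) *\<^sub>R (f (- (- x)) * cnj (g (- (- x))))) = (\<lambda>x. indicator {..<0} x *\<^sub>R (f x * cnj (g x)))"
    by (auto simp: fun_eq_iff split: split_indicator)
  also have "integral\<^sup>L lborel \<dots> = L2_inner (lborel_on {..<0}) f g"
    unfolding L2_inner_def by (rule integral_restrict_space[symmetric]) simp
  finally show ?thesis .
qed

text \<open>An open set of measure zero is empty, so \<open>y\<close> vanishes on the whole open
  half-line, hence so does \<open>y'\<close>, and the end point 0 is reached by continuity.\<close>

lemma sl_sys_L2_norm_zero:
  assumes y: "sl_sys q z y y'" and 0: "L2_norm (lborel_on {0<..}) y = 0" and L: "y \<in> L2 (lborel_on {0<..})"
  shows "y' 0 = 0"
proof -
  have cont: "continuous_on UNIV y" "continuous_on UNIV y'" by (rule sl_sys_continuous[OF y])+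
  have "(LINT x|lborel_on {0<..}. (cmod (y x))\<^sup>2) = 0" using 0 by (simp add: L2_norm_def)
  then have "AE x in lborel_on {0<..}. (cmod (y x))\<^sup>2 = 0"
    using integral_nonneg_eq_0_iff_AE[OF L2_integrable_sq[OF L]] by simp
  then have "AE x in lborel. x \<in> {0<..} \<longrightarrow> y x = 0"
    by (subst (asm) AE_restrict_space_iff) auto
  then have "AE x in lborel. x \<notin> {0<..} \<inter> y -` (- {0})" by eventually_elim auto
  moreover have op: "open ({0<..} \<inter> y -` (- {0}))"
    by (intro open_Int open_greaterThan open_vimage cont) auto
  ultimately have "{0<..} \<inter> y -` (- {0}) \<in> null_sets lborel"
    by (subst AE_iff_null_sets) auto
  then have "negligible ({0<..} \<inter> y -` (- {0}))"
    by (simp add: negligible_iff_null_sets null_sets_completionI)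
  then have "{0<..} \<inter> y -` (- {0}) = {}" using open_not_negligible[OF op] by blast
  then have y0: "y x = 0" if "x > 0" for x using that by auto
  have y'0: "y' x = 0" if "x > 0" for x
  proof -
    have "((\<lambda>x. 0) has_vector_derivative y' x) (at x)"
      by (rule has_vector_derivative_transform_within_open[OF sl_sys_derivs(1)[OF y], where S = "{0<..}"])
         (use that y0 in auto)
    then show ?thesis using vector_derivative_unique_at has_vector_derivative_const by blast
  qed
  have "(y' \<longlongrightarrow> y' 0) (at_right 0)"
    using cont(2) by (simp add: continuous_on_eq_continuous_at isCont_def filterlim_at_split)
  moreover have "(y' \<longlongrightarrow> 0) (at_right 0)"
  proof (rule tendsto_eventually)
    show "\<forall>\<^sub>F x in at_right 0. y' x = 0"
      using eventually_at_right_less[of 0] by eventually_elim (rule y'0)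
  qed
  ultimately show ?thesis using tendsto_unique[OF trivial_limit_at_right_real] by blast
qed

lemma indefinite_sl_operator_L2:
  "(f, g) \<in> indefinite_sl_operator q \<Longrightarrow> f \<in> L2 lborel \<and> g \<in> L2 lborel"
  by (auto simp: indefinite_sl_operator_def sl_operator_def sl_maximal_def lborel_on_UNIV)

text \<open>The two solutions glue to an eigenfunction of \<open>A\<close>, which is not zero since
  its derivative at 0 is 1. Apart from the resolvent bound this is how similarity acts: it separates
  the two Weyl functions off the real axis and keeps \<open>c\<close> from being square
  integrable.\<close>

lemma no_nonreal_eigenfunction:
  assumes q: "continuous_on UNIV q" and y: "sl_sys q z y y'" and u: "sl_sys q (- z) u u'"
    and eq: "y 0 = u 0" "y' 0 = 1" "u' 0 = 1"
    and L: "y \<in> L2 (lborel_on {0<..})" "u \<in> L2 (lborel_on {..<0})"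
    and ev: "\<And>h. (h, \<lambda>x. z * h x) \<in> indefinite_sl_operator q \<Longrightarrow> L2_norm lborel h = 0"
  shows False
proof -
  have "(\<lambda>x. if x > 0 then y x else u x,
      \<lambda>x. (if x > 0 then 0 else 0) + z * (if x > 0 then y x else u x)) \<in> indefinite_sl_operator q"
    by (rule glued_in_indefinite_sl_operator[where y' = y' and u' = u', OF q _ _ eq(1) _ L(1) L2_zero L(2) L2_zero])
       (use sl_inh_of_sys[OF y] sl_inh_of_sys[OF u] eq in auto)
  then have "L2_norm lborel (\<lambda>x. if x > 0 then y x else u x) = 0" by (intro ev) simp
  moreover have "(L2_norm lborel (\<lambda>x. if x > 0 then y x else u x))\<^sup>2 =
      (L2_norm (lborel_on {0<..}) y)\<^sup>2 + (L2_norm (lborel_on {..<0}) u)\<^sup>2"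
    by (intro L2_glue L borel_measurable_continuous_onI sl_sys_continuous[OF y] sl_sys_continuous[OF u])
  ultimately have "(L2_norm (lborel_on {0<..}) y)\<^sup>2 + (L2_norm (lborel_on {..<0}) u)\<^sup>2 = 0" by simp
  then have "L2_norm (lborel_on {0<..}) y = 0"
    by (simp add: add_nonneg_eq_0_iff)
  then show False using sl_sys_L2_norm_zero[OF y _ L(1)] eq(2) by simp
qed

section \<open>Cauchy transforms of partial fractions and the resolvent of \<open>A\<close>\<close>

definition cauchy_transform :: "real measure \<Rightarrow> (real \<Rightarrow> complex) \<Rightarrow> complex \<Rightarrow> complex" where
  "cauchy_transform \<mu> g w = (LINT t|\<mu>. g t / (complex_of_real t - w))"

text \<open>The representative in L^2(\<mu>) of the combination of Weyl solutions
  \<open>p \<zeta>\<close> with coefficients \<open>a \<zeta>\<close>.\<close>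

definition pfrac :: "(complex \<Rightarrow> complex) \<Rightarrow> complex set \<Rightarrow> real \<Rightarrow> complex" where
  "pfrac a Z t = (\<Sum>\<zeta>\<in>Z. a \<zeta> * (1 / (complex_of_real t - \<zeta>)))"

lemma pfrac_L2:
  assumes "sets \<mu> = sets borel" "integrable \<mu> (\<lambda>t. 1 / (1 + \<bar>t\<bar>))" "Z \<inter> \<real> = {}"
  shows "pfrac a Z \<in> L2 \<mu>"
  unfolding pfrac_def[abs_def] using assms by (intro L2_sum L2_cmult integrable_diff_inverse(2)) auto

text \<open>What both half-lines have in common once the Gram identity is known: \<open>P\<close> is
  Lebesgue measure on the half-line and \<open>p z\<close> its Weyl solution.\<close>

locale half_line_model =
  fixes \<mu> P :: "real measure" and M :: "complex \<Rightarrow> complex" and p :: "complex \<Rightarrow> real \<Rightarrow> complex"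
  assumes sets: "sets \<mu> = sets borel" and int: "integrable \<mu> (\<lambda>t. 1 / (1 + \<bar>t\<bar>))"
    and M: "\<And>z. z \<notin> \<real> \<Longrightarrow> M z = (LINT t|\<mu>. 1 / (complex_of_real t - z))"
    and pL: "\<And>z. z \<notin> \<real> \<Longrightarrow> p z \<in> L2 P"
    and iso: "\<And>z w. z \<notin> \<real> \<Longrightarrow> w \<notin> \<real> \<Longrightarrow> L2_inner P (p z) (p w) =
       L2_inner \<mu> (\<lambda>t. 1 / (complex_of_real t - z)) (\<lambda>t. 1 / (complex_of_real t - w))"

text \<open>The quotient (p w - p \<zeta>) / (w - \<zeta>) corresponds to 1 / ((t - w)(t -
  \<zeta>)). So the second claim concerns the Neumann resolvent at w applied to the combination, and
  the third gives its value at 0 up to sign. In the last claim both sides are the integral of Im (1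
  / (t - w)).\<close>

lemma (in half_line_model) half_line_span:
  assumes Z: "finite Z" "Z \<inter> \<real> = {}" and w: "w \<notin> \<real>"
  shows "L2_norm P (\<lambda>x. \<Sum>\<zeta>\<in>Z. a \<zeta> * p \<zeta> x) = L2_norm \<mu> (pfrac a Z)"
    and "w \<notin> Z \<Longrightarrow> L2_norm P (\<lambda>x. \<Sum>\<zeta>\<in>Z. a \<zeta> / (w - \<zeta>) * (p w x - p \<zeta> x)) =
      L2_norm \<mu> (\<lambda>t. pfrac a Z t / (complex_of_real t - w))"
    and "w \<notin> Z \<Longrightarrow> cauchy_transform \<mu> (pfrac a Z) w = (\<Sum>\<zeta>\<in>Z. a \<zeta> / (w - \<zeta>) * (M w - M \<zeta>))"
    and "Im w * (L2_norm P (p w))\<^sup>2 = Im (M w)"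
proof -
  define g where "g z t = 1 / (complex_of_real t - z)" for z t
  note gL = integrable_diff_inverse(2)[OF sets int, folded g_def]
  note gI = integrable_diff_inverse(1)[OF sets int, folded g_def]
  have ne: "complex_of_real t - z \<noteq> 0" if "z \<notin> \<real>" for t z using that by auto
  have ZR: "\<zeta> \<notin> \<real>" if "\<zeta> \<in> Z" for \<zeta> using that Z by auto
  note iso = iso[folded g_def]
  note M = M[folded g_def]
  have pf: "pfrac a Z = (\<lambda>t. \<Sum>\<zeta>\<in>Z. a \<zeta> * g \<zeta> t)" by (simp add: pfrac_def[abs_def] g_def)
  show "L2_norm P (\<lambda>x. \<Sum>\<zeta>\<in>Z. a \<zeta> * p \<zeta> x) = L2_norm \<mu> (pfrac a Z)"
    unfolding pf by (rule L2_norm_combination_eq) (use ZR pL gL iso in auto)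
  have res: "g w t * g \<zeta> t = (g w t - g \<zeta> t) / (w - \<zeta>)" if "\<zeta> \<in> Z" "w \<notin> Z" for \<zeta> t
  proof -
    have "w - \<zeta> \<noteq> 0" using that by auto
    then show ?thesis using ne[OF w, of t] ne[OF ZR[OF that(1)], of t]
      by (simp add: g_def divide_simps) (simp add: algebra_simps)?
  qed
  have pfw: "pfrac a Z t / (complex_of_real t - w) = (\<Sum>\<zeta>\<in>Z. a \<zeta> / (w - \<zeta>) * (g w t - g \<zeta> t))" if wZ: "w \<notin> Z" for t
  proof -
    have "pfrac a Z t / (complex_of_real t - w) = (\<Sum>\<zeta>\<in>Z. a \<zeta> * (g w t * g \<zeta> t))"
      unfolding pf sum_divide_distrib by (intro sum.cong) (auto simp: g_def)
    also have "\<dots> = (\<Sum>\<zeta>\<in>Z. a \<zeta> / (w - \<zeta>) * (g w t - g \<zeta> t))"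
      using wZ by (intro sum.cong refl) (simp add: res)
    finally show ?thesis .
  qed
  show "L2_norm P (\<lambda>x. \<Sum>\<zeta>\<in>Z. a \<zeta> / (w - \<zeta>) * (p w x - p \<zeta> x)) =
      L2_norm \<mu> (\<lambda>t. pfrac a Z t / (complex_of_real t - w))" if wZ: "w \<notin> Z"
  proof -
    \<comment> \<open>The differences are regrouped into one combination over
      \<open>insert w Z\<close>, to which the comparison of Gram matrices applies; w collects the
      sum of all coefficients.\<close>
    define d where "d i = (if i = w then (\<Sum>\<zeta>\<in>Z. a \<zeta> / (w - \<zeta>)) else - (a i / (w - i)))" for i
    have split: "(\<Sum>\<zeta>\<in>Z. a \<zeta> / (w - \<zeta>) * (f w - f \<zeta>)) = (\<Sum>i\<in>insert w Z. d i * f i)" for f :: "complex \<Rightarrow> complex"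
    proof -
      have "(\<Sum>i\<in>Z. d i * f i) = (\<Sum>i\<in>Z. - (a i / (w - i)) * f i)"
        using wZ by (intro sum.cong) (auto simp: d_def)
      then show ?thesis using Z(1) wZ
        by (simp add: d_def right_diff_distrib sum_subtractf sum_distrib_right sum_negf)
    qed
    have "L2_norm P (\<lambda>x. \<Sum>i\<in>insert w Z. d i * p i x) = L2_norm \<mu> (\<lambda>t. \<Sum>i\<in>insert w Z. d i * g i t)"
      by (rule L2_norm_combination_eq) (use ZR w pL gL iso in auto)
    moreover have "(\<lambda>x. \<Sum>\<zeta>\<in>Z. a \<zeta> / (w - \<zeta>) * (p w x - p \<zeta> x)) = (\<lambda>x. \<Sum>i\<in>insert w Z. d i * p i x)"
      by (rule ext, rule split[of "\<lambda>z. p z x" for x])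
    moreover have "(\<lambda>t. pfrac a Z t / (complex_of_real t - w)) = (\<lambda>t. \<Sum>i\<in>insert w Z. d i * g i t)"
      unfolding pfw[OF wZ] by (rule ext, rule split[of "\<lambda>z. g z t" for t])
    ultimately show ?thesis by simp
  qed
  show "cauchy_transform \<mu> (pfrac a Z) w = (\<Sum>\<zeta>\<in>Z. a \<zeta> / (w - \<zeta>) * (M w - M \<zeta>))" if wZ: "w \<notin> Z"
  proof -
    have "cauchy_transform \<mu> (pfrac a Z) w = (\<Sum>\<zeta>\<in>Z. LINT t|\<mu>. a \<zeta> / (w - \<zeta>) * (g w t - g \<zeta> t))"
      unfolding cauchy_transform_def pfw[OF wZ] using ZR w
      by (intro Bochner_Integration.integral_sum integrable_mult_right Bochner_Integration.integrable_diff gI)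
    also have "\<dots> = (\<Sum>\<zeta>\<in>Z. a \<zeta> / (w - \<zeta>) * (M w - M \<zeta>))"
      using ZR w gI by (intro sum.cong refl) (simp add: M)
    finally show ?thesis .
  qed
  show "Im w * (L2_norm P (p w))\<^sup>2 = Im (M w)"
  proof -
    have "complex_of_real ((L2_norm P (p w))\<^sup>2) = of_real ((L2_norm \<mu> (g w))\<^sup>2)"
      unfolding L2_inner_self[symmetric] by (rule iso[OF w w])
    then have "(L2_norm P (p w))\<^sup>2 = (L2_norm \<mu> (g w))\<^sup>2" by (simp only: of_real_eq_iff)
    then have "Im w * (L2_norm P (p w))\<^sup>2 = (LINT t|\<mu>. Im w * (cmod (g w t))\<^sup>2)"
      by (simp add: L2_norm_sq)
    also have "\<dots> = (LINT t|\<mu>. Im (g w t))"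
    proof (intro Bochner_Integration.integral_cong refl)
      fix t
      show "Im w * (cmod (g w t))\<^sup>2 = Im (g w t)"
      proof -
        have "Im (g w t) = Im w / (cmod (complex_of_real t - w))\<^sup>2" by (simp add: g_def Im_divide cmod_power2)
        then show ?thesis by (simp add: g_def norm_divide power_divide)
      qed
    qed
    also have "\<dots> = Im (M w)" using gI[OF w] by (simp add: M[OF w])
    finally show ?thesis .
  qed
qed

text \<open>Im w times the squared norm of the two Weyl solutions together, divided by the squared
  gap between their values at 0. With both imaginary parts in the numerator, a single inequality
  covers both versions of the result.\<close>

definition weyl_weight :: "(complex \<Rightarrow> complex) \<Rightarrow> (complex \<Rightarrow> complex) \<Rightarrow> complex \<Rightarrow> real" where
  "weyl_weight M N w = (Im (M w) + Im (N w)) / (cmod (M w - N w))\<^sup>2"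

text \<open>On each half-line the resolvent of \<open>A\<close> differs from the Neumann resolvent
  by a multiple of the Weyl solution. The factor \<alpha> is the same on both sides because both
  Weyl solutions have derivative 1 at 0, and continuity at 0 determines it. The norm of this
  correction is estimated through the three resolvents.\<close>

lemma weyl_span_inequality:
  fixes s c :: "real \<Rightarrow> complex \<Rightarrow> complex" and mp mm Mp Mm :: "complex \<Rightarrow> complex"
  assumes q: "continuous_on UNIV q"
    and s: "\<And>z. sl_solution q z 0 1 (\<lambda>x. s x z)" and c: "\<And>z. sl_solution q z 1 0 (\<lambda>x. c x z)"
    and mpL: "\<And>z. z \<notin> \<real> \<Longrightarrow> (\<lambda>x. s x z - mp z * c x z) \<in> L2 (lborel_on {0<..})"
    and mmL: "\<And>z. z \<notin> \<real> \<Longrightarrow> (\<lambda>x. s x z + mm z * c x z) \<in> L2 (lborel_on {..<0})"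
    and Mp: "\<And>z. z \<notin> \<real> \<Longrightarrow> Mp z = mp z" and Mm: "\<And>z. z \<notin> \<real> \<Longrightarrow> Mm z = - mm (- z)"
    and sets: "sets \<mu>p = sets borel" "sets \<mu>m = sets borel"
    and int: "integrable \<mu>p (\<lambda>t. 1 / (1 + \<bar>t\<bar>))" "integrable \<mu>m (\<lambda>t. 1 / (1 + \<bar>t\<bar>))"
    and Mp_int: "\<And>z. z \<notin> \<real> \<Longrightarrow> Mp z = (LINT t|\<mu>p. 1 / (complex_of_real t - z))"
    and Mm_int: "\<And>z. z \<notin> \<real> \<Longrightarrow> Mm z = (LINT t|\<mu>m. 1 / (complex_of_real t - z))"
    and T: "L2_selfadjoint lborel T" "L2_similar lborel (indefinite_sl_operator q) T"
  obtains K where "K \<ge> 0" "\<And>Zp Zm a b e. finite Zp \<Longrightarrow> finite Zm \<Longrightarrow> Zp \<inter> \<real> = {} \<Longrightarrow> Zm \<inter> \<real> = {} \<Longrightarrow> e > 0 \<Longrightarrow>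
    (\<integral>\<^sup>+x. ennreal (weyl_weight Mp Mm (Complex x e) * (cmod (cauchy_transform \<mu>p (pfrac a Zp) (Complex x e)
        - cauchy_transform \<mu>m (pfrac b Zm) (Complex x e)))\<^sup>2) \<partial>lborel)
     \<le> ennreal (K * ((L2_norm \<mu>p (pfrac a Zp))\<^sup>2 + (L2_norm \<mu>m (pfrac b Zm))\<^sup>2))"
proof -
  obtain s' where s': "\<And>z. sl_sys q z (\<lambda>x. s x z) (s' z)" "\<And>z. s 0 z = 0" "\<And>z. s' z 0 = 1"
    using sl_solution_sys[OF s] by metis
  obtain c' where c': "\<And>z. sl_sys q z (\<lambda>x. c x z) (c' z)" "\<And>z. c 0 z = 1" "\<And>z. c' z 0 = 0"
    using sl_solution_sys[OF c] by metis
  obtain K where K: "K \<ge> 0"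
    "\<And>E f h e. finite E \<Longrightarrow> f \<in> L2 lborel \<Longrightarrow>
       (\<And>z. z \<notin> \<real> \<Longrightarrow> z \<notin> E \<Longrightarrow> (h z, \<lambda>x. f x + z * h z x) \<in> indefinite_sl_operator q) \<Longrightarrow> e > 0 \<Longrightarrow>
       \<exists>G\<in>borel_measurable lborel. (\<forall>x. 0 \<le> G x) \<and>
         (AE x in lborel. e * (L2_norm lborel (h (Complex x e)))\<^sup>2 \<le> G x) \<and>
         (\<integral>\<^sup>+x. ennreal (G x) \<partial>lborel) \<le> ennreal (K * (L2_norm lborel f)\<^sup>2)"
    and ev: "\<And>z h. z \<notin> \<real> \<Longrightarrow> (h, \<lambda>x. z * h x) \<in> indefinite_sl_operator q \<Longrightarrow> L2_norm lborel h = 0"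
    by (rule similar_selfadjoint_bounds[OF T indefinite_sl_operator_L2]) blast+
  define pp where "pp z x = s x z - Mp z * c x z" for z x
  define pp' where "pp' z x = s' z x - Mp z * c' z x" for z x
  \<comment> \<open>On the left \<open>A\<close> acts as the negative of the differential
    expression, hence the spectral parameter - z.\<close>
  define pm where "pm z x = s x (- z) - Mm z * c x (- z)" for z x
  define pm' where "pm' z x = s' (- z) x - Mm z * c' (- z) x" for z x
  have mR: "- z \<notin> \<real>" if "z \<notin> \<real>" for z :: complex using that by (simp add: complex_is_Real_iff)
  have pp: "sl_sys q z (pp z) (pp' z)" for z
    unfolding pp_def[abs_def] pp'_def[abs_def] by (intro sl_sys_diff_cmult s' c')
  have pm: "sl_sys q (- z) (pm z) (pm' z)" for z
    unfolding pm_def[abs_def] pm'_def[abs_def] by (intro sl_sys_diff_cmult s' c')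
  have ini: "pp z 0 = - Mp z" "pp' z 0 = 1" "pm z 0 = - Mm z" "pm' z 0 = 1" for z
    by (simp_all add: pp_def pp'_def pm_def pm'_def s' c')
  have ppL: "pp z \<in> L2 (lborel_on {0<..})" if "z \<notin> \<real>" for z
    using mpL[OF that] by (simp add: pp_def[abs_def] Mp[OF that])
  have pmL: "pm z \<in> L2 (lborel_on {..<0})" if "z \<notin> \<real>" for z
    using mmL[OF mR[OF that]] by (simp add: pm_def[abs_def] Mm[OF that])
  \<comment> \<open>Equal values at 0, together with the common derivative 1, would produce an
    eigenfunction of \<open>A\<close>.\<close>
  have MpMm: "Mp z \<noteq> Mm z" if z: "z \<notin> \<real>" for z
    using no_nonreal_eigenfunction[OF q pp pm _ _ _ ppL[OF z] pmL[OF z] ev[OF z]] ini by metis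
  \<comment> \<open>Adding a multiple of \<open>c\<close> changes the value at 0 but not the
    derivative. A square integrable \<open>c\<close> could therefore be used to match the left Weyl
    solution, which again yields an eigenfunction.\<close>
  have cp: "(\<lambda>x. c x z) \<notin> L2 (lborel_on {0<..})" if z: "z \<notin> \<real>" for z
  proof
    assume "(\<lambda>x. c x z) \<in> L2 (lborel_on {0<..})"
    from L2_diff[OF ppL[OF z] L2_cmult[OF this, of "Mm z - Mp z"]]
    have 1: "(\<lambda>x. pp z x - (Mm z - Mp z) * c x z) \<in> L2 (lborel_on {0<..})" .
    have 2: "sl_sys q z (\<lambda>x. pp z x - (Mm z - Mp z) * c x z) (\<lambda>x. pp' z x - (Mm z - Mp z) * c' z x)"
      by (intro sl_sys_diff_cmult pp c')
    show False
      by (rule no_nonreal_eigenfunction[OF q 2 pm _ _ _ 1 pmL[OF z] ev[OF z]]) (auto simp: ini c')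
  qed
  have cm: "(\<lambda>x. c x (- z)) \<notin> L2 (lborel_on {..<0})" if z: "z \<notin> \<real>" for z
  proof
    assume "(\<lambda>x. c x (- z)) \<in> L2 (lborel_on {..<0})"
    from L2_diff[OF pmL[OF z] L2_cmult[OF this, of "Mp z - Mm z"]]
    have 1: "(\<lambda>x. pm z x - (Mp z - Mm z) * c x (- z)) \<in> L2 (lborel_on {..<0})" .
    have 2: "sl_sys q (- z) (\<lambda>x. pm z x - (Mp z - Mm z) * c x (- z)) (\<lambda>x. pm' z x - (Mp z - Mm z) * c' (- z) x)"
      by (intro sl_sys_diff_cmult pm c')
    show False
      by (rule no_nonreal_eigenfunction[OF q pp 2 _ _ _ ppL[OF z] 1 ev[OF z]]) (auto simp: ini c')
  qed
  have isop: "L2_inner (lborel_on {0<..}) (pp z) (pp w) =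
      L2_inner \<mu>p (\<lambda>t. 1 / (complex_of_real t - z)) (\<lambda>t. 1 / (complex_of_real t - w))"
    if "z \<notin> \<real>" "w \<notin> \<real>" for z w
    by (rule half_line_isometry[where k = 1 and p = pp and p' = pp' and c = "\<lambda>z x. c x z" and c' = c' and M = Mp and q = q])
       (use sets int pp c' ini ppL cp Mp_int that in auto)
  have isom: "L2_inner (lborel_on {..<0}) (pm z) (pm w) =
      L2_inner \<mu>m (\<lambda>t. 1 / (complex_of_real t - z)) (\<lambda>t. 1 / (complex_of_real t - w))"
    if "z \<notin> \<real>" "w \<notin> \<real>" for z w
    unfolding L2_inner_reflect[symmetric]
  \<comment> \<open>Reflection turns the derivative 1 at 0 into -1, which is \<open>k\<close>; the
    spectral parameter k z is - z, as it should be.\<close>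
  proof (rule half_line_isometry[where k = "-1" and p = "\<lambda>z x. pm z (- x)" and p' = "\<lambda>z x. - pm' z (- x)"
        and c = "\<lambda>z x. c (- x) (- z)" and c' = "\<lambda>z x. - c' (- z) (- x)" and M = Mm and q = "\<lambda>x. q (- x)"])
    fix z :: complex assume z: "z \<notin> \<real>"
    show "sl_sys (\<lambda>x. q (- x)) (complex_of_real (- 1) * z) (\<lambda>x. pm z (- x)) (\<lambda>x. - pm' z (- x))"
      using sl_sys_reflect[OF pm[of z]] by simp
    show "sl_sys (\<lambda>x. q (- x)) (complex_of_real (- 1) * z) (\<lambda>x. c (- x) (- z)) (\<lambda>x. - c' (- z) (- x))"
      using sl_sys_reflect[OF c'(1)[of "- z"]] by simp
    show "(\<lambda>x. pm z (- x)) \<in> L2 (lborel_on {0<..})"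
      using pmL[OF z] by (subst L2_reflect[OF sl_sys_continuous(1)[OF pm]])
    show "(\<lambda>x. c (- x) (- z)) \<notin> L2 (lborel_on {0<..})"
      using cm[OF z] L2_reflect[OF sl_sys_continuous(1)[OF c'(1)[of "- z"]]] by simp
  qed (use sets int ini c' Mm_int that in auto)
  show ?thesis
  \<comment> \<open>The estimate yields 2 K + 4 pi: a factor 2 from the squared triangle inequality,
    K from the resolvent of \<open>A\<close> and 2 pi from each Neumann resolvent. The constant
    given is a convenient larger one.\<close>
  proof (rule that[of "4 * K + 16 * pi"])
    show "4 * K + 16 * pi \<ge> 0" using K(1) by simp
    fix Zp Zm :: "complex set" and a b :: "complex \<Rightarrow> complex" and e :: real
    assume fin: "finite Zp" "finite Zm" and Z: "Zp \<inter> \<real> = {}" "Zm \<inter> \<real> = {}" and e: "e > 0"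
    have ZpR: "\<zeta> \<notin> \<real>" if "\<zeta> \<in> Zp" for \<zeta> using that Z by auto
    have ZmR: "\<zeta> \<notin> \<real>" if "\<zeta> \<in> Zm" for \<zeta> using that Z by auto
    interpret p: half_line_model \<mu>p "lborel_on {0<..}" Mp pp
      by unfold_locales (fact sets int Mp_int ppL isop)+
    interpret m: half_line_model \<mu>m "lborel_on {..<0}" Mm pm
      by unfold_locales (fact sets int Mm_int pmL isom)+
    note hp = p.half_line_span[OF fin(1) Z(1)]
    note hm = m.half_line_span[OF fin(2) Z(2)]
    define f1 where "f1 x = (\<Sum>\<zeta>\<in>Zp. a \<zeta> * pp \<zeta> x)" for x
    define f2 where "f2 x = (\<Sum>\<zeta>\<in>Zm. b \<zeta> * pm \<zeta> x)" for x
    define f where "f x = (if x > 0 then f1 x else f2 x)" for x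
    define Np Nm where "Np = (L2_norm \<mu>p (pfrac a Zp))\<^sup>2" and "Nm = (L2_norm \<mu>m (pfrac b Zm))\<^sup>2"
    define Fp where "Fp w = (\<Sum>\<zeta>\<in>Zp. a \<zeta> / (w - \<zeta>) * (Mp w - Mp \<zeta>))" for w
    define Fm where "Fm w = (\<Sum>\<zeta>\<in>Zm. b \<zeta> / (w - \<zeta>) * (Mm w - Mm \<zeta>))" for w
    \<comment> \<open>Solves Fp + \<alpha> Mp = Fm + \<alpha> Mm, the matching condition at
      0.\<close>
    define \<alpha> where "\<alpha> w = (Fp w - Fm w) / (Mm w - Mp w)" for w
    define G1 where "G1 w x = (\<Sum>\<zeta>\<in>Zp. a \<zeta> / (w - \<zeta>) * (pp w x - pp \<zeta> x))" for w x
    define G2 where "G2 w x = (\<Sum>\<zeta>\<in>Zm. b \<zeta> / (w - \<zeta>) * (pm w x - pm \<zeta> x))" for w x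
    define y where "y w x = G1 w x + \<alpha> w * pp w x" for w x
    define u where "u w x = G2 w x + \<alpha> w * pm w x" for w x
    have f1L: "f1 \<in> L2 (lborel_on {0<..})" and f2L: "f2 \<in> L2 (lborel_on {..<0})"
      unfolding f1_def[abs_def] f2_def[abs_def] by (intro L2_sum L2_cmult ppL pmL ZpR ZmR; assumption)+
    have G1L: "G1 w \<in> L2 (lborel_on {0<..})" if "w \<notin> \<real>" for w
      unfolding G1_def[abs_def] by (intro L2_sum L2_cmult L2_diff ppL that ZpR)
    have G2L: "G2 w \<in> L2 (lborel_on {..<0})" if "w \<notin> \<real>" for w
      unfolding G2_def[abs_def] by (intro L2_sum L2_cmult L2_diff pmL that ZmR)
    have yL: "y w \<in> L2 (lborel_on {0<..})" and uL: "u w \<in> L2 (lborel_on {..<0})" if "w \<notin> \<real>" for w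
      unfolding y_def[abs_def] u_def[abs_def] using that
      by (intro L2_add L2_cmult G1L G2L ppL pmL; assumption)+
    have cont: "continuous_on UNIV f1" "continuous_on UNIV f2" "continuous_on UNIV (y w)" "continuous_on UNIV (u w)" for w
      unfolding f1_def[abs_def] f2_def[abs_def] y_def[abs_def] u_def[abs_def] G1_def G2_def
      by (intro continuous_intros sl_sys_continuous[OF pp] sl_sys_continuous[OF pm])+
    note meas = cont[THEN borel_measurable_continuous_onI]
    have fL: "f \<in> L2 lborel" and fN: "(L2_norm lborel f)\<^sup>2 = Np + Nm"
      unfolding f_def[abs_def] using L2_glue[OF f1L f2L meas(1,2)] hp(1)[of \<i> a] hm(1)[of \<i> b]
      by (simp_all add: Np_def Nm_def f1_def[abs_def] f2_def[abs_def] complex_is_Real_iff)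
    \<comment> \<open>The glued function is the resolvent of \<open>A\<close> at w applied to
      \<open>f\<close>; the poles of the coefficients a \<zeta> / (w - \<zeta>) and b \<zeta> / (w -
      \<zeta>) form the exceptional set.\<close>
    have opA: "(\<lambda>x. if x > 0 then y w x else u w x, \<lambda>x. f x + w * (if x > 0 then y w x else u w x)) \<in> indefinite_sl_operator q"
      if w: "w \<notin> \<real>" "w \<notin> Zp \<union> Zm" for w
    proof -
      have iy: "sl_inh q (y w) (\<lambda>x. (\<Sum>\<zeta>\<in>Zp. a \<zeta> / (w - \<zeta>) * (pp' w x + -1 * pp' \<zeta> x)) + \<alpha> w * pp' w x) (\<lambda>x. f1 x + w * y w x)"
      proof -
        have "sl_inh q (\<lambda>x. (\<Sum>\<zeta>\<in>Zp. a \<zeta> / (w - \<zeta>) * (pp w x + -1 * pp \<zeta> x)) + \<alpha> w * pp w x)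
         (\<lambda>x. (\<Sum>\<zeta>\<in>Zp. a \<zeta> / (w - \<zeta>) * (pp' w x + -1 * pp' \<zeta> x)) + \<alpha> w * pp' w x)
         (\<lambda>x. (\<Sum>\<zeta>\<in>Zp. a \<zeta> / (w - \<zeta>) * (w * pp w x + -1 * (\<zeta> * pp \<zeta> x))) + \<alpha> w * (w * pp w x))"
          by (intro sl_inh_add sl_inh_sum sl_inh_cmult sl_inh_of_sys pp)
        moreover have "(\<Sum>\<zeta>\<in>Zp. a \<zeta> / (w - \<zeta>) * (w * pp w x + -1 * (\<zeta> * pp \<zeta> x))) + \<alpha> w * (w * pp w x) = f1 x + w * y w x" for x
        proof -
          have "(\<Sum>\<zeta>\<in>Zp. a \<zeta> / (w - \<zeta>) * (w * pp w x + -1 * (\<zeta> * pp \<zeta> x))) =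
             (\<Sum>\<zeta>\<in>Zp. a \<zeta> * pp \<zeta> x + w * (a \<zeta> / (w - \<zeta>) * (pp w x - pp \<zeta> x)))"
          proof (intro sum.cong refl)
            fix \<zeta> assume "\<zeta> \<in> Zp"
            then have "w - \<zeta> \<noteq> 0" using w by auto
            then show "a \<zeta> / (w - \<zeta>) * (w * pp w x + -1 * (\<zeta> * pp \<zeta> x)) = a \<zeta> * pp \<zeta> x + w * (a \<zeta> / (w - \<zeta>) * (pp w x - pp \<zeta> x))"
              by (simp add: divide_simps) (simp add: algebra_simps)
          qed
          also have "\<dots> = f1 x + w * G1 w x"
            by (simp only: sum.distrib sum_distrib_left[symmetric] f1_def G1_def)
          finally show ?thesis by (simp only: y_def) (simp add: algebra_simps)
        qed
        ultimately show ?thesis by (simp add: y_def[abs_def] G1_def)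
      qed
      have iu: "sl_inh q (u w) (\<lambda>x. (\<Sum>\<zeta>\<in>Zm. b \<zeta> / (w - \<zeta>) * (pm' w x + -1 * pm' \<zeta> x)) + \<alpha> w * pm' w x) (\<lambda>x. - (f2 x + w * u w x))"
      proof -
        have "sl_inh q (\<lambda>x. (\<Sum>\<zeta>\<in>Zm. b \<zeta> / (w - \<zeta>) * (pm w x + -1 * pm \<zeta> x)) + \<alpha> w * pm w x)
         (\<lambda>x. (\<Sum>\<zeta>\<in>Zm. b \<zeta> / (w - \<zeta>) * (pm' w x + -1 * pm' \<zeta> x)) + \<alpha> w * pm' w x)
         (\<lambda>x. (\<Sum>\<zeta>\<in>Zm. b \<zeta> / (w - \<zeta>) * ((- w) * pm w x + -1 * ((- \<zeta>) * pm \<zeta> x))) + \<alpha> w * ((- w) * pm w x))"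
          by (intro sl_inh_add sl_inh_sum sl_inh_cmult sl_inh_of_sys pm)
        moreover have "(\<Sum>\<zeta>\<in>Zm. b \<zeta> / (w - \<zeta>) * ((- w) * pm w x + -1 * ((- \<zeta>) * pm \<zeta> x))) + \<alpha> w * ((- w) * pm w x) = - (f2 x + w * u w x)" for x
        proof -
          have "(\<Sum>\<zeta>\<in>Zm. b \<zeta> / (w - \<zeta>) * ((- w) * pm w x + -1 * ((- \<zeta>) * pm \<zeta> x))) =
             (\<Sum>\<zeta>\<in>Zm. - (b \<zeta> * pm \<zeta> x + w * (b \<zeta> / (w - \<zeta>) * (pm w x - pm \<zeta> x))))"
          proof (intro sum.cong refl)
            fix \<zeta> assume "\<zeta> \<in> Zm"
            then have "w - \<zeta> \<noteq> 0" using w by auto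
            then show "b \<zeta> / (w - \<zeta>) * ((- w) * pm w x + -1 * ((- \<zeta>) * pm \<zeta> x)) = - (b \<zeta> * pm \<zeta> x + w * (b \<zeta> / (w - \<zeta>) * (pm w x - pm \<zeta> x)))"
              by (simp add: divide_simps) (simp add: algebra_simps)
          qed
          also have "\<dots> = - (f2 x + w * G2 w x)"
            by (simp only: sum_negf sum.distrib sum_distrib_left[symmetric] f2_def G2_def)
          finally show ?thesis by (simp only: u_def) (simp add: algebra_simps)
        qed
        ultimately show ?thesis by (simp add: u_def[abs_def] G2_def)
      qed
      have e1: "y w 0 = u w 0"
      proof -
        have "G1 w 0 = - Fp w" unfolding G1_def Fp_def sum_negf[symmetric] ini
          by (intro sum.cong refl) (simp add: right_diff_distrib)
        moreover have "G2 w 0 = - Fm w" unfolding G2_def Fm_def sum_negf[symmetric] ini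
          by (intro sum.cong refl) (simp add: right_diff_distrib)
        ultimately have "y w 0 = - (Fp w + \<alpha> w * Mp w)" "u w 0 = - (Fm w + \<alpha> w * Mm w)"
          by (simp_all add: y_def u_def ini)
        moreover have "\<alpha> w * (Mm w - Mp w) = Fp w - Fm w" using MpMm[OF w(1)] by (simp add: \<alpha>_def)
        then have "Fp w + \<alpha> w * Mp w = Fm w + \<alpha> w * Mm w" by (simp add: algebra_simps)
        ultimately show ?thesis by simp
      qed
      show ?thesis unfolding f_def
        by (rule glued_in_indefinite_sl_operator[OF q iy iu e1 _ yL[OF w(1)] f1L uL[OF w(1)] f2L])
           (simp add: ini)
    qed
    \<comment> \<open>A majorant for the resolvent of \<open>A\<close>; \<open>H1\<close> and
      \<open>H2\<close> serve the Neumann resolvents of the two half-lines.\<close>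
    obtain H0 where H0[measurable]: "H0 \<in> borel_measurable lborel" and H0n: "\<And>x. 0 \<le> H0 x"
      and H0A: "AE x in lborel. e * (L2_norm lborel (\<lambda>t. if t > 0 then y (Complex x e) t else u (Complex x e) t))\<^sup>2 \<le> H0 x"
      and H0I: "(\<integral>\<^sup>+x. ennreal (H0 x) \<partial>lborel) \<le> ennreal (K * (Np + Nm))"
      using K(2)[OF finite_UnI[OF fin] fL opA e] unfolding fN by blast
    obtain H1 where H1[measurable]: "H1 \<in> borel_measurable lborel" and H1n: "\<And>x. 0 \<le> H1 x"
      and H1A: "AE x in lborel. e * (L2_norm \<mu>p (\<lambda>t. pfrac a Zp t / (complex_of_real t - Complex x e)))\<^sup>2 \<le> H1 x"
      and H1I: "(\<integral>\<^sup>+x. ennreal (H1 x) \<partial>lborel) \<le> ennreal (2 * pi * Np)"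
      using multiplication_resolvent_bound[OF sets(1) pfrac_L2[OF sets(1) int(1) Z(1)] e, of a] unfolding Np_def by blast
    obtain H2 where H2[measurable]: "H2 \<in> borel_measurable lborel" and H2n: "\<And>x. 0 \<le> H2 x"
      and H2A: "AE x in lborel. e * (L2_norm \<mu>m (\<lambda>t. pfrac b Zm t / (complex_of_real t - Complex x e)))\<^sup>2 \<le> H2 x"
      and H2I: "(\<integral>\<^sup>+x. ennreal (H2 x) \<partial>lborel) \<le> ennreal (2 * pi * Nm)"
      using multiplication_resolvent_bound[OF sets(2) pfrac_L2[OF sets(2) int(2) Z(2)] e, of b] unfolding Nm_def by blast
    have "(\<integral>\<^sup>+x. ennreal (weyl_weight Mp Mm (Complex x e) * (cmod (cauchy_transform \<mu>p (pfrac a Zp) (Complex x e)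
        - cauchy_transform \<mu>m (pfrac b Zm) (Complex x e)))\<^sup>2) \<partial>lborel)
      \<le> (\<integral>\<^sup>+x. ennreal (2 * H0 x + 2 * H1 x + 2 * H2 x) \<partial>lborel)"
    proof (rule nn_integral_mono_AE)
      have "finite ((\<lambda>z. Re z) ` (Zp \<union> Zm))" using fin by simp
      then have "AE x in lborel. x \<notin> (\<lambda>z. Re z) ` (Zp \<union> Zm)"
        by (intro AE_not_in finite_imp_null_set_lborel)
      then show "AE x in lborel. ennreal (weyl_weight Mp Mm (Complex x e) * (cmod (cauchy_transform \<mu>p (pfrac a Zp) (Complex x e)
        - cauchy_transform \<mu>m (pfrac b Zm) (Complex x e)))\<^sup>2) \<le> ennreal (2 * H0 x + 2 * H1 x + 2 * H2 x)"
        using H0A H1A H2A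
      proof eventually_elim
        case (elim x)
        define w where "w = Complex x e"
        have w: "w \<notin> \<real>" "w \<notin> Zp" "w \<notin> Zm" using elim(1) e by (force simp: w_def complex_is_Real_iff)+
        have Imw: "Im w = e" by (simp add: w_def)
        have CF: "cauchy_transform \<mu>p (pfrac a Zp) w = Fp w" "cauchy_transform \<mu>m (pfrac b Zm) w = Fm w"
          using hp(3)[OF w(1,2)] hm(3)[OF w(1,3)] by (simp_all add: Fp_def Fm_def)
        \<comment> \<open>By the formula for the norms of the Weyl solutions the integrand is e
          times the squared norm of the correction.\<close>
        have "weyl_weight Mp Mm w * (cmod (Fp w - Fm w))\<^sup>2 = (cmod (\<alpha> w))\<^sup>2 * (Im (Mp w) + Im (Mm w))"
          by (simp add: weyl_weight_def \<alpha>_def norm_divide power_divide norm_minus_commute)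
        also have "\<dots> = e * ((L2_norm (lborel_on {0<..}) (\<lambda>t. \<alpha> w * pp w t))\<^sup>2 + (L2_norm (lborel_on {..<0}) (\<lambda>t. \<alpha> w * pm w t))\<^sup>2)"
          unfolding L2_norm_cmult hp(4)[OF w(1), symmetric] hm(4)[OF w(1), symmetric] Imw
          by (simp add: power_mult_distrib algebra_simps)
        also have "\<dots> \<le> e * ((2 * (L2_norm (lborel_on {0<..}) (y w))\<^sup>2 + 2 * (L2_norm (lborel_on {0<..}) (G1 w))\<^sup>2) +
           (2 * (L2_norm (lborel_on {..<0}) (u w))\<^sup>2 + 2 * (L2_norm (lborel_on {..<0}) (G2 w))\<^sup>2))"
        proof (intro mult_left_mono add_mono)
          have n1: "L2_norm P (\<lambda>t. -1 * g t) = L2_norm P g" for P g unfolding L2_norm_cmult by simp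
          have "(\<lambda>t. \<alpha> w * pp w t) = (\<lambda>t. y w t + -1 * G1 w t)" by (simp add: y_def)
          then show "(L2_norm (lborel_on {0<..}) (\<lambda>t. \<alpha> w * pp w t))\<^sup>2 \<le>
             2 * (L2_norm (lborel_on {0<..}) (y w))\<^sup>2 + 2 * (L2_norm (lborel_on {0<..}) (G1 w))\<^sup>2"
            using L2_norm_add_sq[OF yL[OF w(1)] L2_cmult[OF G1L[OF w(1)], of "-1"]] by (simp only: n1)
          have "(\<lambda>t. \<alpha> w * pm w t) = (\<lambda>t. u w t + -1 * G2 w t)" by (simp add: u_def)
          then show "(L2_norm (lborel_on {..<0}) (\<lambda>t. \<alpha> w * pm w t))\<^sup>2 \<le>
             2 * (L2_norm (lborel_on {..<0}) (u w))\<^sup>2 + 2 * (L2_norm (lborel_on {..<0}) (G2 w))\<^sup>2"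
            using L2_norm_add_sq[OF uL[OF w(1)] L2_cmult[OF G2L[OF w(1)], of "-1"]] by (simp only: n1)
        qed (use e in simp)
        also have "\<dots> = 2 * (e * (L2_norm lborel (\<lambda>t. if t > 0 then y w t else u w t))\<^sup>2)
           + 2 * (e * (L2_norm (lborel_on {0<..}) (G1 w))\<^sup>2) + 2 * (e * (L2_norm (lborel_on {..<0}) (G2 w))\<^sup>2)"
          unfolding L2_glue(2)[OF yL[OF w(1)] uL[OF w(1)] meas(3,4)] by (simp add: algebra_simps)
        also have "\<dots> \<le> 2 * H0 x + 2 * H1 x + 2 * H2 x"
        proof -
          have "L2_norm (lborel_on {0<..}) (G1 w) = L2_norm \<mu>p (\<lambda>t. pfrac a Zp t / (complex_of_real t - w))"
            unfolding G1_def[abs_def] by (rule hp(2)[OF w(1,2)])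
          moreover have "L2_norm (lborel_on {..<0}) (G2 w) = L2_norm \<mu>m (\<lambda>t. pfrac b Zm t / (complex_of_real t - w))"
            unfolding G2_def[abs_def] by (rule hm(2)[OF w(1,3)])
          ultimately show ?thesis using elim(2-4) unfolding w_def[symmetric]
            by (intro add_mono mult_left_mono) simp_all
        qed
        finally show ?case unfolding w_def[symmetric] CF by (rule ennreal_leI)
      qed
    qed
    also have "\<dots> = (\<integral>\<^sup>+x. 2 * ennreal (H0 x) + 2 * ennreal (H1 x) + 2 * ennreal (H2 x) \<partial>lborel)"
      using H0n H1n H2n by (intro nn_integral_cong) (simp add: ennreal_plus ennreal_mult')
    also have "\<dots> = 2 * (\<integral>\<^sup>+x. ennreal (H0 x) \<partial>lborel) + 2 * (\<integral>\<^sup>+x. ennreal (H1 x) \<partial>lborel) + 2 * (\<integral>\<^sup>+x. ennreal (H2 x) \<partial>lborel)"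
      by (simp add: nn_integral_add nn_integral_cmult)
    also have "\<dots> \<le> 2 * ennreal (K * (Np + Nm)) + 2 * ennreal (2 * pi * Np) + 2 * ennreal (2 * pi * Nm)"
      by (intro add_mono mult_left_mono H0I H1I H2I) auto
    also have "\<dots> = ennreal (2 * (K * (Np + Nm)) + 2 * (2 * pi * Np) + 2 * (2 * pi * Nm))"
    proof -
      have d: "2 * ennreal r = ennreal (2 * r)" for r by (simp add: ennreal_mult')
      show ?thesis unfolding d using K(1) by (simp add: Np_def Nm_def del: ennreal_plus flip: ennreal_plus)
    qed
    also have "\<dots> \<le> ennreal ((4 * K + 16 * pi) * (Np + Nm))"
    proof (rule ennreal_leI)
      have "0 \<le> 2 * (K * (Np + Nm)) + 12 * (pi * (Np + Nm))" using K(1) by (simp add: Np_def Nm_def)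
      then show "2 * (K * (Np + Nm)) + 2 * (2 * pi * Np) + 2 * (2 * pi * Nm) \<le> (4 * K + 16 * pi) * (Np + Nm)"
        by (simp add: algebra_simps)
    qed
    finally show "(\<integral>\<^sup>+x. ennreal (weyl_weight Mp Mm (Complex x e) * (cmod (cauchy_transform \<mu>p (pfrac a Zp) (Complex x e)
        - cauchy_transform \<mu>m (pfrac b Zm) (Complex x e)))\<^sup>2) \<partial>lborel)
     \<le> ennreal ((4 * K + 16 * pi) * ((L2_norm \<mu>p (pfrac a Zp))\<^sup>2 + (L2_norm \<mu>m (pfrac b Zm))\<^sup>2))"
      by (simp add: Np_def Nm_def)
  qed
qed

section \<open>Partial fractions in \<open>L\<^sup>2\<close>\<close>

lemma dominated_class_induct:
  fixes C :: "(real \<Rightarrow> complex) set" and Q :: "(real \<Rightarrow> real) \<Rightarrow> bool"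
  assumes ind: "\<And>a b. a < b \<Longrightarrow> (\<lambda>x. indicator {a<..<b} x) \<in> C"
    and add: "\<And>f g. f \<in> C \<Longrightarrow> g \<in> C \<Longrightarrow> (\<lambda>x. f x + g x) \<in> C"
    and cmult: "\<And>f a. f \<in> C \<Longrightarrow> (\<lambda>x. a * f x) \<in> C"
    and lim: "\<And>f g h. (\<And>n. f n \<in> C) \<Longrightarrow> (\<And>x. (\<lambda>n. f n x) \<longlonglongrightarrow> g x) \<Longrightarrow> h \<in> borel_measurable borel \<Longrightarrow>
        Q h \<Longrightarrow> (\<And>n x. cmod (f n x) \<le> h x) \<Longrightarrow> g \<in> C"
    and bdd: "\<And>B n. B \<ge> 0 \<Longrightarrow> Q (\<lambda>x. B * indicator {- real n..real n} x)"
    and g: "g \<in> borel_measurable borel" and Qg: "Q (\<lambda>x. 2 * cmod (g x))"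
  shows "g \<in> C"
proof -
  have zero: "(\<lambda>x. 0) \<in> C" using cmult[OF ind[of 0 1], of 0] by simp
  have sum: "(\<lambda>x. \<Sum>i\<in>Z. f i x) \<in> C" if "finite Z" "\<And>i. i \<in> Z \<Longrightarrow> f i \<in> C" for Z :: "'i set" and f
    using that by (induction Z rule: finite_induct) (auto intro: zero add)
  have iv: "(\<lambda>x. indicator {a<..<b} x) \<in> C" for a b :: real
    using ind[of a b] zero by (cases "a < b") auto
  \<comment> \<open>Intersecting with a bounded interval keeps the majorants admissible and makes
    complements available as differences from that interval.\<close>
  have sets: "(\<lambda>x. indicator (A \<inter> {- real n<..<real n}) x) \<in> C" if "A \<in> sets borel" for A :: "real set" and n :: nat
  proof -
    let ?G = "range (\<lambda>(a, b). box a b :: real set)"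
    have "sets borel = sigma_sets UNIV ?G" by (subst borel_eq_box) simp
    then have A: "A \<in> sigma_sets UNIV ?G" using that by simp
    have IS: "Int_stable ?G"
    proof (intro Int_stableI)
      fix a b assume "a \<in> ?G" "b \<in> ?G"
      then obtain p q r s where "a = {p<..<q}" "b = {r<..<s}" by (auto simp: box_real)
      then have "a \<inter> b = {max p r<..<min q s}" by auto
      then show "a \<inter> b \<in> ?G" by (auto simp: box_real intro!: image_eqI[of _ _ "(max p r, min q s)"])
    qed
    have "?G \<subseteq> Pow UNIV" by simp
    from IS this A show ?thesis
    proof (induction A rule: sigma_sets_induct_disjoint)
      case (basic A)
      then obtain p q where "A = {p<..<q}" by (auto simp: box_real)
      then have "A \<inter> {- real n<..<real n} = {max p (- real n)<..<min q (real n)}" by auto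
      then show ?case using iv by simp
    next
      case empty
      then show ?case using zero by simp
    next
      case (compl A)
      have "(\<lambda>x. indicator ((UNIV - A) \<inter> {- real n<..<real n}) x :: complex) =
          (\<lambda>x. indicator {- real n<..<real n} x + - 1 * indicator (A \<inter> {- real n<..<real n}) x)"
        by (auto split: split_indicator)
      then show ?case using add[OF iv cmult[OF compl(2), of "-1"]] by simp
    next
      case (union A)
      show ?case
      proof (rule lim[where f = "\<lambda>k x. \<Sum>i<k. indicator (A i \<inter> {- real n<..<real n}) x"])
        show "(\<lambda>x. \<Sum>i<k. indicator (A i \<inter> {- real n<..<real n}) x :: complex) \<in> C" for k
          using union(3) by (intro sum) auto
        have dis: "(\<Sum>i<k. indicator (A i \<inter> {- real n<..<real n}) x :: complex) = indicator ((\<Union>i<k. A i) \<inter> {- real n<..<real n}) x" for k x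
        proof (induction k)
          case (Suc k)
          have "\<not> (x \<in> A k \<and> x \<in> (\<Union>i<k. A i))"
          proof
            assume x: "x \<in> A k \<and> x \<in> (\<Union>i<k. A i)"
            then obtain i where i: "i < k" "x \<in> A i" by blast
            then have "A i \<inter> A k = {}" using union(1) by (simp add: disjoint_family_on_def)
            then show False using x i by blast
          qed
          moreover have "(\<Union>i<Suc k. A i) = (\<Union>i<k. A i) \<union> A k" by (auto simp: less_Suc_eq)
          ultimately show ?case unfolding sum.lessThan_Suc Suc by (simp add: indicator_def)
        qed simp
        show "(\<lambda>k. \<Sum>i<k. indicator (A i \<inter> {- real n<..<real n}) x :: complex) \<longlonglongrightarrow> indicator (\<Union> (range A) \<inter> {- real n<..<real n}) x" for x
          unfolding dis
        proof (rule tendsto_eventually)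
          show "\<forall>\<^sub>F k in sequentially. (indicator ((\<Union>i<k. A i) \<inter> {- real n<..<real n}) x :: complex) = indicator (\<Union> (range A) \<inter> {- real n<..<real n}) x"
          proof (cases "x \<in> \<Union> (range A)")
            case True
            then obtain j where j: "x \<in> A j" by auto
            show ?thesis using eventually_gt_at_top[of j]
              by eventually_elim (use j in \<open>auto split: split_indicator\<close>)
          qed (auto split: split_indicator)
        qed
        show "Q (\<lambda>x. 1 * indicator {- real n..real n} x)" by (rule bdd) simp
        show "cmod (\<Sum>i<k. indicator (A i \<inter> {- real n<..<real n}) x) \<le> 1 * indicator {- real n..real n} x" for k x
          unfolding dis by (auto split: split_indicator)
      qed simp
    qed
  qed
  \<comment> \<open>The approximating simple functions are bounded by 2 |g|, whence the factor 2 in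
    the hypothesis on the majorant.\<close>
  obtain F where F: "\<And>i. simple_function borel (F i)" "\<And>x. (\<lambda>i. F i x) \<longlonglongrightarrow> g x" "\<And>i x. cmod (F i x) \<le> 2 * cmod (g x)"
    using borel_measurable_implies_sequence_metric[OF g, of 0] by (auto simp: dist_norm)
  show ?thesis
  proof (rule lim[where f = "\<lambda>k x. indicator {- real k<..<real k} x * F k x" and h = "\<lambda>x. 2 * cmod (g x)"])
    fix k
    have fin: "finite (range (F k))" using F(1)[of k] by (simp add: simple_function_def)
    have "indicator {- real k<..<real k} x * F k x = (\<Sum>y\<in>range (F k). y * indicator ((F k -` {y}) \<inter> {- real k<..<real k}) x)" for x
    proof -
      have "(\<Sum>y\<in>range (F k). y * indicator ((F k -` {y}) \<inter> {- real k<..<real k}) x)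
         = (\<Sum>y\<in>range (F k). if y = F k x then y * indicator {- real k<..<real k} x else 0)"
        by (intro sum.cong) (auto split: split_indicator)
      then show ?thesis using fin by (simp add: mult.commute)
    qed
    moreover have "(\<lambda>x. \<Sum>y\<in>range (F k). y * indicator ((F k -` {y}) \<inter> {- real k<..<real k}) x) \<in> C"
    proof (intro sum fin cmult sets)
      fix y
      show "F k -` {y} \<in> sets borel"
        using measurable_sets[OF borel_measurable_simple_function[OF F(1)[of k]], of "{y}"] by simp
    qed
    ultimately show "(\<lambda>x. indicator {- real k<..<real k} x * F k x) \<in> C" by simp
  next
    fix x
    have "(\<lambda>k. indicator {- real k<..<real k} x :: complex) \<longlonglongrightarrow> 1"
    proof (rule tendsto_eventually)
      obtain j where j: "\<bar>x\<bar> < real j" using reals_Archimedean2 by blast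
      show "\<forall>\<^sub>F k in sequentially. (indicator {- real k<..<real k} x :: complex) = 1"
        using eventually_ge_at_top[of j] by eventually_elim (use j in \<open>auto split: split_indicator\<close>)
    qed
    from tendsto_mult[OF this F(2)[of x]]
    show "(\<lambda>k. indicator {- real k<..<real k} x * F k x) \<longlonglongrightarrow> g x" by simp
  next
    show "cmod (indicator {- real k<..<real k} x * F k x) \<le> 2 * cmod (g x)" for k x
      using F(3)[of k x] by (auto split: split_indicator)
  qed (use g Qg in auto)
qed

lemma pfrac_add:
  assumes "finite Z" "finite Y"
  shows "pfrac a Z t + pfrac b Y t = pfrac (\<lambda>\<zeta>. (if \<zeta> \<in> Z then a \<zeta> else 0) + (if \<zeta> \<in> Y then b \<zeta> else 0)) (Z \<union> Y) t"
proof -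
  have 1: "(\<Sum>\<zeta>\<in>Z \<union> Y. (if \<zeta> \<in> Z then a \<zeta> else 0) * (1 / (complex_of_real t - \<zeta>))) = pfrac a Z t"
    unfolding pfrac_def using assms by (intro sum.mono_neutral_cong_right) auto
  have 2: "(\<Sum>\<zeta>\<in>Z \<union> Y. (if \<zeta> \<in> Y then b \<zeta> else 0) * (1 / (complex_of_real t - \<zeta>))) = pfrac b Y t"
    unfolding pfrac_def using assms by (intro sum.mono_neutral_cong_right) auto
  show ?thesis unfolding 1[symmetric] 2[symmetric] by (simp only: pfrac_def distrib_right sum.distrib)
qed

lemma pfrac_cmult: "c * pfrac a Z t = pfrac (\<lambda>\<zeta>. c * a \<zeta>) Z t"
  by (simp add: pfrac_def sum_distrib_left)

text \<open>The closure in L^2(\<mu>) of the rational functions that vanish at infinity and have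
  only simple nonreal poles. Squared norms fit the estimate \<open>L2_norm_add_sq\<close>.\<close>

definition cauchy_closure :: "real measure \<Rightarrow> (real \<Rightarrow> complex) set" where
  "cauchy_closure \<mu> = {g \<in> L2 \<mu>. \<forall>e>0. \<exists>a Z. finite Z \<and> Z \<inter> \<real> = {} \<and>
     (L2_norm \<mu> (\<lambda>t. g t - pfrac a Z t))\<^sup>2 < e}"

locale cauchy_measure =
  fixes \<mu> :: "real measure"
  assumes sets: "sets \<mu> = sets borel" and int: "integrable \<mu> (\<lambda>t. 1 / (1 + \<bar>t\<bar>))"
begin

lemma measurable_iff: "f \<in> borel_measurable \<mu> \<longleftrightarrow> f \<in> borel_measurable borel"
  by (rule measurable_cong_sets[OF sets refl, THEN eqset_imp_iff])

lemma cauchy_closureI: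
  assumes g: "g \<in> L2 \<mu>" and ap: "\<And>e. e > 0 \<Longrightarrow> \<exists>f\<in>cauchy_closure \<mu>. (L2_norm \<mu> (\<lambda>t. g t - f t))\<^sup>2 < e"
  shows "g \<in> cauchy_closure \<mu>"
  unfolding cauchy_closure_def
proof (intro CollectI conjI allI impI g)
  fix e :: real assume "e > 0"
  \<comment> \<open>The squared triangle inequality has factors 2, so two errors below e / 4 add up
    to less than e.\<close>
  then obtain f where f: "f \<in> cauchy_closure \<mu>" "(L2_norm \<mu> (\<lambda>t. g t - f t))\<^sup>2 < e / 4" using ap[of "e / 4"] by auto
  then obtain a Z where Z: "finite Z" "Z \<inter> \<real> = {}" "(L2_norm \<mu> (\<lambda>t. f t - pfrac a Z t))\<^sup>2 < e / 4"
    using \<open>e > 0\<close> by (auto simp: cauchy_closure_def dest!: spec[of _ "e / 4"])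
  have fL: "f \<in> L2 \<mu>" using f by (simp add: cauchy_closure_def)
  have "(L2_norm \<mu> (\<lambda>t. (g t - f t) + (f t - pfrac a Z t)))\<^sup>2 \<le>
      2 * (L2_norm \<mu> (\<lambda>t. g t - f t))\<^sup>2 + 2 * (L2_norm \<mu> (\<lambda>t. f t - pfrac a Z t))\<^sup>2"
    by (intro L2_norm_add_sq L2_diff g fL pfrac_L2 sets int Z)
  then show "\<exists>a Z. finite Z \<and> Z \<inter> \<real> = {} \<and> (L2_norm \<mu> (\<lambda>t. g t - pfrac a Z t))\<^sup>2 < e"
    using f(2) Z by (intro exI[of _ a] exI[of _ Z]) simp
qed

lemma cauchy_closure_pfrac: "finite Z \<Longrightarrow> Z \<inter> \<real> = {} \<Longrightarrow> pfrac a Z \<in> cauchy_closure \<mu>"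
  unfolding cauchy_closure_def using pfrac_L2[OF sets int] by (auto simp: L2_norm_def intro!: exI[of _ a] exI[of _ Z])

lemma cauchy_closure_add:
  assumes f: "f \<in> cauchy_closure \<mu>" and g: "g \<in> cauchy_closure \<mu>"
  shows "(\<lambda>t. f t + g t) \<in> cauchy_closure \<mu>"
proof -
  have fL: "f \<in> L2 \<mu>" and gL: "g \<in> L2 \<mu>" using f g by (auto simp: cauchy_closure_def)
  show ?thesis
  proof (rule cauchy_closureI[OF L2_add[OF fL gL]])
    fix e :: real assume "e > 0"
    then obtain a Z where Z: "finite Z" "Z \<inter> \<real> = {}" "(L2_norm \<mu> (\<lambda>t. f t - pfrac a Z t))\<^sup>2 < e / 4"
      using f by (auto simp: cauchy_closure_def dest!: spec[of _ "e / 4"])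
    obtain b Y where Y: "finite Y" "Y \<inter> \<real> = {}" "(L2_norm \<mu> (\<lambda>t. g t - pfrac b Y t))\<^sup>2 < e / 4"
      using g \<open>e > 0\<close> by (auto simp: cauchy_closure_def dest!: spec[of _ "e / 4"])
    have "(L2_norm \<mu> (\<lambda>t. (f t - pfrac a Z t) + (g t - pfrac b Y t)))\<^sup>2 \<le>
        2 * (L2_norm \<mu> (\<lambda>t. f t - pfrac a Z t))\<^sup>2 + 2 * (L2_norm \<mu> (\<lambda>t. g t - pfrac b Y t))\<^sup>2"
      by (intro L2_norm_add_sq L2_diff gL fL pfrac_L2 sets int Z Y)
    also have "\<dots> < e" using Z Y by simp
    also have "(\<lambda>t. (f t - pfrac a Z t) + (g t - pfrac b Y t)) = (\<lambda>t. (f t + g t) - (pfrac a Z t + pfrac b Y t))" by auto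
    finally show "\<exists>h\<in>cauchy_closure \<mu>. (L2_norm \<mu> (\<lambda>t. (f t + g t) - h t))\<^sup>2 < e"
      using Z(1,2) Y(1,2) by (intro bexI[of _ "\<lambda>t. pfrac a Z t + pfrac b Y t"])
         (auto simp: pfrac_add intro!: cauchy_closure_pfrac)
  qed
qed

lemma cauchy_closure_cmult:
  assumes f: "f \<in> cauchy_closure \<mu>" shows "(\<lambda>t. c * f t) \<in> cauchy_closure \<mu>"
proof -
  have fL: "f \<in> L2 \<mu>" using f by (auto simp: cauchy_closure_def)
  show ?thesis
  proof (rule cauchy_closureI[OF L2_cmult[OF fL]])
    fix e :: real assume e: "e > 0"
    define d where "d = e / ((cmod c)\<^sup>2 + 1)"
    have "(cmod c)\<^sup>2 + 1 > 0" by (simp add: add_nonneg_pos)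
    then have d: "d > 0" "(cmod c)\<^sup>2 * d < e" using e by (auto simp: d_def field_simps)
    then obtain a Z where Z: "finite Z" "Z \<inter> \<real> = {}" "(L2_norm \<mu> (\<lambda>t. f t - pfrac a Z t))\<^sup>2 < d"
      using f by (auto simp: cauchy_closure_def)
    have "(L2_norm \<mu> (\<lambda>t. c * (f t - pfrac a Z t)))\<^sup>2 = (cmod c)\<^sup>2 * (L2_norm \<mu> (\<lambda>t. f t - pfrac a Z t))\<^sup>2"
      unfolding L2_norm_cmult by (rule power_mult_distrib)
    also have "\<dots> \<le> (cmod c)\<^sup>2 * d" using Z by (intro mult_left_mono) auto
    also have "\<dots> < e" by (rule d)
    finally show "\<exists>h\<in>cauchy_closure \<mu>. (L2_norm \<mu> (\<lambda>t. c * f t - h t))\<^sup>2 < e"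
      using Z by (intro bexI[of _ "\<lambda>t. c * pfrac a Z t"])
         (auto simp: right_diff_distrib pfrac_cmult intro!: cauchy_closure_pfrac)
  qed
qed

lemma cauchy_closure_sum:
  assumes "finite Y" "\<And>w. w \<in> Y \<Longrightarrow> F w \<in> cauchy_closure \<mu>"
  shows "(\<lambda>t. \<Sum>w\<in>Y. F w t) \<in> cauchy_closure \<mu>"
  using assms
proof (induction Y rule: finite_induct)
  case empty
  then show ?case using cauchy_closure_pfrac[of "{}"] by (simp add: pfrac_def[abs_def])
qed (simp add: cauchy_closure_add)

text \<open>Dominated convergence for the squares turns a pointwise limit below a square integrable
  majorant into a limit in L^2(\<mu>).\<close>

lemma cauchy_closure_dominated:
  assumes f: "\<And>n. f n \<in> cauchy_closure \<mu>" and lim: "\<And>t. (\<lambda>n. f n t) \<longlonglongrightarrow> g t"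
    and h: "h \<in> borel_measurable borel" "integrable \<mu> (\<lambda>t. (h t)\<^sup>2)" and le: "\<And>n t. cmod (f n t) \<le> h t"
  shows "g \<in> cauchy_closure \<mu>"
proof -
  have fL: "f n \<in> L2 \<mu>" for n using f[of n] by (auto simp: cauchy_closure_def)
  have gm[measurable]: "g \<in> borel_measurable \<mu>"
    using fL L2_measurable by (intro borel_measurable_LIMSEQ_metric[OF _ lim]) auto
  have gle: "cmod (g t) \<le> h t" for t
    by (rule tendsto_upperbound[OF tendsto_norm[OF lim]]) (use le in auto)
  have h0: "h t \<ge> 0" for t using gle[of t] norm_ge_zero order_trans by blast
  have gL: "g \<in> L2 \<mu>"
  proof -
    have "integrable \<mu> (\<lambda>t. (cmod (g t))\<^sup>2)"
      by (rule Bochner_Integration.integrable_bound[OF h(2)]) (use gle in \<open>auto intro!: power_mono\<close>)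
    then show ?thesis by (simp add: L2_def)
  qed
  have "(\<lambda>n. LINT t|\<mu>. (cmod (g t - f n t))\<^sup>2) \<longlonglongrightarrow> (LINT t|\<mu>. 0)"
  proof (rule integral_dominated_convergence[where w = "\<lambda>t. 4 * (h t)\<^sup>2"])
    show "(\<lambda>t. (cmod (g t - f n t))\<^sup>2) \<in> borel_measurable \<mu>" for n using L2_measurable[OF fL[of n]] by measurable
    show "AE t in \<mu>. (\<lambda>n. (cmod (g t - f n t))\<^sup>2) \<longlonglongrightarrow> 0"
    proof (intro AE_I2)
      fix t
      have "(\<lambda>n. (cmod (g t - f n t))\<^sup>2) \<longlonglongrightarrow> (cmod (g t - g t))\<^sup>2" by (intro tendsto_intros lim)
      then show "(\<lambda>n. (cmod (g t - f n t))\<^sup>2) \<longlonglongrightarrow> 0" by simp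
    qed
    show "AE t in \<mu>. norm ((cmod (g t - f n t))\<^sup>2) \<le> 4 * (h t)\<^sup>2" for n
    proof (intro AE_I2)
      fix t
      have "cmod (g t - f n t) \<le> 2 * h t" using norm_triangle_ineq4[of "g t" "f n t"] gle[of t] le[of n t] by linarith
      then have "(cmod (g t - f n t))\<^sup>2 \<le> (2 * h t)\<^sup>2" by (intro power_mono) auto
      then show "norm ((cmod (g t - f n t))\<^sup>2) \<le> 4 * (h t)\<^sup>2" by (simp add: power_mult_distrib)
    qed
  qed (use h in auto)
  then have lim0: "(\<lambda>n. (L2_norm \<mu> (\<lambda>t. g t - f n t))\<^sup>2) \<longlonglongrightarrow> 0" by (simp add: L2_norm_sq)
  show ?thesis
  proof (rule cauchy_closureI[OF gL])
    fix e :: real assume "e > 0"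
    from order_tendstoD(2)[OF lim0 this] obtain n where "(L2_norm \<mu> (\<lambda>t. g t - f n t))\<^sup>2 < e"
      by (auto simp: eventually_sequentially)
    then show "\<exists>f\<in>cauchy_closure \<mu>. (L2_norm \<mu> (\<lambda>t. g t - f t))\<^sup>2 < e" using f by blast
  qed
qed

lemma cauchy_kernel_closure: "z \<notin> \<real> \<Longrightarrow> (\<lambda>t. 1 / (complex_of_real t - z)) \<in> cauchy_closure \<mu>"
  using cauchy_closure_pfrac[of "{z}" "\<lambda>_. 1"] by (auto simp: pfrac_def[abs_def])

text \<open>A double pole is a limit of products of two simple ones, and such a product is a
  combination of simple kernels as long as the poles are distinct. The approximating poles keep the
  imaginary part of z, so one majorant serves for all of them.\<close>

lemma cauchy_kernel_square_closure:
  assumes z: "z \<notin> \<real>" shows "(\<lambda>t. 1 / (complex_of_real t - z) * (1 / (complex_of_real t - z))) \<in> cauchy_closure \<mu>"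
proof -
  have Im: "\<bar>Im z\<bar> > 0" using z by (simp add: complex_is_Real_iff)
  define v where "v n = z + of_real (1 / real (Suc n))" for n
  have v: "v n \<notin> \<real>" "Im (v n) = Im z" "v n \<noteq> z" for n
  proof -
    show i: "Im (v n) = Im z" by (simp add: v_def)
    then show "v n \<notin> \<real>" using Im by (simp add: complex_is_Real_iff)
    have "Re (v n) \<noteq> Re z" by (simp add: v_def)
    then show "v n \<noteq> z" by auto
  qed
  have ne: "complex_of_real t - z \<noteq> 0" if "z \<notin> \<real>" for t z using that by auto
  show ?thesis
  proof (rule cauchy_closure_dominated[where f = "\<lambda>n t. 1 / (complex_of_real t - z) * (1 / (complex_of_real t - v n))"
        and h = "\<lambda>t. cmod (of_real (1 / \<bar>Im z\<bar>) * (1 / (complex_of_real t - z)))"])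
    fix n
    have "(\<lambda>t. 1 / (complex_of_real t - z) * (1 / (complex_of_real t - v n))) =
       (\<lambda>t. 1 / (z - v n) * (1 / (complex_of_real t - z)) + - (1 / (z - v n)) * (1 / (complex_of_real t - v n)))"
    proof
      fix t
      show "1 / (complex_of_real t - z) * (1 / (complex_of_real t - v n)) =
         1 / (z - v n) * (1 / (complex_of_real t - z)) + - (1 / (z - v n)) * (1 / (complex_of_real t - v n))"
        using v(3)[of n] ne[OF z, of t] ne[OF v(1), of t n] by (simp add: divide_simps)
    qed
    then show "(\<lambda>t. 1 / (complex_of_real t - z) * (1 / (complex_of_real t - v n))) \<in> cauchy_closure \<mu>"
      using z v(1) by (simp only:) (intro cauchy_closure_add cauchy_closure_cmult cauchy_kernel_closure)
  next
    fix t
    have "v \<longlonglongrightarrow> z + of_real 0" unfolding v_def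
      by (intro tendsto_intros LIMSEQ_Suc lim_1_over_n)
    then show "(\<lambda>n. 1 / (complex_of_real t - z) * (1 / (complex_of_real t - v n))) \<longlonglongrightarrow> 1 / (complex_of_real t - z) * (1 / (complex_of_real t - z))"
      using ne[OF z, of t] by (intro tendsto_intros) auto
  next
    show "integrable \<mu> (\<lambda>t. (cmod (of_real (1 / \<bar>Im z\<bar>) * (1 / (complex_of_real t - z))))\<^sup>2)"
      by (intro L2_integrable_sq L2_cmult integrable_diff_inverse(2) sets int z)
  next
    fix n t
    have "\<bar>Im z\<bar> \<le> cmod (complex_of_real t - v n)"
      using abs_Im_le_cmod[of "complex_of_real t - v n"] v(2)[of n] by simp
    then have "1 / cmod (complex_of_real t - v n) \<le> 1 / \<bar>Im z\<bar>"
      using Im by (intro divide_left_mono mult_pos_pos) linarith+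
    then have "1 / cmod (complex_of_real t - z) * (1 / cmod (complex_of_real t - v n)) \<le> 1 / cmod (complex_of_real t - z) * (1 / \<bar>Im z\<bar>)"
      by (intro mult_left_mono) auto
    then show "cmod (1 / (complex_of_real t - z) * (1 / (complex_of_real t - v n))) \<le> cmod (of_real (1 / \<bar>Im z\<bar>) * (1 / (complex_of_real t - z)))"
      unfolding norm_mult norm_of_real norm_divide by (simp add: mult.commute)
  qed measurable
qed

text \<open>Multiplication by the kernel is bounded on L^2(\<mu>) with norm at most 1 / |Im z|, and
  it maps partial fractions into the closure; coinciding poles are the double pole case.\<close>

lemma cauchy_closure_mult_kernel:
  assumes g: "g \<in> cauchy_closure \<mu>" and z: "z \<notin> \<real>"
  shows "(\<lambda>t. 1 / (complex_of_real t - z) * g t) \<in> cauchy_closure \<mu>"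
proof -
  have Im: "\<bar>Im z\<bar> > 0" using z by (simp add: complex_is_Real_iff)
  have ne: "complex_of_real t - z \<noteq> 0" if "z \<notin> \<real>" for t z using that by auto
  have kle: "cmod (1 / (complex_of_real t - z)) \<le> 1 / \<bar>Im z\<bar>" for t
  proof -
    have "\<bar>Im z\<bar> \<le> cmod (complex_of_real t - z)" using abs_Im_le_cmod[of "complex_of_real t - z"] by simp
    then show ?thesis unfolding norm_divide using Im by (simp add: frac_le)
  qed
  have gL: "g \<in> L2 \<mu>" using g by (simp add: cauchy_closure_def)
  have mL: "(\<lambda>t. 1 / (complex_of_real t - z) * f t) \<in> L2 \<mu>" if fL: "f \<in> L2 \<mu>" for f
  proof (rule L2_bound[OF L2_cmult[OF fL, of "of_real (1 / \<bar>Im z\<bar>)"]])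
    show "(\<lambda>t. 1 / (complex_of_real t - z) * f t) \<in> borel_measurable \<mu>"
      using L2_measurable[OF fL] unfolding measurable_iff by measurable
    show "cmod (1 / (complex_of_real t - z) * f t) \<le> cmod (of_real (1 / \<bar>Im z\<bar>) * f t)" for t
      using kle[of t] unfolding norm_mult norm_of_real by (intro mult_right_mono) auto
  qed
  have mle: "(L2_norm \<mu> (\<lambda>t. 1 / (complex_of_real t - z) * f t))\<^sup>2 \<le> (1 / \<bar>Im z\<bar>)\<^sup>2 * (L2_norm \<mu> f)\<^sup>2" if fL: "f \<in> L2 \<mu>" for f
  proof -
    have "(LINT t|\<mu>. (cmod (1 / (complex_of_real t - z) * f t))\<^sup>2) \<le> (LINT t|\<mu>. (1 / \<bar>Im z\<bar>)\<^sup>2 * (cmod (f t))\<^sup>2)"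
    proof (intro integral_mono L2_integrable_sq mL fL integrable_mult_right)
      fix t
      show "(cmod (1 / (complex_of_real t - z) * f t))\<^sup>2 \<le> (1 / \<bar>Im z\<bar>)\<^sup>2 * (cmod (f t))\<^sup>2"
        using kle[of t] unfolding norm_mult power_mult_distrib by (intro mult_right_mono power_mono) auto
    qed
    then show ?thesis by (simp add: L2_norm_sq)
  qed
  have span: "(\<lambda>t. 1 / (complex_of_real t - z) * pfrac a Z t) \<in> cauchy_closure \<mu>" if Z: "finite Z" "Z \<inter> \<real> = {}" for a Z
  proof -
    have one: "(\<lambda>t. a w * (1 / (complex_of_real t - z) * (1 / (complex_of_real t - w)))) \<in> cauchy_closure \<mu>" if "w \<in> Z" for w
    proof (rule cauchy_closure_cmult, cases "w = z")
      case True
      then show "(\<lambda>t. 1 / (complex_of_real t - z) * (1 / (complex_of_real t - w))) \<in> cauchy_closure \<mu>"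
        using cauchy_kernel_square_closure[OF z] by simp
    next
      case False
      have w: "w \<notin> \<real>" using that Z by auto
      have "(\<lambda>t. 1 / (complex_of_real t - z) * (1 / (complex_of_real t - w))) =
       (\<lambda>t. 1 / (z - w) * (1 / (complex_of_real t - z)) + - (1 / (z - w)) * (1 / (complex_of_real t - w)))"
      proof
        fix t
        show "1 / (complex_of_real t - z) * (1 / (complex_of_real t - w)) =
           1 / (z - w) * (1 / (complex_of_real t - z)) + - (1 / (z - w)) * (1 / (complex_of_real t - w))"
          using False ne[OF z, of t] ne[OF w, of t] by (simp add: divide_simps)
      qed
      then show "(\<lambda>t. 1 / (complex_of_real t - z) * (1 / (complex_of_real t - w))) \<in> cauchy_closure \<mu>"
        using z w by (simp only:) (intro cauchy_closure_add cauchy_closure_cmult cauchy_kernel_closure)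
    qed
    from cauchy_closure_sum[OF Z(1) one] show ?thesis
      by (simp only: pfrac_def sum_distrib_left mult.left_commute)
  qed
  show ?thesis
  proof (rule cauchy_closureI[OF mL[OF gL]])
    fix e :: real assume e: "e > 0"
    define d where "d = e * \<bar>Im z\<bar>\<^sup>2"
    have "d > 0" using e Im by (simp add: d_def)
    then obtain a Z where Z: "finite Z" "Z \<inter> \<real> = {}" "(L2_norm \<mu> (\<lambda>t. g t - pfrac a Z t))\<^sup>2 < d"
      using g by (auto simp: cauchy_closure_def)
    have "(L2_norm \<mu> (\<lambda>t. 1 / (complex_of_real t - z) * (g t - pfrac a Z t)))\<^sup>2 \<le> (1 / \<bar>Im z\<bar>)\<^sup>2 * (L2_norm \<mu> (\<lambda>t. g t - pfrac a Z t))\<^sup>2"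
      by (intro mle L2_diff gL pfrac_L2 sets int Z)
    also have "\<dots> < (1 / \<bar>Im z\<bar>)\<^sup>2 * d" using Z Im by (intro mult_strict_left_mono) auto
    also have "\<dots> = e" using Im by (simp add: d_def power_divide)
    finally show "\<exists>h\<in>cauchy_closure \<mu>. (L2_norm \<mu> (\<lambda>t. 1 / (complex_of_real t - z) * g t - h t))\<^sup>2 < e"
      using span[OF Z(1,2), of a] by (intro bexI[of _ "\<lambda>t. 1 / (complex_of_real t - z) * pfrac a Z t"])
         (auto simp: right_diff_distrib)
  qed
qed

lemma cauchy_closure_prod:
  assumes "A \<noteq> {#}" "\<And>x. x \<in># A \<Longrightarrow> x \<notin> \<real>"
  shows "(\<lambda>t. 1 / (\<Prod>x\<in>#A. complex_of_real t - x)) \<in> cauchy_closure \<mu>"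
  using assms
proof (induction A)
  case (add z A)
  show ?case
  proof (cases "A = {#}")
    case True
    then show ?thesis using cauchy_kernel_closure[of z] add.prems by simp
  next
    case False
    then show ?thesis using cauchy_closure_mult_kernel[OF add.IH, of z] add.prems by simp
  qed
qed simp

text \<open>The denominator is a polynomial without real zeros, so over the complex numbers the
  function is a constant times a product of kernels.\<close>

lemma cauchy_closure_butterworth:
  assumes r: "r > 0"
  shows "(\<lambda>t. of_real (1 / (1 + ((t - c) / r) ^ (2 * Suc n)))) \<in> cauchy_closure \<mu>"
proof -
  define l where "l = [:- of_real (c / r), complex_of_real (1 / r):]"
  define P where "P = 1 + l ^ (2 * Suc n)"
  have degl: "degree l = 1" using r by (simp add: l_def)
  then have degln: "degree (l ^ (2 * Suc n)) = 2 * Suc n" by (subst degree_power_eq) auto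
  then have deg: "degree P = 2 * Suc n" unfolding P_def by (subst degree_add_eq_right) auto
  then have P0: "P \<noteq> 0" by auto
  obtain A where A: "size A = degree P" "P = smult (lead_coeff P) (\<Prod>x\<in>#A. [:-x, 1:])"
    using alg_closed_imp_factorization[OF P0] by blast
  have pv: "poly P (of_real t) = of_real (1 + ((t - c) / r) ^ (2 * Suc n))" for t
  proof -
    have "poly l (of_real t) = of_real ((t - c) / r)" by (simp add: l_def diff_divide_distrib)
    then show ?thesis by (simp only: P_def poly_add poly_1 poly_power of_real_add of_real_power of_real_1)
  qed
  have pos: "1 + ((t - c) / r) ^ (2 * Suc n) > 0" for t
    using zero_le_even_power[of "2 * Suc n" "(t - c) / r"] by simp
  have pp: "poly (\<Prod>x\<in>#A. [:-x, 1:]) z = (\<Prod>x\<in>#A. z - x)" for z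
    by (induction A) (auto simp: algebra_simps)
  have pA: "poly P z = lead_coeff P * (\<Prod>x\<in>#A. z - x)" for z
    by (subst A(2)) (simp only: poly_smult pp)
  have nr: "x \<notin> \<real>" if "x \<in># A" for x
  proof
    assume "x \<in> \<real>"
    then obtain t where t: "x = of_real t" by (auto elim: Reals_cases)
    have "(\<Prod>y\<in>#A. x - y) = 0" using that by (auto simp: prod_mset_zero_iff)
    then have "poly P x = 0" by (simp add: pA)
    then show False using pv[of t] pos[of t] unfolding t by (simp only: of_real_eq_0_iff) 
  qed
  have "A \<noteq> {#}" using A(1) deg by auto
  then have "(\<lambda>t. 1 / lead_coeff P * (1 / (\<Prod>x\<in>#A. complex_of_real t - x))) \<in> cauchy_closure \<mu>"
    by (intro cauchy_closure_cmult cauchy_closure_prod nr)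
  moreover have "1 / lead_coeff P * (1 / (\<Prod>x\<in>#A. complex_of_real t - x)) = of_real (1 / (1 + ((t - c) / r) ^ (2 * Suc n)))" for t
    unfolding of_real_divide of_real_1 pv[symmetric] pA by simp
  ultimately show ?thesis by simp
qed

lemma integrable_bounded_support: "integrable \<mu> (\<lambda>t. (B * indicator {- real n..real n} t :: real)\<^sup>2)"
proof (rule Bochner_Integration.integrable_bound[OF integrable_mult_right[OF int, of "B\<^sup>2 * (1 + real n)"]])
  show "(\<lambda>t. (B * indicator {- real n..real n} t)\<^sup>2) \<in> borel_measurable \<mu>" unfolding measurable_iff by measurable
  show "AE t in \<mu>. norm ((B * indicator {- real n..real n} t)\<^sup>2) \<le> norm (B\<^sup>2 * (1 + real n) * (1 / (1 + \<bar>t\<bar>)))"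
  proof (intro AE_I2)
    fix t
    show "norm ((B * indicator {- real n..real n} t)\<^sup>2) \<le> norm (B\<^sup>2 * (1 + real n) * (1 / (1 + \<bar>t\<bar>)))"
    proof (cases "t \<in> {- real n..real n}")
      case True
      then have "1 \<le> (1 + real n) * (1 / (1 + \<bar>t\<bar>))" by (auto simp: field_simps)
      from mult_left_mono[OF this, of "B\<^sup>2"] True show ?thesis by (simp add: mult.assoc)
    qed simp
  qed
qed

text \<open>
  Butterworth functions with centre \<open>c\<close> converge to the indicator of \<open>{c - r<..<c + r}\<close> with value \<open>1/2\<close>
  at the end points; the end points disappear by letting \<open>r\<close> increase to half the length of the interval.
\<close>

lemma cauchy_closure_indicator:
  assumes "a < b" shows "(\<lambda>t. indicator {a<..<b} t) \<in> cauchy_closure \<mu>"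
proof -
  define c where "c = (a + b) / 2"
  define E where "E r t = (if \<bar>t - c\<bar> < r then 1 else if \<bar>t - c\<bar> = r then 1/2 else 0 :: real)" for r t
  have E: "(\<lambda>t. of_real (E r t)) \<in> cauchy_closure \<mu>" if r: "r > 0" for r
  proof (rule cauchy_closure_dominated[where f = "\<lambda>n t. of_real (1 / (1 + ((t - c) / r) ^ (2 * Suc n)))"
        and h = "\<lambda>t. cmod (of_real (2 * r) * (1 / (complex_of_real t - Complex c r)))"])
    show "(\<lambda>t. complex_of_real (1 / (1 + ((t - c) / r) ^ (2 * Suc n)))) \<in> cauchy_closure \<mu>" for n
      by (rule cauchy_closure_butterworth[OF r])
    show "integrable \<mu> (\<lambda>t. (cmod (of_real (2 * r) * (1 / (complex_of_real t - Complex c r))))\<^sup>2)"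
      using r by (intro L2_integrable_sq L2_cmult integrable_diff_inverse(2) sets int) (simp add: complex_is_Real_iff)
    fix t
    define s where "s = ((t - c) / r)\<^sup>2"
    have s0: "s \<ge> 0" by (simp add: s_def)
    have pw: "((t - c) / r) ^ (2 * Suc n) = s ^ Suc n" for n by (simp only: s_def power_mult)
    have sc: "\<bar>t - c\<bar> < r \<longleftrightarrow> s < 1" "\<bar>t - c\<bar> = r \<longleftrightarrow> s = 1"
    proof -
      have "s = (\<bar>t - c\<bar> / r)\<^sup>2" by (simp add: s_def power_divide)
      moreover have "\<bar>t - c\<bar> / r \<ge> 0" using r by simp
      ultimately have "s < 1 \<longleftrightarrow> \<bar>t - c\<bar> / r < 1" "s = 1 \<longleftrightarrow> \<bar>t - c\<bar> / r = 1"
        by (auto simp: power_less_one_iff power2_eq_1_iff)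
      then show "\<bar>t - c\<bar> < r \<longleftrightarrow> s < 1" "\<bar>t - c\<bar> = r \<longleftrightarrow> s = 1" using r by (auto simp: field_simps)
    qed
    have "(\<lambda>n. 1 / (1 + s ^ Suc n)) \<longlonglongrightarrow> E r t"
    proof (cases s "1 :: real" rule: linorder_cases)
      case less
      then have "(\<lambda>n. 1 / (1 + s ^ Suc n)) \<longlonglongrightarrow> 1 / (1 + 0)"
        using s0 by (intro tendsto_intros LIMSEQ_Suc LIMSEQ_power_zero) auto
      then show ?thesis using less sc by (simp add: E_def)
    next
      case equal
      then show ?thesis using sc by (simp add: E_def)
    next
      case greater
      have "(\<lambda>n. 1 / (1 + s ^ Suc n)) \<longlonglongrightarrow> 0"
      proof (rule Lim_null_comparison)
        show "\<forall>\<^sub>F n in sequentially. norm (1 / (1 + s ^ Suc n)) \<le> (1 / s) ^ Suc n"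
        proof (intro always_eventually allI)
          fix n
          have "s ^ Suc n > 0" using greater by (intro zero_less_power) simp
          then have "1 / (1 + s ^ Suc n) \<le> 1 / s ^ Suc n" by (intro divide_left_mono mult_pos_pos) auto
          then show "norm (1 / (1 + s ^ Suc n)) \<le> (1 / s) ^ Suc n"
            using \<open>s ^ Suc n > 0\<close> by (simp only: power_one_over real_norm_def) simp
        qed
        show "(\<lambda>n. (1 / s) ^ Suc n) \<longlonglongrightarrow> 0"
          using greater by (intro LIMSEQ_Suc LIMSEQ_power_zero) simp
      qed
      moreover have "\<not> \<bar>t - c\<bar> < r" "\<not> \<bar>t - c\<bar> = r" using greater sc by auto
      ultimately show ?thesis by (simp add: E_def)
    qed
    then show "(\<lambda>n. complex_of_real (1 / (1 + ((t - c) / r) ^ (2 * Suc n)))) \<longlonglongrightarrow> of_real (E r t)"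
      unfolding pw by (intro tendsto_of_real)
    fix n
    \<comment> \<open>A majorant independent of n: 1 + s is |t - (c + i r)|^2 / r^2, and one factor
      of this square is at least r, which leaves a single kernel with pole c + i r.\<close>
    have "1 / (1 + s ^ Suc n) \<le> 2 / (1 + s)"
    proof (cases "s \<le> 1")
      case True
      have "1 / (1 + s ^ Suc n) \<le> 1 / 1" using s0
        by (intro divide_left_mono) (auto intro!: add_pos_nonneg mult_nonneg_nonneg)
      also have "\<dots> \<le> 2 / (1 + s)" using True s0 by (simp add: field_simps)
      finally show ?thesis .
    next
      case False
      then have "s ^ Suc n \<ge> s" using self_le_power[of s "Suc n"] by simp
      then have "1 / (1 + s ^ Suc n) \<le> 1 / (1 + s)" using s0
        by (intro divide_left_mono mult_pos_pos) (auto intro!: add_pos_nonneg mult_nonneg_nonneg)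
      also have "\<dots> \<le> 2 / (1 + s)" using s0 by (simp add: divide_right_mono)
      finally show ?thesis .
    qed
    also have "2 / (1 + s) = 2 * r\<^sup>2 / (cmod (complex_of_real t - Complex c r))\<^sup>2"
      using r by (simp add: cmod_power2 s_def power_divide field_simps)
    also have "\<dots> \<le> 2 * r * (1 / cmod (complex_of_real t - Complex c r))"
    proof -
      have rl: "r \<le> cmod (complex_of_real t - Complex c r)"
        using abs_Im_le_cmod[of "complex_of_real t - Complex c r"] r by simp
      then have "2 * r * r \<le> 2 * r * cmod (complex_of_real t - Complex c r)" using r by simp
      then show ?thesis using rl r by (simp add: power2_eq_square divide_simps)
    qed
    finally have "1 / (1 + s ^ Suc n) \<le> 2 * r * (1 / cmod (complex_of_real t - Complex c r))" .
    then show "cmod (complex_of_real (1 / (1 + ((t - c) / r) ^ (2 * Suc n)))) \<le> cmod (of_real (2 * r) * (1 / (complex_of_real t - Complex c r)))"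
      unfolding pw norm_mult norm_of_real norm_divide using r s0 by simp
  qed measurable
  define r where "r = (b - a) / 2"
  have r: "r > 0" using assms by (simp add: r_def)
  obtain m where m: "\<bar>a\<bar> + \<bar>b\<bar> \<le> real m" using real_arch_simple by blast
  show ?thesis
  \<comment> \<open>The radii increase to r strictly from below; the shift by 2 makes the one for n
    = 0 positive.\<close>
  proof (rule cauchy_closure_dominated[where f = "\<lambda>n t. of_real (E (r * (1 - 1 / real (n + 2))) t)"
        and h = "\<lambda>t. 1 * indicator {- real m..real m} t"])
    have rn: "r * (1 - 1 / real (n + 2)) > 0" "r * (1 - 1 / real (n + 2)) < r" for n
    proof -
      have "1 - 1 / real (n + 2) > 0" "1 - 1 / real (n + 2) < 1" by (auto simp: field_simps)
      then show "r * (1 - 1 / real (n + 2)) > 0" "r * (1 - 1 / real (n + 2)) < r"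
        using r mult_strict_left_mono[of "1 - 1 / real (n + 2)" 1 r] by auto
    qed
    show "(\<lambda>t. complex_of_real (E (r * (1 - 1 / real (n + 2))) t)) \<in> cauchy_closure \<mu>" for n
      by (rule E[OF rn(1)])
    show "integrable \<mu> (\<lambda>t. (1 * indicator {- real m..real m} t :: real)\<^sup>2)" by (rule integrable_bounded_support)
    have ab: "t \<in> {a<..<b} \<longleftrightarrow> \<bar>t - c\<bar> < r" for t
      by (simp add: r_def c_def abs_less_iff field_simps) linarith
    show "(\<lambda>n. complex_of_real (E (r * (1 - 1 / real (n + 2))) t)) \<longlonglongrightarrow> indicator {a<..<b} t" for t
    proof (rule tendsto_eventually)
      show "\<forall>\<^sub>F n in sequentially. complex_of_real (E (r * (1 - 1 / real (n + 2))) t) = indicator {a<..<b} t"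
      proof (cases "\<bar>t - c\<bar> < r")
        case True
        have "(\<lambda>n. r * (1 - 1 / real (n + 2))) \<longlonglongrightarrow> r * (1 - 0)"
          by (intro tendsto_intros LIMSEQ_ignore_initial_segment lim_1_over_n)
        then have "\<forall>\<^sub>F n in sequentially. r * (1 - 1 / real (n + 2)) > \<bar>t - c\<bar>"
          using True by (intro order_tendstoD(1)) auto
        then show ?thesis by eventually_elim (use True ab in \<open>auto simp: E_def\<close>)
      next
        case False
        have "complex_of_real (E (r * (1 - 1 / real (n + 2))) t) = indicator {a<..<b} t" for n
          using False ab[of t] rn(2)[of n] by (auto simp: E_def)
        then show ?thesis by simp
      qed
    qed
    show "cmod (complex_of_real (E (r * (1 - 1 / real (n + 2))) t)) \<le> 1 * indicator {- real m..real m} t" for n t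
    proof (cases "t \<in> {a<..<b}")
      case True
      then have "t \<in> {- real m..real m}" using m by auto
      then show ?thesis by (simp add: E_def)
    next
      case False
      then show ?thesis using ab[of t] rn(2)[of n] by (auto simp: E_def)
    qed
  qed measurable
qed

lemma cauchy_closure_eq_L2: "cauchy_closure \<mu> = L2 \<mu>"
proof
  show "cauchy_closure \<mu> \<subseteq> L2 \<mu>" by (auto simp: cauchy_closure_def)
  show "L2 \<mu> \<subseteq> cauchy_closure \<mu>"
  proof
    fix g assume g: "g \<in> L2 \<mu>"
    show "g \<in> cauchy_closure \<mu>"
    proof (rule dominated_class_induct[where Q = "\<lambda>h. integrable \<mu> (\<lambda>t. (h t)\<^sup>2)"])
      show "g \<in> borel_measurable borel" using L2_measurable[OF g] by (simp add: measurable_iff)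
      show "integrable \<mu> (\<lambda>t. (2 * cmod (g t))\<^sup>2)" using L2_integrable_sq[OF g] by (simp add: power_mult_distrib)
    next
      fix f g h
      assume "\<And>n. f n \<in> cauchy_closure \<mu>" "\<And>x. (\<lambda>n. f n x) \<longlonglongrightarrow> g x" "h \<in> borel_measurable borel"
        "integrable \<mu> (\<lambda>t. (h t)\<^sup>2)" "\<And>n x. cmod (f n x) \<le> h x"
      then show "g \<in> cauchy_closure \<mu>" by (rule cauchy_closure_dominated)
    qed (intro cauchy_closure_indicator cauchy_closure_add cauchy_closure_cmult integrable_bounded_support; assumption)+
  qed
qed

lemma L2_approx_pfrac: "g \<in> L2 \<mu> \<Longrightarrow> e > 0 \<Longrightarrow>
  \<exists>a Z. finite Z \<and> Z \<inter> \<real> = {} \<and> (L2_norm \<mu> (\<lambda>t. g t - pfrac a Z t))\<^sup>2 < e"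
  unfolding cauchy_closure_eq_L2[symmetric] unfolding cauchy_closure_def by blast

section \<open>Cauchy transforms as functions on the upper half-plane\<close>

lemma integrable_kernel:
  assumes g: "integrable \<mu> (\<lambda>t. g t / of_real (1 + \<bar>t\<bar>))" and z: "z \<notin> \<real>"
  shows "integrable \<mu> (\<lambda>t. g t / (complex_of_real t - z))"
proof -
  obtain C where C: "\<And>t. cmod (1 / (complex_of_real t - z)) \<le> C * (1 / (1 + \<bar>t\<bar>))"
    using cauchy_kernel_bound[OF z] by blast
  have "integrable \<mu> (\<lambda>t. g t / of_real (1 + \<bar>t\<bar>) * (of_real (1 + \<bar>t\<bar>) / (complex_of_real t - z)))"
  proof (rule integrable_mult_bounded[OF sets g])
    show "cmod (of_real (1 + \<bar>t\<bar>) / (complex_of_real t - z)) \<le> C" for t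
    proof -
      have "1 + \<bar>t\<bar> > 0" by linarith
      then have "cmod (complex_of_real (1 + \<bar>t\<bar>)) = 1 + \<bar>t\<bar>" unfolding norm_of_real by simp
      then show ?thesis using C[of t] \<open>1 + \<bar>t\<bar> > 0\<close> unfolding norm_divide by (simp add: field_simps)
    qed
  qed measurable
  moreover have "g t / of_real (1 + \<bar>t\<bar>) * (of_real (1 + \<bar>t\<bar>) / (complex_of_real t - z)) = g t / (complex_of_real t - z)" for t
  proof -
    have "complex_of_real (1 + \<bar>t\<bar>) \<noteq> 0" unfolding of_real_eq_0_iff by linarith
    then show ?thesis by simp
  qed
  ultimately show ?thesis by (simp only:)
qed

lemma cmod_kernel_le: "Im z > 0 \<Longrightarrow> cmod (1 / (complex_of_real t - z)) \<le> 1 / Im z"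
  using abs_Im_le_cmod[of "complex_of_real t - z"] by (simp add: norm_divide frac_le)

text \<open>Differentiation under the integral sign: the error of the difference quotient is exactly
  w - z times the integral of \<open>g\<close> against a product of three kernels, and the kernel at
  w is at most 2 / Im z when w is near z.\<close>

lemma cauchy_transform_holomorphic:
  assumes g: "integrable \<mu> (\<lambda>t. g t / of_real (1 + \<bar>t\<bar>))"
  shows "cauchy_transform \<mu> g holomorphic_on {z. Im z > 0}"
proof (rule holomorphic_onI)
  fix z assume "z \<in> {z. Im z > 0}"
  then have Im: "Im z > 0" by simp
  have nr: "z \<notin> \<real>" if "Im z > 0" for z using that by (auto simp: complex_is_Real_iff)
  have ne: "complex_of_real t - z \<noteq> 0" if "Im z > 0" for t z using nr[OF that] by auto
  let ?k = "\<lambda>z t. 1 / (complex_of_real t - z)"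
  have gk: "integrable \<mu> (\<lambda>t. g t * ?k z t)" if "Im z > 0" for z
    using integrable_kernel[OF g nr[OF that]] by simp
  have gkk: "integrable \<mu> (\<lambda>t. g t * ?k z t * ?k w t)" if "Im w > 0" for w
    by (rule integrable_mult_bounded[OF sets gk[OF Im] _ cmod_kernel_le[OF that]]) measurable
  have gkkk: "integrable \<mu> (\<lambda>t. g t * ?k z t * ?k z t * ?k w t)" if "Im w > 0" for w
    by (rule integrable_mult_bounded[OF sets gkk[OF Im] _ cmod_kernel_le[OF that]]) measurable
  define D where "D = (LINT t|\<mu>. g t * ?k z t * ?k z t)"
  define B where "B = (2 / Im z) * (LINT t|\<mu>. cmod (g t * ?k z t * ?k z t))"
  have "((\<lambda>w. (cauchy_transform \<mu> g w - cauchy_transform \<mu> g z) / (w - z)) \<longlongrightarrow> D) (at z)"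
  proof (rule LIM_zero_cancel, rule Lim_null_comparison)
    have "(Im \<longlongrightarrow> Im z) (at z)" by (intro tendsto_intros)
    then have "\<forall>\<^sub>F w in at z. Im w > Im z / 2" using Im by (intro order_tendstoD(1)) auto
    moreover have "\<forall>\<^sub>F w in at z. w \<noteq> z" by (simp add: eventually_at_filter)
    ultimately show "\<forall>\<^sub>F w in at z. norm ((cauchy_transform \<mu> g w - cauchy_transform \<mu> g z) / (w - z) - D) \<le> cmod (w - z) * B"
    proof eventually_elim
      case (elim w)
      then have w: "Im w > 0" "w - z \<noteq> 0" using Im by auto
      have "cauchy_transform \<mu> g w - cauchy_transform \<mu> g z = (LINT t|\<mu>. g t * ?k w t - g t * ?k z t)"
        using gk[OF w(1)] gk[OF Im] by (simp add: cauchy_transform_def)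
      also have "\<dots> = (LINT t|\<mu>. (w - z) * (g t * ?k z t * ?k w t))"
      proof (intro Bochner_Integration.integral_cong refl)
        fix t
        have "?k w t - ?k z t = (w - z) * (?k z t * ?k w t)"
          using ne[OF w(1), of t] ne[OF Im, of t] by (simp add: divide_simps)
        then have "g t * (?k w t - ?k z t) = g t * ((w - z) * (?k z t * ?k w t))" by (rule arg_cong)
        then show "g t * ?k w t - g t * ?k z t = (w - z) * (g t * ?k z t * ?k w t)"
          by (simp only: right_diff_distrib mult_ac)
      qed
      finally have q: "(cauchy_transform \<mu> g w - cauchy_transform \<mu> g z) / (w - z) = (LINT t|\<mu>. g t * ?k z t * ?k w t)"
        unfolding integral_mult_right_zero by (simp only: nonzero_mult_div_cancel_left[OF w(2)])
      have "(LINT t|\<mu>. g t * ?k z t * ?k w t) - D = (LINT t|\<mu>. g t * ?k z t * ?k w t - g t * ?k z t * ?k z t)"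
        using gkk[OF w(1)] gkk[OF Im] by (simp add: D_def)
      also have "\<dots> = (LINT t|\<mu>. (w - z) * (g t * ?k z t * ?k z t * ?k w t))"
      proof (intro Bochner_Integration.integral_cong refl)
        fix t
        have "?k w t - ?k z t = (w - z) * (?k z t * ?k w t)"
          using ne[OF w(1), of t] ne[OF Im, of t] by (simp add: divide_simps)
        then have "g t * ?k z t * (?k w t - ?k z t) = g t * ?k z t * ((w - z) * (?k z t * ?k w t))" by (rule arg_cong)
        then show "g t * ?k z t * ?k w t - g t * ?k z t * ?k z t = (w - z) * (g t * ?k z t * ?k z t * ?k w t)"
          by (simp only: right_diff_distrib mult_ac)
      qed
      finally have e: "(LINT t|\<mu>. g t * ?k z t * ?k w t) - D = (w - z) * (LINT t|\<mu>. g t * ?k z t * ?k z t * ?k w t)"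
        unfolding integral_mult_right_zero .
      have "cmod ((LINT t|\<mu>. g t * ?k z t * ?k w t) - D) = cmod (w - z) * cmod (LINT t|\<mu>. g t * ?k z t * ?k z t * ?k w t)"
        unfolding e by (rule norm_mult)
      also have "\<dots> \<le> cmod (w - z) * B"
      proof (rule mult_left_mono)
        have "cmod (LINT t|\<mu>. g t * ?k z t * ?k z t * ?k w t) \<le> (LINT t|\<mu>. cmod (g t * ?k z t * ?k z t * ?k w t))"
          by (rule integral_norm_bound)
        also have "\<dots> \<le> (LINT t|\<mu>. (2 / Im z) * cmod (g t * ?k z t * ?k z t))"
        proof (intro integral_mono integrable_norm gkkk w integrable_mult_right gkk Im)
          fix t
          have "cmod (?k w t) \<le> 1 / Im w" by (rule cmod_kernel_le[OF w(1)])
          also have "\<dots> \<le> 1 / (Im z / 2)" using elim(1) Im by (intro divide_left_mono mult_pos_pos) auto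
          finally have "cmod (?k w t) \<le> 2 / Im z" by simp
          from mult_right_mono[OF this norm_ge_zero[of "g t * ?k z t * ?k z t"]]
          show "cmod (g t * ?k z t * ?k z t * ?k w t) \<le> (2 / Im z) * cmod (g t * ?k z t * ?k z t)"
            unfolding norm_mult[of _ "?k w t"] by (simp only: mult.commute)
        qed
        also have "\<dots> = B" unfolding B_def by (rule integral_mult_right_zero)
        finally show "cmod (LINT t|\<mu>. g t * ?k z t * ?k z t * ?k w t) \<le> B" .
      qed simp
      finally show ?case unfolding q .
    qed
    have "((\<lambda>w. cmod (w - z) * B) \<longlongrightarrow> cmod (z - z) * B) (at z)" by (intro tendsto_intros)
    then show "((\<lambda>w. cmod (w - z) * B) \<longlongrightarrow> 0) (at z)" by simp
  qed
  then have "(cauchy_transform \<mu> g has_field_derivative D) (at z)" by (simp add: has_field_derivative_iff)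
  then show "cauchy_transform \<mu> g field_differentiable at z within {z. Im z > 0}"
    using field_differentiable_at_within field_differentiable_def by blast
qed

text \<open>The weight 1 / (1 + |t|) is at most 1, so its square is at most the weight itself and
  the weight belongs to L^2(\<mu>).\<close>

lemma L2_integrable_weight:
  assumes "g \<in> L2 \<mu>" shows "integrable \<mu> (\<lambda>t. g t / of_real (1 + \<bar>t\<bar>))"
proof -
  have "integrable \<mu> (\<lambda>t. (cmod (1 / complex_of_real (1 + \<bar>t\<bar>)))\<^sup>2)"
  proof (rule Bochner_Integration.integrable_bound[OF int])
    show "(\<lambda>t. (cmod (1 / complex_of_real (1 + \<bar>t\<bar>)))\<^sup>2) \<in> borel_measurable \<mu>" unfolding measurable_iff by measurable
    show "AE t in \<mu>. norm ((cmod (1 / complex_of_real (1 + \<bar>t\<bar>)))\<^sup>2) \<le> norm (1 / (1 + \<bar>t\<bar>))"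
    proof (intro AE_I2)
      fix t :: real
      have c: "cmod (1 / complex_of_real (1 + \<bar>t\<bar>)) = 1 / (1 + \<bar>t\<bar>)" unfolding norm_divide norm_of_real by simp
      have "(1 / (1 + \<bar>t\<bar>))\<^sup>2 \<le> 1 / (1 + \<bar>t\<bar>)" using power_decreasing[of 1 2 "1 / (1 + \<bar>t\<bar>)"] by simp
      then show "norm ((cmod (1 / complex_of_real (1 + \<bar>t\<bar>)))\<^sup>2) \<le> norm (1 / (1 + \<bar>t\<bar>))" unfolding c by simp
    qed
  qed
  then have "(\<lambda>t. 1 / complex_of_real (1 + \<bar>t\<bar>)) \<in> L2 \<mu>" unfolding L2_def measurable_iff by simp
  from integrable_L2_mult[OF assms this] show ?thesis by simp
qed

lemma cauchy_transform_L2_bound: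
  assumes g: "g \<in> L2 \<mu>" and w: "w \<notin> \<real>"
  shows "cmod (cauchy_transform \<mu> g w) \<le> L2_norm \<mu> g * L2_norm \<mu> (\<lambda>t. 1 / (complex_of_real t - w))"
proof -
  have "cmod (cauchy_transform \<mu> g w) \<le> (LINT t|\<mu>. cmod (g t * (1 / (complex_of_real t - w))))"
    unfolding cauchy_transform_def by (simp only: times_divide_eq_right mult_1_right) (rule integral_norm_bound)
  also have "\<dots> \<le> L2_norm \<mu> g * L2_norm \<mu> (\<lambda>t. 1 / (complex_of_real t - w))"
    by (rule L2_Cauchy_Schwarz_abs[OF g integrable_diff_inverse(2)[OF sets int w]])
  finally show ?thesis .
qed

lemma cauchy_transform_diff:
  assumes "g \<in> L2 \<mu>" "h \<in> L2 \<mu>" "w \<notin> \<real>"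
  shows "cauchy_transform \<mu> (\<lambda>t. g t - h t) w = cauchy_transform \<mu> g w - cauchy_transform \<mu> h w"
  unfolding cauchy_transform_def diff_divide_distrib
  by (intro Bochner_Integration.integral_diff integrable_kernel L2_integrable_weight assms)

lemma cauchy_transform_line_measurable:
  assumes g: "integrable \<mu> (\<lambda>t. g t / of_real (1 + \<bar>t\<bar>))" and e: "e > 0"
  shows "(\<lambda>x. cauchy_transform \<mu> g (Complex x e)) \<in> borel_measurable borel"
  by (intro borel_measurable_continuous_onI continuous_on_compose2[OF holomorphic_on_imp_continuous_on[OF cauchy_transform_holomorphic[OF g]]])
     (use e in \<open>auto simp: Complex_eq intro!: continuous_intros\<close>)

lemma integrable_weight_one: "integrable \<mu> (\<lambda>t. 1 / complex_of_real (1 + \<bar>t\<bar>))"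
  using integrable_of_real[OF int, where 'a = complex] by simp

end

text \<open>Norm convergence of partial fractions implies convergence of their Cauchy transforms at
  each nonreal point, by Cauchy-Schwarz against the kernel, so Fatou's lemma applies on the line.
  The factor 2 comes from estimating the norms of the approximants by the squared triangle
  inequality.\<close>

lemma weyl_L2_inequality:
  fixes Mp Mm :: "complex \<Rightarrow> complex"
  assumes p: "cauchy_measure \<mu>p" and m: "cauchy_measure \<mu>m"
    and Mp: "\<And>z. z \<notin> \<real> \<Longrightarrow> Mp z = cauchy_transform \<mu>p (\<lambda>_. 1) z"
    and Mm: "\<And>z. z \<notin> \<real> \<Longrightarrow> Mm z = cauchy_transform \<mu>m (\<lambda>_. 1) z"
    and K: "K \<ge> 0" and e: "e > 0"
    and span: "\<And>Zp Zm a b. finite Zp \<Longrightarrow> finite Zm \<Longrightarrow> Zp \<inter> \<real> = {} \<Longrightarrow> Zm \<inter> \<real> = {} \<Longrightarrow>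
      (\<integral>\<^sup>+x. ennreal (weyl_weight Mp Mm (Complex x e) * (cmod (cauchy_transform \<mu>p (pfrac a Zp) (Complex x e)
          - cauchy_transform \<mu>m (pfrac b Zm) (Complex x e)))\<^sup>2) \<partial>lborel)
       \<le> ennreal (K * ((L2_norm \<mu>p (pfrac a Zp))\<^sup>2 + (L2_norm \<mu>m (pfrac b Zm))\<^sup>2))"
    and gp: "gp \<in> L2 \<mu>p" and gm: "gm \<in> L2 \<mu>m"
  shows "(\<integral>\<^sup>+x. ennreal (weyl_weight Mp Mm (Complex x e) * (cmod (cauchy_transform \<mu>p gp (Complex x e)
          - cauchy_transform \<mu>m gm (Complex x e)))\<^sup>2) \<partial>lborel)
       \<le> ennreal (2 * K * ((L2_norm \<mu>p gp)\<^sup>2 + (L2_norm \<mu>m gm)\<^sup>2))"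
proof -
  interpret p: cauchy_measure \<mu>p by fact
  interpret m: cauchy_measure \<mu>m by fact
  let ?w = "\<lambda>x. Complex x e"
  have nr: "?w x \<notin> \<real>" for x using e by (simp add: complex_is_Real_iff)
  define N where "N = (L2_norm \<mu>p gp)\<^sup>2 + (L2_norm \<mu>m gm)\<^sup>2"
  define L where "L = (\<integral>\<^sup>+x. ennreal (weyl_weight Mp Mm (?w x) * (cmod (cauchy_transform \<mu>p gp (?w x)
          - cauchy_transform \<mu>m gm (?w x)))\<^sup>2) \<partial>lborel)"
  have meas: "(\<lambda>x. weyl_weight Mp Mm (?w x)) \<in> borel_measurable borel"
    unfolding weyl_weight_def using Mp[OF nr] Mm[OF nr]
      p.cauchy_transform_line_measurable[OF p.integrable_weight_one e]
      m.cauchy_transform_line_measurable[OF m.integrable_weight_one e] by simp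
  \<comment> \<open>\<open>d\<close> bounds the squared distances of all approximants at once and
    tends to 0 only after the limit along the sequence.\<close>
  have step: "L \<le> ennreal (2 * K * N + 4 * K * d)" if d: "d > 0" for d
  proof -
    have "\<exists>a Z. finite Z \<and> Z \<inter> \<real> = {} \<and> (L2_norm \<mu>p (\<lambda>t. gp t - pfrac a Z t))\<^sup>2 < d * (1 / real (Suc n))" for n
      by (rule p.L2_approx_pfrac[OF gp]) (use d in simp)
    then obtain a Z where Z: "\<And>n. finite (Z n)" "\<And>n. Z n \<inter> \<real> = {}"
      "\<And>n. (L2_norm \<mu>p (\<lambda>t. gp t - pfrac (a n) (Z n) t))\<^sup>2 < d * (1 / real (Suc n))" by metis
    have "\<exists>b Y. finite Y \<and> Y \<inter> \<real> = {} \<and> (L2_norm \<mu>m (\<lambda>t. gm t - pfrac b Y t))\<^sup>2 < d * (1 / real (Suc n))" for n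
      by (rule m.L2_approx_pfrac[OF gm]) (use d in simp)
    then obtain b Y where Y: "\<And>n. finite (Y n)" "\<And>n. Y n \<inter> \<real> = {}"
      "\<And>n. (L2_norm \<mu>m (\<lambda>t. gm t - pfrac (b n) (Y n) t))\<^sup>2 < d * (1 / real (Suc n))" by metis
    have pL: "pfrac (a n) (Z n) \<in> L2 \<mu>p" "pfrac (b n) (Y n) \<in> L2 \<mu>m" for n
      by (intro pfrac_L2 p.sets p.int m.sets m.int Z Y)+
    have conv: "(\<lambda>n. cauchy_transform \<nu> (f n) w) \<longlonglongrightarrow> cauchy_transform \<nu> g w"
      if \<nu>: "cauchy_measure \<nu>" and g: "g \<in> L2 \<nu>" and f: "\<And>n. f n \<in> L2 \<nu>"
        and le: "\<And>n. (L2_norm \<nu> (\<lambda>t. g t - f n t))\<^sup>2 < d * (1 / real (Suc n))" and w: "w \<notin> \<real>" for \<nu> g f w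
    proof -
      interpret n: cauchy_measure \<nu> by fact
      have "(\<lambda>n. L2_norm \<nu> (\<lambda>t. g t - f n t)) \<longlonglongrightarrow> 0"
      proof (rule Lim_null_comparison)
        have "L2_norm \<nu> (\<lambda>t. g t - f n t) \<le> sqrt (d * (1 / real (Suc n)))" for n
          using le[of n] by (intro real_le_rsqrt) simp
        then show "\<forall>\<^sub>F n in sequentially. norm (L2_norm \<nu> (\<lambda>t. g t - f n t)) \<le> sqrt (d * (1 / real (Suc n)))" by simp
        have "(\<lambda>n. sqrt (d * (1 / real (Suc n)))) \<longlonglongrightarrow> sqrt (d * 0)"
          by (intro tendsto_intros LIMSEQ_Suc lim_1_over_n)
        then show "(\<lambda>n. sqrt (d * (1 / real (Suc n)))) \<longlonglongrightarrow> 0" by simp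
      qed
      from tendsto_mult_left_zero[OF this]
      have "(\<lambda>n. L2_norm \<nu> (\<lambda>t. g t - f n t) * L2_norm \<nu> (\<lambda>t. 1 / (complex_of_real t - w))) \<longlonglongrightarrow> 0" .
      then have "(\<lambda>n. cauchy_transform \<nu> g w - cauchy_transform \<nu> (f n) w) \<longlonglongrightarrow> 0"
        by (rule Lim_null_comparison[rotated])
           (use n.cauchy_transform_L2_bound[OF L2_diff[OF g f] w] in \<open>simp add: n.cauchy_transform_diff[OF g f w]\<close>)
      from tendsto_diff[OF tendsto_const[of "cauchy_transform \<nu> g w"] this] show ?thesis by simp
    qed
    have "(\<integral>\<^sup>+x. ennreal (weyl_weight Mp Mm (?w x) * (cmod (cauchy_transform \<mu>p gp (?w x)
          - cauchy_transform \<mu>m gm (?w x)))\<^sup>2) \<partial>lborel) \<le> ennreal (2 * K * N + 4 * K * d)"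
    proof (rule nn_integral_le_of_tendsto[where f = "\<lambda>n x. weyl_weight Mp Mm (?w x) * (cmod (cauchy_transform \<mu>p (pfrac (a n) (Z n)) (?w x)
          - cauchy_transform \<mu>m (pfrac (b n) (Y n)) (?w x)))\<^sup>2"])
      fix n
      show "(\<lambda>x. weyl_weight Mp Mm (?w x) * (cmod (cauchy_transform \<mu>p (pfrac (a n) (Z n)) (?w x)
          - cauchy_transform \<mu>m (pfrac (b n) (Y n)) (?w x)))\<^sup>2) \<in> borel_measurable lborel"
        using meas p.cauchy_transform_line_measurable[OF p.L2_integrable_weight[OF pL(1)[of n]] e]
          m.cauchy_transform_line_measurable[OF m.L2_integrable_weight[OF pL(2)[of n]] e] by simp
    next
      show "AE x in lborel. (\<lambda>n. weyl_weight Mp Mm (?w x) * (cmod (cauchy_transform \<mu>p (pfrac (a n) (Z n)) (?w x)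
          - cauchy_transform \<mu>m (pfrac (b n) (Y n)) (?w x)))\<^sup>2) \<longlonglongrightarrow>
          weyl_weight Mp Mm (?w x) * (cmod (cauchy_transform \<mu>p gp (?w x) - cauchy_transform \<mu>m gm (?w x)))\<^sup>2"
        by (intro AE_I2 tendsto_intros conv[OF p gp pL(1) Z(3) nr] conv[OF m gm pL(2) Y(3) nr])
    next
      fix n
      have b: "(L2_norm \<nu> f)\<^sup>2 \<le> 2 * (L2_norm \<nu> g)\<^sup>2 + 2 * d"
        if g: "g \<in> L2 \<nu>" and f: "f \<in> L2 \<nu>" and le: "(L2_norm \<nu> (\<lambda>t. g t - f t))\<^sup>2 < d * (1 / real (Suc n))" for \<nu> g f
      proof -
        have "(L2_norm \<nu> (\<lambda>t. g t + -1 * (g t - f t)))\<^sup>2 \<le> 2 * (L2_norm \<nu> g)\<^sup>2 + 2 * (L2_norm \<nu> (\<lambda>t. -1 * (g t - f t)))\<^sup>2"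
          by (intro L2_norm_add_sq g L2_cmult L2_diff f)
        also have "L2_norm \<nu> (\<lambda>t. -1 * (g t - f t)) = L2_norm \<nu> (\<lambda>t. g t - f t)" unfolding L2_norm_cmult by simp
        also have "2 * (L2_norm \<nu> g)\<^sup>2 + 2 * (L2_norm \<nu> (\<lambda>t. g t - f t))\<^sup>2 \<le> 2 * (L2_norm \<nu> g)\<^sup>2 + 2 * d"
        proof -
          have "d * (1 / real (Suc n)) \<le> d * 1" using d by (intro mult_left_mono) auto
          then show ?thesis using le by simp
        qed
        finally show ?thesis by simp
      qed
      have "K * ((L2_norm \<mu>p (pfrac (a n) (Z n)))\<^sup>2 + (L2_norm \<mu>m (pfrac (b n) (Y n)))\<^sup>2) \<le>
         K * ((2 * (L2_norm \<mu>p gp)\<^sup>2 + 2 * d) + (2 * (L2_norm \<mu>m gm)\<^sup>2 + 2 * d))"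
        by (intro mult_left_mono add_mono b[OF gp pL(1) Z(3)] b[OF gm pL(2) Y(3)] K)
      also have "\<dots> = 2 * K * N + 4 * K * d" by (simp add: N_def algebra_simps)
      finally show "(\<integral>\<^sup>+x. ennreal (weyl_weight Mp Mm (?w x) * (cmod (cauchy_transform \<mu>p (pfrac (a n) (Z n)) (?w x)
          - cauchy_transform \<mu>m (pfrac (b n) (Y n)) (?w x)))\<^sup>2) \<partial>lborel) \<le> ennreal (2 * K * N + 4 * K * d)"
        by (rule order_trans[OF span[OF Z(1) Y(1) Z(2) Y(2)] ennreal_leI])
    qed
    then show ?thesis by (simp add: L_def)
  qed
  have "L \<le> ennreal (2 * K * N)"
  proof (rule ennreal_le_epsilon)
    fix r :: real assume r: "0 < r"
    \<comment> \<open>The added 1 avoids a division by zero for K = 0.\<close>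
    define d where "d = r / (4 * K + 1)"
    have d: "d > 0" "4 * K * d \<le> r" using r K by (auto simp: d_def field_simps)
    have "L \<le> ennreal (2 * K * N + 4 * K * d)" by (rule step[OF d(1)])
    also have "\<dots> \<le> ennreal (2 * K * N + r)" using d by (intro ennreal_leI) simp
    also have "\<dots> = ennreal (2 * K * N) + ennreal r" using K r by (intro ennreal_plus) (auto simp: N_def)
    finally show "L \<le> ennreal (2 * K * N) + ennreal r" .
  qed
  then show ?thesis by (simp add: L_def N_def)
qed

section \<open>Weak-type bounds for the Cauchy transform\<close>

lemma maximal_ball_weak_type:
  fixes \<kappa> :: "real measure"
  assumes fin: "finite_measure \<kappa>" and sets[measurable_cong]: "sets \<kappa> = sets borel" and c: "c > 0"
  shows "\<exists>V\<in>sets borel. {x. \<exists>r>0. emeasure \<kappa> (ball x r) > ennreal (c * r)} \<subseteq> V \<and>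
    emeasure lborel V \<le> ennreal (10 / c) * emeasure \<kappa> (space \<kappa>)"
proof -
  interpret finite_measure \<kappa> by fact
  define U where "U = {x. \<exists>r>0. emeasure \<kappa> (ball x r) > ennreal (c * r)}"
  obtain r where r: "\<And>x. x \<in> U \<Longrightarrow> r x > 0" "\<And>x. x \<in> U \<Longrightarrow> emeasure \<kappa> (ball x (r x)) > ennreal (c * r x)"
  proof -
    have "\<forall>x\<in>U. \<exists>r>0. emeasure \<kappa> (ball x r) > ennreal (c * r)" by (simp add: U_def)
    then show ?thesis using that by metis
  qed
  have spk: "space \<kappa> = UNIV" using sets_eq_imp_space_eq[OF sets] by simp
  \<comment> \<open>Balls that carry more than c r of a finite mass have bounded radii, as Vitali's
    covering lemma requires.\<close>
  have rB: "r x \<le> measure \<kappa> UNIV / c" if "x \<in> U" for x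
  proof -
    have "ennreal (c * r x) < emeasure \<kappa> UNIV"
      by (rule less_le_trans[OF r(2)[OF that]]) (rule emeasure_mono, auto simp: sets)
    then have "c * r x < measure \<kappa> UNIV"
      using r(1)[OF that] c by (simp add: emeasure_eq_measure ennreal_less_iff)
    then show ?thesis using c by (simp add: field_simps)
  qed
  have "U \<subseteq> (\<Union>i\<in>U. cball i (r i))" using r(1) by force
  then obtain C where C: "countable C" "C \<subseteq> U"
      "pairwise (\<lambda>i j. disjnt (cball i (r i)) (cball j (r j))) C" "U \<subseteq> (\<Union>i\<in>C. cball i (5 * r i))"
    by (rule Vitali_covering_lemma_cballs[where B = "measure \<kappa> UNIV / c"]) (use r(1) rB in auto)
  define I where "I = to_nat_on C ` C"
  define p where "p n = from_nat_into C n" for n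
  have pC: "p n \<in> C" if "n \<in> I" for n using that C(1) by (auto simp: I_def p_def)
  have pinj: "p n \<noteq> p m" if "n \<in> I" "m \<in> I" "n \<noteq> m" for n m using that C(1) by (auto simp: I_def p_def)
  have Ccov: "\<exists>n\<in>I. p n = i" if "i \<in> C" for i using that C(1) by (auto simp: I_def p_def intro!: bexI[of _ "to_nat_on C i"])
  define X where "X n = (if n \<in> I then cball (p n) (5 * r (p n)) else {})" for n
  define Y where "Y n = (if n \<in> I then ball (p n) (r (p n)) else {})" for n
  \<comment> \<open>The enlarged ball has length 10 r, and c r is less than the mass of the original
    ball.\<close>
  have XY: "emeasure lborel (X n) \<le> ennreal (10 / c) * emeasure \<kappa> (Y n)" for n
  proof (cases "n \<in> I")
    case True
    then have pU: "p n \<in> U" using pC C(2) by auto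
    have "emeasure lborel (X n) = ennreal (10 * r (p n))"
      using True r(1)[OF pU] by (simp add: X_def cball_eq_atLeastAtMost)
    also have "\<dots> = ennreal (10 / c) * ennreal (c * r (p n))"
      using c by (simp add: ennreal_mult'[symmetric])
    also have "\<dots> \<le> ennreal (10 / c) * emeasure \<kappa> (Y n)"
      using r(2)[OF pU] True by (intro mult_left_mono) (auto simp: Y_def)
    finally show ?thesis .
  qed (simp add: X_def)
  have disj: "disjoint_family Y"
    unfolding disjoint_family_on_def
  proof (intro ballI impI)
    fix m n :: nat assume mn: "m \<noteq> n"
    show "Y m \<inter> Y n = {}"
    proof (cases "m \<in> I \<and> n \<in> I")
      case True
      then have "disjnt (cball (p m) (r (p m))) (cball (p n) (r (p n)))"
        using C(3) pC pinj mn unfolding pairwise_def by blast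
      then have "cball (p m) (r (p m)) \<inter> cball (p n) (r (p n)) = {}" by (simp add: disjnt_def)
      moreover have "Y m \<subseteq> cball (p m) (r (p m))" "Y n \<subseteq> cball (p n) (r (p n))" by (auto simp: Y_def)
      ultimately show ?thesis by blast
    qed (auto simp: Y_def)
  qed
  show ?thesis
  proof (intro bexI[of _ "\<Union>n. X n"] conjI)
    show "{x. \<exists>r>0. emeasure \<kappa> (ball x r) > ennreal (c * r)} \<subseteq> (\<Union>n. X n)"
      unfolding U_def[symmetric]
    proof
      fix x assume "x \<in> U"
      then obtain i where i: "i \<in> C" "x \<in> cball i (5 * r i)" using C(4) by blast
      then obtain n where "n \<in> I" "p n = i" using Ccov by blast
      then show "x \<in> (\<Union>n. X n)" using i by (auto simp: X_def intro!: exI[of _ n])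
    qed
    have "emeasure lborel (\<Union>n. X n) \<le> (\<Sum>n. emeasure lborel (X n))"
      by (rule emeasure_subadditive_countably) (auto simp: X_def)
    also have "\<dots> \<le> (\<Sum>n. ennreal (10 / c) * emeasure \<kappa> (Y n))"
      by (intro suminf_le XY) auto
    also have "\<dots> = ennreal (10 / c) * (\<Sum>n. emeasure \<kappa> (Y n))" by simp
    also have "(\<Sum>n. emeasure \<kappa> (Y n)) = emeasure \<kappa> (\<Union>n. Y n)"
      by (rule suminf_emeasure[OF _ disj]) (auto simp: Y_def sets)
    also have "ennreal (10 / c) * \<dots> \<le> ennreal (10 / c) * emeasure \<kappa> (space \<kappa>)"
      by (intro mult_left_mono emeasure_mono) (auto simp: spk)
    finally show "emeasure lborel (\<Union>n. X n) \<le> ennreal (10 / c) * emeasure \<kappa> (space \<kappa>)" .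
    show "(\<Union>n. X n) \<in> sets borel" by (auto simp: X_def)
  qed
qed

text \<open>The Poisson kernel is at most a sum of multiples of indicators of the balls of radius
  2^j s, and the hypothesis bounds the mass of each ball. The resulting geometric series has sum 8 c
  / pi, which is below 3 c because pi > 3.\<close>

lemma poisson_le_maximal:
  fixes \<kappa> :: "real measure"
  assumes sets[measurable_cong]: "sets \<kappa> = sets borel" and c: "c \<ge> 0" and s: "s > 0"
    and le: "\<And>r. r > 0 \<Longrightarrow> emeasure \<kappa> (ball x r) \<le> ennreal (c * r)"
  shows "(\<integral>\<^sup>+t. ennreal (s / pi / ((t - x)\<^sup>2 + s\<^sup>2)) \<partial>\<kappa>) \<le> ennreal (3 * c)"
proof -
  \<comment> \<open>For j \<ge> 1 the kernel outside the ball of radius 2^(j-1) s is at most 1 / (pi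
    s) divided by 4^(j-1), which is \<open>a j\<close>.\<close>
  define a where "a j = 4 / (pi * s) * (1/4) ^ j" for j :: nat
  have a0: "a j \<ge> 0" for j using s by (simp add: a_def)
  have bm: "ball x r \<in> sets \<kappa>" for r by (simp add: sets)
  have ptw: "ennreal (s / pi / ((t - x)\<^sup>2 + s\<^sup>2)) \<le> (\<Sum>j. ennreal (a j) * indicator (ball x (2 ^ j * s)) t)" for t
  proof -
    define v where "v = \<bar>t - x\<bar>"
    have "\<exists>j. v < 2 ^ j * s"
    proof -
      obtain j where "v / s < 2 ^ j" using real_arch_pow[of 2 "v / s"] by auto
      then show ?thesis using s by (auto simp: field_simps)
    qed
    define j where "j = (LEAST j. v < 2 ^ j * s)"
    have j: "v < 2 ^ j * s" unfolding j_def by (rule LeastI_ex) fact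
    have vv: "(t - x)\<^sup>2 = v\<^sup>2" by (simp add: v_def)
    have pos: "v\<^sup>2 + s\<^sup>2 > 0" using s by (simp add: add_nonneg_pos)
    have "s / pi / (v\<^sup>2 + s\<^sup>2) \<le> a j"
    proof (cases j)
      case 0
      have "s / pi / (v\<^sup>2 + s\<^sup>2) \<le> s / pi / s\<^sup>2" using s pos by (intro divide_left_mono mult_pos_pos) auto
      also have "\<dots> = 1 / (pi * s)" using s by (simp add: power2_eq_square)
      also have "\<dots> \<le> 4 / (pi * s)" using s by (intro divide_right_mono) auto
      finally show ?thesis using 0 by (simp add: a_def)
    next
      case (Suc i)
      have "\<not> v < 2 ^ i * s" using not_less_Least[of i "\<lambda>j. v < 2 ^ j * s"] Suc by (simp add: j_def)
      then have "(2 ^ i * s)\<^sup>2 \<le> v\<^sup>2" using s by (intro power_mono) auto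
      then have "s / pi / (v\<^sup>2 + s\<^sup>2) \<le> s / pi / (2 ^ i * s)\<^sup>2"
        using s pos zero_le_power2[of s] by (intro divide_left_mono mult_pos_pos) (linarith | simp)+
      also have "\<dots> = a j"
      proof -
        have "(4::real) ^ i = 2 ^ i * 2 ^ i" by (simp add: power_mult_distrib[symmetric])
        then show ?thesis using s Suc by (simp add: a_def power2_eq_square power_one_over field_simps)
      qed
      finally show ?thesis .
    qed
    then have "ennreal (s / pi / ((t - x)\<^sup>2 + s\<^sup>2)) \<le> ennreal (a j) * indicator (ball x (2 ^ j * s)) t"
      using j unfolding vv by (simp add: ennreal_leI v_def dist_real_def abs_minus_commute)
    also have "\<dots> \<le> (\<Sum>j. ennreal (a j) * indicator (ball x (2 ^ j * s)) t)"
      using sum_le_suminf[of "\<lambda>j. ennreal (a j) * indicator (ball x (2 ^ j * s)) t" "{j}"]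
      by (simp del: sum_mult_indicator)
    finally show ?thesis .
  qed
  have "(\<integral>\<^sup>+t. ennreal (s / pi / ((t - x)\<^sup>2 + s\<^sup>2)) \<partial>\<kappa>) \<le> (\<integral>\<^sup>+t. (\<Sum>j. ennreal (a j) * indicator (ball x (2 ^ j * s)) t) \<partial>\<kappa>)"
    by (intro nn_integral_mono ptw)
  also have "\<dots> = (\<Sum>j. \<integral>\<^sup>+t. ennreal (a j) * indicator (ball x (2 ^ j * s)) t \<partial>\<kappa>)"
    by (intro nn_integral_suminf borel_measurable_times_ennreal borel_measurable_const borel_measurable_indicator bm)
  also have "\<dots> = (\<Sum>j. ennreal (a j) * emeasure \<kappa> (ball x (2 ^ j * s)))"
    by (simp add: nn_integral_cmult_indicator bm)
  also have "\<dots> \<le> (\<Sum>j. ennreal (4 * c / pi * (1/2) ^ j))"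
  proof (intro suminf_le allI)
    fix j
    have "ennreal (a j) * emeasure \<kappa> (ball x (2 ^ j * s)) \<le> ennreal (a j) * ennreal (c * (2 ^ j * s))"
      using s by (intro mult_left_mono le) auto
    also have "\<dots> = ennreal (a j * (c * (2 ^ j * s)))" using a0 by (simp add: ennreal_mult')
    also have "a j * (c * (2 ^ j * s)) = 4 * c / pi * (1/2) ^ j"
    proof -
      have "(1/4 :: real) ^ j * 2 ^ j = (1/2) ^ j" by (simp add: power_mult_distrib[symmetric])
      then show ?thesis using s by (simp add: a_def field_simps)
    qed
    finally show "ennreal (a j) * emeasure \<kappa> (ball x (2 ^ j * s)) \<le> ennreal (4 * c / pi * (1/2) ^ j)" .
  qed auto
  also have "\<dots> = ennreal (\<Sum>j. 4 * c / pi * (1/2) ^ j)"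
    using c by (intro suminf_ennreal2 summable_mult summable_geometric) auto
  also have "(\<Sum>j. 4 * c / pi * (1/2) ^ j) = 8 * c / pi"
    by (subst suminf_mult) (auto simp: suminf_geometric summable_geometric)
  also have "ennreal (8 * c / pi) \<le> ennreal (3 * c)"
  proof (rule ennreal_leI)
    have "8 * c \<le> 3 * c * pi" using pi_gt3 c mult_left_mono[of 3 pi "3 * c"] by linarith
    then show "8 * c / pi \<le> 3 * c" by (simp add: pos_divide_le_eq)
  qed
  finally show ?thesis .
qed

lemma finite_cauchy_measure:
  assumes "finite_measure \<mu>" "sets \<mu> = sets borel"
  shows "cauchy_measure \<mu>"
proof
  interpret finite_measure \<mu> by fact
  show "integrable \<mu> (\<lambda>t. 1 / (1 + \<bar>t\<bar>))"
    by (rule integrable_const_bound[where B = 1])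
       (auto simp: measurable_cong_sets[OF assms(2) refl])
qed fact

lemma Im_cauchy_transform_one:
  assumes "cauchy_measure \<mu>" "Im z > 0"
  shows "Im (cauchy_transform \<mu> (\<lambda>_. 1) z) = (LINT t|\<mu>. Im (1 / (complex_of_real t - z)))"
    and "Im (1 / (complex_of_real t - z)) \<ge> 0"
    and "integrable \<mu> (\<lambda>t. Im (1 / (complex_of_real t - z)))"
    and "Im (cauchy_transform \<mu> (\<lambda>_. 1) z) \<ge> 0"
proof -
  interpret cauchy_measure \<mu> by fact
  have nr: "z \<notin> \<real>" using assms by (auto simp: complex_is_Real_iff)
  note i = integrable_kernel[OF integrable_weight_one nr]
  show 1: "Im (cauchy_transform \<mu> (\<lambda>_. 1) z) = (LINT t|\<mu>. Im (1 / (complex_of_real t - z)))"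
    using i by (simp add: cauchy_transform_def)
  show 2: "Im (1 / (complex_of_real t - z)) \<ge> 0" for t using assms by (simp add: Im_divide)
  show "integrable \<mu> (\<lambda>t. Im (1 / (complex_of_real t - z)))" using i by simp
  show "Im (cauchy_transform \<mu> (\<lambda>_. 1) z) \<ge> 0" unfolding 1 using 2 by (intro integral_nonneg_AE AE_I2)
qed

text \<open>
  For \<open>F\<close> mapping the upper half plane to itself, \<open>G = F / (F + \<i>\<lambda>)\<close> satisfies \<open>\<bar>G\<bar>\<^sup>2 \<le> Re G\<close>, so that
  \<open>\<integral> \<bar>G\<bar>\<^sup>2\<close> over horizontal lines is at most a multiple of \<open>\<mu>(\<real>) / \<lambda>\<close>, while \<open>\<bar>G\<bar> > 1/2\<close> where \<open>\<bar>F\<bar> > \<lambda>\<close>.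
\<close>

lemma cauchy_transform_weak_type_above:
  assumes fin: "finite_measure \<mu>" and sets: "sets \<mu> = sets borel" and lam: "lam > 0" and y0: "y0 > 0"
  shows "{x. \<exists>y>y0. cmod (cauchy_transform \<mu> (\<lambda>_. 1) (Complex x y)) > lam} \<in> sets borel"
    and "emeasure lborel {x. \<exists>y>y0. cmod (cauchy_transform \<mu> (\<lambda>_. 1) (Complex x y)) > lam}
      \<le> ennreal (240 * pi * measure \<mu> UNIV / lam)"
proof -
  interpret finite_measure \<mu> by fact
  interpret cauchy_measure \<mu> by (rule finite_cauchy_measure[OF fin sets])
  have spm: "space \<mu> = UNIV" using sets_eq_imp_space_eq[OF sets] by simp
  define F where "F = cauchy_transform \<mu> (\<lambda>_. 1)"
  define H where "H = {z. Im z > 0}"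
  define m where "m = measure \<mu> UNIV"
  have holF: "F holomorphic_on H"
    unfolding F_def H_def by (rule cauchy_transform_holomorphic[OF integrable_weight_one])
  have ImF: "Im (F z) \<ge> 0" if "z \<in> H" for z
    using Im_cauchy_transform_one(4)[OF cauchy_measure_axioms] that by (simp add: F_def H_def)
  have F_le: "cmod (F z) \<le> m / Im z" if "z \<in> H" for z
  proof -
    have "cmod (F z) \<le> (LINT t|\<mu>. cmod (1 / (complex_of_real t - z)))"
      unfolding F_def cauchy_transform_def by (rule integral_norm_bound)
    also have "\<dots> \<le> (LINT t|\<mu>. 1 / Im z)"
      using that cmod_kernel_le[of z] integrable_kernel[OF integrable_weight_one, of z]
      by (intro integral_mono integrable_norm) (auto simp: H_def complex_is_Real_iff)
    finally show ?thesis by (simp add: m_def spm)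
  qed
  have ne: "F z + \<i> * of_real lam \<noteq> 0" if "z \<in> H" for z
  proof
    assume "F z + \<i> * of_real lam = 0"
    from arg_cong[OF this, of Im] show False using ImF[OF that] lam by simp
  qed
  \<comment> \<open>Where Im F \<ge> 0 all three terms are nonnegative, so |F + i lam| dominates
    both |F| and lam.\<close>
  have sq: "(cmod (F z + \<i> * of_real lam))\<^sup>2 = (cmod (F z))\<^sup>2 + 2 * lam * Im (F z) + lam\<^sup>2" for z
    unfolding cmod_power2 by (simp add: power2_eq_square algebra_simps)
  define G where "G z = F z / (F z + \<i> * of_real lam)" for z
  have holG: "G holomorphic_on H" unfolding G_def[abs_def] by (intro holomorphic_intros holF) (use ne in auto)
  have Gsq: "(cmod (G z))\<^sup>2 \<le> Re (G z)" if z: "z \<in> H" for z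
  proof -
    define D where "D = (cmod (F z + \<i> * of_real lam))\<^sup>2"
    have D: "D > 0" using ne[OF z] by (simp add: D_def)
    have "Re (G z) = ((cmod (F z))\<^sup>2 + lam * Im (F z)) / D"
      unfolding G_def Re_divide D_def cmod_power2 by (simp add: power2_eq_square algebra_simps)
    moreover have "(cmod (G z))\<^sup>2 = (cmod (F z))\<^sup>2 / D" by (simp add: G_def norm_divide power_divide D_def)
    ultimately show ?thesis using D ImF[OF z] lam by (simp add: divide_right_mono)
  qed
  have G1: "cmod (G z) \<le> 1" if z: "z \<in> H" for z
  proof -
    have "(cmod (F z))\<^sup>2 \<le> (cmod (F z + \<i> * of_real lam))\<^sup>2" unfolding sq using ImF[OF z] lam by simp
    then have "cmod (F z) \<le> cmod (F z + \<i> * of_real lam)" by (rule power2_le_imp_le) simp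
    then show ?thesis using ne[OF z] by (simp add: G_def norm_divide)
  qed
  have G2: "cmod (G z) \<le> (m / lam) / Im z" if z: "z \<in> H" for z
  proof -
    have "lam\<^sup>2 \<le> (cmod (F z + \<i> * of_real lam))\<^sup>2" unfolding sq using ImF[OF z] lam by simp
    then have l: "lam \<le> cmod (F z + \<i> * of_real lam)" by (rule power2_le_imp_le) simp
    have "cmod (G z) \<le> cmod (F z) / lam"
      unfolding G_def norm_divide using l lam by (intro divide_left_mono mult_pos_pos) auto
    also have "\<dots> \<le> (m / Im z) / lam" using F_le[OF z] lam by (intro divide_right_mono) auto
    finally show ?thesis by (simp add: mult.commute)
  qed
  have lineH: "Complex x y0 \<in> H" for x using y0 by (simp add: H_def)
  \<comment> \<open>The measure |G|^2 dx on the line Im z = y0. Its mass is at most 2 pi m / lam by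
    the half-plane estimate for i G.\<close>
  define \<kappa> where "\<kappa> = density lborel (\<lambda>x. ennreal ((cmod (G (Complex x y0)))\<^sup>2))"
  have contG: "continuous_on UNIV (\<lambda>x. G (Complex x y0))"
    by (rule continuous_on_compose2[OF holomorphic_on_imp_continuous_on[OF holG]])
       (use lineH in \<open>auto simp: Complex_eq intro!: continuous_intros\<close>)
  have mG[measurable]: "(\<lambda>x. (cmod (G (Complex x y0)))\<^sup>2) \<in> borel_measurable borel"
    by (intro borel_measurable_continuous_onI continuous_intros contG)
  have kle: "emeasure \<kappa> (space \<kappa>) \<le> ennreal (2 * pi * (m / lam))"
  proof -
    have "emeasure \<kappa> (space \<kappa>) = (\<integral>\<^sup>+x. ennreal ((cmod (G (Complex x y0)))\<^sup>2) \<partial>lborel)"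
      unfolding \<kappa>_def by (subst emeasure_density) (auto simp: space_density)
    also have "\<dots> \<le> (\<integral>\<^sup>+x. ennreal (Im (\<i> * G (Complex x y0))) \<partial>lborel)"
      using Gsq[OF lineH] by (intro nn_integral_mono ennreal_leI) simp
    also have "\<dots> \<le> ennreal (2 * pi * (m / lam))"
    proof (rule halfplane_integral_bound[where \<phi> = "\<lambda>z. \<i> * G z"])
      show "(\<lambda>z. \<i> * G z) holomorphic_on {z. 0 < Im z}" using holG by (auto simp: H_def intro!: holomorphic_intros)
      show "0 \<le> Im (\<i> * G z)" if "0 < Im z" for z using Gsq[of z] that order_trans[OF zero_le_power2] by (simp add: H_def)
      show "cmod (\<i> * G z) \<le> (m / lam) / Im z" if "0 < Im z" for z using G2[of z] that by (simp add: H_def norm_mult)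
    qed (rule y0)
    finally show ?thesis .
  qed
  have fink: "finite_measure \<kappa>"
    by (rule finite_measureI) (use kle in \<open>auto simp: top_unique\<close>)
  have setsk: "sets \<kappa> = sets borel" by (simp add: \<kappa>_def)
  \<comment> \<open>The level 1/12 is chosen so that three times it is 1/4, the lower bound for
    |G|^2 where |F| > lam. It makes the final constant 10 * 12 * 2 pi.\<close>
  obtain V where V: "V \<in> sets borel" "{x. \<exists>r>0. emeasure \<kappa> (ball x r) > ennreal (1/12 * r)} \<subseteq> V"
      "emeasure lborel V \<le> ennreal (10 / (1/12)) * emeasure \<kappa> (space \<kappa>)"
    using maximal_ball_weak_type[OF fink setsk, of "1/12"] by auto
  define U where "U = {x. \<exists>y>y0. cmod (F (Complex x y)) > lam}"
  have UV: "U \<subseteq> V"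
  proof
    fix x assume "x \<in> U"
    then obtain y where y: "y > y0" "cmod (F (Complex x y)) > lam" by (auto simp: U_def)
    define z where "z = Complex x y"
    have z: "z \<in> H" using y y0 by (simp add: z_def H_def)
    have "cmod (F z + \<i> * of_real lam) \<le> cmod (F z) + lam"
      using norm_triangle_ineq[of "F z" "\<i> * of_real lam"] lam by (simp add: norm_mult)
    also have "\<dots> < 2 * cmod (F z)" using y by (simp add: z_def)
    finally have Gz: "cmod (G z) > 1/2" using ne[OF z] by (simp add: G_def norm_divide field_simps)
    have "(1/2)\<^sup>2 < (cmod (G z))\<^sup>2" using Gz by (intro power_strict_mono) auto
    then have G4: "1/4 < cmod ((G z)\<^sup>2)" by (simp add: norm_power) (simp add: power2_eq_square)
    show "x \<in> V"
    proof (rule ccontr)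
      assume "x \<notin> V"
      then have le: "emeasure \<kappa> (ball x r) \<le> ennreal (1/12 * r)" if "r > 0" for r
        using V(2) that by (force simp: not_less)
      define s where "s = y - y0"
      have s: "s > 0" using y by (simp add: s_def)
      have zz: "Complex x y0 + \<i> * of_real s = z" by (simp add: z_def s_def complex_eq_iff)
      have line: "Complex x y0 + of_real v = Complex (x + v) y0" for v by (simp add: complex_eq_iff)
      \<comment> \<open>The Poisson inequality is applied to G^2, since the estimate on the line is
        one for the integral of |G|^2.\<close>
      have "ennreal (cmod ((G z)\<^sup>2)) \<le> (\<integral>\<^sup>+v. ennreal (s / pi / (v\<^sup>2 + s\<^sup>2) * cmod ((G (Complex (x + v) y0))\<^sup>2)) \<partial>lborel)"
      proof -
        have "ennreal (cmod ((\<lambda>z. (G z)\<^sup>2) (Complex x y0 + \<i> * of_real s)))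
          \<le> (\<integral>\<^sup>+v. ennreal (s / pi / (v\<^sup>2 + s\<^sup>2) * cmod ((\<lambda>z. (G z)\<^sup>2) (Complex x y0 + of_real v))) \<partial>lborel)"
        proof (rule poisson_kernel_bound[where b = 0 and B = 1])
          show "(\<lambda>z. (G z)\<^sup>2) holomorphic_on {z. 0 < Im z}" using holG by (auto simp: H_def intro!: holomorphic_intros)
          show "cmod ((G z)\<^sup>2) \<le> 1" if "0 < Im z" for z using G1[of z] that by (simp add: norm_power power_le_one H_def)
        qed (use y0 s in auto)
        then show ?thesis unfolding zz line by simp
      qed
      also have "\<dots> = (\<integral>\<^sup>+t. ennreal (s / pi / ((t - x)\<^sup>2 + s\<^sup>2) * (cmod (G (Complex t y0)))\<^sup>2) \<partial>lborel)"
        by (subst nn_integral_real_affine[where c = 1 and t = x]) (auto simp: norm_power intro!: measurable_compose[OF _ measurable_ennreal])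
      also have "\<dots> = (\<integral>\<^sup>+t. ennreal (s / pi / ((t - x)\<^sup>2 + s\<^sup>2)) \<partial>\<kappa>)"
        unfolding \<kappa>_def using s by (subst nn_integral_density) (auto simp: ennreal_mult'[symmetric] mult.commute intro!: nn_integral_cong)
      also have "\<dots> \<le> ennreal (3 * (1/12))"
        by (rule poisson_le_maximal[OF setsk _ s le]) auto
      finally have "cmod ((G z)\<^sup>2) \<le> 1/4" by simp
      then show False using G4 by simp
    qed
  qed
  \<comment> \<open>A union of open sets over all y, hence measurable although y ranges over an
    uncountable set.\<close>
  have "open U"
  proof -
    have "open {x. cmod (F (Complex x y)) > lam}" if y: "y > y0" for y
    proof (rule open_Collect_less)
      show "continuous_on UNIV (\<lambda>x. cmod (F (Complex x y)))"
        by (intro continuous_on_norm continuous_on_compose2[OF holomorphic_on_imp_continuous_on[OF holF]])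
           (use y y0 in \<open>auto simp: Complex_eq H_def intro!: continuous_intros\<close>)
    qed auto
    moreover have "U = (\<Union>y\<in>{y0<..}. {x. cmod (F (Complex x y)) > lam})" by (auto simp: U_def)
    ultimately show ?thesis by (auto intro!: open_UN)
  qed
  then show "{x. \<exists>y>y0. cmod (cauchy_transform \<mu> (\<lambda>_. 1) (Complex x y)) > lam} \<in> sets borel"
    by (simp add: U_def F_def)
  have "emeasure lborel U \<le> emeasure lborel V" using UV V(1) by (intro emeasure_mono) auto
  also have "\<dots> \<le> ennreal (10 / (1/12)) * ennreal (2 * pi * (m / lam))"
    by (rule order_trans[OF V(3)]) (intro mult_left_mono kle, simp)
  also have "\<dots> = ennreal (10 / (1/12) * (2 * pi * (m / lam)))" by (rule ennreal_mult'[symmetric]) simp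
  also have "10 / (1/12) * (2 * pi * (m / lam)) = 240 * pi * measure \<mu> UNIV / lam" by (simp add: m_def)
  finally show "emeasure lborel {x. \<exists>y>y0. cmod (cauchy_transform \<mu> (\<lambda>_. 1) (Complex x y)) > lam}
      \<le> ennreal (240 * pi * measure \<mu> UNIV / lam)"
    by (simp add: U_def F_def)
qed

text \<open>The bound above the line Im z = y0 does not depend on y0, and the sets increase as y0
  decreases to 0.\<close>

lemma cauchy_transform_weak_type:
  assumes fin: "finite_measure \<mu>" and sets: "sets \<mu> = sets borel" and lam: "lam > 0"
  shows "{x. \<exists>y>0. cmod (cauchy_transform \<mu> (\<lambda>_. 1) (Complex x y)) > lam} \<in> sets borel"
    and "emeasure lborel {x. \<exists>y>0. cmod (cauchy_transform \<mu> (\<lambda>_. 1) (Complex x y)) > lam}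
      \<le> ennreal (240 * pi * measure \<mu> UNIV / lam)"
proof -
  define U where "U n = {x. \<exists>y>1 / real (Suc n). cmod (cauchy_transform \<mu> (\<lambda>_. 1) (Complex x y)) > lam}" for n
  have U: "U n \<in> sets borel" "emeasure lborel (U n) \<le> ennreal (240 * pi * measure \<mu> UNIV / lam)" for n
    unfolding U_def by (intro cauchy_transform_weak_type_above fin sets lam; simp)+
  have inc: "incseq U"
  proof (rule incseq_SucI)
    fix n
    have "1 / real (Suc (Suc n)) \<le> 1 / real (Suc n)" by (simp add: frac_le)
    then show "U n \<subseteq> U (Suc n)" unfolding U_def using order_le_less_trans by blast
  qed
  have eq: "{x. \<exists>y>0. cmod (cauchy_transform \<mu> (\<lambda>_. 1) (Complex x y)) > lam} = (\<Union>n. U n)"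
  proof (intro equalityI subsetI)
    fix x assume "x \<in> {x. \<exists>y>0. cmod (cauchy_transform \<mu> (\<lambda>_. 1) (Complex x y)) > lam}"
    then obtain y where y: "y > 0" "cmod (cauchy_transform \<mu> (\<lambda>_. 1) (Complex x y)) > lam" by auto
    obtain n where "1 / real (Suc n) < y" using nat_approx_posE[OF y(1)] by blast
    then show "x \<in> (\<Union>n. U n)" using y by (auto simp: U_def)
  next
    fix x assume "x \<in> (\<Union>n. U n)"
    then obtain n y where y: "y > 1 / real (Suc n)" "cmod (cauchy_transform \<mu> (\<lambda>_. 1) (Complex x y)) > lam"
      by (auto simp: U_def)
    have "0 < 1 / real (Suc n)" by simp
    then have "y > 0" using y(1) by linarith
    then show "x \<in> {x. \<exists>y>0. cmod (cauchy_transform \<mu> (\<lambda>_. 1) (Complex x y)) > lam}" using y(2) by blast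
  qed
  show "{x. \<exists>y>0. cmod (cauchy_transform \<mu> (\<lambda>_. 1) (Complex x y)) > lam} \<in> sets borel"
    unfolding eq using U(1) by auto
  have "emeasure lborel (\<Union>n. U n) = (SUP n. emeasure lborel (U n))"
    using U(1) inc by (intro SUP_emeasure_incseq[symmetric]) auto
  also have "\<dots> \<le> ennreal (240 * pi * measure \<mu> UNIV / lam)" by (intro SUP_least U)
  finally show "emeasure lborel {x. \<exists>y>0. cmod (cauchy_transform \<mu> (\<lambda>_. 1) (Complex x y)) > lam}
      \<le> ennreal (240 * pi * measure \<mu> UNIV / lam)" unfolding eq .
qed

section \<open>Boundary values of Cauchy transforms\<close>

definition trunc :: "real measure \<Rightarrow> (real \<Rightarrow> complex) \<Rightarrow> real \<Rightarrow> real \<Rightarrow> complex" where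
  "trunc M g \<delta> x = (LINT t:{t. \<bar>x - t\<bar> > \<delta>}|M. g t / complex_of_real (x - t))"

definition trunc_kernel :: "real \<Rightarrow> real \<Rightarrow> real \<Rightarrow> complex" where
  "trunc_kernel \<delta> x t = indicator {t. \<bar>x - t\<bar> > \<delta>} t / complex_of_real (x - t)"

lemma trunc_eq: "trunc M g \<delta> x = (LINT t|M. g t * trunc_kernel \<delta> x t)"
  unfolding trunc_def set_lebesgue_integral_def trunc_kernel_def
  by (intro Bochner_Integration.integral_cong) (auto split: split_indicator)

lemma cauchy_transform_eq: "cauchy_transform M g z = (LINT t|M. g t * (1 / (complex_of_real t - z)))"
  by (simp add: cauchy_transform_def)

lemma trunc_kernel_measurable [measurable]: "trunc_kernel \<delta> x \<in> borel_measurable borel"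
  unfolding trunc_kernel_def[abs_def] by measurable

lemma trunc_kernel_bound: "\<delta> > 0 \<Longrightarrow> cmod (trunc_kernel \<delta> x t) \<le> 1 / \<delta>"
  by (auto simp: trunc_kernel_def norm_divide frac_le split: split_indicator simp flip: of_real_diff)

lemma cauchy_kernel_bound_Complex: "\<delta> > 0 \<Longrightarrow> cmod (1 / (complex_of_real t - Complex x \<delta>)) \<le> 1 / \<delta>"
  using abs_Im_le_cmod[of "complex_of_real t - Complex x \<delta>"] by (simp add: norm_divide frac_le)

text \<open>The two kernels have opposite signs, so their sum is the discrepancy, to be controlled
  by \<delta> / |t - z|^2 with z = x + i \<delta>. For |t - x| > \<delta> it has modulus \<delta> /
  (|t - x| |t - z|), and |t - z| \<le> 2 |t - x|. Otherwise the truncated kernel is 0 and |t - z|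
  \<le> 2 \<delta>.\<close>

lemma kernel_sum_bound:
  assumes d: "\<delta> > 0"
  shows "cmod (1 / (complex_of_real t - Complex x \<delta>) + trunc_kernel \<delta> x t) \<le> 2 * Im (1 / (complex_of_real t - Complex x \<delta>))"
proof -
  define v where "v = t - x"
  define R where "R = cmod (complex_of_real t - Complex x \<delta>)"
  have R2: "R\<^sup>2 = v\<^sup>2 + \<delta>\<^sup>2" by (simp add: R_def cmod_power2 v_def)
  have Rp: "R > 0" using R2 d by (simp add: R_def complex_eq_iff)
  have Im: "Im (1 / (complex_of_real t - Complex x \<delta>)) = \<delta> / R\<^sup>2"
    by (simp add: Im_divide R_def cmod_power2)
  have ne: "complex_of_real t - Complex x \<delta> \<noteq> 0" using d by (simp add: complex_eq_iff)
  show ?thesis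
  proof (cases "\<bar>x - t\<bar> > \<delta>")
    case True
    then have vd: "\<bar>v\<bar> > \<delta>" by (simp add: v_def abs_minus_commute)
    have e: "1 / (complex_of_real t - Complex x \<delta>) + trunc_kernel \<delta> x t = \<i> * of_real \<delta> / (of_real v * (complex_of_real t - Complex x \<delta>))"
    proof -
      define r where "r = complex_of_real (x - t)"
      define D where "D = - r - \<i> * of_real \<delta>"
      have r: "r \<noteq> 0" unfolding r_def of_real_eq_0_iff using True d by auto
      have v: "complex_of_real v = - r" by (simp add: r_def v_def)
      have D: "complex_of_real t - Complex x \<delta> = D" by (simp add: D_def r_def complex_eq_iff)
      have "D \<noteq> 0" using ne D by simp
      then have "1 / D + 1 / r = \<i> * of_real \<delta> / (- r * D)"
        using r by (simp add: divide_simps) (simp add: D_def algebra_simps)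
      then show ?thesis unfolding trunc_kernel_def D v r_def[symmetric] using True by simp
    qed
    have "\<delta>\<^sup>2 \<le> v\<^sup>2" using vd d by (intro abs_le_square_iff[THEN iffD1]) simp
    then have "R\<^sup>2 \<le> 4 * v\<^sup>2" unfolding R2 using zero_le_power2[of v] by linarith
    then have "R\<^sup>2 \<le> (2 * \<bar>v\<bar>)\<^sup>2" by (simp add: power_mult_distrib)
    then have "R \<le> 2 * \<bar>v\<bar>" by (rule power2_le_imp_le) simp
    then have "\<delta> * R * R \<le> \<delta> * R * (2 * \<bar>v\<bar>)" using d Rp by (intro mult_left_mono) auto
    then have "\<delta> / (\<bar>v\<bar> * R) \<le> 2 * (\<delta> / R\<^sup>2)" using vd d Rp by (simp add: divide_simps power2_eq_square mult_ac)
    then show ?thesis unfolding Im e by (simp add: norm_divide norm_mult R_def d less_imp_le)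
  next
    case False
    then have vd: "\<bar>v\<bar> \<le> \<delta>" by (simp add: v_def abs_minus_commute)
    then have "v\<^sup>2 \<le> \<delta>\<^sup>2" using d by (intro abs_le_square_iff[THEN iffD1]) simp
    then have "R\<^sup>2 \<le> 4 * \<delta>\<^sup>2" unfolding R2 using zero_le_power2[of \<delta>] by linarith
    then have "R\<^sup>2 \<le> (2 * \<delta>)\<^sup>2" by (simp add: power_mult_distrib)
    then have "R \<le> 2 * \<delta>" by (rule power2_le_imp_le) (use d in simp)
    then have "1 / R \<le> 2 * (\<delta> / R\<^sup>2)" using Rp by (simp add: divide_simps power2_eq_square)
    then show ?thesis unfolding Im using False by (simp add: trunc_kernel_def norm_divide R_def)
  qed
qed

text \<open>For nonnegative \<open>h\<close> the bound of \<open>kernel_sum_bound\<close> integrates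
  to 2 Im F \<le> 2 |F|, where F is the Cauchy transform. Positivity is essential to this passage,
  so complex functions are split into four nonnegative ones.\<close>

lemma trunc_le_cauchy_transform:
  fixes h :: "real \<Rightarrow> real"
  assumes sets: "sets M = sets borel" and h: "integrable M h" and h0: "\<And>t. h t \<ge> 0" and d: "\<delta> > 0"
  shows "cmod (trunc M (\<lambda>t. of_real (h t)) \<delta> x) \<le> 3 * cmod (cauchy_transform M (\<lambda>t. of_real (h t)) (Complex x \<delta>))"
proof -
  let ?g = "\<lambda>t. complex_of_real (h t)" and ?k = "\<lambda>t. 1 / (complex_of_real t - Complex x \<delta>)"
  have g: "integrable M ?g" using h by simp
  have i1: "integrable M (\<lambda>t. ?g t * ?k t)"
    by (rule integrable_mult_bounded[OF sets g _ cauchy_kernel_bound_Complex[OF d]]) measurable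
  have i2: "integrable M (\<lambda>t. ?g t * trunc_kernel \<delta> x t)"
    by (rule integrable_mult_bounded[OF sets g _ trunc_kernel_bound[OF d]]) measurable
  let ?F = "cauchy_transform M ?g (Complex x \<delta>)"
  have "?F + trunc M ?g \<delta> x = (LINT t|M. ?g t * (?k t + trunc_kernel \<delta> x t))"
    unfolding cauchy_transform_eq trunc_eq distrib_left using i1 i2 by simp
  also have "cmod \<dots> \<le> (LINT t|M. 2 * Im (?g t * ?k t))"
  proof (rule order_trans[OF integral_norm_bound], rule integral_mono)
    show "integrable M (\<lambda>t. norm (?g t * (?k t + trunc_kernel \<delta> x t)))"
      unfolding distrib_left using i1 i2 by (intro integrable_norm Bochner_Integration.integrable_add)
    show "integrable M (\<lambda>t. 2 * Im (?g t * ?k t))" using i1 by simp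
    fix t
    have "cmod (?g t * (?k t + trunc_kernel \<delta> x t)) = h t * cmod (?k t + trunc_kernel \<delta> x t)"
      using h0 by (simp add: norm_mult)
    also have "\<dots> \<le> h t * (2 * Im (?k t))" by (intro mult_left_mono kernel_sum_bound d h0)
    also have "\<dots> = 2 * Im (?g t * ?k t)" by (simp del: times_divide_eq_right)
    finally show "cmod (?g t * (?k t + trunc_kernel \<delta> x t)) \<le> 2 * Im (?g t * ?k t)" .
  qed
  also have "\<dots> = 2 * Im ?F" using i1 unfolding cauchy_transform_eq by simp
  also have "\<dots> \<le> 2 * cmod ?F" using abs_Im_le_cmod[of ?F] by simp
  finally show ?thesis using norm_triangle_ineq2[of "trunc M ?g \<delta> x" "- ?F"] by (simp add: add.commute)
qed

text \<open>Absorbing \<open>h\<close> into the measure leaves the Cauchy transform of the constant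
  1 for a finite measure.\<close>

lemma cauchy_transform_density_weak_type:
  fixes h :: "real \<Rightarrow> real"
  assumes sets: "sets M = sets borel" and h: "integrable M h" and h0: "\<And>t. h t \<ge> 0" and lam: "lam > 0"
  shows "\<exists>V\<in>sets borel. {x. \<exists>y>0. cmod (cauchy_transform M (\<lambda>t. of_real (h t)) (Complex x y)) > lam} \<subseteq> V \<and>
    emeasure lborel V \<le> ennreal (240 * pi * (LINT t|M. h t) / lam)"
proof -
  define \<mu> where "\<mu> = density M (\<lambda>t. ennreal (h t))"
  have spM: "space M = UNIV" using sets_eq_imp_space_eq[OF sets] by simp
  have hm[measurable]: "h \<in> borel_measurable M" using h by simp
  have em: "emeasure \<mu> (space \<mu>) = ennreal (LINT t|M. h t)"
    unfolding \<mu>_def using h h0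
    by (subst emeasure_density) (auto simp: space_density nn_integral_eq_integral cong: nn_integral_cong)
  have fin: "finite_measure \<mu>" by (rule finite_measureI) (simp add: em)
  have setsm: "sets \<mu> = sets borel" by (simp add: \<mu>_def sets)
  have ms: "measure \<mu> UNIV = (LINT t|M. h t)"
    using em h0 by (simp add: measure_def \<mu>_def space_density spM)
  have ct: "cauchy_transform \<mu> (\<lambda>_. 1) z = cauchy_transform M (\<lambda>t. of_real (h t)) z" for z
  proof -
    have "(\<lambda>t. 1 / (complex_of_real t - z)) \<in> borel_measurable M"
      by (subst measurable_cong_sets[OF sets refl]) measurable
    then show ?thesis
      unfolding cauchy_transform_eq \<mu>_def using h0 hm
      by (subst integral_density) (auto simp: scaleR_conv_of_real)
  qed
  note W = cauchy_transform_weak_type[OF fin setsm lam, unfolded ct ms]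
  show ?thesis by (rule bexI[OF _ W(1)]) (intro conjI subset_refl W(2))
qed

text \<open>The kernel is arbitrary but bounded, so that the splitting serves the Cauchy kernel and
  the truncated one alike.\<close>

lemma kernel_integral_split:
  fixes g k :: "real \<Rightarrow> complex"
  assumes sets: "sets M = sets borel" and g: "integrable M g"
    and k: "k \<in> borel_measurable borel" "\<And>t. cmod (k t) \<le> B"
  shows "(LINT t|M. g t * k t) = (LINT t|M. of_real (max 0 (Re (g t))) * k t) - (LINT t|M. of_real (max 0 (- Re (g t))) * k t)
    + \<i> * (LINT t|M. of_real (max 0 (Im (g t))) * k t) - \<i> * (LINT t|M. of_real (max 0 (- Im (g t))) * k t)"
proof -
  have i: "integrable M (\<lambda>t. complex_of_real (max 0 (Re (g t))))" "integrable M (\<lambda>t. complex_of_real (max 0 (- Re (g t))))"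
     "integrable M (\<lambda>t. complex_of_real (max 0 (Im (g t))))" "integrable M (\<lambda>t. complex_of_real (max 0 (- Im (g t))))"
    using g by (auto intro!: integrable_of_real integrable_max)
  note ik = i[THEN integrable_mult_bounded[OF sets _ k]]
  have eq: "g t * k t = of_real (max 0 (Re (g t))) * k t - of_real (max 0 (- Re (g t))) * k t
     + \<i> * (of_real (max 0 (Im (g t))) * k t) - \<i> * (of_real (max 0 (- Im (g t))) * k t)" for t
  proof -
    have "g t = of_real (max 0 (Re (g t))) - of_real (max 0 (- Re (g t))) + \<i> * of_real (max 0 (Im (g t))) - \<i> * of_real (max 0 (- Im (g t)))"
      by (simp add: complex_eq_iff max_def)
    from arg_cong[OF this, of "\<lambda>u. u * k t"] show ?thesis by (simp add: algebra_simps)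
  qed
  have ik': "integrable M (\<lambda>t. \<i> * (of_real (max 0 (Im (g t))) * k t))" "integrable M (\<lambda>t. \<i> * (of_real (max 0 (- Im (g t))) * k t))"
    using ik by (auto intro!: integrable_mult_right)
  show ?thesis
    unfolding eq using ik ik'
    by (simp only: Bochner_Integration.integral_diff Bochner_Integration.integral_add Bochner_Integration.integrable_diff
        Bochner_Integration.integrable_add integral_mult_right_zero)
qed

text \<open>Its supremum over \<delta> is the maximal operator that governs almost everywhere
  convergence of the Cauchy transform and of the principal value at the same time.\<close>

definition cauchy_trunc_size :: "real measure \<Rightarrow> (real \<Rightarrow> complex) \<Rightarrow> real \<Rightarrow> real \<Rightarrow> real" where
  "cauchy_trunc_size M g x \<delta> = cmod (cauchy_transform M g (Complex x \<delta>)) + cmod (trunc M g \<delta> x)"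

text \<open>Each of the four nonnegative parts contributes at most 1 + 3 times the modulus of its
  Cauchy transform, so a size above 16 lam forces one of the four above lam. The constant 960 is 4 *
  240.\<close>

lemma cauchy_trunc_size_weak_type:
  assumes sets: "sets M = sets borel" and g: "integrable M g" and lam: "lam > 0"
  shows "\<exists>V\<in>sets borel. {x. \<exists>\<delta>>0. cauchy_trunc_size M g x \<delta> > 16 * lam} \<subseteq> V \<and>
    emeasure lborel V \<le> ennreal (960 * pi / lam * (LINT t|M. cmod (g t)))"
proof -
  define h where "h = (\<lambda>i::nat. if i = 0 then (\<lambda>t. max 0 (Re (g t))) else if i = 1 then (\<lambda>t. max 0 (- Re (g t)))
     else if i = 2 then (\<lambda>t. max 0 (Im (g t))) else (\<lambda>t. max 0 (- Im (g t))))"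
  have hi: "integrable M (h i)" for i
    using g by (auto simp: h_def intro!: integrable_max)
  have h0: "h i t \<ge> 0" for i t by (simp add: h_def)
  have hg: "h i t \<le> cmod (g t)" for i t
    using abs_Re_le_cmod[of "g t"] abs_Im_le_cmod[of "g t"] by (auto simp: h_def)
  define S where "S i = {x. \<exists>y>0. cmod (cauchy_transform M (\<lambda>t. of_real (h i t)) (Complex x y)) > lam}" for i
  have "\<exists>V. V \<in> sets borel \<and> S i \<subseteq> V \<and> emeasure lborel V \<le> ennreal (240 * pi * (LINT t|M. h i t) / lam)" for i
    using cauchy_transform_density_weak_type[OF sets hi[of i] h0[of i] lam] unfolding Bex_def S_def[symmetric] .
  then have "\<forall>i. \<exists>V. V \<in> sets borel \<and> S i \<subseteq> V \<and> emeasure lborel V \<le> ennreal (240 * pi * (LINT t|M. h i t) / lam)" by blast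
  from choice[OF this] obtain V where V: "\<And>i. V i \<in> sets borel" "\<And>i. S i \<subseteq> V i"
    "\<And>i. emeasure lborel (V i) \<le> ennreal (240 * pi * (LINT t|M. h i t) / lam)" by blast
  have le: "cauchy_trunc_size M g x \<delta> \<le> (\<Sum>i<4. 4 * cmod (cauchy_transform M (\<lambda>t. of_real (h i t)) (Complex x \<delta>)))" if d: "\<delta> > 0" for x \<delta>
  proof -
    have tri: "cmod (a - b + \<i> * c - \<i> * e) \<le> cmod a + cmod b + cmod c + cmod e" for a b c e :: complex
      using norm_triangle_ineq4[of "a - b + \<i> * c" "\<i> * e"] norm_triangle_ineq[of "a - b" "\<i> * c"] norm_triangle_ineq4[of a b]
      by (simp add: norm_mult)
    have s4: "(\<Sum>i<4. f i) = f 0 + f 1 + f 2 + f (3::nat)" for f :: "nat \<Rightarrow> real" by (simp add: eval_nat_numeral)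
    have hs: "h 0 = (\<lambda>t. max 0 (Re (g t)))" "h 1 = (\<lambda>t. max 0 (- Re (g t)))"
       "h 2 = (\<lambda>t. max 0 (Im (g t)))" "h 3 = (\<lambda>t. max 0 (- Im (g t)))"
      by (simp_all add: h_def)
    have "(\<lambda>t. 1 / (complex_of_real t - Complex x \<delta>)) \<in> borel_measurable borel" by measurable
    note k1 = kernel_integral_split[OF sets g this cauchy_kernel_bound_Complex[OF d]]
    note k2 = kernel_integral_split[OF sets g trunc_kernel_measurable trunc_kernel_bound[OF d]]
    have "cmod (cauchy_transform M g (Complex x \<delta>)) \<le> (\<Sum>i<4. cmod (cauchy_transform M (\<lambda>t. of_real (h i t)) (Complex x \<delta>)))"
      unfolding s4 hs cauchy_transform_eq k1 by (rule tri)
    moreover have "cmod (trunc M g \<delta> x) \<le> (\<Sum>i<4. cmod (trunc M (\<lambda>t. of_real (h i t)) \<delta> x))"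
      unfolding s4 hs trunc_eq k2 by (rule tri)
    moreover have "(\<Sum>i<4. cmod (trunc M (\<lambda>t. of_real (h i t)) \<delta> x)) \<le> (\<Sum>i<4. 3 * cmod (cauchy_transform M (\<lambda>t. of_real (h i t)) (Complex x \<delta>)))"
      by (intro sum_mono trunc_le_cauchy_transform sets hi h0 d)
    ultimately show ?thesis unfolding cauchy_trunc_size_def sum_distrib_left[symmetric] by linarith
  qed
  show ?thesis
  proof (intro bexI[of _ "\<Union>i<4. V i"] conjI)
    show "{x. \<exists>\<delta>>0. cauchy_trunc_size M g x \<delta> > 16 * lam} \<subseteq> (\<Union>i<4. V i)"
    proof
      fix x assume "x \<in> {x. \<exists>\<delta>>0. cauchy_trunc_size M g x \<delta> > 16 * lam}"
      then obtain \<delta> where d: "\<delta> > 0" "cauchy_trunc_size M g x \<delta> > 16 * lam" by auto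
      have "\<exists>i<4. cmod (cauchy_transform M (\<lambda>t. of_real (h i t)) (Complex x \<delta>)) > lam"
      proof (rule ccontr)
        assume "\<not> ?thesis"
        then have "cmod (cauchy_transform M (\<lambda>t. of_real (h i t)) (Complex x \<delta>)) \<le> lam" if "i < 4" for i
          using that not_le_imp_less by blast
        then have "(\<Sum>i<4. 4 * cmod (cauchy_transform M (\<lambda>t. of_real (h i t)) (Complex x \<delta>))) \<le> (\<Sum>i<(4::nat). 4 * lam)"
          by (intro sum_mono mult_left_mono) (auto simp: not_less)
        then show False using le[OF d(1), of x] d(2) by simp
      qed
      then obtain i where i: "i < 4" "cmod (cauchy_transform M (\<lambda>t. of_real (h i t)) (Complex x \<delta>)) > lam" by blast
      then have "x \<in> V i" using d(1) by (intro subsetD[OF V(2)]) (auto simp: S_def)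
      then show "x \<in> (\<Union>i<4. V i)" using i(1) by blast
    qed
    have "emeasure lborel (\<Union>i<4. V i) \<le> (\<Sum>i<4. emeasure lborel (V i))"
      using V(1) by (intro emeasure_subadditive_finite) auto
    also have "\<dots> \<le> (\<Sum>i<(4::nat). ennreal (240 * pi * (LINT t|M. cmod (g t)) / lam))"
    proof (intro sum_mono order_trans[OF V(3)] ennreal_leI divide_right_mono mult_left_mono)
      show "(LINT t|M. h i t) \<le> (LINT t|M. cmod (g t))" for i
        using hi g hg by (intro integral_mono) auto
    qed (use lam in auto)
    also have "\<dots> = of_nat 4 * ennreal (240 * pi * (LINT t|M. cmod (g t)) / lam)" by simp
    also have "\<dots> = ennreal (960 * pi / lam * (LINT t|M. cmod (g t)))"
      by (simp add: ennreal_mult'[symmetric] mult_ac flip: ennreal_numeral)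
    finally show "emeasure lborel (\<Union>i<4. V i) \<le> ennreal (960 * pi / lam * (LINT t|M. cmod (g t)))" .
    show "(\<Union>i<4. V i) \<in> sets borel" using V(1) by auto
  qed
qed

text \<open>
  \<open>trunc\<close> is \<open>\<pi>\<close> times the truncated Hilbert transform; \<open>d\<close> is the density of \<open>g dM\<close> at \<open>x\<close>.
\<close>

definition plemelj :: "real measure \<Rightarrow> (real \<Rightarrow> complex) \<Rightarrow> complex \<Rightarrow> real \<Rightarrow> bool" where
  "plemelj M g d x \<longleftrightarrow>
     ((\<lambda>\<delta>. cauchy_transform M g (Complex x \<delta>) + trunc M g \<delta> x) \<longlongrightarrow> \<i> * of_real pi * d) (at_right 0) \<and>
     (\<exists>l. ((\<lambda>\<delta>. trunc M g \<delta> x) \<longlongrightarrow> l) (at_right 0))"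

lemma plemelj_combine:
  assumes 1: "plemelj M1 g1 d1 x" and 2: "plemelj M2 g2 d2 x"
    and ct: "\<And>\<delta>. \<delta> > 0 \<Longrightarrow> cauchy_transform M g (Complex x \<delta>) = cauchy_transform M1 g1 (Complex x \<delta>) + a * cauchy_transform M2 g2 (Complex x \<delta>)"
    and tr: "\<And>\<delta>. \<delta> > 0 \<Longrightarrow> trunc M g \<delta> x = trunc M1 g1 \<delta> x + a * trunc M2 g2 \<delta> x"
  shows "plemelj M g (d1 + a * d2) x"
proof -
  obtain l1 l2 where l: "((\<lambda>\<delta>. trunc M1 g1 \<delta> x) \<longlongrightarrow> l1) (at_right 0)" "((\<lambda>\<delta>. trunc M2 g2 \<delta> x) \<longlongrightarrow> l2) (at_right 0)"
    using 1 2 by (auto simp: plemelj_def)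
  have ev: "\<forall>\<^sub>F \<delta> in at_right 0. (0::real) < \<delta>" by (rule eventually_at_right_less)
  have "((\<lambda>\<delta>. trunc M g \<delta> x) \<longlongrightarrow> l1 + a * l2) (at_right 0)"
    by (rule Lim_transform_eventually[OF tendsto_add[OF l(1) tendsto_mult_left[OF l(2), of a]]])
       (use ev in eventually_elim, simp add: tr)
  moreover have "((\<lambda>\<delta>. cauchy_transform M g (Complex x \<delta>) + trunc M g \<delta> x) \<longlongrightarrow> \<i> * of_real pi * d1 + a * (\<i> * of_real pi * d2)) (at_right 0)"
  proof (rule Lim_transform_eventually)
    show "((\<lambda>\<delta>. (cauchy_transform M1 g1 (Complex x \<delta>) + trunc M1 g1 \<delta> x) + a * (cauchy_transform M2 g2 (Complex x \<delta>) + trunc M2 g2 \<delta> x))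
       \<longlongrightarrow> \<i> * of_real pi * d1 + a * (\<i> * of_real pi * d2)) (at_right 0)"
      using 1 2 by (intro tendsto_intros) (auto simp: plemelj_def)
    show "\<forall>\<^sub>F \<delta> in at_right 0. (cauchy_transform M1 g1 (Complex x \<delta>) + trunc M1 g1 \<delta> x) + a * (cauchy_transform M2 g2 (Complex x \<delta>) + trunc M2 g2 \<delta> x)
       = cauchy_transform M g (Complex x \<delta>) + trunc M g \<delta> x"
      using ev by eventually_elim (simp add: ct tr algebra_simps)
  qed
  ultimately show ?thesis unfolding plemelj_def by (auto simp: algebra_simps)
qed

lemma cauchy_trunc_linear:
  assumes sets: "sets M = sets borel" and f: "integrable M f" and g: "integrable M g" and d: "\<delta> > 0"
  shows "cauchy_transform M (\<lambda>t. f t + a * g t) (Complex x \<delta>) = cauchy_transform M f (Complex x \<delta>) + a * cauchy_transform M g (Complex x \<delta>)"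
    and "trunc M (\<lambda>t. f t + a * g t) \<delta> x = trunc M f \<delta> x + a * trunc M g \<delta> x"
proof -
  have *: "(LINT t|M. (f t + a * g t) * k t) = (LINT t|M. f t * k t) + a * (LINT t|M. g t * k t)"
    if "k \<in> borel_measurable borel" "\<And>t. cmod (k t) \<le> B" for k B
    using integrable_mult_bounded[OF sets f that] integrable_mult_bounded[OF sets g that]
    by (simp add: distrib_right mult.assoc)
  show "cauchy_transform M (\<lambda>t. f t + a * g t) (Complex x \<delta>) = cauchy_transform M f (Complex x \<delta>) + a * cauchy_transform M g (Complex x \<delta>)"
    unfolding cauchy_transform_eq by (rule *[OF _ cauchy_kernel_bound_Complex[OF d]]) measurable
  show "trunc M (\<lambda>t. f t + a * g t) \<delta> x = trunc M f \<delta> x + a * trunc M g \<delta> x"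
    unfolding trunc_eq by (rule *[OF _ trunc_kernel_bound[OF d]]) measurable
qed

text \<open>The covers for 1 / (n + 1) are intersected; \<open>B\<close> itself may be
  nonmeasurable.\<close>

lemma AE_not_in_of_small_covers:
  assumes "\<And>e::real. e > 0 \<Longrightarrow> \<exists>V\<in>sets lborel. B \<subseteq> V \<and> emeasure lborel V \<le> ennreal e"
  shows "AE x in lborel. x \<notin> (B :: real set)"
proof -
  have "\<exists>V. V \<in> sets lborel \<and> B \<subseteq> V \<and> emeasure lborel V \<le> ennreal (1 / real (Suc n))" for n
    using assms[of "1 / real (Suc n)"] by auto
  then obtain V where V: "\<And>n. V n \<in> sets lborel" "\<And>n. B \<subseteq> V n" "\<And>n. emeasure lborel (V n) \<le> ennreal (1 / real (Suc n))"
    by metis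
  have "emeasure lborel (\<Inter>n. V n) \<le> ennreal 0"
  proof (rule tendsto_lowerbound[OF tendsto_ennrealI[OF LIMSEQ_Suc[OF lim_1_over_n]]])
    have "emeasure lborel (\<Inter>n. V n) \<le> ennreal (1 / real (Suc n))" for n
      by (rule order_trans[OF emeasure_mono V(3)]) (use V(1) in auto)
    then show "\<forall>\<^sub>F n in sequentially. emeasure lborel (\<Inter>n. V n) \<le> ennreal (1 / real (Suc n))" by simp
  qed simp
  then have "(\<Inter>n. V n) \<in> null_sets lborel" using V(1) by (auto intro!: null_setsI)
  then show ?thesis by (rule AE_I') (use V(2) in auto)
qed

lemma integrable_weight_of_integrable:
  assumes sets: "sets M = sets borel" and g: "integrable M g"
  shows "integrable M (\<lambda>t. g t / complex_of_real (1 + \<bar>t\<bar>))"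
proof -
  have "integrable M (\<lambda>t. g t * (1 / complex_of_real (1 + \<bar>t\<bar>)))"
  proof (rule integrable_mult_bounded[OF sets g])
    show "cmod (1 / complex_of_real (1 + \<bar>t\<bar>)) \<le> 1" for t
      unfolding norm_divide norm_of_real by simp
  qed measurable
  then show ?thesis by simp
qed

text \<open>Away from the support of \<open>g\<close> nothing is singular: the truncation does not
  change for \<delta> < \<rho>, and the sum of the two kernels is O(\<delta>).\<close>

lemma plemelj_vanish:
  assumes sets: "sets M = sets borel" and g: "integrable M (\<lambda>t. g t / complex_of_real (1 + \<bar>t\<bar>))"
    and \<rho>: "\<rho> > 0" and van: "\<And>t. \<bar>t - x\<bar> < \<rho> \<Longrightarrow> g t = 0"
  shows "plemelj M g 0 x"
proof -
  \<comment> \<open>Outside the interval 1 + |t| \<le> C |t - x|, which compares the kernels with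
    the weight 1 / (1 + |t|).\<close>
  define C where "C = 1 + (1 + \<bar>x\<bar>) / \<rho>"
  have C0: "C \<ge> 0" using \<rho> by (simp add: C_def)
  have Cle: "1 + \<bar>t\<bar> \<le> C * \<bar>t - x\<bar>" if "\<not> \<bar>t - x\<bar> < \<rho>" for t
  proof -
    have "\<bar>t\<bar> \<le> \<bar>t - x\<bar> + \<bar>x\<bar>" by linarith
    moreover have "(1 + \<bar>x\<bar>) * 1 \<le> (1 + \<bar>x\<bar>) * (\<bar>t - x\<bar> / \<rho>)" using that \<rho> by (intro mult_left_mono) (auto simp: field_simps)
    ultimately show ?thesis by (simp add: C_def distrib_right)
  qed
  let ?w = "\<lambda>t. g t / complex_of_real (1 + \<bar>t\<bar>)"
  have wne: "complex_of_real (1 + \<bar>t\<bar>) \<noteq> 0" for t unfolding of_real_eq_0_iff by linarith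
  have wn: "cmod (complex_of_real (1 + \<bar>t\<bar>)) = 1 + \<bar>t\<bar>" for t unfolding norm_of_real by simp
  have int: "integrable M (\<lambda>t. g t * k t)"
    if k: "k \<in> borel_measurable borel" and le: "\<And>t. \<not> \<bar>t - x\<bar> < \<rho> \<Longrightarrow> cmod (k t) \<le> 1 / \<bar>t - x\<bar>" for k
  proof -
    have "integrable M (\<lambda>t. ?w t * (if \<bar>t - x\<bar> < \<rho> then 0 else complex_of_real (1 + \<bar>t\<bar>) * k t))"
    proof (rule integrable_mult_bounded[OF sets g, where B = C])
      show "(\<lambda>t. if \<bar>t - x\<bar> < \<rho> then 0 else complex_of_real (1 + \<bar>t\<bar>) * k t) \<in> borel_measurable borel"
        using k by measurable
      fix t
      show "cmod (if \<bar>t - x\<bar> < \<rho> then 0 else complex_of_real (1 + \<bar>t\<bar>) * k t) \<le> C"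
      proof (cases "\<bar>t - x\<bar> < \<rho>")
        case False
        have "(1 + \<bar>t\<bar>) * cmod (k t) \<le> C * \<bar>t - x\<bar> * (1 / \<bar>t - x\<bar>)"
          using Cle[OF False] le[OF False] C0 by (intro mult_mono) auto
        also have "\<dots> = C" using False \<rho> by auto
        finally show ?thesis using False wn by (simp add: norm_mult del: of_real_add)
      qed (use C0 in simp)
    qed
    moreover have "?w t * (if \<bar>t - x\<bar> < \<rho> then 0 else complex_of_real (1 + \<bar>t\<bar>) * k t) = g t * k t" for t
      using van[of t] wne[of t] by simp
    ultimately show ?thesis by (simp only:)
  qed
  define k0 where "k0 t = 1 / complex_of_real (x - t)" for t
  have k0: "integrable M (\<lambda>t. g t * k0 t)"
  proof (rule int)
    show "cmod (k0 t) \<le> 1 / \<bar>t - x\<bar>" for t unfolding k0_def norm_divide norm_of_real by (simp add: abs_minus_commute)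
  qed (unfold k0_def[abs_def], measurable)
  have tr: "trunc M g \<delta> x = (LINT t|M. g t * k0 t)" if "0 < \<delta>" "\<delta> < \<rho>" for \<delta>
    unfolding trunc_eq
  proof (intro Bochner_Integration.integral_cong refl)
    fix t
    show "g t * trunc_kernel \<delta> x t = g t * k0 t"
    proof (cases "\<bar>t - x\<bar> < \<rho>")
      case False
      then have "\<bar>x - t\<bar> > \<delta>" using that by linarith
      then show ?thesis by (simp add: trunc_kernel_def k0_def)
    qed (simp add: van)
  qed
  define I where "I = (LINT t|M. cmod (?w t))"
  have le: "cmod (cauchy_transform M g (Complex x \<delta>) + trunc M g \<delta> x) \<le> \<delta> * (C / \<rho> * I)" if d: "0 < \<delta>" "\<delta> < \<rho>" for \<delta>
  proof -
    let ?k = "\<lambda>t. 1 / (complex_of_real t - Complex x \<delta>)"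
    have ckl: "\<bar>t - x\<bar> \<le> cmod (complex_of_real t - Complex x \<delta>)" for t
      using abs_Re_le_cmod[of "complex_of_real t - Complex x \<delta>"] by simp
    have i: "integrable M (\<lambda>t. g t * ?k t)"
    proof (rule int)
      fix t assume "\<not> \<bar>t - x\<bar> < \<rho>"
      then show "cmod (?k t) \<le> 1 / \<bar>t - x\<bar>" using ckl[of t] \<rho> by (simp add: norm_divide frac_le)
    qed measurable
    have e: "cauchy_transform M g (Complex x \<delta>) + trunc M g \<delta> x = (LINT t|M. g t * ?k t + g t * k0 t)"
      unfolding tr[OF d] cauchy_transform_eq by (rule Bochner_Integration.integral_add[OF i k0, symmetric])
    have "cmod (cauchy_transform M g (Complex x \<delta>) + trunc M g \<delta> x) \<le> (LINT t|M. (\<delta> * (C / \<rho>)) * cmod (?w t))"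
      unfolding e
    proof (rule order_trans[OF integral_norm_bound], rule integral_mono)
      show "integrable M (\<lambda>t. norm (g t * ?k t + g t * k0 t))" using i k0 by (intro integrable_norm Bochner_Integration.integrable_add)
      show "integrable M (\<lambda>t. (\<delta> * (C / \<rho>)) * cmod (?w t))" using g by (intro integrable_mult_right integrable_norm)
      fix t
      show "norm (g t * ?k t + g t * k0 t) \<le> (\<delta> * (C / \<rho>)) * cmod (?w t)"
      proof (cases "\<bar>t - x\<bar> < \<rho>")
        case True
        then show ?thesis using van by simp
      next
        case False
        have vpos: "\<bar>t - x\<bar> > 0" using False \<rho> by linarith
        define D where "D = complex_of_real t - Complex x \<delta>"
        have Dpos: "cmod D > 0" unfolding D_def by (rule less_le_trans[OF vpos ckl])
        have Dx: "D = - complex_of_real (x - t) - \<i> * of_real \<delta>" by (simp add: D_def complex_eq_iff)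
        have xt: "complex_of_real (x - t) \<noteq> 0" unfolding of_real_eq_0_iff using vpos by auto
        have "?k t + k0 t = - (\<i> * of_real \<delta>) / (complex_of_real (x - t) * D)"
        proof -
          define r where "r = complex_of_real (x - t)"
          have r: "r \<noteq> 0" using xt by (simp only: r_def) simp
          have Dr: "D = - r - \<i> * of_real \<delta>" using Dx by (simp only: r_def)
          have "D \<noteq> 0" using Dpos by auto
          then have "1 / D + 1 / r = - (\<i> * of_real \<delta>) / (r * D)"
            using r by (simp add: divide_simps) (simp add: Dr algebra_simps)
          then show ?thesis by (simp add: r_def k0_def D_def)
        qed
        then have "cmod (?k t + k0 t) = \<delta> / (\<bar>t - x\<bar> * cmod D)"
          using d abs_minus_commute[of x t] by (simp only: norm_divide norm_mult norm_minus_cancel norm_of_real norm_ii mult_1_left abs_of_pos)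
        also have "\<dots> \<le> \<delta> / (\<rho> * \<bar>t - x\<bar>)"
        proof (rule divide_left_mono)
          have "\<rho> * \<bar>t - x\<bar> \<le> cmod D * \<bar>t - x\<bar>" using ckl[of t] False by (intro mult_right_mono) (auto simp: D_def)
          then show "\<rho> * \<bar>t - x\<bar> \<le> \<bar>t - x\<bar> * cmod D" by (simp add: mult.commute)
        qed (use d \<rho> vpos Dpos in auto)
        also have "\<dots> \<le> \<delta> * (C / \<rho>) * (1 / (1 + \<bar>t\<bar>))"
        proof -
          have "1 / \<bar>t - x\<bar> \<le> C / (1 + \<bar>t\<bar>)" 
          proof -
            have p: "0 < 1 + \<bar>t\<bar>" by linarith
            show ?thesis unfolding pos_divide_le_eq[OF vpos] times_divide_eq_left pos_le_divide_eq[OF p]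
              using Cle[OF False] by simp
          qed
          from mult_left_mono[OF this, of "\<delta> / \<rho>"] show ?thesis using d \<rho> by simp
        qed
        finally have "cmod (?k t + k0 t) \<le> \<delta> * (C / \<rho>) * (1 / (1 + \<bar>t\<bar>))" .
        from mult_left_mono[OF this norm_ge_zero[of "g t"]]
        moreover have "cmod (?w t) = cmod (g t) * (1 / (1 + \<bar>t\<bar>))" unfolding norm_divide wn by simp
        moreover have "norm (g t * ?k t + g t * k0 t) = cmod (g t) * cmod (?k t + k0 t)"
          by (simp only: distrib_left[symmetric] norm_mult)
        ultimately show ?thesis by (simp only: mult.left_commute)
      qed
    qed
    also have "\<dots> = \<delta> * (C / \<rho>) * I" unfolding I_def by (rule integral_mult_right_zero)
    finally show ?thesis by (simp only: mult.assoc)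
  qed
  have ev: "\<forall>\<^sub>F \<delta> in at_right 0. 0 < \<delta> \<and> \<delta> < \<rho>" using eventually_at_right_real[OF \<rho>] by simp
  have "((\<lambda>\<delta>. cauchy_transform M g (Complex x \<delta>) + trunc M g \<delta> x) \<longlongrightarrow> 0) (at_right 0)"
  proof (rule Lim_null_comparison)
    show "\<forall>\<^sub>F \<delta> in at_right 0. norm (cauchy_transform M g (Complex x \<delta>) + trunc M g \<delta> x) \<le> \<delta> * (C / \<rho> * I)"
      using ev by eventually_elim (use le in auto)
    have "((\<lambda>\<delta>. \<delta> * (C / \<rho> * I)) \<longlongrightarrow> 0 * (C / \<rho> * I)) (at_right 0)" by (intro tendsto_intros)
    then show "((\<lambda>\<delta>. \<delta> * (C / \<rho> * I)) \<longlongrightarrow> 0) (at_right 0)" by simp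
  qed
  moreover have "((\<lambda>\<delta>. trunc M g \<delta> x) \<longlongrightarrow> (LINT t|M. g t * k0 t)) (at_right 0)"
    by (rule tendsto_eventually) (use ev in eventually_elim, use tr in auto)
  ultimately show ?thesis unfolding plemelj_def by auto
qed

text \<open>A version with tolerance \<eta>, in Cauchy form for the truncations, so that it survives
  a perturbation of \<open>g\<close> without a limit being named.\<close>

definition plemelj_within :: "real \<Rightarrow> real measure \<Rightarrow> (real \<Rightarrow> complex) \<Rightarrow> complex \<Rightarrow> real \<Rightarrow> bool" where
  "plemelj_within \<eta> M g d x \<longleftrightarrow> (\<exists>\<delta>0>0. \<forall>\<delta>. 0 < \<delta> \<longrightarrow> \<delta> < \<delta>0 \<longrightarrow>
     cmod (cauchy_transform M g (Complex x \<delta>) + trunc M g \<delta> x - \<i> * of_real pi * d) \<le> \<eta> \<and>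
     (\<forall>\<delta>'. 0 < \<delta>' \<longrightarrow> \<delta>' < \<delta>0 \<longrightarrow> cmod (trunc M g \<delta> x - trunc M g \<delta>' x) \<le> \<eta>))"

lemma plemelj_imp_osc:
  assumes "plemelj M g d x" and \<eta>: "\<eta> > 0"
  shows "plemelj_within \<eta> M g d x"
proof -
  obtain l where l: "((\<lambda>\<delta>. trunc M g \<delta> x) \<longlongrightarrow> l) (at_right 0)" using assms by (auto simp: plemelj_def)
  have "((\<lambda>\<delta>. cauchy_transform M g (Complex x \<delta>) + trunc M g \<delta> x) \<longlongrightarrow> \<i> * of_real pi * d) (at_right 0)"
    using assms by (auto simp: plemelj_def)
  from tendstoD[OF this \<eta>] obtain a where a: "a > 0"
    "\<forall>\<delta>>0. \<delta> < a \<longrightarrow> dist (cauchy_transform M g (Complex x \<delta>) + trunc M g \<delta> x) (\<i> * of_real pi * d) < \<eta>"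
    unfolding eventually_at_right_field by (elim exE conjE) (rule that)
  have "\<eta> / 2 > 0" using \<eta> by simp
  from tendstoD[OF l this] obtain b where b: "b > 0"
    "\<forall>\<delta>>0. \<delta> < b \<longrightarrow> dist (trunc M g \<delta> x) l < \<eta> / 2"
    unfolding eventually_at_right_field by (elim exE conjE) (rule that)
  show ?thesis unfolding plemelj_within_def
  proof (intro exI[of _ "min a b"] conjI allI impI)
    fix \<delta> assume d: "0 < \<delta>" "\<delta> < min a b"
    show "cmod (cauchy_transform M g (Complex x \<delta>) + trunc M g \<delta> x - \<i> * of_real pi * d) \<le> \<eta>"
      using a(2)[rule_format, of \<delta>] d by (simp add: dist_norm less_imp_le)
    fix \<delta>' assume d': "0 < \<delta>'" "\<delta>' < min a b"
    have "dist (trunc M g \<delta> x) (trunc M g \<delta>' x) < \<eta>"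
      by (rule dist_triangle_half_l[OF b(2)[rule_format] b(2)[rule_format]]) (use d d' in simp_all)
    then show "cmod (trunc M g \<delta> x - trunc M g \<delta>' x) \<le> \<eta>" by (simp add: dist_norm)
  qed (use a(1) b(1) in simp)
qed

text \<open>Cauchy's criterion at 0 from the right; the limit is found along 1 / (n + 1).\<close>

lemma tendsto_of_oscillation:
  fixes A B :: "real \<Rightarrow> complex"
  assumes osc: "\<And>n. \<exists>b>0. \<forall>x y. 0 < x \<longrightarrow> x < b \<longrightarrow> 0 < y \<longrightarrow> y < b \<longrightarrow>
    cmod (A x) \<le> 1 / real (Suc n) \<and> cmod (B x - B y) \<le> 1 / real (Suc n)"
  shows "(A \<longlongrightarrow> 0) (at_right 0)" and "\<exists>l. (B \<longlongrightarrow> l) (at_right 0)"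
proof -
  have small: "\<exists>b>0. \<forall>x y. 0 < x \<longrightarrow> x < b \<longrightarrow> 0 < y \<longrightarrow> y < b \<longrightarrow> cmod (A x) < e \<and> cmod (B x - B y) < e" if e: "e > 0" for e
  proof -
    obtain n where n: "1 / real (Suc n) < e" using nat_approx_posE[OF e] by blast
    obtain b where b: "b > 0" "\<forall>x y. 0 < x \<longrightarrow> x < b \<longrightarrow> 0 < y \<longrightarrow> y < b \<longrightarrow>
      cmod (A x) \<le> 1 / real (Suc n) \<and> cmod (B x - B y) \<le> 1 / real (Suc n)" using osc[of n] by (elim exE conjE) (rule that)
    have "cmod (A x) < e \<and> cmod (B x - B y) < e" if "0 < x" "x < b" "0 < y" "y < b" for x y
    proof -
      note h = b(2)[rule_format, OF that]
      show ?thesis by (rule conjI[OF le_less_trans[OF conjunct1[OF h] n] le_less_trans[OF conjunct2[OF h] n]])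
    qed
    note * = this
    show ?thesis
    proof (intro exI[of _ b] conjI allI impI b(1))
      fix x y assume xy: "0 < x" "x < b" "0 < y" "y < b"
      show "cmod (A x) < e" by (rule conjunct1[OF *[OF xy]])
      show "cmod (B x - B y) < e" by (rule conjunct2[OF *[OF xy]])
    qed
  qed
  show "(A \<longlongrightarrow> 0) (at_right 0)"
  proof (rule tendstoI)
    fix e :: real assume "e > 0"
    from small[OF this] obtain b where b: "b > 0" "\<forall>x y. 0 < x \<longrightarrow> x < b \<longrightarrow> 0 < y \<longrightarrow> y < b \<longrightarrow> cmod (A x) < e \<and> cmod (B x - B y) < e"
      by (elim exE conjE) (rule that)
    show "\<forall>\<^sub>F x in at_right 0. dist (A x) 0 < e"
      unfolding eventually_at_right_field
    proof (intro exI[of _ b] conjI allI impI b(1))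
      fix x assume "x > 0" "x < b"
      then show "dist (A x) 0 < e" using b(2)[rule_format, of x x] by simp
    qed
  qed
  define X where "X n = B (1 / real (Suc n))" for n
  have Xlim: "\<forall>\<^sub>F n in sequentially. 1 / real (Suc n) < a" if "a > 0" for a
    by (rule order_tendstoD(2)[OF LIMSEQ_Suc[OF lim_1_over_n] that])
  have pos: "0 < 1 / real (Suc n)" for n by simp
  have "Cauchy X"
  proof (rule CauchyI)
    fix e :: real assume "e > 0"
    from small[OF this] obtain b where b: "b > 0" "\<forall>x y. 0 < x \<longrightarrow> x < b \<longrightarrow> 0 < y \<longrightarrow> y < b \<longrightarrow> cmod (A x) < e \<and> cmod (B x - B y) < e"
      by (elim exE conjE) (rule that)
    obtain N where N: "\<forall>n\<ge>N. 1 / real (Suc n) < b"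
      using Xlim[OF b(1)] unfolding eventually_sequentially by (elim exE) (rule that)
    show "\<exists>N. \<forall>m\<ge>N. \<forall>n\<ge>N. norm (X m - X n) < e"
    proof (intro exI[of _ N] allI impI)
      fix m n assume "m \<ge> N" "n \<ge> N"
      from b(2)[rule_format, OF pos N[rule_format, OF this(1)] pos N[rule_format, OF this(2)]]
      show "norm (X m - X n) < e" unfolding X_def by (rule conjunct2)
    qed
  qed
  then obtain l where l: "X \<longlonglongrightarrow> l" unfolding Cauchy_convergent_iff convergent_def by (elim exE) (rule that)
  have "(B \<longlongrightarrow> l) (at_right 0)"
  proof (rule tendstoI)
    fix e :: real assume e: "e > 0"
    then have "e / 2 > 0" by simp
    from small[OF this] obtain b where b: "b > 0" "\<forall>x y. 0 < x \<longrightarrow> x < b \<longrightarrow> 0 < y \<longrightarrow> y < b \<longrightarrow> cmod (A x) < e / 2 \<and> cmod (B x - B y) < e / 2"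
      by (elim exE conjE) (rule that)
    have "dist (B x) l < e" if x: "0 < x" "x < b" for x
    proof -
      have "cmod (B x - l) \<le> e / 2"
      proof (rule tendsto_upperbound)
        show "(\<lambda>n. cmod (B x - X n)) \<longlonglongrightarrow> cmod (B x - l)" by (intro tendsto_intros l)
        show "\<forall>\<^sub>F n in sequentially. cmod (B x - X n) \<le> e / 2"
          using Xlim[OF b(1)]
        proof eventually_elim
          case (elim n)
          from b(2)[rule_format, OF x pos elim]
          show ?case unfolding X_def by (intro less_imp_le) (rule conjunct2)
        qed
      qed simp
      then show ?thesis using e by (simp add: dist_norm)
    qed
    then show "\<forall>\<^sub>F x in at_right 0. dist (B x) l < e"
      unfolding eventually_at_right_field using b(1) by (intro exI[of _ b]) simp
  qed
  then show "\<exists>l. (B \<longlongrightarrow> l) (at_right 0)" by (rule exI)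
qed

lemma plemelj_within_imp_ok:
  assumes osc: "\<And>n. plemelj_within (1 / real (Suc n)) M g d x"
  shows "plemelj M g d x"
proof -
  define B where "B \<delta> = trunc M g \<delta> x" for \<delta>
  define A where "A \<delta> = cauchy_transform M g (Complex x \<delta>) + B \<delta> - \<i> * of_real pi * d" for \<delta>
  have "\<exists>b>0. \<forall>x y. 0 < x \<longrightarrow> x < b \<longrightarrow> 0 < y \<longrightarrow> y < b \<longrightarrow>
    cmod (A x) \<le> 1 / real (Suc n) \<and> cmod (B x - B y) \<le> 1 / real (Suc n)" for n
  proof -
    obtain b where b: "b > 0" "\<forall>\<delta>. 0 < \<delta> \<longrightarrow> \<delta> < b \<longrightarrow> cmod (A \<delta>) \<le> 1 / real (Suc n) \<and>
        (\<forall>\<delta>'. 0 < \<delta>' \<longrightarrow> \<delta>' < b \<longrightarrow> cmod (B \<delta> - B \<delta>') \<le> 1 / real (Suc n))"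
      using osc[of n] unfolding plemelj_within_def B_def[symmetric] A_def[symmetric] by (elim exE conjE) (rule that)
    show ?thesis
    proof (intro exI[of _ b] conjI allI impI b(1))
      fix x y assume xy: "0 < x" "x < b" "0 < y" "y < b"
      note * = b(2)[rule_format, OF xy(1,2)]
      show "cmod (A x) \<le> 1 / real (Suc n)" by (rule conjunct1[OF *])
      show "cmod (B x - B y) \<le> 1 / real (Suc n)" by (rule conjunct2[OF *, rule_format, OF xy(3,4)])
    qed
  qed
  note lims = tendsto_of_oscillation[of A B, OF this]
  have "((\<lambda>\<delta>. cauchy_transform M g (Complex x \<delta>) + trunc M g \<delta> x) \<longlongrightarrow> \<i> * of_real pi * d) (at_right 0)"
    by (rule LIM_zero_cancel) (use lims(1) in \<open>simp only: A_def[abs_def] B_def\<close>)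
  then show ?thesis using lims(2) unfolding plemelj_def B_def[abs_def] by (rule conjI)
qed

lemma cmod_add_diff_le:
  assumes "cmod u \<le> a" "cmod v \<le> b" "cmod w \<le> c"
  shows "cmod (u + v - w) \<le> a + b + c"
  using norm_triangle_ineq4[of "u + v" w] norm_triangle_ineq[of u v] assms by linarith

text \<open>One \<eta> each for \<open>f\<close>, for the size of the difference and for the change
  of the density. For the truncations the second \<eta> occurs once at each of the two
  radii.\<close>

lemma plemelj_within_perturb:
  assumes sets: "sets M = sets borel" and f: "integrable M f" and g: "integrable M g"
    and osc: "plemelj_within \<eta> M f d x" and mx: "\<And>\<delta>. \<delta> > 0 \<Longrightarrow> cauchy_trunc_size M (\<lambda>t. g t - f t) x \<delta> \<le> \<eta>"
    and de: "pi * cmod (e - d) \<le> \<eta>"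
  shows "plemelj_within (3 * \<eta>) M g e x"
proof -
  obtain \<delta>0 where d0: "\<delta>0 > 0" "\<forall>\<delta>. 0 < \<delta> \<longrightarrow> \<delta> < \<delta>0 \<longrightarrow>
     cmod (cauchy_transform M f (Complex x \<delta>) + trunc M f \<delta> x - \<i> * of_real pi * d) \<le> \<eta> \<and>
     (\<forall>\<delta>'. 0 < \<delta>' \<longrightarrow> \<delta>' < \<delta>0 \<longrightarrow> cmod (trunc M f \<delta> x - trunc M f \<delta>' x) \<le> \<eta>)"
    using osc unfolding plemelj_within_def by (elim exE conjE) (rule that)
  have d1: "cmod (cauchy_transform M f (Complex x \<delta>) + trunc M f \<delta> x - \<i> * of_real pi * d) \<le> \<eta>"
    if "0 < \<delta>" "\<delta> < \<delta>0" for \<delta> by (rule conjunct1[OF d0(2)[rule_format, OF that]])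
  have d2: "cmod (trunc M f \<delta> x - trunc M f \<delta>' x) \<le> \<eta>"
    if "0 < \<delta>" "\<delta> < \<delta>0" "0 < \<delta>'" "\<delta>' < \<delta>0" for \<delta> \<delta>'
    by (rule conjunct2[OF d0(2)[rule_format, OF that(1,2)], rule_format, OF that(3,4)])
  let ?h = "\<lambda>t. g t - f t"
  have lin: "cauchy_transform M g (Complex x \<delta>) = cauchy_transform M f (Complex x \<delta>) + cauchy_transform M ?h (Complex x \<delta>)"
     "trunc M g \<delta> x = trunc M f \<delta> x + trunc M ?h \<delta> x" if "\<delta> > 0" for \<delta>
  proof -
    have h: "integrable M ?h" using f g by simp
    show "cauchy_transform M g (Complex x \<delta>) = cauchy_transform M f (Complex x \<delta>) + cauchy_transform M ?h (Complex x \<delta>)"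
     "trunc M g \<delta> x = trunc M f \<delta> x + trunc M ?h \<delta> x"
      using cauchy_trunc_linear[OF sets f h that, of 1 x] by simp_all
  qed
  show ?thesis unfolding plemelj_within_def
  proof (intro exI[of _ \<delta>0] conjI allI impI d0(1))
    fix \<delta> assume d: "0 < \<delta>" "\<delta> < \<delta>0"
    have m1: "cmod (cauchy_transform M ?h (Complex x \<delta>)) + cmod (trunc M ?h \<delta> x) \<le> \<eta>"
      using mx[OF d(1)] by (simp add: cauchy_trunc_size_def)
    have m2: "cmod (\<i> * of_real pi * (e - d)) \<le> \<eta>" using de by (simp add: norm_mult)
    have e1: "cauchy_transform M g (Complex x \<delta>) + trunc M g \<delta> x - \<i> * of_real pi * e =
       (cauchy_transform M f (Complex x \<delta>) + trunc M f \<delta> x - \<i> * of_real pi * d)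
       + (cauchy_transform M ?h (Complex x \<delta>) + trunc M ?h \<delta> x) - \<i> * of_real pi * (e - d)"
      unfolding lin[OF d(1)] by (simp add: algebra_simps)
    have "cmod (cauchy_transform M g (Complex x \<delta>) + trunc M g \<delta> x - \<i> * of_real pi * e) \<le> \<eta> + \<eta> + \<eta>"
      unfolding e1 by (rule cmod_add_diff_le[OF d1[OF d] order_trans[OF norm_triangle_ineq m1] m2])
    then show "cmod (cauchy_transform M g (Complex x \<delta>) + trunc M g \<delta> x - \<i> * of_real pi * e) \<le> 3 * \<eta>" by simp
    fix \<delta>' assume d': "0 < \<delta>'" "\<delta>' < \<delta>0"
    have t1: "cmod (trunc M ?h \<delta> x) \<le> \<eta>" using m1 norm_ge_zero[of "cauchy_transform M ?h (Complex x \<delta>)"] by linarith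
    have t2: "cmod (trunc M ?h \<delta>' x) \<le> \<eta>"
      using mx[OF d'(1)] norm_ge_zero[of "cauchy_transform M ?h (Complex x \<delta>')"] unfolding cauchy_trunc_size_def by linarith
    have e2: "trunc M g \<delta> x - trunc M g \<delta>' x = (trunc M f \<delta> x - trunc M f \<delta>' x) + trunc M ?h \<delta> x - trunc M ?h \<delta>' x"
      unfolding lin(2)[OF d(1)] lin(2)[OF d'(1)] by simp
    have "cmod (trunc M g \<delta> x - trunc M g \<delta>' x) \<le> \<eta> + \<eta> + \<eta>"
      unfolding e2 by (rule cmod_add_diff_le[OF d2[OF d d'] t1 t2])
    then show "cmod (trunc M g \<delta> x - trunc M g \<delta>' x) \<le> 3 * \<eta>" by simp
  qed
qed

text \<open>The Banach principle: functions with the limit property form a closed set in L^1,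
  because the error of an approximation is controlled by a maximal operator of weak type. For a
  given tolerance the bad points lie in a null set, in the cover \<open>V\<close> from the weak type
  bound, or in the set \<open>W\<close> where the densities differ too much.\<close>

lemma plemelj_limit:
  fixes g :: "real \<Rightarrow> complex"
  assumes sets: "sets M = sets borel" and g: "integrable M g" and G: "\<And>n. integrable M (G n)"
    and lim: "(\<lambda>n. LINT t|M. cmod (g t - G n t)) \<longlonglongrightarrow> 0"
    and d[measurable]: "d \<in> borel_measurable borel" and D[measurable]: "\<And>n. D n \<in> borel_measurable borel"
    and dlim: "(\<lambda>n. \<integral>\<^sup>+x. ennreal (cmod (d x - D n x)) \<partial>lborel) \<longlonglongrightarrow> 0"
    and ok: "\<And>n. AE x in lborel. plemelj M (G n) (D n x) x"
  shows "AE x in lborel. plemelj M g (d x) x"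
proof -
  have "AE x in lborel. plemelj_within (1 / real (Suc k)) M g (d x) x" for k
  proof -
    define \<eta> where "\<eta> = 1 / real (Suc k) / 3"
    have \<eta>: "\<eta> > 0" by (simp add: \<eta>_def)
    \<comment> \<open>16 lam is the threshold in the weak type bound.\<close>
    define lam where "lam = \<eta> / 16"
    have lam: "lam > 0" using \<eta> by (simp add: lam_def)
    have "AE x in lborel. x \<notin> {x. \<not> plemelj_within (3 * \<eta>) M g (d x) x}"
    proof (rule AE_not_in_of_small_covers)
      fix e :: real assume e: "e > 0"
      \<comment> \<open>With 1920 = 2 * 960 the cover \<open>V\<close> has measure at most e / 2;
        \<open>ev2\<close> does the same for \<open>W\<close> through Markov's inequality.\<close>
      have ev1: "\<forall>\<^sub>F n in sequentially. (LINT t|M. cmod (g t - G n t)) < e * lam / (1920 * pi)"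
        using e lam by (intro order_tendstoD(2)[OF lim]) simp
      have ev2: "\<forall>\<^sub>F n in sequentially. (\<integral>\<^sup>+x. ennreal (cmod (d x - D n x)) \<partial>lborel) < ennreal (e * \<eta> / (2 * pi))"
        using e \<eta> by (intro order_tendstoD(2)[OF dlim]) simp
      obtain n where n: "(LINT t|M. cmod (g t - G n t)) < e * lam / (1920 * pi)"
          "(\<integral>\<^sup>+x. ennreal (cmod (d x - D n x)) \<partial>lborel) < ennreal (e * \<eta> / (2 * pi))"
        using eventually_happens'[OF sequentially_bot eventually_conj[OF ev1 ev2]] by (elim exE conjE) (rule that)
      have gG: "integrable M (\<lambda>t. g t - G n t)" using g G by simp
      obtain V where V: "V \<in> sets borel" "{x. \<exists>\<delta>>0. cauchy_trunc_size M (\<lambda>t. g t - G n t) x \<delta> > 16 * lam} \<subseteq> V"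
          "emeasure lborel V \<le> ennreal (960 * pi / lam * (LINT t|M. cmod (g t - G n t)))"
        using cauchy_trunc_size_weak_type[OF sets gG lam] by (elim bexE conjE) (rule that)
      obtain N where N: "{x \<in> space lborel. \<not> plemelj M (G n) (D n x) x} \<subseteq> N" "emeasure lborel N = 0" "N \<in> sets lborel"
        by (rule AE_E[OF ok[of n]])
      define W where "W = {x\<in>UNIV. 1 \<le> ennreal (pi / \<eta>) * ennreal (cmod (d x - D n x))}"
      have dm: "(\<lambda>x. ennreal (cmod (d x - D n x))) \<in> borel_measurable lborel" by measurable
      have "{x \<in> space borel. 1 \<le> ennreal (pi / \<eta>) * ennreal (cmod (d x - D n x))} \<in> sets borel"
        by measurable
      then have Wm: "W \<in> sets lborel" unfolding W_def by (simp only: space_borel sets_lborel)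
      have "emeasure lborel W \<le> ennreal (pi / \<eta>) * (\<integral>\<^sup>+x. ennreal (cmod (d x - D n x)) * indicator UNIV x \<partial>lborel)"
        unfolding W_def by (rule nn_integral_Markov_inequality) (simp_all add: dm)
      also have "\<dots> \<le> ennreal (pi / \<eta>) * ennreal (e * \<eta> / (2 * pi))"
        by (rule mult_left_mono) (simp_all only: indicator_UNIV mult_1_right less_imp_le[OF n(2)] zero_le)
      also have "\<dots> = ennreal (e / 2)" using \<eta> by (simp add: ennreal_mult'[symmetric])
      finally have We: "emeasure lborel W \<le> ennreal (e / 2)" .
      have "960 * pi / lam * (LINT t|M. cmod (g t - G n t)) \<le> 960 * pi / lam * (e * lam / (1920 * pi))"
        using n(1) lam by (intro mult_left_mono) auto
      also have "\<dots> = e / 2" using lam by simp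
      finally have Ve: "emeasure lborel V \<le> ennreal (e / 2)" by (rule order_trans[OF V(3) ennreal_leI])
      show "\<exists>V\<in>sets lborel. {x. \<not> plemelj_within (3 * \<eta>) M g (d x) x} \<subseteq> V \<and> emeasure lborel V \<le> ennreal e"
      proof (intro bexI[of _ "N \<union> (V \<union> W)"] conjI)
        show "N \<union> (V \<union> W) \<in> sets lborel" using V(1) by (intro sets.Un N(3) Wm) (simp only: sets_lborel)
        have "emeasure lborel (N \<union> (V \<union> W)) \<le> emeasure lborel N + (emeasure lborel V + emeasure lborel W)"
          by (rule order_trans[OF emeasure_subadditive add_left_mono[OF emeasure_subadditive]])
             (use V(1) in \<open>simp_all only: sets_lborel[symmetric] N(3) Wm sets.Un\<close>)
        also have "\<dots> \<le> 0 + (ennreal (e / 2) + ennreal (e / 2))" by (intro add_mono Ve We) (simp only: N(2) order_refl)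
        also have "\<dots> = ennreal e" using ennreal_plus[of "e / 2" "e / 2"] e by (simp only: add_0 field_sum_of_halves)
        finally show "emeasure lborel (N \<union> (V \<union> W)) \<le> ennreal e" .
        show "{x. \<not> plemelj_within (3 * \<eta>) M g (d x) x} \<subseteq> N \<union> (V \<union> W)"
        proof (rule subsetI, rule ccontr)
          fix x assume x: "x \<in> {x. \<not> plemelj_within (3 * \<eta>) M g (d x) x}" "x \<notin> N \<union> (V \<union> W)"
          have ok': "plemelj M (G n) (D n x) x" 
          proof (rule ccontr)
            assume "\<not> ?thesis"
            then have "x \<in> N" by (intro subsetD[OF N(1)]) (simp only: space_lborel space_borel mem_Collect_eq UNIV_I simp_thms)
            then show False using x(2) by (simp only: Un_iff simp_thms)
          qed
          have mx: "cauchy_trunc_size M (\<lambda>t. g t - G n t) x \<delta> \<le> \<eta>" if "\<delta> > 0" for \<delta>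
          proof (rule ccontr)
            assume "\<not> ?thesis"
            then have "cauchy_trunc_size M (\<lambda>t. g t - G n t) x \<delta> > 16 * lam" by (simp add: lam_def)
            then have "\<exists>\<delta>>0. cauchy_trunc_size M (\<lambda>t. g t - G n t) x \<delta> > 16 * lam" using that by (intro exI[of _ \<delta>] conjI)
            then have "x \<in> V" by (intro subsetD[OF V(2)]) (simp only: mem_Collect_eq)
            then show False using x(2) by (simp only: Un_iff simp_thms)
          qed
          have "\<not> 1 \<le> ennreal (pi / \<eta>) * ennreal (cmod (d x - D n x))" using x(2) by (simp only: W_def Un_iff de_Morgan_disj mem_Collect_eq UNIV_I simp_thms)
          moreover have "1 \<le> ennreal (pi / \<eta>) * ennreal (cmod (d x - D n x))" if "1 \<le> pi / \<eta> * cmod (d x - D n x)"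
            
          proof -
            have "ennreal 1 \<le> ennreal (pi / \<eta>) * ennreal (cmod (d x - D n x))"
              using ennreal_leI[OF that] ennreal_mult'[of "pi / \<eta>" "cmod (d x - D n x)"] \<eta> by (simp only: divide_nonneg_nonneg pi_ge_zero less_imp_le simp_thms)
            then show ?thesis by (simp only: ennreal_1)
          qed
          ultimately have "pi / \<eta> * cmod (d x - D n x) < 1" by argo
          then have "pi * cmod (d x - D n x) \<le> \<eta>" using \<eta> by (simp add: field_simps)
          then have "plemelj_within (3 * \<eta>) M g (d x) x"
            by (intro plemelj_within_perturb[OF sets G g plemelj_imp_osc[OF ok' \<eta>]] mx)
          then show False using x(1) by (simp only: mem_Collect_eq simp_thms)
        qed
      qed
    qed
    moreover have "3 * \<eta> = 1 / real (Suc k)" by (simp add: \<eta>_def del: of_nat_Suc)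
    ultimately show ?thesis by (simp only: mem_Collect_eq not_not)
  qed
  then have "AE x in lborel. \<forall>k. plemelj_within (1 / real (Suc k)) M g (d x) x" by (simp only: AE_all_countable simp_thms)
  then show ?thesis by eventually_elim (rule plemelj_within_imp_ok, simp)
qed

section \<open>The limit property for Lebesgue measure\<close>

lemma lborel_integral_reflect:
  fixes f :: "real \<Rightarrow> complex"
  shows "(LINT t|lborel. f t) = (LINT t|lborel. f (2 * x - t))"
  using lborel_integral_real_affine[of "-1" f "2 * x"] by simp

lemma integrable_complex_indicator:
  assumes "A \<in> sets borel" "emeasure lborel A < \<infinity>"
  shows "integrable lborel (indicator A :: real \<Rightarrow> complex)"
proof -
  have "integrable lborel (\<lambda>x. complex_of_real (indicator A x))" using assms by (intro integrable_of_real integrable_real_indicator) simp_all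
  moreover have "complex_of_real (indicator A x) = indicator A x" for x by (simp split: split_indicator)
  ultimately show ?thesis by simp
qed

lemma integral_poisson_interval:
  fixes x \<rho> \<delta> :: real
  assumes "\<rho> > 0" and d: "\<delta> > 0"
  shows "(LINT t|lborel. \<delta> / ((t - x)\<^sup>2 + \<delta>\<^sup>2) * indicator {x - \<rho>..x + \<rho>} t) = 2 * arctan (\<rho> / \<delta>)"
proof -
  have pos: "(t - x)\<^sup>2 + \<delta>\<^sup>2 > 0" for t using d by (simp add: add_nonneg_pos)
  have "has_bochner_integral lborel (\<lambda>t. \<delta> / ((t - x)\<^sup>2 + \<delta>\<^sup>2) * indicator {x - \<rho>..x + \<rho>} t)
      (arctan ((x + \<rho> - x) / \<delta>) - arctan ((x - \<rho> - x) / \<delta>))"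
  proof (rule has_bochner_integral_FTC_Icc_real)
    fix t
    have "inverse (1 + ((t - x) / \<delta>)\<^sup>2) * (1 / \<delta>) = \<delta> / ((t - x)\<^sup>2 + \<delta>\<^sup>2)"
      using d pos[of t] by (simp add: field_simps power2_eq_square)
    then show "((\<lambda>t. arctan ((t - x) / \<delta>)) has_real_derivative \<delta> / ((t - x)\<^sup>2 + \<delta>\<^sup>2)) (at t)"
      using d by (auto intro!: derivative_eq_intros)
    show "isCont (\<lambda>t. \<delta> / ((t - x)\<^sup>2 + \<delta>\<^sup>2)) t" using pos[of t] by (intro continuous_intros) (rule less_imp_neq[symmetric])
  qed (use assms in simp)
  from has_bochner_integral_integral_eq[OF this] show ?thesis by (simp add: arctan_minus)
qed

text \<open>The truncated kernel is odd under reflection in x, so the truncations are 0.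
  Symmetrising the Cauchy kernel leaves i \<delta> / ((t - x)^2 + \<delta>^2), whose integral over
  the interval is i times 2 arctan (\<rho> / \<delta>), and this tends to i pi.\<close>

lemma plemelj_symmetric_interval:
  assumes \<rho>: "\<rho> > 0"
  shows "plemelj lborel (indicator {x - \<rho>..x + \<rho>}) 1 x"
proof -
  let ?S = "{x - \<rho>..x + \<rho>}"
  let ?g = "indicator ?S :: real \<Rightarrow> complex"
  have refl: "?g (2 * x - t) = ?g t" for t by (auto simp: indicator_def)
  have gi: "integrable lborel ?g" by (rule integrable_complex_indicator) (simp_all add: emeasure_lborel_Icc_eq)
  have tr: "trunc lborel ?g \<delta> x = 0" for \<delta>
  proof -
    have odd: "trunc_kernel \<delta> x (2 * x - t) = - trunc_kernel \<delta> x t" for t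
    proof -
      have "x - (2 * x - t) = - (x - t)" by simp
      then show ?thesis
        unfolding trunc_kernel_def indicator_def mem_Collect_eq by (simp only: abs_minus_cancel of_real_minus divide_minus_right)
    qed
    have "trunc lborel ?g \<delta> x = - trunc lborel ?g \<delta> x"
      unfolding trunc_eq by (subst lborel_integral_reflect[of _ x]) (simp add: refl odd)
    then show ?thesis by simp
  qed
  have ct: "cauchy_transform lborel ?g (Complex x \<delta>) = \<i> * of_real (2 * arctan (\<rho> / \<delta>))" if d: "\<delta> > 0" for \<delta>
  proof -
    let ?f = "\<lambda>t. ?g t * (1 / (complex_of_real t - Complex x \<delta>))"
    have fi: "integrable lborel ?f"
      by (rule integrable_mult_bounded[OF sets_lborel gi _ cauchy_kernel_bound_Complex[OF d]]) measurable
    have "integrable lborel (\<lambda>t. ?f (2 * x + (-1) * t))" by (rule lborel_integrable_real_affine[OF fi]) simp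
    then have fi': "integrable lborel (\<lambda>t. ?f (2 * x - t))" by simp
    have k: "?f t + ?f (2 * x - t) = (2 * \<i>) * complex_of_real (\<delta> / ((t - x)\<^sup>2 + \<delta>\<^sup>2) * indicator ?S t)" for t
    proof -
      define u where "u = complex_of_real (t - x)"
      have pos: "(t - x)\<^sup>2 + \<delta>\<^sup>2 > 0" using d by (simp add: add_nonneg_pos)
      then have nz: "u\<^sup>2 + of_real \<delta> ^ 2 \<noteq> 0" unfolding u_def of_real_power[symmetric] of_real_add[symmetric] of_real_eq_0_iff by (rule less_imp_neq[symmetric])
      have a: "complex_of_real t - Complex x \<delta> = u - \<i> * of_real \<delta>" by (simp add: u_def complex_eq_iff)
      have b: "complex_of_real (2 * x - t) - Complex x \<delta> = - (u + \<i> * of_real \<delta>)" by (simp add: u_def complex_eq_iff)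
      have f: "(u - \<i> * of_real \<delta>) * (u + \<i> * of_real \<delta>) = u\<^sup>2 + of_real \<delta> ^ 2" by (simp add: algebra_simps power2_eq_square)
      then have n: "u - \<i> * of_real \<delta> \<noteq> 0" "u + \<i> * of_real \<delta> \<noteq> 0" using nz by auto
      have "1 / (u - \<i> * of_real \<delta>) + 1 / (- (u + \<i> * of_real \<delta>)) = 2 * \<i> * of_real \<delta> / (u\<^sup>2 + of_real \<delta> ^ 2)"
      proof -
        have "1 / p + 1 / (- r) = (r - p) / (p * r)" if "p \<noteq> 0" "r \<noteq> 0" for p r :: complex using that by (simp add: field_simps)
        from this[OF n] show ?thesis unfolding f by simp
      qed
      then show ?thesis unfolding refl a b distrib_left[symmetric] by (simp add: u_def split: split_indicator)
    qed
    have "2 * cauchy_transform lborel ?g (Complex x \<delta>) = (LINT t|lborel. ?f t) + (LINT t|lborel. ?f (2 * x - t))"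
      unfolding cauchy_transform_eq by (subst lborel_integral_reflect[of ?f x, symmetric]) simp
    also have "\<dots> = (LINT t|lborel. ?f t + ?f (2 * x - t))" by (rule Bochner_Integration.integral_add[OF fi fi', symmetric])
    also have "\<dots> = (2 * \<i>) * (LINT t|lborel. complex_of_real (\<delta> / ((t - x)\<^sup>2 + \<delta>\<^sup>2) * indicator ?S t))"
      unfolding k by (rule integral_mult_right_zero)
    also have "\<dots> = (2 * \<i>) * of_real (2 * arctan (\<rho> / \<delta>))"
      by (subst integral_complex_of_real) (simp only: integral_poisson_interval[OF \<rho> d])
    finally show ?thesis by simp
  qed
  have "((\<lambda>\<delta>. 2 * arctan (\<rho> / \<delta>)) \<longlongrightarrow> pi) (at_right 0)" using \<rho> by real_asymp
  then have "((\<lambda>\<delta>. \<i> * complex_of_real (2 * arctan (\<rho> / \<delta>))) \<longlongrightarrow> \<i> * of_real pi) (at_right 0)"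
    by (intro tendsto_intros)
  moreover have "\<forall>\<^sub>F \<delta> in at_right 0. \<i> * complex_of_real (2 * arctan (\<rho> / \<delta>)) = cauchy_transform lborel ?g (Complex x \<delta>)"
    by (rule eventually_mono[OF eventually_at_right_real[OF zero_less_one]]) (simp add: ct)
  ultimately have "((\<lambda>\<delta>. cauchy_transform lborel ?g (Complex x \<delta>)) \<longlongrightarrow> \<i> * of_real pi) (at_right 0)"
    by (rule Lim_transform_eventually)
  then show ?thesis unfolding plemelj_def by (simp add: tr) (rule exI[of _ 0], simp)
qed

lemma plemelj_add:
  assumes sets: "sets M = sets borel" and f: "integrable M f" and g: "integrable M g"
    and "plemelj M f d x" "plemelj M g e x"
  shows "plemelj M (\<lambda>t. f t + a * g t) (d + a * e) x"
  by (rule plemelj_combine[OF assms(4,5)]) (rule cauchy_trunc_linear[OF sets f g]; assumption)+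

text \<open>At an interior point the indicator differs from that of a symmetric interval by a
  function vanishing near x; at an exterior point it vanishes near x itself.\<close>

lemma plemelj_interval:
  assumes x: "x \<noteq> a" "x \<noteq> b"
  shows "plemelj lborel (indicator {a<..<b}) (indicator {a<..<b} x) x"
proof (cases "x \<in> {a<..<b}")
  case True
  define \<rho> where "\<rho> = min (x - a) (b - x) / 2"
  have \<rho>: "\<rho> > 0" using True by (simp add: \<rho>_def)
  let ?S = "{x - \<rho>..x + \<rho>}"
  let ?r = "\<lambda>t. indicator {a<..<b} t - indicator ?S t :: complex"
  have sub: "?S \<subseteq> {a<..<b}" using True by (auto simp: \<rho>_def min_def field_simps)
  have i: "integrable lborel (indicator ?S :: real \<Rightarrow> complex)" by (rule integrable_complex_indicator) (simp_all add: emeasure_lborel_Icc_eq)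
  have i2: "integrable lborel (indicator {a<..<b} :: real \<Rightarrow> complex)" using True by (intro integrable_complex_indicator) simp_all
  have ri: "integrable lborel ?r" by (rule Bochner_Integration.integrable_diff[OF i2 i])
  have "plemelj lborel ?r 0 x"
  proof (rule plemelj_vanish[OF sets_lborel integrable_weight_of_integrable[OF sets_lborel ri] \<rho>])
    fix t assume "\<bar>t - x\<bar> < \<rho>"
    then have "t \<in> ?S" by (auto simp: abs_less_iff)
    then show "?r t = 0" using sub by (auto simp: indicator_def)
  qed
  from plemelj_add[OF sets_lborel i ri plemelj_symmetric_interval[OF \<rho>] this, of 1] True
  show ?thesis by simp
next
  case False
  define \<rho> where "\<rho> = min \<bar>x - a\<bar> \<bar>x - b\<bar>"
  have i2: "integrable lborel (indicator {a<..<b} :: real \<Rightarrow> complex)" by (cases "a < b") (auto intro!: integrable_complex_indicator)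
  have "plemelj lborel (indicator {a<..<b}) 0 x"
  proof (rule plemelj_vanish[OF sets_lborel integrable_weight_of_integrable[OF sets_lborel i2]])
    show "\<rho> > 0" using x by (simp add: \<rho>_def)
    fix t assume "\<bar>t - x\<bar> < \<rho>"
    then show "indicator {a<..<b} t = (0::complex)" using False by (auto simp: \<rho>_def min_def abs_if indicator_def split: if_splits)
  qed
  then show ?thesis using False by simp
qed

lemma integral_dominated_tendsto_zero:
  fixes f :: "nat \<Rightarrow> real \<Rightarrow> complex"
  assumes sets: "sets M = sets borel" and f: "\<And>n. f n \<in> borel_measurable borel"
    and lim: "\<And>x. (\<lambda>n. f n x) \<longlonglongrightarrow> g x" and h: "integrable M h" and le: "\<And>n x. cmod (f n x) \<le> h x"
  shows "integrable M g" and "\<And>n. integrable M (f n)" and "(\<lambda>n. LINT t|M. cmod (g t - f n t)) \<longlonglongrightarrow> 0"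
proof -
  have fm: "f n \<in> borel_measurable M" for n using f[of n] by (simp add: measurable_cong_sets[OF sets refl])
  have gm: "g \<in> borel_measurable M" by (rule borel_measurable_LIMSEQ_metric[OF fm lim])
  have gle: "cmod (g x) \<le> h x" for x by (rule tendsto_upperbound[OF tendsto_norm[OF lim[of x]]]) (simp_all add: le)
  have h0: "0 \<le> h x" for x using norm_ge_zero gle by (rule order_trans)
  show fi: "integrable M (f n)" for n by (rule Bochner_Integration.integrable_bound[OF h fm]) (simp add: le h0)
  show gi: "integrable M g" by (rule Bochner_Integration.integrable_bound[OF h gm]) (simp add: gle h0)
  have "(\<lambda>n. LINT t|M. cmod (g t - f n t)) \<longlonglongrightarrow> (LINT t|M. 0)"
  proof (rule integral_dominated_convergence)
    show "(\<lambda>t. 0::real) \<in> borel_measurable M" by simp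
    show "(\<lambda>t. cmod (g t - f n t)) \<in> borel_measurable M" for n using fm gm by measurable
    show "integrable M (\<lambda>t. 2 * h t)" using h by simp
    have "(\<lambda>n. cmod (g x - f n x)) \<longlonglongrightarrow> cmod (g x - g x)" for x by (intro tendsto_intros lim)
    then show "AE x in M. (\<lambda>n. cmod (g x - f n x)) \<longlonglongrightarrow> 0" by simp
    have "norm (cmod (g x - f n x)) \<le> 2 * h x" for n x using norm_triangle_ineq4[of "g x" "f n x"] gle[of x] le[of n x] by simp
    then show "AE x in M. norm (cmod (g x - f n x)) \<le> 2 * h x" for n by simp
  qed
  then show "(\<lambda>n. LINT t|M. cmod (g t - f n t)) \<longlonglongrightarrow> 0" by simp
qed

lemma plemelj_lborel:
  assumes g: "g \<in> borel_measurable borel" and gi: "integrable lborel g"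
  shows "AE x in lborel. plemelj lborel g (g x) x"
proof -
  define C where "C = {g. g \<in> borel_measurable borel \<and> integrable lborel g \<and> (AE x in lborel. plemelj lborel g (g x) x)}"
  have "g \<in> C"
  proof (rule dominated_class_induct[where Q = "integrable lborel"])
    fix a b :: real assume "a < b"
    have "AE x in lborel. x \<notin> {a, b}" by (rule AE_not_in) (simp add: finite_imp_null_set_lborel)
    then have "AE x in lborel. plemelj lborel (indicator {a<..<b}) (indicator {a<..<b} x) x"
      by eventually_elim (rule plemelj_interval, simp_all)
    then show "indicator {a<..<b} \<in> C" using \<open>a < b\<close> by (auto simp: C_def intro!: integrable_complex_indicator)
  next
    fix f g :: "real \<Rightarrow> complex" assume "f \<in> C" "g \<in> C"
    then have fC: "f \<in> borel_measurable borel" "integrable lborel f" "AE x in lborel. plemelj lborel f (f x) x"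
      and gC: "g \<in> borel_measurable borel" "integrable lborel g" "AE x in lborel. plemelj lborel g (g x) x" by (simp_all add: C_def)
    from fC(3) gC(3) have "AE x in lborel. plemelj lborel (\<lambda>t. f t + 1 * g t) (f x + 1 * g x) x"
      by eventually_elim (rule plemelj_add[OF sets_lborel fC(2) gC(2)])
    then show "(\<lambda>x. f x + g x) \<in> C" using fC gC by (simp add: C_def)
  next
    fix f :: "real \<Rightarrow> complex" and a assume "f \<in> C"
    then have fC: "f \<in> borel_measurable borel" "integrable lborel f" "AE x in lborel. plemelj lborel f (f x) x" by (simp_all add: C_def)
    \<comment> \<open>The multiple is written as a sum with first term f, so that
      \<open>plemelj_add\<close> covers it.\<close>
    from fC(3) have "AE x in lborel. plemelj lborel (\<lambda>t. f t + (a - 1) * f t) (f x + (a - 1) * f x) x"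
      by eventually_elim (rule plemelj_add[OF sets_lborel fC(2) fC(2)])
    moreover have "f t + (a - 1) * f t = a * f t" for t by (simp add: algebra_simps)
    ultimately show "(\<lambda>x. a * f x) \<in> C" using fC by (simp add: C_def)
  next
    fix f :: "nat \<Rightarrow> real \<Rightarrow> complex" and g h
    assume fC: "\<And>n. f n \<in> C" and lim: "\<And>x. (\<lambda>n. f n x) \<longlonglongrightarrow> g x" and h: "integrable lborel h"
      and le: "\<And>n x. cmod (f n x) \<le> h x"
    have fm: "f n \<in> borel_measurable borel" for n using fC[of n] by (simp add: C_def)
    have ok: "AE x in lborel. plemelj lborel (f n) (f n x) x" for n using fC[of n] by (simp add: C_def)
    have gm: "g \<in> borel_measurable borel" by (rule borel_measurable_LIMSEQ_metric[OF fm lim])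
    note i = integral_dominated_tendsto_zero[OF sets_lborel fm lim h le]
    have "(\<lambda>n. ennreal (LINT t|lborel. cmod (g t - f n t))) \<longlonglongrightarrow> ennreal 0" by (intro tendsto_intros i(3))
    moreover have "ennreal (LINT t|lborel. cmod (g t - f n t)) = (\<integral>\<^sup>+x. ennreal (cmod (g x - f n x)) \<partial>lborel)" for n
      by (rule nn_integral_eq_integral[symmetric]) (use i(1,2) in simp_all)
    ultimately have "(\<lambda>n. \<integral>\<^sup>+x. ennreal (cmod (g x - f n x)) \<partial>lborel) \<longlonglongrightarrow> 0" by simp
    from plemelj_limit[OF sets_lborel i(1) i(2) i(3) gm fm this ok]
    show "g \<in> C" using gm i(1) by (simp add: C_def)
  next
    show "integrable lborel (\<lambda>x. B * indicator {- real n..real n} x)" for B :: real and n by (rule Bochner_Integration.integrable_mult_right, rule integrable_real_indicator) (simp_all add: emeasure_lborel_Icc_eq)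
  next
    show "g \<in> borel_measurable borel" by (rule g)
    show "integrable lborel (\<lambda>x. 2 * cmod (g x))" using gi by simp
  qed
  then show ?thesis by (simp add: C_def)
qed

section \<open>The limit property for measures with a singular part\<close>

lemma compact_approximation:
  fixes g :: "real \<Rightarrow> complex"
  assumes sets: "sets M = sets borel" and gi: "integrable M g" and N: "N \<in> sets borel"
    and van: "\<And>t. t \<notin> N \<Longrightarrow> g t = 0" and e: "e > 0"
  shows "\<exists>K. compact K \<and> K \<subseteq> N \<and> (LINT t|M. cmod (g t - g t * indicator K t)) \<le> e"
proof -
  \<comment> \<open>Inner regularity is applied to the finite measure |g| dM.\<close>
  define F where "F = density M (\<lambda>t. ennreal (cmod (g t)))"
  have gm: "(\<lambda>t. ennreal (cmod (g t))) \<in> borel_measurable M" using gi by measurable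
  have Fs: "sets F = sets borel" by (simp add: F_def sets)
  have FE: "emeasure F A = (\<integral>\<^sup>+t. ennreal (cmod (g t)) * indicator A t \<partial>M)" if "A \<in> sets borel" for A
    unfolding F_def by (rule emeasure_density[OF gm]) (use that sets in simp)
  have "(\<integral>\<^sup>+t. ennreal (cmod (g t)) \<partial>M) \<noteq> \<infinity>" using gi by (simp add: integrable_iff_bounded less_top)
  moreover have sp: "space F = UNIV" using sets_eq_imp_space_eq[OF Fs] by simp
  ultimately have Ffin: "emeasure F (space F) \<noteq> \<infinity>" by (simp add: FE)
  interpret F: finite_measure F by standard (use Ffin in simp)
  have "{K. K \<subseteq> N \<and> compact K} \<noteq> {}" using compact_empty by blast
  from SUP_approx_ennreal[OF e this inner_regular[OF Fs Ffin N]]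
  obtain K where K: "K \<subseteq> N" "compact K" "emeasure F N < emeasure F K + ennreal e"
    by (auto simp: F.emeasure_eq_measure)
  have Kb: "K \<in> sets borel" using K(2) by (simp add: borel_compact)
  have gK: "integrable M (\<lambda>t. g t * indicator K t)"
    by (rule integrable_mult_bounded[OF sets gi, where B = 1]) (use Kb in \<open>auto split: split_indicator\<close>)
  have "ennreal (LINT t|M. cmod (g t - g t * indicator K t)) = (\<integral>\<^sup>+t. ennreal (cmod (g t - g t * indicator K t)) \<partial>M)"
    by (rule nn_integral_eq_integral[symmetric]) (use gi gK in simp_all)
  also have "\<dots> = (\<integral>\<^sup>+t. ennreal (cmod (g t)) * indicator (N - K) t \<partial>M)"
    using K(1) van by (intro nn_integral_cong) (auto split: split_indicator)
  also have "\<dots> = emeasure F (N - K)" by (rule FE[symmetric]) (use N Kb in simp)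
  also have "\<dots> \<le> ennreal e"
  proof -
    have "emeasure F N = emeasure F K + emeasure F (N - K)"
      using plus_emeasure[of K F "N - K"] N Kb K(1) Fs by (simp add: Un_absorb1)
    then have "measure F (N - K) \<le> e" using K(3) e measure_nonneg[of F K] measure_nonneg[of F "N - K"]
      unfolding F.emeasure_eq_measure by (simp flip: ennreal_plus add: ennreal_less_iff)
    then show ?thesis unfolding F.emeasure_eq_measure by (rule ennreal_leI)
  qed
  finally have "(LINT t|M. cmod (g t - g t * indicator K t)) \<le> e" using e by simp
  with K show ?thesis by (intro exI[of _ K] conjI)
qed

text \<open>\<open>g\<close> is approximated by its restrictions to compact subsets K of the null
  set \<open>N\<close>. Off K such a restriction vanishes near each point, so it has the limit
  property with density 0 almost everywhere, and \<open>plemelj_limit\<close> passes this on to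
  \<open>g\<close>.\<close>

lemma plemelj_singular:
  fixes g :: "real \<Rightarrow> complex"
  assumes sets: "sets M = sets borel" and gi: "integrable M g" and N: "N \<in> null_sets lborel"
    and van: "\<And>t. t \<notin> N \<Longrightarrow> g t = 0"
  shows "AE x in lborel. plemelj M g 0 x"
proof -
  have Nb: "N \<in> sets borel" using null_setsD2[OF N] by simp
  have "\<forall>n. \<exists>K. compact K \<and> K \<subseteq> N \<and> (LINT t|M. cmod (g t - g t * indicator K t)) \<le> 1 / real (Suc n)"
    by (intro allI compact_approximation[OF sets gi Nb van]) simp_all
  from choice[OF this] obtain K where K: "\<forall>n. compact (K n) \<and> K n \<subseteq> N \<and> (LINT t|M. cmod (g t - g t * indicator (K n) t)) \<le> 1 / real (Suc n)"
    by (elim exE) (rule that)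
  have gK: "integrable M (\<lambda>t. g t * indicator (K n) t)" for n
    by (rule integrable_mult_bounded[OF sets gi, where B = 1]) (use K in \<open>auto intro!: borel_measurable_indicator borel_compact split: split_indicator\<close>)
  have lim: "(\<lambda>n. LINT t|M. cmod (g t - g t * indicator (K n) t)) \<longlonglongrightarrow> 0"
    by (rule tendsto_sandwich[OF _ _ tendsto_const LIMSEQ_Suc[OF lim_1_over_n]]) (use K in simp_all)
  have "AE x in lborel. plemelj M (\<lambda>t. g t * indicator (K n) t) 0 x" for n
    using AE_not_in[OF N]
  proof eventually_elim
    case (elim x)
    then have x: "x \<in> - K n" using K by auto
    have "open (- K n)" using K compact_imp_closed by auto
    from this[unfolded open_contains_ball, rule_format, OF x]
    obtain r where r: "r > 0" "ball x r \<subseteq> - K n" by (elim exE conjE) (rule that)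
    show ?case
    proof (rule plemelj_vanish[OF sets integrable_weight_of_integrable[OF sets gK] r(1)])
      fix t assume "\<bar>t - x\<bar> < r"
      then have "t \<in> ball x r" by (simp add: dist_real_def)
      then show "g t * indicator (K n) t = 0" using r(2) by auto
    qed
  qed
  from plemelj_limit[OF sets gi gK lim, of "\<lambda>_. 0" "\<lambda>_ _. 0", OF _ _ _ this] show ?thesis by simp
qed

text \<open>Off \<open>N\<close> the measure is w dt, so this part reduces to Lebesgue measure with
  g w in place of g. The part on \<open>N\<close> is singular and contributes density 0.\<close>

lemma (in cauchy_measure) plemelj_integrable:
  assumes w: "is_ac_density \<mu> w" and gm: "g \<in> borel_measurable borel" and gi: "integrable \<mu> g"
  shows "AE x in lborel. plemelj \<mu> g (g x * of_real (w x)) x"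
proof -
  obtain N where N: "N \<in> null_sets lborel"
    "\<forall>B\<in>sets borel. emeasure \<mu> B = emeasure (density lborel (\<lambda>t. ennreal (w t))) B + emeasure \<mu> (B \<inter> N)"
    using w unfolding is_ac_density_def by (elim conjE bexE) (rule that)
  have wm[measurable]: "w \<in> borel_measurable borel" and w0: "\<And>t. 0 \<le> w t" using w by (simp_all add: is_ac_density_def)
  have Nb: "N \<in> sets borel" using null_setsD2[OF N(1)] by simp
  have Nb': "- N \<in> sets borel" using Nb by simp
  have im: "(\<lambda>t. indicator (- N) t :: real) \<in> borel_measurable \<mu>" using Nb' sets by (intro borel_measurable_indicator) simp
  \<comment> \<open>\<open>N\<close> is also a null set for w dt, so removing from \<mu> what it has
    on \<open>N\<close> leaves exactly w dt.\<close>
  have eq: "density lborel (\<lambda>t. ennreal (w t)) = density \<mu> (\<lambda>t. ennreal (indicator (- N) t))"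
  proof (rule measure_eqI)
    show "sets (density lborel (\<lambda>t. ennreal (w t))) = sets (density \<mu> (\<lambda>t. ennreal (indicator (- N) t)))"
      by (simp add: sets)
    fix A assume "A \<in> sets (density lborel (\<lambda>t. ennreal (w t)))"
    then have A: "A \<in> sets borel" by simp
    have AN: "A \<inter> - N \<in> sets borel" using A Nb' by (rule sets.Int)
    have zero: "emeasure (density lborel (\<lambda>t. ennreal (w t))) (A \<inter> N) = 0"
    proof -
      have "A \<inter> N \<in> null_sets lborel" using null_set_Int1[OF N(1), of A] A by simp
      from AE_not_in[OF this] have "AE x in lborel. x \<in> A \<inter> N \<longrightarrow> ennreal (w x) = 0" by eventually_elim blast
      moreover have "A \<inter> N \<in> sets lborel" using A Nb by simp
      ultimately have "A \<inter> N \<in> null_sets (density lborel (\<lambda>t. ennreal (w t)))" by (subst null_sets_density_iff) simp_all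
      then show ?thesis by (rule null_setsD1)
    qed
    have "emeasure (density lborel (\<lambda>t. ennreal (w t))) A =
        emeasure (density lborel (\<lambda>t. ennreal (w t))) (A \<inter> - N) + emeasure (density lborel (\<lambda>t. ennreal (w t))) (A \<inter> N)"
      using plus_emeasure[of "A \<inter> - N" "density lborel (\<lambda>t. ennreal (w t))" "A \<inter> N"] AN A Nb
      by (simp add: Int_Un_distrib[symmetric] disjoint_iff)
    also have "\<dots> = emeasure \<mu> (A \<inter> - N)"
      using N(2)[rule_format, OF AN] unfolding zero by (simp add: Int_assoc)
    also have "\<dots> = emeasure (density \<mu> (\<lambda>t. ennreal (indicator (- N) t))) A"
    proof -
      have "emeasure (density \<mu> (\<lambda>t. ennreal (indicator (- N) t))) A = (\<integral>\<^sup>+t. ennreal (indicator (- N) t) * indicator A t \<partial>\<mu>)"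
        by (rule emeasure_density) (use im A sets in simp_all)
      also have "\<dots> = (\<integral>\<^sup>+t. indicator (A \<inter> - N) t \<partial>\<mu>)" by (intro nn_integral_cong) (simp split: split_indicator)
      also have "\<dots> = emeasure \<mu> (A \<inter> - N)" by (rule nn_integral_indicator) (use AN sets in simp)
      finally show ?thesis by simp
    qed
    finally show "emeasure (density lborel (\<lambda>t. ennreal (w t))) A = emeasure (density \<mu> (\<lambda>t. ennreal (indicator (- N) t))) A" .
  qed
  define g1 where "g1 t = g t * indicator (- N) t" for t
  define g2 where "g2 t = g t * indicator N t" for t
  define h where "h t = g t * complex_of_real (w t)" for t
  have hm: "h \<in> borel_measurable borel" unfolding h_def[abs_def] using gm by measurable
  have g1i: "integrable \<mu> g1" unfolding g1_def[abs_def]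
    by (rule integrable_mult_bounded[OF sets gi, where B = 1]) (use Nb' in \<open>auto split: split_indicator\<close>)
  have g2i: "integrable \<mu> g2" unfolding g2_def[abs_def]
    by (rule integrable_mult_bounded[OF sets gi, where B = 1]) (use Nb in \<open>auto split: split_indicator\<close>)
  have hi: "integrable lborel h"
  proof -
    have "integrable (density \<mu> (\<lambda>t. ennreal (indicator (- N) t))) g"
      by (subst integrable_density) (use gm g1i im in \<open>simp_all add: measurable_iff g1_def[abs_def] scaleR_conv_of_real mult.commute of_real_indicator\<close>)
    then have "integrable (density lborel (\<lambda>t. ennreal (w t))) g" by (simp only: eq)
    then show ?thesis
      by (subst (asm) integrable_density) (use gm w0 in \<open>simp_all add: h_def[abs_def] scaleR_conv_of_real mult.commute\<close>)
  qed
  have key: "(LINT t|\<mu>. g1 t * k t) = (LINT t|lborel. h t * k t)" if k: "k \<in> borel_measurable borel" for k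
  proof -
    have gk: "(\<lambda>t. g t * k t) \<in> borel_measurable borel" using gm k by measurable
    have "(LINT t|\<mu>. g1 t * k t) = (LINT t|density \<mu> (\<lambda>t. ennreal (indicator (- N) t)). g t * k t)"
      by (subst integral_density) (use gk im in \<open>simp_all add: measurable_iff g1_def scaleR_conv_of_real of_real_indicator mult_ac\<close>)
    also have "\<dots> = (LINT t|density lborel (\<lambda>t. ennreal (w t)). g t * k t)" by (simp only: eq)
    also have "\<dots> = (LINT t|lborel. h t * k t)"
      by (subst integral_density) (use gk w0 in \<open>simp_all add: h_def scaleR_conv_of_real mult_ac\<close>)
    finally show ?thesis .
  qed
  have ct: "cauchy_transform \<mu> g1 z = cauchy_transform lborel h z" for z
    unfolding cauchy_transform_eq by (rule key) measurable
  have tr: "trunc \<mu> g1 \<delta> x = trunc lborel h \<delta> x" for \<delta> x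
    unfolding trunc_eq by (rule key) measurable
  have split: "g1 t + 1 * g2 t = g t" for t by (simp add: g1_def g2_def split: split_indicator)
  have "AE x in lborel. plemelj \<mu> g2 0 x" by (rule plemelj_singular[OF sets g2i N(1)]) (simp add: g2_def)
  with plemelj_lborel[OF hm hi] show ?thesis
  proof eventually_elim
    case (elim x)
    have "plemelj \<mu> g1 (h x) x" using elim(1) unfolding plemelj_def ct tr .
    from plemelj_add[OF sets g1i g2i this elim(2), of 1] show ?case unfolding split by (simp add: h_def)
  qed
qed

lemma integrable_weight_times_kernel:
  assumes sets: "sets M = sets borel" and g: "integrable M (\<lambda>t. g t / complex_of_real (1 + \<bar>t\<bar>))"
    and k: "k \<in> borel_measurable borel" and le: "\<And>t. cmod (k t) \<le> 1 / \<delta>" "\<And>t. \<bar>t - x\<bar> * cmod (k t) \<le> 1"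
  shows "integrable M (\<lambda>t. g t * k t)"
proof -
  have wne: "complex_of_real (1 + \<bar>t\<bar>) \<noteq> 0" for t unfolding of_real_eq_0_iff by linarith
  have "integrable M (\<lambda>t. g t / complex_of_real (1 + \<bar>t\<bar>) * (complex_of_real (1 + \<bar>t\<bar>) * k t))"
  proof (rule integrable_mult_bounded[OF sets g])
    show "(\<lambda>t. complex_of_real (1 + \<bar>t\<bar>) * k t) \<in> borel_measurable borel" using k by measurable
    fix t
    have "cmod (complex_of_real (1 + \<bar>t\<bar>) * k t) = (1 + \<bar>t\<bar>) * cmod (k t)" unfolding norm_mult norm_of_real by simp
    also have "\<dots> \<le> ((1 + \<bar>x\<bar>) + \<bar>t - x\<bar>) * cmod (k t)" by (rule mult_right_mono) auto
    also have "\<dots> \<le> (1 + \<bar>x\<bar>) * (1 / \<delta>) + 1"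
      unfolding distrib_right[of "1 + \<bar>x\<bar>"] by (intro add_mono le mult_left_mono) simp
    finally show "cmod (complex_of_real (1 + \<bar>t\<bar>) * k t) \<le> (1 + \<bar>x\<bar>) * (1 / \<delta>) + 1" .
  qed
  moreover have "g t / complex_of_real (1 + \<bar>t\<bar>) * (complex_of_real (1 + \<bar>t\<bar>) * k t) = g t * k t" for t using wne[of t] by simp
  ultimately show ?thesis by (simp only:)
qed

lemma integrable_weight_kernels:
  assumes sets: "sets M = sets borel" and g: "integrable M (\<lambda>t. g t / complex_of_real (1 + \<bar>t\<bar>))" and d: "\<delta> > 0"
  shows "integrable M (\<lambda>t. g t * (1 / (complex_of_real t - Complex x \<delta>)))" and "integrable M (\<lambda>t. g t * trunc_kernel \<delta> x t)"
proof -
  show "integrable M (\<lambda>t. g t * (1 / (complex_of_real t - Complex x \<delta>)))"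
  proof (rule integrable_weight_times_kernel[OF sets g, of _ \<delta> x])
    show "cmod (1 / (complex_of_real t - Complex x \<delta>)) \<le> 1 / \<delta>" for t by (rule cauchy_kernel_bound_Complex[OF d])
    show "\<bar>t - x\<bar> * cmod (1 / (complex_of_real t - Complex x \<delta>)) \<le> 1" for t
      using abs_Re_le_cmod[of "complex_of_real t - Complex x \<delta>"] by (auto simp: norm_divide divide_le_eq)
  qed measurable
  show "integrable M (\<lambda>t. g t * trunc_kernel \<delta> x t)"
  proof (rule integrable_weight_times_kernel[OF sets g, of _ \<delta> x])
    show "cmod (trunc_kernel \<delta> x t) \<le> 1 / \<delta>" for t by (rule trunc_kernel_bound[OF d])
    show "\<bar>t - x\<bar> * cmod (trunc_kernel \<delta> x t) \<le> 1" for t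
      by (simp add: trunc_kernel_def norm_divide abs_minus_commute split: split_indicator flip: of_real_diff)
  qed measurable
qed

text \<open>The property is local: for |x| < n the part of \<open>g\<close> outside [-n, n] vanishes
  near x, and the other part is integrable because 1 + |t| is bounded there.\<close>

lemma (in cauchy_measure) plemelj_weight_integrable:
  assumes w: "is_ac_density \<mu> w" and gm: "g \<in> borel_measurable borel"
    and gi: "integrable \<mu> (\<lambda>t. g t / complex_of_real (1 + \<bar>t\<bar>))"
  shows "AE x in lborel. plemelj \<mu> g (g x * of_real (w x)) x"
proof -
  have "AE x in lborel. \<bar>x\<bar> < real n \<longrightarrow> plemelj \<mu> g (g x * of_real (w x)) x" for n
  proof -
    let ?S = "{- real n..real n}"
    define h where "h t = g t * indicator ?S t" for t
    define r where "r t = g t * indicator (- ?S) t" for t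
    have hm: "h \<in> borel_measurable borel" unfolding h_def[abs_def] using gm by measurable
    have wne: "complex_of_real (1 + \<bar>t\<bar>) \<noteq> 0" for t unfolding of_real_eq_0_iff by linarith
    have hi: "integrable \<mu> h"
    proof -
      have "integrable \<mu> (\<lambda>t. g t / complex_of_real (1 + \<bar>t\<bar>) * (complex_of_real (1 + \<bar>t\<bar>) * indicator ?S t))"
      proof (rule integrable_mult_bounded[OF sets gi])
        show "(\<lambda>t. complex_of_real (1 + \<bar>t\<bar>) * indicator ?S t) \<in> borel_measurable borel" by measurable
        have "cmod (complex_of_real (1 + \<bar>t\<bar>)) = 1 + \<bar>t\<bar>" for t unfolding norm_of_real by simp
        then show "cmod (complex_of_real (1 + \<bar>t\<bar>) * indicator ?S t) \<le> 1 + real n" for t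
          by (auto simp: norm_mult split: split_indicator)
      qed
      moreover have "g t / complex_of_real (1 + \<bar>t\<bar>) * (complex_of_real (1 + \<bar>t\<bar>) * indicator ?S t) = h t" for t
        using wne[of t] by (simp add: h_def)
      ultimately show ?thesis by (simp only:)
    qed
    have hw: "integrable \<mu> (\<lambda>t. h t / complex_of_real (1 + \<bar>t\<bar>))" by (rule integrable_weight_of_integrable[OF sets hi])
    have rw: "integrable \<mu> (\<lambda>t. r t / complex_of_real (1 + \<bar>t\<bar>))"
    proof -
      have "integrable \<mu> (\<lambda>t. g t / complex_of_real (1 + \<bar>t\<bar>) * indicator (- ?S) t)"
        by (rule integrable_mult_bounded[OF sets gi, where B = 1]) (auto split: split_indicator)
      then show ?thesis by (simp add: r_def)
    qed
    have sp: "g t = h t + r t" for t by (simp add: h_def r_def split: split_indicator)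
    from plemelj_integrable[OF w hm hi] show ?thesis
    proof eventually_elim
      case (elim x)
      show ?case
      proof
        assume x: "\<bar>x\<bar> < real n"
        have r: "plemelj \<mu> r 0 x"
        proof (rule plemelj_vanish[OF sets rw, of "real n - \<bar>x\<bar>"])
          fix t assume "\<bar>t - x\<bar> < real n - \<bar>x\<bar>"
          then show "r t = 0" by (auto simp: r_def split: split_indicator)
        qed (use x in simp)
        have "plemelj \<mu> g (h x * of_real (w x) + 1 * 0) x"
        proof (rule plemelj_combine[OF elim r])
          fix \<delta> :: real assume d: "\<delta> > 0"
          note i = integrable_weight_kernels[OF sets hw d, of x] integrable_weight_kernels[OF sets rw d, of x]
          show "cauchy_transform \<mu> g (Complex x \<delta>) = cauchy_transform \<mu> h (Complex x \<delta>) + 1 * cauchy_transform \<mu> r (Complex x \<delta>)"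
            unfolding cauchy_transform_eq sp distrib_right mult_1_left by (rule Bochner_Integration.integral_add[OF i(1,3)])
          show "trunc \<mu> g \<delta> x = trunc \<mu> h \<delta> x + 1 * trunc \<mu> r \<delta> x"
            unfolding trunc_eq sp distrib_right mult_1_left by (rule Bochner_Integration.integral_add[OF i(2,4)])
        qed
        moreover have "h x = g x" using x by (auto simp: h_def split: split_indicator)
        ultimately show "plemelj \<mu> g (g x * of_real (w x)) x" by simp
      qed
    qed
  qed
  then have "AE x in lborel. \<forall>n. \<bar>x\<bar> < real n \<longrightarrow> plemelj \<mu> g (g x * of_real (w x)) x" by (simp only: AE_all_countable simp_thms)
  then show ?thesis
  proof eventually_elim
    case (elim x)
    obtain n where "\<bar>x\<bar> < real n" using reals_Archimedean2 by blast
    with elim show ?case by blast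
  qed
qed

section \<open>Lebesgue decomposition\<close>

text \<open>Exhaustion: a countable union of Lebesgue null sets attains the supremum of
  \<open>F\<close> over them, and a null set with mass outside this union would exceed that finite
  supremum.\<close>

lemma null_set_of_maximal_measure:
  fixes F :: "real measure"
  assumes sets: "sets F = sets borel" and fin: "emeasure F UNIV \<noteq> \<infinity>"
  shows "\<exists>N\<in>null_sets lborel. \<forall>B\<in>null_sets lborel. emeasure F (B - N) = 0"
proof -
  have ne: "null_sets lborel \<noteq> ({} :: real set set)" by blast
  from ennreal_SUP_countable_SUP[OF ne, of "emeasure F"]
  obtain f :: "nat \<Rightarrow> ennreal" where f: "range f \<subseteq> emeasure F ` null_sets lborel" "Sup (emeasure F ` null_sets lborel) = Sup (range f)"
    by (elim exE conjE) (rule that)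
  have "\<forall>n. \<exists>N. N \<in> null_sets lborel \<and> f n = emeasure F N" using f(1) by auto
  from choice[OF this] obtain P where P: "\<forall>n. P n \<in> null_sets lborel \<and> f n = emeasure F (P n)" by (elim exE) (rule that)
  define N where "N = (\<Union>n. P n)"
  have N: "N \<in> null_sets lborel" unfolding N_def using P by (intro null_sets_UN) simp
  have Nb: "N \<in> sets F" using null_setsD2[OF N] sets by simp
  have top: "Sup (emeasure F ` null_sets lborel) \<le> emeasure F N"
    unfolding f(2)
  proof (rule SUP_least)
    fix n show "f n \<le> emeasure F N"
      using P emeasure_mono[of "P n" N F] Nb by (auto simp: N_def)
  qed
  have "emeasure F (B - N) = 0" if B: "B \<in> null_sets lborel" for B
  proof -
    have Bb: "B \<in> sets F" using null_setsD2[OF B] sets by simp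
    have "N \<union> B \<in> null_sets lborel" using N B by (rule null_sets.Un)
    then have "emeasure F (N \<union> B) \<le> emeasure F N" by (intro order_trans[OF SUP_upper top])
    moreover have "emeasure F (N \<union> B) = emeasure F N + emeasure F (B - N)"
      using plus_emeasure[of N F "B - N"] Nb Bb by auto
    moreover have "emeasure F N \<noteq> \<infinity>"
      using emeasure_mono[of N UNIV F] fin sets sets_eq_imp_space_eq[OF sets] by (auto simp: top_unique)
    ultimately show ?thesis 
      by (cases "emeasure F N"; cases "emeasure F (B - N)") (simp_all flip: ennreal_plus add: top_unique)
  qed
  with N show ?thesis by (intro bexI[of _ N]) simp_all
qed

lemma (in cauchy_measure) emeasure_bounded_finite: "emeasure \<mu> {- real n..real n} < \<infinity>"
proof -
  have "integrable \<mu> (\<lambda>t. (1 + real n) * (1 / (1 + \<bar>t\<bar>)))" using int by (rule Bochner_Integration.integrable_mult_right)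
  then have fin: "(\<integral>\<^sup>+t. ennreal ((1 + real n) * (1 / (1 + \<bar>t\<bar>))) \<partial>\<mu>) < \<infinity>"
    by (simp add: integrable_iff_bounded)
  have "emeasure \<mu> {- real n..real n} = (\<integral>\<^sup>+t. indicator {- real n..real n} t \<partial>\<mu>)"
    by (rule nn_integral_indicator[symmetric]) (simp add: sets)
  also have "\<dots> \<le> (\<integral>\<^sup>+t. ennreal ((1 + real n) * (1 / (1 + \<bar>t\<bar>))) \<partial>\<mu>)"
  proof (rule nn_integral_mono)
    fix t
    show "indicator {- real n..real n} t \<le> ennreal ((1 + real n) * (1 / (1 + \<bar>t\<bar>)))"
    proof (cases "t \<in> {- real n..real n}")
      case True
      then have "1 \<le> (1 + real n) * (1 / (1 + \<bar>t\<bar>))" by (auto simp: le_divide_eq)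
      from ennreal_leI[OF this] True show ?thesis by simp
    qed simp
  qed
  finally show ?thesis using fin by (rule order.strict_trans1)
qed

text \<open>A Lebesgue null set of maximal mass absorbs the singular part; off it \<mu> is
  absolutely continuous and has a Radon-Nikodym density. The density is finite almost everywhere
  since \<mu> is finite on bounded sets, so it can be taken real valued.\<close>

lemma (in cauchy_measure) ex_ac_density: "\<exists>w. is_ac_density \<mu> w"
proof -
  \<comment> \<open>A finite measure with the same null sets as \<mu>, because the weight is
    positive everywhere.\<close>
  define F where "F = density \<mu> (\<lambda>t. ennreal (1 / (1 + \<bar>t\<bar>)))"
  have Fs: "sets F = sets borel" by (simp add: F_def sets)
  have wm: "(\<lambda>t. ennreal (1 / (1 + \<bar>t\<bar>))) \<in> borel_measurable \<mu>" unfolding measurable_cong_sets[OF sets refl] by measurable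
  have sp: "space \<mu> = UNIV" using sets_eq_imp_space_eq[OF sets] by simp
  have "emeasure F UNIV = (\<integral>\<^sup>+t. ennreal (1 / (1 + \<bar>t\<bar>)) \<partial>\<mu>)"
    unfolding F_def by (subst emeasure_density[OF wm]) (simp_all add: sets)
  also have "\<dots> < \<infinity>" using int by (simp add: integrable_iff_bounded)
  finally obtain N where N: "N \<in> null_sets lborel" "\<forall>B\<in>null_sets lborel. emeasure F (B - N) = 0"
    using null_set_of_maximal_measure[OF Fs] by (auto simp: less_top)
  have Nb: "N \<in> sets borel" using null_setsD2[OF N(1)] by simp
  have null: "emeasure \<mu> (B - N) = 0" if "B \<in> null_sets lborel" for B
  proof -
    have B: "B - N \<in> sets \<mu>" using null_setsD2[OF that] Nb sets by auto
    then have "B - N \<in> null_sets F" using N(2) that Fs sets by (auto simp: null_sets_def)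
    then have "AE x in \<mu>. x \<in> B - N \<longrightarrow> ennreal (1 / (1 + \<bar>x\<bar>)) = 0"
      unfolding F_def null_sets_density_iff[OF wm] by (rule conjunct2)
    moreover have "ennreal (1 / (1 + \<bar>x\<bar>)) \<noteq> 0" for x
    proof -
      have "1 / (1 + \<bar>x\<bar>) > 0" by (rule divide_pos_pos) linarith+
      then show ?thesis by (simp add: ennreal_eq_0_iff)
    qed
    ultimately have "AE x in \<mu>. x \<notin> B - N" by simp
    moreover have "{x \<in> space \<mu>. \<not> x \<notin> B - N} = B - N" using sp by auto
    ultimately show ?thesis by (simp only: AE_iff_measurable[OF B])
  qed
  define \<nu> where "\<nu> = density \<mu> (indicator (- N))"
  have \<nu>s: "sets \<nu> = sets borel" by (simp add: \<nu>_def sets)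
  have \<nu>l: "sets \<nu> = sets lborel" using \<nu>s by simp
  have im: "indicator (- N) \<in> borel_measurable \<mu>" using Nb sets by (intro borel_measurable_indicator) simp
  have \<nu>E: "emeasure \<nu> B = emeasure \<mu> (B - N)" if "B \<in> sets borel" for B
  proof -
    have "emeasure \<nu> B = (\<integral>\<^sup>+t. indicator (- N) t * indicator B t \<partial>\<mu>)"
      unfolding \<nu>_def by (rule emeasure_density[OF im]) (use that sets in simp)
    also have "\<dots> = (\<integral>\<^sup>+t. indicator (B - N) t \<partial>\<mu>)" by (intro nn_integral_cong) (simp split: split_indicator)
    also have "\<dots> = emeasure \<mu> (B - N)" by (rule nn_integral_indicator) (use that Nb sets in simp)
    finally show ?thesis .
  qed
  have "absolutely_continuous lborel \<nu>"
    unfolding absolutely_continuous_def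
  proof
    fix B :: "real set" assume B: "B \<in> null_sets lborel"
    then have "B \<in> sets borel" by (simp only: null_setsD2 flip: sets_lborel)
    then show "B \<in> null_sets \<nu>" using null[OF B] \<nu>E[of B] \<nu>s by (simp add: null_sets_def)
  qed
  from sigma_finite_measure.Radon_Nikodym[OF sigma_finite_lborel this \<nu>l] obtain f where f: "f \<in> borel_measurable lborel" "density lborel f = \<nu>"
    by (elim bexE) (rule that)
  have fin: "AE x in lborel. x \<in> {- real n..real n} \<longrightarrow> f x \<noteq> \<infinity>" for n
  proof -
    let ?S = "{- real n..real n}"
    have "(\<integral>\<^sup>+x. f x * indicator ?S x \<partial>lborel) = emeasure \<nu> ?S"
      unfolding f(2)[symmetric] by (rule emeasure_density[symmetric]) (use f in simp_all)
    also have "\<dots> = emeasure \<mu> (?S - N)" by (rule \<nu>E) simp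
    also have "\<dots> \<le> emeasure \<mu> ?S" by (rule emeasure_mono) (auto simp: sets)
    also have "\<dots> < \<infinity>" by (rule emeasure_bounded_finite)
    finally have "AE x in lborel. f x * indicator ?S x \<noteq> \<infinity>" using f(1) by (intro nn_integral_PInf_AE) simp_all
    then show ?thesis by eventually_elim (auto split: split_indicator)
  qed
  then have "AE x in lborel. \<forall>n. x \<in> {- real n..real n} \<longrightarrow> f x \<noteq> \<infinity>" by (simp only: AE_all_countable simp_thms)
  then have ffin: "AE x in lborel. f x \<noteq> \<infinity>"
  proof eventually_elim
    case (elim x)
    obtain n where "\<bar>x\<bar> < real n" using reals_Archimedean2 by blast
    then have "x \<in> {- real n..real n}" by auto
    with elim show ?case by blast
  qed
  define w where "w x = enn2real (f x)" for x
  have wb: "w \<in> borel_measurable borel" unfolding w_def[abs_def] using f(1) by measurable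
  have "density lborel (\<lambda>t. ennreal (w t)) = density lborel f"
  proof (rule density_cong)
    show "AE x in lborel. ennreal (w x) = f x" using ffin by eventually_elim (simp add: w_def less_top)
  qed (use wb f(1) in simp_all)
  then have wd: "density lborel (\<lambda>t. ennreal (w t)) = \<nu>" using f(2) by simp
  have "is_ac_density \<mu> w" unfolding is_ac_density_def
  proof (intro conjI allI bexI[of _ N] ballI wb N(1))
    show "0 \<le> w t" for t by (simp add: w_def)
    fix B :: "real set" assume B: "B \<in> sets borel"
    have "emeasure \<mu> B = emeasure \<mu> ((B - N) \<union> (B \<inter> N))" by (simp add: Un_Diff_Int)
    also have "\<dots> = emeasure \<mu> (B - N) + emeasure \<mu> (B \<inter> N)"
      by (rule plus_emeasure[symmetric]) (use B Nb sets in auto)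
    finally show "emeasure \<mu> B = emeasure (density lborel (\<lambda>t. ennreal (w t))) B + emeasure \<mu> (B \<inter> N)"
      unfolding wd \<nu>E[OF B] .
  qed
  then show ?thesis by blast
qed

lemma (in cauchy_measure) ac_density: "is_ac_density \<mu> (ac_density \<mu>)"
  unfolding ac_density_def by (rule someI_ex[OF ex_ac_density])

section \<open>Passage to the real line\<close>

context cauchy_measure begin

text \<open>\<open>boundary_value\<close> is a \<open>Lim\<close> and carries no information where
  no limit exists; the limit property for the constant function 1 supplies the limit almost
  everywhere.\<close>

lemma tendsto_boundary_value:
  assumes M: "\<And>z. z \<notin> \<real> \<Longrightarrow> M z = cauchy_transform \<mu> (\<lambda>_. 1) z"
  shows "AE t in lborel. ((\<lambda>e. M (Complex t e)) \<longlongrightarrow> boundary_value M t) (at_right 0)"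
proof -
  have "AE t in lborel. plemelj \<mu> (\<lambda>_. 1) (1 * of_real (ac_density \<mu> t)) t"
    by (rule plemelj_weight_integrable[OF ac_density _ integrable_weight_one]) simp
  then show ?thesis
  proof eventually_elim
    case (elim t)
    obtain l where l: "((\<lambda>\<delta>. trunc \<mu> (\<lambda>_. 1) \<delta> t) \<longlongrightarrow> l) (at_right 0)" using elim unfolding plemelj_def by (elim conjE exE) (rule that)
    from tendsto_diff[OF conjunct1[OF elim[unfolded plemelj_def]] l]
    have lim: "((\<lambda>\<delta>. cauchy_transform \<mu> (\<lambda>_. 1) (Complex t \<delta>)) \<longlongrightarrow> \<i> * of_real pi * (1 * of_real (ac_density \<mu> t)) - l) (at_right 0)"
      by (simp only: add_diff_cancel_right')
    have "\<forall>\<^sub>F \<delta> in at_right 0. cauchy_transform \<mu> (\<lambda>_. 1) (Complex t \<delta>) = M (Complex t \<delta>)"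
      by (rule eventually_mono[OF eventually_at_right_real[OF zero_less_one]]) (simp add: M complex_is_Real_iff)
    from Lim_transform_eventually[OF lim this]
    have "((\<lambda>\<delta>. M (Complex t \<delta>)) \<longlongrightarrow> \<i> * of_real pi * (1 * of_real (ac_density \<mu> t)) - l) (at_right 0)" .
    moreover from tendsto_Lim[OF trivial_limit_at_right_real this]
    have "boundary_value M t = \<i> * of_real pi * (1 * of_real (ac_density \<mu> t)) - l" unfolding boundary_value_def .
    ultimately show ?case by simp
  qed
qed

lemma trunc_real:
  fixes h :: "real \<Rightarrow> real"
  shows "Im (trunc \<mu> (\<lambda>t. of_real (h t)) \<delta> x) = 0"
proof -
  have "trunc \<mu> (\<lambda>t. of_real (h t)) \<delta> x = (LINT t|\<mu>. complex_of_real (h t * (indicator {t. \<bar>x - t\<bar> > \<delta>} t / (x - t))))"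
    unfolding trunc_eq by (intro Bochner_Integration.integral_cong refl) (simp add: trunc_kernel_def split: split_indicator)
  then show ?thesis by (simp only: integral_complex_of_real Im_complex_of_real)
qed

text \<open>
  The boundary value of the Cauchy transform of \<open>h\<close> is \<open>\<pi> (\<i> h w - H h)\<close>, whose modulus controls that of
  \<open>h w + H h\<close> only for real \<open>h\<close>; hence the splitting of \<open>g\<close> into real and imaginary parts.
\<close>

lemma hilbert_transform_le:
  fixes g :: "real \<Rightarrow> complex"
  assumes g: "g \<in> borel_measurable borel" and gi: "integrable \<mu> (\<lambda>t. g t / complex_of_real (1 + \<bar>t\<bar>))"
  shows "AE t in lborel. \<exists>a b.
    ((\<lambda>e. cauchy_transform \<mu> (\<lambda>t. of_real (Re (g t))) (Complex t e)) \<longlongrightarrow> a) (at_right 0) \<and>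
    ((\<lambda>e. cauchy_transform \<mu> (\<lambda>t. of_real (Im (g t))) (Complex t e)) \<longlongrightarrow> b) (at_right 0) \<and>
    (cmod (g t * of_real (ac_density \<mu> t) + hilbert_transform \<mu> g t))\<^sup>2 \<le> 2 * (cmod a)\<^sup>2 + 2 * (cmod b)\<^sup>2"
proof -
  let ?w = "ac_density \<mu>"
  have real_case: "\<exists>a T. ((\<lambda>e. cauchy_transform \<mu> (\<lambda>t. of_real (h t)) (Complex x e)) \<longlongrightarrow> a) (at_right 0) \<and>
      ((\<lambda>e. trunc \<mu> (\<lambda>t. of_real (h t)) e x) \<longlongrightarrow> of_real T) (at_right 0) \<and> (h x * ?w x + T / pi)\<^sup>2 \<le> (cmod a)\<^sup>2"
    if ok: "plemelj \<mu> (\<lambda>t. of_real (h t)) (of_real (h x) * of_real (?w x)) x" for h :: "real \<Rightarrow> real" and x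
  proof -
    obtain l where l: "((\<lambda>e. trunc \<mu> (\<lambda>t. of_real (h t)) e x) \<longlongrightarrow> l) (at_right 0)" using ok unfolding plemelj_def by (elim conjE exE) (rule that)
    have "((\<lambda>e. Im (trunc \<mu> (\<lambda>t. of_real (h t)) e x)) \<longlongrightarrow> Im l) (at_right 0)" by (rule tendsto_Im[OF l])
    then have "Im l = 0" unfolding trunc_real by (simp add: tendsto_const_iff)
    then have lT: "l = of_real (Re l)" by (simp add: complex_eq_iff)
    define a where "a = \<i> * of_real pi * (of_real (h x) * of_real (?w x)) - l"
    have "((\<lambda>e. cauchy_transform \<mu> (\<lambda>t. of_real (h t)) (Complex x e)) \<longlongrightarrow> a) (at_right 0)"
      using tendsto_diff[OF conjunct1[OF ok[unfolded plemelj_def]] l] unfolding a_def by (simp only: add_diff_cancel_right')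
    \<comment> \<open>With d = h w and T = Re l one has |a|^2 = T^2 + pi^2 d^2, while (d + T / pi)^2
      \<le> 2 d^2 + 2 T^2 / pi^2 = (2 / pi^2) |a|^2.\<close>
    moreover have "(h x * ?w x + Re l / pi)\<^sup>2 \<le> (cmod a)\<^sup>2"
    proof -
      define d where "d = h x * ?w x"
      have "Re a = - Re l" "Im a = pi * d" using \<open>Im l = 0\<close> by (simp_all add: a_def d_def)
      then have a2: "(cmod a)\<^sup>2 = (Re l)\<^sup>2 + (pi * d)\<^sup>2" by (simp add: cmod_power2)
      have "(u + v)\<^sup>2 \<le> 2 * u\<^sup>2 + 2 * v\<^sup>2" for u v :: real
        using zero_le_power2[of "u - v"] by (simp add: power2_eq_square algebra_simps)
      then have "(d + Re l / pi)\<^sup>2 \<le> 2 * d\<^sup>2 + 2 * (Re l / pi)\<^sup>2" .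
      also have "\<dots> = 2 / pi\<^sup>2 * (cmod a)\<^sup>2" unfolding a2 by (simp add: field_simps)
      also have "\<dots> \<le> 1 * (cmod a)\<^sup>2"
      proof (rule mult_right_mono)
        have "2 * 2 \<le> pi * pi" using pi_ge_two by (intro mult_mono) auto
        then show "2 / pi\<^sup>2 \<le> 1" by (simp add: power2_eq_square)
      qed simp
      finally show ?thesis by (simp add: d_def)
    qed
    ultimately show ?thesis using l lT by (intro exI[of _ a] exI[of _ "Re l"]) simp
  qed
  have mr: "(\<lambda>t. complex_of_real (Re (g t))) \<in> borel_measurable borel" and mi: "(\<lambda>t. complex_of_real (Im (g t))) \<in> borel_measurable borel"
    using g by measurable
  have wr: "Re (g t / complex_of_real (1 + \<bar>t\<bar>)) = Re (g t) / (1 + \<bar>t\<bar>)" "Im (g t / complex_of_real (1 + \<bar>t\<bar>)) = Im (g t) / (1 + \<bar>t\<bar>)" for t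
    by (simp_all only: Re_divide_of_real Im_divide_of_real)
  have ir: "integrable \<mu> (\<lambda>t. complex_of_real (Re (g t)) / complex_of_real (1 + \<bar>t\<bar>))"
    using integrable_of_real[OF integrable_Re[OF gi], where 'a = complex] unfolding wr of_real_divide .
  have ii: "integrable \<mu> (\<lambda>t. complex_of_real (Im (g t)) / complex_of_real (1 + \<bar>t\<bar>))"
    using integrable_of_real[OF integrable_Im[OF gi], where 'a = complex] unfolding wr of_real_divide .
  from plemelj_weight_integrable[OF ac_density mr ir] plemelj_weight_integrable[OF ac_density mi ii]
  show ?thesis
  proof eventually_elim
    case (elim x)
    obtain a S where a: "((\<lambda>e. cauchy_transform \<mu> (\<lambda>t. of_real (Re (g t))) (Complex x e)) \<longlongrightarrow> a) (at_right 0)"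
      "((\<lambda>e. trunc \<mu> (\<lambda>t. of_real (Re (g t))) e x) \<longlongrightarrow> of_real S) (at_right 0)" "(Re (g x) * ?w x + S / pi)\<^sup>2 \<le> (cmod a)\<^sup>2"
      using real_case[OF elim(1)] by (elim exE conjE) (rule that)
    obtain b T where b: "((\<lambda>e. cauchy_transform \<mu> (\<lambda>t. of_real (Im (g t))) (Complex x e)) \<longlongrightarrow> b) (at_right 0)"
      "((\<lambda>e. trunc \<mu> (\<lambda>t. of_real (Im (g t))) e x) \<longlongrightarrow> of_real T) (at_right 0)" "(Im (g x) * ?w x + T / pi)\<^sup>2 \<le> (cmod b)\<^sup>2"
      using real_case[OF elim(2)] by (elim exE conjE) (rule that)
    have "((\<lambda>e. trunc \<mu> (\<lambda>t. of_real (Re (g t))) e x + \<i> * trunc \<mu> (\<lambda>t. of_real (Im (g t))) e x) \<longlongrightarrow> of_real S + \<i> * of_real T) (at_right 0)"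
      by (intro tendsto_intros a(2) b(2))
    moreover have "\<forall>\<^sub>F e in at_right 0. trunc \<mu> (\<lambda>t. of_real (Re (g t))) e x + \<i> * trunc \<mu> (\<lambda>t. of_real (Im (g t))) e x = trunc \<mu> g e x"
    proof (rule eventually_mono[OF eventually_at_right_real[OF zero_less_one]])
      fix e :: real assume "e \<in> {0<..<1}"
      then have e: "e > 0" by simp
      have gsp: "g t * k = of_real (Re (g t)) * k + \<i> * (of_real (Im (g t)) * k)" for t k
        by (subst complex_eq[of "g t"]) (simp add: algebra_simps)
      have "(LINT t|\<mu>. g t * trunc_kernel e x t) = (LINT t|\<mu>. of_real (Re (g t)) * trunc_kernel e x t + \<i> * (of_real (Im (g t)) * trunc_kernel e x t))"
        by (simp only: gsp[symmetric])
      also have "\<dots> = (LINT t|\<mu>. of_real (Re (g t)) * trunc_kernel e x t) + (LINT t|\<mu>. \<i> * (of_real (Im (g t)) * trunc_kernel e x t))"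
        by (rule Bochner_Integration.integral_add[OF integrable_weight_kernels(2)[OF sets ir e]
             Bochner_Integration.integrable_mult_right[OF integrable_weight_kernels(2)[OF sets ii e]]])
      also have "\<dots> = (LINT t|\<mu>. of_real (Re (g t)) * trunc_kernel e x t) + \<i> * (LINT t|\<mu>. of_real (Im (g t)) * trunc_kernel e x t)"
        by (simp only: integral_mult_right_zero)
      finally show "trunc \<mu> (\<lambda>t. of_real (Re (g t))) e x + \<i> * trunc \<mu> (\<lambda>t. of_real (Im (g t))) e x = trunc \<mu> g e x"
        unfolding trunc_eq by (rule sym)
    qed
    ultimately have "((\<lambda>e. trunc \<mu> g e x) \<longlongrightarrow> of_real S + \<i> * of_real T) (at_right 0)" by (rule Lim_transform_eventually)
    from tendsto_Lim[OF trivial_limit_at_right_real this]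
    have H: "hilbert_transform \<mu> g x = complex_of_real (1 / pi) * (of_real S + \<i> * of_real T)"
      unfolding hilbert_transform_def trunc_def by (simp only:)
    \<comment> \<open>\<open>S\<close> and \<open>T\<close> are real, so they separate the real and
      imaginary parts of g w + H g and the two squares add.\<close>
    have "(cmod (g x * of_real (?w x) + hilbert_transform \<mu> g x))\<^sup>2 = (Re (g x) * ?w x + S / pi)\<^sup>2 + (Im (g x) * ?w x + T / pi)\<^sup>2"
      unfolding H cmod_power2 by simp
    also have "\<dots> \<le> 2 * (cmod a)\<^sup>2 + 2 * (cmod b)\<^sup>2" using a(3) b(3) zero_le_power2[of "cmod a"] zero_le_power2[of "cmod b"] by linarith
    finally show ?case using a(1) b(1) by (intro exI[of _ a] exI[of _ b] conjI)
  qed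
qed

end

text \<open>The inequality on each line is applied to Re g and Im g separately, because
  \<open>hilbert_transform_le\<close> compares g w + H g with the boundary values of these two
  Cauchy transforms. The additional factor 2 is the one in that comparison.\<close>

lemma weyl_boundary_inequality:
  fixes Mp Mm :: "complex \<Rightarrow> complex"
  assumes p: "cauchy_measure \<mu>p" and m: "cauchy_measure \<mu>m" and c: "cauchy_measure \<mu>"
    and Mp: "\<And>z. z \<notin> \<real> \<Longrightarrow> Mp z = cauchy_transform \<mu>p (\<lambda>_. 1) z"
    and Mm: "\<And>z. z \<notin> \<real> \<Longrightarrow> Mm z = cauchy_transform \<mu>m (\<lambda>_. 1) z"
    and K: "K \<ge> 0"
    and ineq: "\<And>h e. h \<in> L2 \<mu> \<Longrightarrow> e > 0 \<Longrightarrow>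
      (\<integral>\<^sup>+x. ennreal (weyl_weight Mp Mm (Complex x e) * (cmod (cauchy_transform \<mu> h (Complex x e)))\<^sup>2) \<partial>lborel)
        \<le> ennreal (K * (L2_norm \<mu> h)\<^sup>2)"
    and g: "g \<in> L2 \<mu>" and M: "M \<in> {Mp, Mm}"
  shows "(\<integral>\<^sup>+t. ennreal (Im (boundary_value M t) / (cmod (boundary_value Mp t - boundary_value Mm t))\<^sup>2
      * (cmod (g t * complex_of_real (ac_density \<mu> t) + hilbert_transform \<mu> g t))\<^sup>2) \<partial>lborel)
    \<le> ennreal (2 * K * (LINT t|\<mu>. (cmod (g t))\<^sup>2))"
proof -
  interpret p: cauchy_measure \<mu>p by fact
  interpret m: cauchy_measure \<mu>m by fact
  interpret c: cauchy_measure \<mu> by fact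
  let ?r = "\<lambda>t. complex_of_real (Re (g t))"
  let ?i = "\<lambda>t. complex_of_real (Im (g t))"
  let ?C = "cauchy_transform \<mu>"
  define \<epsilon> where "\<epsilon> n = 1 / real (Suc n)" for n
  have \<epsilon>: "\<epsilon> n > 0" for n by (simp add: \<epsilon>_def)
  have \<epsilon>0: "\<epsilon> \<longlonglongrightarrow> 0" unfolding \<epsilon>_def[abs_def] by (rule LIMSEQ_Suc[OF lim_1_over_n])
  have \<epsilon>lim: "filterlim \<epsilon> (at_right 0) sequentially"
    by (rule tendsto_imp_filterlim_at_right[OF \<epsilon>0]) (simp add: \<epsilon>)
  have nr: "Complex x e \<notin> \<real>" if "e > 0" for x e using that by (simp add: complex_is_Real_iff)
  have gm: "g \<in> borel_measurable \<mu>" by (rule L2_measurable[OF g])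
  then have gb: "g \<in> borel_measurable borel" by (simp add: c.measurable_iff)
  have rm: "?r \<in> borel_measurable \<mu>" "?i \<in> borel_measurable \<mu>" using gm by measurable
  have rL: "?r \<in> L2 \<mu>"
  proof (rule L2_bound[OF g rm(1)])
  qed (simp add: abs_Re_le_cmod)
  have iL: "?i \<in> L2 \<mu>"
  proof (rule L2_bound[OF g rm(2)])
  qed (simp add: abs_Im_le_cmod)
  define G where "G = (LINT t|\<mu>. (cmod (g t))\<^sup>2)"
  have norms: "(L2_norm \<mu> ?r)\<^sup>2 + (L2_norm \<mu> ?i)\<^sup>2 = G"
  proof -
    have "(LINT t|\<mu>. (cmod (?r t))\<^sup>2 + (cmod (?i t))\<^sup>2) = (LINT t|\<mu>. (cmod (?r t))\<^sup>2) + (LINT t|\<mu>. (cmod (?i t))\<^sup>2)"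
      by (rule Bochner_Integration.integral_add[OF L2_integrable_sq[OF rL] L2_integrable_sq[OF iL]])
    moreover have "(cmod (?r t))\<^sup>2 + (cmod (?i t))\<^sup>2 = (cmod (g t))\<^sup>2" for t by (simp add: cmod_power2)
    ultimately show ?thesis unfolding L2_norm_sq G_def by simp
  qed
  define W where "W n x = weyl_weight Mp Mm (Complex x (\<epsilon> n))" for n x
  define f where "f n x = W n x * (cmod (?C ?r (Complex x (\<epsilon> n))))\<^sup>2 + W n x * (cmod (?C ?i (Complex x (\<epsilon> n))))\<^sup>2" for n x
  have Im0: "Im (Mp (Complex x e)) \<ge> 0" "Im (Mm (Complex x e)) \<ge> 0" if "e > 0" for x e
    using Im_cauchy_transform_one(4)[OF p, of "Complex x e"] Im_cauchy_transform_one(4)[OF m, of "Complex x e"] Mp[OF nr[OF that]] Mm[OF nr[OF that]] that by simp_all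
  have W0: "W n x \<ge> 0" for n x using Im0[OF \<epsilon>] by (simp add: W_def weyl_weight_def)
  have Wm: "W n \<in> borel_measurable borel" for n
    unfolding W_def weyl_weight_def using Mp[OF nr[OF \<epsilon>]] Mm[OF nr[OF \<epsilon>]]
      p.cauchy_transform_line_measurable[OF p.integrable_weight_one \<epsilon>]
      m.cauchy_transform_line_measurable[OF m.integrable_weight_one \<epsilon>] by simp
  have Cm: "(\<lambda>x. ?C h (Complex x (\<epsilon> n))) \<in> borel_measurable borel" if "h \<in> L2 \<mu>" for h n
    by (rule c.cauchy_transform_line_measurable[OF c.L2_integrable_weight[OF that] \<epsilon>])
  have m1: "(\<lambda>x. ennreal (W n x * (cmod (?C h (Complex x (\<epsilon> n))))\<^sup>2)) \<in> borel_measurable lborel" if "h \<in> L2 \<mu>" for h n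
    using Wm[of n] Cm[OF that, of n] by measurable
  have fle: "(\<integral>\<^sup>+x. ennreal (f n x) \<partial>lborel) \<le> ennreal (K * G)" for n
  proof -
    have "(\<integral>\<^sup>+x. ennreal (f n x) \<partial>lborel) = (\<integral>\<^sup>+x. ennreal (W n x * (cmod (?C ?r (Complex x (\<epsilon> n))))\<^sup>2) \<partial>lborel)
        + (\<integral>\<^sup>+x. ennreal (W n x * (cmod (?C ?i (Complex x (\<epsilon> n))))\<^sup>2) \<partial>lborel)"
      unfolding nn_integral_add[OF m1[OF rL] m1[OF iL], symmetric] f_def
      by (intro nn_integral_cong ennreal_plus mult_nonneg_nonneg W0 zero_le_power2)
    also have "\<dots> \<le> ennreal (K * (L2_norm \<mu> ?r)\<^sup>2) + ennreal (K * (L2_norm \<mu> ?i)\<^sup>2)"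
      unfolding W_def by (intro add_mono ineq rL iL \<epsilon>)
    also have "\<dots> = ennreal (K * G)"
      unfolding norms[symmetric] distrib_left by (intro ennreal_plus[symmetric] mult_nonneg_nonneg K zero_le_power2)
    finally show ?thesis .
  qed
  have fm: "f n \<in> borel_measurable borel" for n
    unfolding f_def using Wm[of n] Cm[OF rL, of n] Cm[OF iL, of n] by measurable
  define T where "T t = Im (boundary_value M t) / (cmod (boundary_value Mp t - boundary_value Mm t))\<^sup>2
      * (cmod (g t * complex_of_real (ac_density \<mu> t) + hilbert_transform \<mu> g t))\<^sup>2" for t
  have bp: "AE t in lborel. ((\<lambda>e. Mp (Complex t e)) \<longlongrightarrow> boundary_value Mp t) (at_right 0)"
    by (rule p.tendsto_boundary_value) (rule Mp)
  have bm: "AE t in lborel. ((\<lambda>e. Mm (Complex t e)) \<longlongrightarrow> boundary_value Mm t) (at_right 0)"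
    by (rule m.tendsto_boundary_value) (rule Mm)
  have "AE t in lborel. ennreal (T t) \<le> liminf (\<lambda>n. ennreal (2 * f n t))"
    using bp bm c.hilbert_transform_le[OF gb c.L2_integrable_weight[OF g]]
  proof eventually_elim
    case (elim t)
    let ?P = "boundary_value Mp t" and ?M = "boundary_value Mm t"
    obtain a b where ab: "((\<lambda>e. ?C ?r (Complex t e)) \<longlongrightarrow> a) (at_right 0)" "((\<lambda>e. ?C ?i (Complex t e)) \<longlongrightarrow> b) (at_right 0)"
      "(cmod (g t * of_real (ac_density \<mu> t) + hilbert_transform \<mu> g t))\<^sup>2 \<le> 2 * (cmod a)\<^sup>2 + 2 * (cmod b)\<^sup>2"
      using elim(3) by (elim exE conjE) (rule that)
    have ev: "\<forall>\<^sub>F e::real in at_right 0. e > 0" by (rule eventually_at_right_less)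
    have P0: "Im ?P \<ge> 0"
      by (rule tendsto_lowerbound[OF tendsto_Im[OF elim(1)] eventually_mono[OF ev Im0(1)] trivial_limit_at_right_real])
    have M0: "Im ?M \<ge> 0"
      by (rule tendsto_lowerbound[OF tendsto_Im[OF elim(2)] eventually_mono[OF ev Im0(2)] trivial_limit_at_right_real])
    show ?case
    proof (cases "?P = ?M")
      \<comment> \<open>Division by zero gives 0, so the integrand vanishes where the two boundary
        values coincide.\<close>
      case True
      then show ?thesis by (simp add: T_def)
    next
      case False
      define L where "L = (Im ?P + Im ?M) / (cmod (?P - ?M))\<^sup>2"
      have "(\<lambda>n. W n t) \<longlonglongrightarrow> L"
        unfolding W_def weyl_weight_def L_def
        by (intro tendsto_intros filterlim_compose[OF elim(1) \<epsilon>lim] filterlim_compose[OF elim(2) \<epsilon>lim]) (use False in simp)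
      then have "(\<lambda>n. 2 * f n t) \<longlonglongrightarrow> 2 * (L * (cmod a)\<^sup>2 + L * (cmod b)\<^sup>2)"
        unfolding f_def by (intro tendsto_intros filterlim_compose[OF ab(1) \<epsilon>lim] filterlim_compose[OF ab(2) \<epsilon>lim])
      then have "(\<lambda>n. ennreal (2 * f n t)) \<longlonglongrightarrow> ennreal (2 * (L * (cmod a)\<^sup>2 + L * (cmod b)\<^sup>2))" by (rule tendsto_ennrealI)
      from lim_imp_Liminf[OF sequentially_bot this]
      have lim: "liminf (\<lambda>n. ennreal (2 * f n t)) = ennreal (2 * (L * (cmod a)\<^sup>2 + L * (cmod b)\<^sup>2))" .
      \<comment> \<open>Both imaginary parts are nonnegative, so each of them is at most the
        numerator of the limiting weight.\<close>
      have "Im (boundary_value M t) \<le> Im ?P + Im ?M" using M P0 M0 by auto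
      then have "T t \<le> L * (2 * (cmod a)\<^sup>2 + 2 * (cmod b)\<^sup>2)"
        unfolding T_def L_def using ab(3) P0 M0 by (intro mult_mono divide_right_mono) simp_all
      also have "\<dots> = 2 * (L * (cmod a)\<^sup>2 + L * (cmod b)\<^sup>2)" by (simp add: algebra_simps)
      finally show ?thesis unfolding lim by (rule ennreal_leI)
    qed
  qed
  then have "(\<integral>\<^sup>+t. ennreal (T t) \<partial>lborel) \<le> (\<integral>\<^sup>+t. liminf (\<lambda>n. ennreal (2 * f n t)) \<partial>lborel)" by (rule nn_integral_mono_AE)
  also have "\<dots> \<le> liminf (\<lambda>n. \<integral>\<^sup>+t. ennreal (2 * f n t) \<partial>lborel)"
    by (rule nn_integral_liminf) (use fm in measurable)
  also have "\<dots> \<le> liminf (\<lambda>n::nat. ennreal (2 * K * G))"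
  proof (rule Liminf_mono, rule always_eventually, rule allI)
    fix n
    have "(\<integral>\<^sup>+t. ennreal (2 * f n t) \<partial>lborel) = (\<integral>\<^sup>+t. 2 * ennreal (f n t) \<partial>lborel)"
      by (intro nn_integral_cong) (simp add: ennreal_mult')
    also have "\<dots> = 2 * (\<integral>\<^sup>+t. ennreal (f n t) \<partial>lborel)" by (rule nn_integral_cmult) (use fm in measurable)
    also have "\<dots> \<le> 2 * ennreal (K * G)" by (rule mult_left_mono[OF fle zero_le])
    also have "\<dots> = ennreal (2 * K * G)" by (simp add: ennreal_mult' mult.assoc)
    finally show "(\<integral>\<^sup>+t. ennreal (2 * f n t) \<partial>lborel) \<le> ennreal (2 * K * G)" .
  qed
  also have "\<dots> = ennreal (2 * K * G)" by (rule Liminf_const[OF sequentially_bot])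
  finally show ?thesis unfolding T_def G_def .
qed

theorem theorem5p2:
  fixes q :: "real \<Rightarrow> real"
    and s c :: "real \<Rightarrow> complex \<Rightarrow> complex"
    and mp mm Mp Mm :: "complex \<Rightarrow> complex"
    and Sp Sm :: "real \<Rightarrow> real"
  assumes "continuous_on UNIV q"
    and "L2_deficiency_indices (lborel_on {0<..}) (sl_minimal q {0<..}) 1 1"
    and "L2_deficiency_indices (lborel_on {..<0}) (sl_minimal q {..<0}) 1 1"
    and "\<And>z. sl_solution q z 0 1 (\<lambda>x. s x z)"
    and "\<And>z. sl_solution q z 1 0 (\<lambda>x. c x z)"
    and "\<And>z. z \<notin> \<real> \<Longrightarrow> (\<lambda>x. s x z - mp z * c x z) \<in> L2 (lborel_on {0<..})"
    and "\<And>z. z \<notin> \<real> \<Longrightarrow> (\<lambda>x. s x z + mm z * c x z) \<in> L2 (lborel_on {..<0})"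
    and "\<And>z. z \<notin> \<real> \<Longrightarrow> Mp z = mp z"
    and "\<And>z. z \<notin> \<real> \<Longrightarrow> Mm z = - mm (- z)"
    and "mono Sp" and "mono Sm"
    and "integrable (stieltjes_measure Sp) (\<lambda>t. 1 / (1 + \<bar>t\<bar>))"
    and "integrable (stieltjes_measure Sm) (\<lambda>t. 1 / (1 + \<bar>t\<bar>))"
    and "\<And>z. z \<notin> \<real> \<Longrightarrow> Mp z = (LINT t|stieltjes_measure Sp. 1 / (complex_of_real t - z))"
    and "\<And>z. z \<notin> \<real> \<Longrightarrow> Mm z = (LINT t|stieltjes_measure Sm. 1 / (complex_of_real t - z))"
    and similar: "\<exists>T. L2_selfadjoint lborel T \<and> L2_similar lborel (indefinite_sl_operator q) T"
  shows "\<exists>Kp Km :: real.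
    (\<forall>g\<in>L2 (stieltjes_measure Sp). \<forall>M\<in>{Mp, Mm}.
       (\<integral>\<^sup>+t. ennreal (Im (boundary_value M t)
                / (cmod (boundary_value Mp t - boundary_value Mm t))\<^sup>2
                * (cmod (g t * complex_of_real (ac_density (stieltjes_measure Sp) t)
                         + hilbert_transform (stieltjes_measure Sp) g t))\<^sup>2) \<partial>lborel)
       \<le> ennreal (Kp * (LINT t|stieltjes_measure Sp. (cmod (g t))\<^sup>2))) \<and>
    (\<forall>g\<in>L2 (stieltjes_measure Sm). \<forall>M\<in>{Mp, Mm}.
       (\<integral>\<^sup>+t. ennreal (Im (boundary_value M t)
                / (cmod (boundary_value Mp t - boundary_value Mm t))\<^sup>2
                * (cmod (g t * complex_of_real (ac_density (stieltjes_measure Sm) t)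
                         + hilbert_transform (stieltjes_measure Sm) g t))\<^sup>2) \<partial>lborel)
       \<le> ennreal (Km * (LINT t|stieltjes_measure Sm. (cmod (g t))\<^sup>2)))"
proof -
  define \<mu>p where "\<mu>p = stieltjes_measure Sp"
  define \<mu>m where "\<mu>m = stieltjes_measure Sm"
  have sp: "sets \<mu>p = sets borel" and sm: "sets \<mu>m = sets borel" by (simp_all add: \<mu>p_def \<mu>m_def stieltjes_measure_def)
  have p: "cauchy_measure \<mu>p" and m: "cauchy_measure \<mu>m"
    using sp sm assms(12,13) by (simp_all add: cauchy_measure_def \<mu>p_def \<mu>m_def)
  note ints = assms(12,13)[folded \<mu>p_def \<mu>m_def]
  note reps = assms(14,15)[folded \<mu>p_def \<mu>m_def]
  obtain T where T: "L2_selfadjoint lborel T" "L2_similar lborel (indefinite_sl_operator q) T" using similar by (elim exE conjE) (rule that)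
  obtain K where K: "K \<ge> 0" and span: "\<And>Zp Zm a b e. finite Zp \<Longrightarrow> finite Zm \<Longrightarrow> Zp \<inter> \<real> = {} \<Longrightarrow> Zm \<inter> \<real> = {} \<Longrightarrow> e > 0 \<Longrightarrow>
    (\<integral>\<^sup>+x. ennreal (weyl_weight Mp Mm (Complex x e) * (cmod (cauchy_transform \<mu>p (pfrac a Zp) (Complex x e)
        - cauchy_transform \<mu>m (pfrac b Zm) (Complex x e)))\<^sup>2) \<partial>lborel)
     \<le> ennreal (K * ((L2_norm \<mu>p (pfrac a Zp))\<^sup>2 + (L2_norm \<mu>m (pfrac b Zm))\<^sup>2))"
  proof (rule weyl_span_inequality[OF assms(1,4-9) sp sm ints reps T])
    fix K assume "K \<ge> 0" "\<And>Zp Zm a b e. finite Zp \<Longrightarrow> finite Zm \<Longrightarrow> Zp \<inter> \<real> = {} \<Longrightarrow> Zm \<inter> \<real> = {} \<Longrightarrow> e > 0 \<Longrightarrow>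
      (\<integral>\<^sup>+x. ennreal (weyl_weight Mp Mm (Complex x e) * (cmod (cauchy_transform \<mu>p (pfrac a Zp) (Complex x e)
        - cauchy_transform \<mu>m (pfrac b Zm) (Complex x e)))\<^sup>2) \<partial>lborel)
       \<le> ennreal (K * ((L2_norm \<mu>p (pfrac a Zp))\<^sup>2 + (L2_norm \<mu>m (pfrac b Zm))\<^sup>2))"
    then show thesis by (rule that)
  qed
  have Mp: "Mp z = cauchy_transform \<mu>p (\<lambda>_. 1) z" if "z \<notin> \<real>" for z using reps(1)[OF that] by (simp only: cauchy_transform_def)
  have Mm: "Mm z = cauchy_transform \<mu>m (\<lambda>_. 1) z" if "z \<notin> \<real>" for z using reps(2)[OF that] by (simp only: cauchy_transform_def)
  have zero: "(\<lambda>_. 0) \<in> L2 M" for M by (simp add: L2_def)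
  have ineq: "(\<integral>\<^sup>+x. ennreal (weyl_weight Mp Mm (Complex x e) * (cmod (cauchy_transform \<mu>p gp (Complex x e)
          - cauchy_transform \<mu>m gm (Complex x e)))\<^sup>2) \<partial>lborel)
       \<le> ennreal (2 * K * ((L2_norm \<mu>p gp)\<^sup>2 + (L2_norm \<mu>m gm)\<^sup>2))"
    if "e > 0" "gp \<in> L2 \<mu>p" "gm \<in> L2 \<mu>m" for e gp gm
    by (rule weyl_L2_inequality[OF p m Mp Mm K that(1) span that(2,3)]) (assumption | rule that(1))+
  have ip: "(\<integral>\<^sup>+x. ennreal (weyl_weight Mp Mm (Complex x e) * (cmod (cauchy_transform \<mu>p h (Complex x e)))\<^sup>2) \<partial>lborel)
       \<le> ennreal (2 * K * (L2_norm \<mu>p h)\<^sup>2)" if "h \<in> L2 \<mu>p" "e > 0" for h e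
    using ineq[OF that(2,1) zero] by (simp add: cauchy_transform_def L2_norm_def)
  have im: "(\<integral>\<^sup>+x. ennreal (weyl_weight Mp Mm (Complex x e) * (cmod (cauchy_transform \<mu>m h (Complex x e)))\<^sup>2) \<partial>lborel)
       \<le> ennreal (2 * K * (L2_norm \<mu>m h)\<^sup>2)" if "h \<in> L2 \<mu>m" "e > 0" for h e
    using ineq[OF that(2) zero that(1)] by (simp add: cauchy_transform_def L2_norm_def)
  have K2: "2 * K \<ge> 0" using K by simp
  \<comment> \<open>One factor 2 stems from the density argument, the other from the separation of
    real and imaginary parts.\<close>
  show ?thesis unfolding \<mu>p_def[symmetric] \<mu>m_def[symmetric]
    by (intro exI[of _ "2 * (2 * K)"] conjI ballI)
       (rule weyl_boundary_inequality[OF p m p Mp Mm K2 ip] weyl_boundary_inequality[OF p m m Mp Mm K2 im]; assumption)+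
qed

end
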